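(* Let $\hbar\in\mathbb{R}_{>0}\setminus\mathbb{Q}$, let $\Gamma^{(0)}$ be a $\mathcal{D}$-seed of rank $n$ with exchange matrix $\varepsilon^{(0)}$, and let $i,j\in\{1,\dots,n\}$ satisfy either $\varepsilon^{(0)}_{ij}=1,\ \varepsilon^{(0)}_{ji}=-1$, or $\varepsilon^{(0)}_{ij}=-1,\ \varepsilon^{(0)}_{ji}=1$. Put $$\Gamma^{(1)}=\mu_i(\Gamma^{(0)}),\ \Gamma^{(2)}=\mu_j(\Gamma^{(1)}),\ \Gamma^{(3)}=\mu_i(\Gamma^{(2)}),\quad \Gamma^{(4)}=\mu_j(\Gamma^{(0)}),\ \Gamma^{(5)}=\mu_i(\Gamma^{(4)}),$$ so that $\Gamma^{(3)}=P_{(i\,j)}(\Gamma^{(5)})$. Let $c_{A_2}\in\mathrm{U}(1)\subset\mathbb{C}^\times$ be the constant such that $$\mathbf{K}^\hbar_{\Gamma^{(0)}\stackrel{i}{\to}\Gamma^{(1)}}\,\mathbf{K}^\hbar_{\Gamma^{(1)}\stackrel{j}{\to}\Gamma^{(2)}}\,\mathbf{K}^\hbar_{\Gamma^{(2)}\stackrel{i}{\to}\Gamma^{(3)}}=c_{A_2}\cdot\mathbf{K}^\hbar_{\Gamma^{(0)}\stackrel{j}{\to}\Gamma^{(4)}}\,\mathbf{K}^\hbar_{\Gamma^{(4)}\stackrel{i}{\to}\Gamma^{(5)}}\,\mathbf{P}_{(i\,j)}$$ as operators $\mathscr{H}_{\Gamma^{(3)}}\to\mathscr{H}_{\Gamma^{(0)}}$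 (such a constant exists by a theorem of Fock and Goncharov). Then $c_{A_2}=1$.
   Context: **Seeds and mutations.** Fix $n\ge1$; $[a]_+=\max(a,0)$. A $\mathcal{D}$-seed $\Gamma$ has an exchange matrix $\varepsilon=(\varepsilon_{ij})\in\mathbb{Z}^{n\times n}$ and a skew-symmetrizer $d=(d_1,\dots,d_n)$ of positive integers such that $\varepsilon_{ij}d_j^{-1}=-\varepsilon_{ji}d_i^{-1}$ for all $i,j$. (It also carries $2n$ formal cluster variables $B_i,X_i$, which play no role in the operators below; all operators depend only on $(\varepsilon,d)$.) The mutated seed $\Gamma'=\mu_k(\Gamma)$ has data $(\varepsilon',d')$ with $d'=d$, $\varepsilon'_{ij}=-\varepsilon_{ij}$ if $i=k$ or $j=k$, and $\varepsilon'_{ij}=\varepsilon_{ij}+\frac12(|\varepsilon_{ik}|\varepsilon_{kj}+\varepsilon_{ik}|\varepsilon_{kj}|)$ otherwise. For a permutation $\sigma$ of $\{1,\dots,n\}$, $P_\sigma(\Gamma)=\Gamma'$ means $d'_{\sigma(i)}=d_i$, $\varepsilon'_{\sigma(i)\sigma(j)}=\varepsilon_{ij}$ (and cluster variables are relabelled accordingly); $(i\,j)$ is the transposition of $i$ and $j$. **Hilbert space and operators.** $\hbar_k:=\hbar/d_k$. To each seed is attached $\mathscr{H}_\Gamma=L^2(\mathbb{R}^n,da_1\cdots da_n)$ and the dense subspace $D_\Gamma$ spanned by the functions $e^{-\sum_i(\alpha_ia_i^2+\beta_ia_i)}P(a_1,\dots,a_n)$ with $\alpha_i,\beta_i\in\mathbb{C}$,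 $\mathrm{Re}(\alpha_i)>0$, $P$ a complex polynomial. On $D_\Gamma$ put $\widehat{\mathbf q}_i^\hbar=a_i$ (multiplication), $\widehat{\mathbf p}_i^\hbar=2\pi\sqrt{-1}\,\hbar\,\frac{\partial}{\partial a_i}$, and $$\widehat{\mathbf x}^\hbar_{\Gamma;i}=\tfrac12d_i^{-1}\widehat{\mathbf p}_i^\hbar-\sum_{j}\varepsilon_{ij}\widehat{\mathbf q}_j^\hbar,\qquad \widehat{\widetilde{\mathbf x}}{}^\hbar_{\Gamma;i}=\tfrac12d_i^{-1}\widehat{\mathbf p}_i^\hbar+\sum_{j}\varepsilon_{ij}\widehat{\mathbf q}_j^\hbar .$$ These are essentially self-adjoint on $D_\Gamma$; the same symbols denote the unique self-adjoint extensions inside functional calculus. **Quantum dilogarithm.** For real $h>0$ and real $z$, $$\Phi^h(z)=\exp\left(-\frac14\int_\Omega\frac{e^{-\sqrt{-1}\,pz}}{\sinh(\pi p)\sinh(\pi hp)}\frac{dp}{p}\right),$$ where $\Omega$ is the real line (oriented left to right) avoiding the origin by a small half circle above it. One has $|\Phi^h(z)|=1$ for real $z$. **Intertwiners.** For $\Gamma'=\mu_k(\Gamma)$, $\mathbf{K}^\hbar_{\Gamma\stackrel{k}{\to}\Gamma'}:\mathscr{H}_{\Gamma'}\to\mathscr{H}_\Gamma$ is the unitary map $$\mathbf{K}^\hbar_{\Gamma\stackrel{k}{\to}\Gamma'}=\Phi^{\hbar_k}(\widehat{\mathbf x}^\hbar_{\Gamma;k})\,\bigl(\Phi^{\hbar_k}(\widehat{\widetilde{\mathbf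 x}}{}^\hbar_{\Gamma;k})\bigr)^{-1}\circ\mathbf{K}'_{\Gamma\stackrel{k}{\to}\Gamma'},$$ where the first two factors are defined by functional calculus and $(\mathbf{K}'_{\Gamma\stackrel{k}{\to}\Gamma'}f)(a_1,\dots,a_n)=f(a_1',\dots,a_n')$ with $a'_i=a_i$ for $i\ne k$ and $a'_k=-a_k+\sum_{j=1}^n[-\varepsilon_{kj}]_+a_j$. For a permutation $\sigma$, $\mathbf{P}_\sigma:\mathscr{H}_{P_\sigma(\Gamma)}\to\mathscr{H}_\Gamma$ is the relabelling map sending the coordinate $a_{\sigma(i)}$ to $a_i$, i.e. $(\mathbf{P}_\sigma f)(a_1,\dots,a_n)=f(a'_1,\dots,a'_n)$ with $a'_{\sigma(i)}=a_i$ for all $i$; for $\sigma=(i\,j)$ it exchanges the $i$-th and $j$-th arguments. Here $\mathbf{P}_{(i\,j)}$ is regarded as a map $\mathscr{H}_{P_{(i\,j)}(\Gamma^{(5)})}=\mathscr{H}_{\Gamma^{(3)}}\to\mathscr{H}_{\Gamma^{(5)}}$. *)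

theory Defs
  imports "HOL-Complex_Analysis.Complex_Analysis"
begin

no_notation fps_nth (infixl \<open>$\<close> 75)

section \<open>Seeds\<close>

text \<open>
  The index set \<open>{1,\<dots>,n}\<close> is a finite type \<open>'n\<close>. The formal cluster variables of a seed are
  left out: the operators below depend only on the exchange matrix and the skew-symmetrizer.
\<close>

record 'n seed =
  exch :: "'n \<Rightarrow> 'n \<Rightarrow> int"
  symm :: "'n \<Rightarrow> int"

definition pos_part :: "int \<Rightarrow> int" where
  "pos_part t = max t 0"

lemma pos_part_simps [simp]:
  "t \<ge> 0 \<Longrightarrow> pos_part t = t" "t \<le> 0 \<Longrightarrow> pos_part t = 0"
  by (auto simp: pos_part_def)

definition D_seed :: "'n::finite seed \<Rightarrow> bool" where
  "D_seed \<Gamma> \<longleftrightarrow>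
     (\<forall>i. 0 < symm \<Gamma> i) \<and>
     (\<forall>i j. of_int (exch \<Gamma> i j) / of_int (symm \<Gamma> j) =
            - (of_int (exch \<Gamma> j i) / of_int (symm \<Gamma> i) :: real))"

text \<open>The integer division by 2 is exact, as both summands have the same parity.\<close>

definition mutate :: "'n::finite \<Rightarrow> 'n seed \<Rightarrow> 'n seed" where
  "mutate k \<Gamma> =
     \<lparr>exch = (\<lambda>i j. if i = k \<or> j = k then - exch \<Gamma> i j
        else exch \<Gamma> i j +
             (\<bar>exch \<Gamma> i k\<bar> * exch \<Gamma> k j + exch \<Gamma> i k * \<bar>exch \<Gamma> k j\<bar>) div 2),
      symm = symm \<Gamma>\<rparr>"

text \<open>With \<open>\<Gamma>' = relabel \<sigma> \<Gamma>\<close> one has \<open>symm \<Gamma>' (\<sigma> i) = symm \<Gamma> i\<close> and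
  \<open>exch \<Gamma>' (\<sigma> i) (\<sigma> j) = exch \<Gamma> i j\<close>.\<close>

definition relabel :: "('n::finite \<Rightarrow> 'n) \<Rightarrow> 'n seed \<Rightarrow> 'n seed" where
  "relabel \<sigma> \<Gamma> =
     \<lparr>exch = (\<lambda>i j. exch \<Gamma> (inv \<sigma> i) (inv \<sigma> j)), symm = (\<lambda>i. symm \<Gamma> (inv \<sigma> i))\<rparr>"

lemma mutate_symm [simp]: "symm (mutate k \<Gamma>) = symm \<Gamma>"
  by (simp add: mutate_def)

lemma D_seed_iff:
  "D_seed \<Gamma> \<longleftrightarrow> (\<forall>i. 0 < symm \<Gamma> i) \<and>
     (\<forall>i j. exch \<Gamma> i j * symm \<Gamma> i = - (exch \<Gamma> j i * symm \<Gamma> j))"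
proof -
  have "of_int (exch \<Gamma> i j) / of_int (symm \<Gamma> j) = - (of_int (exch \<Gamma> j i) / of_int (symm \<Gamma> i) :: real)
      \<longleftrightarrow> exch \<Gamma> i j * symm \<Gamma> i = - (exch \<Gamma> j i * symm \<Gamma> j)"
    if "\<forall>i. 0 < symm \<Gamma> i" for i j
  proof -
    have pos: "(of_int (symm \<Gamma> i) :: real) \<noteq> 0" "(of_int (symm \<Gamma> j) :: real) \<noteq> 0"
      using that[rule_format, of i] that[rule_format, of j] by auto
    have "of_int (exch \<Gamma> i j) / of_int (symm \<Gamma> j) = - (of_int (exch \<Gamma> j i) / of_int (symm \<Gamma> i) :: real)
      \<longleftrightarrow> of_int (exch \<Gamma> i j) * of_int (symm \<Gamma> i) = - (of_int (exch \<Gamma> j i) * of_int (symm \<Gamma> j) :: real)"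
      using pos by (simp add: field_simps)
    also have "\<dots> \<longleftrightarrow> (of_int (exch \<Gamma> i j * symm \<Gamma> i) :: real) = of_int (- (exch \<Gamma> j i * symm \<Gamma> j))"
      by simp
    finally show ?thesis by (simp only: of_int_eq_iff)
  qed
  then show ?thesis unfolding D_seed_def by blast
qed

lemma half_abs:
  "(\<bar>x\<bar> * y + x * \<bar>y\<bar>) div 2 = pos_part x * pos_part y - pos_part (- x) * pos_part (- y)"
proof -
  have "\<bar>x\<bar> * y + x * \<bar>y\<bar> = 2 * (pos_part x * pos_part y - pos_part (- x) * pos_part (- y))"
    by (cases "x \<ge> 0"; cases "y \<ge> 0") auto
  then show ?thesis by simp
qed

lemma exch_mutate:
  "exch (mutate k \<Gamma>) i j = (if i = k \<or> j = k then - exch \<Gamma> i j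
     else exch \<Gamma> i j + (pos_part (exch \<Gamma> i k) * pos_part (exch \<Gamma> k j)
                        - pos_part (- exch \<Gamma> i k) * pos_part (- exch \<Gamma> k j)))"
  by (simp add: mutate_def half_abs)

lemma pentagon_int:
  fixes x y u v w :: int
  defines "p \<equiv> pos_part"
  shows "w + (p x * p u - p (- x) * p (- u))
      + (p (y + p x) * p (v - p (- u)) - p (- (y + p x)) * p (- (v - p (- u))))
      + (p (p (y + p x) - x) * p (- u - p (- (v - p (- u)))) - p (x - p (y + p x)) * p (u + p (- (v - p (- u)))))
    = w + (p y * p v - p (- y) * p (- v)) + (p (x - p (- y)) * p (u + p v) - p (p (- y) - x) * p (- u - p v))"
  unfolding p_def
  by (cases "x \<ge> 0"; cases "u \<ge> 0"; cases "y \<ge> 0"; cases "v \<ge> 0"; cases "x + y \<ge> 0"; cases "u + v \<ge> 0")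
     (simp_all add: algebra_simps)

lemma pentagon_exch:
  assumes "i \<noteq> j" and z: "exch \<Gamma> i i = 0" "exch \<Gamma> j j = 0"
    and e: "exch \<Gamma> i j = 1 \<and> exch \<Gamma> j i = - 1 \<or> exch \<Gamma> i j = - 1 \<and> exch \<Gamma> j i = 1"
  shows "exch (mutate i (mutate j (mutate i \<Gamma>))) a b =
     exch (mutate i (mutate j \<Gamma>)) (Transposition.transpose i j a) (Transposition.transpose i j b)"
proof -
  note facts = z \<open>i \<noteq> j\<close> \<open>i \<noteq> j\<close>[symmetric]
  consider (ab) "a \<in> {i, j}" "b \<in> {i, j}" | (a) "a \<in> {i, j}" "b \<noteq> i" "b \<noteq> j"
    | (b) "b \<in> {i, j}" "a \<noteq> i" "a \<noteq> j" | (none) "a \<noteq> i" "a \<noteq> j" "b \<noteq> i" "b \<noteq> j"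
    by blast
  then show ?thesis
  proof cases
    case ab
    with e facts show ?thesis by (elim disjE conjE insertE emptyE) (simp_all add: exch_mutate)
  next
    case a
    with e facts show ?thesis
      by (elim disjE conjE insertE emptyE; simp add: exch_mutate; simp add: pos_part_def max_def)
  next
    case b
    with e facts show ?thesis
      by (elim disjE conjE insertE emptyE; simp add: exch_mutate; simp add: pos_part_def max_def)
  next
    case none
    from e show ?thesis
    proof (elim disjE conjE)
      assume e: "exch \<Gamma> i j = 1" "exch \<Gamma> j i = - 1"
      show ?thesis
        using none facts e
          pentagon_int[of "exch \<Gamma> a b" "exch \<Gamma> a i" "exch \<Gamma> i b" "exch \<Gamma> a j" "exch \<Gamma> j b"]
        by (simp add: exch_mutate algebra_simps)
    next
      assume e: "exch \<Gamma> i j = - 1" "exch \<Gamma> j i = 1"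
      show ?thesis
        using none facts e
          pentagon_int[of "- exch \<Gamma> a b" "- exch \<Gamma> a i" "- exch \<Gamma> i b" "- exch \<Gamma> a j" "- exch \<Gamma> j b"]
        by (simp add: exch_mutate algebra_simps)
    qed
  qed
qed

lemma pentagon_seeds:
  assumes "D_seed \<Gamma>"
    and "exch \<Gamma> i j = 1 \<and> exch \<Gamma> j i = - 1 \<or> exch \<Gamma> i j = - 1 \<and> exch \<Gamma> j i = 1"
  shows "mutate i (mutate j (mutate i \<Gamma>)) =
         relabel (Transposition.transpose i j) (mutate i (mutate j \<Gamma>))"
proof -
  have diag: "exch \<Gamma> k k = 0" for k
  proof -
    have "exch \<Gamma> k k * symm \<Gamma> k = - (exch \<Gamma> k k * symm \<Gamma> k)" "symm \<Gamma> k > 0"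
      using assms(1) unfolding D_seed_iff by blast+
    then show ?thesis by auto
  qed
  then have "i \<noteq> j" using assms(2) by auto
  have "exch \<Gamma> i j * symm \<Gamma> i = - (exch \<Gamma> j i * symm \<Gamma> j)"
    using assms(1) unfolding D_seed_iff by blast+
  then have "symm \<Gamma> i = symm \<Gamma> j" using assms(2) by auto
  then have "symm \<Gamma> (Transposition.transpose i j a) = symm \<Gamma> a" for a
    by (simp add: Transposition.transpose_def)
  moreover note pentagon_exch[OF \<open>i \<noteq> j\<close> diag diag assms(2)]
  ultimately show ?thesis
    by (intro seed.equality) (auto simp: relabel_def fun_eq_iff)
qed

lemma D_seed_mutate:
  assumes "D_seed \<Gamma>"
  shows "D_seed (mutate k \<Gamma>)"
proof -
  have pos: "0 < symm \<Gamma> i" and skew: "exch \<Gamma> i j * symm \<Gamma> i = - (exch \<Gamma> j i * symm \<Gamma> j)" for i j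
    using assms unfolding D_seed_iff by blast+
  have pp: "pos_part t * s = pos_part (t * s)" if "s > 0" for t s
    using that by (cases "t \<ge> 0") (auto simp: mult_nonpos_nonneg)
  have P: "pos_part (exch \<Gamma> i j) * symm \<Gamma> i = pos_part (- exch \<Gamma> j i) * symm \<Gamma> j" for i j
    unfolding pp[OF pos] skew[of i j] by simp
  have N: "pos_part (- exch \<Gamma> i j) * symm \<Gamma> i = pos_part (exch \<Gamma> j i) * symm \<Gamma> j" for i j
    using P[of j i] by simp
  have "exch (mutate k \<Gamma>) i j * symm \<Gamma> i = - (exch (mutate k \<Gamma>) j i * symm \<Gamma> j)" for i j
  proof (cases "i = k \<or> j = k")
    case True
    then show ?thesis using skew[of i j] by (auto simp: exch_mutate)
  next
    case False
    have "pos_part (exch \<Gamma> i k) * pos_part (exch \<Gamma> k j) * symm \<Gamma> i =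
        pos_part (- exch \<Gamma> j k) * pos_part (- exch \<Gamma> k i) * symm \<Gamma> j"
      using P[of i k] P[of k j] by (metis mult.assoc mult.commute)
    moreover have "pos_part (- exch \<Gamma> i k) * pos_part (- exch \<Gamma> k j) * symm \<Gamma> i =
        pos_part (exch \<Gamma> j k) * pos_part (exch \<Gamma> k i) * symm \<Gamma> j"
      using N[of i k] N[of k j] by (metis mult.assoc mult.commute)
    ultimately show ?thesis
      using False skew[of i j] by (simp add: exch_mutate ring_distribs)
  qed
  with pos show ?thesis
    unfolding D_seed_iff mutate_symm by blast
qed

section \<open>The Hilbert space \<open>L\<^sup>2(\<real>\<^sup>n)\<close>\<close>

definition square_integrable :: "(real^'n \<Rightarrow> complex) \<Rightarrow> bool" where
  "square_integrable f \<longleftrightarrow>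
     f \<in> borel_measurable borel \<and> integrable lborel (\<lambda>a. (cmod (f a))\<^sup>2)"

lemma square_integrable_0 [simp]: "square_integrable (\<lambda>a. 0)"
  by (simp add: square_integrable_def)

lemma square_integrable_mult_left:
  assumes "square_integrable f"
  shows "square_integrable (\<lambda>a. c * f a)"
  using assms by (auto simp: square_integrable_def norm_mult power_mult_distrib)

lemma square_integrable_add:
  assumes "square_integrable f" "square_integrable g"
  shows "square_integrable (\<lambda>a. f a + g a)"
proof -
  have [measurable]: "f \<in> borel_measurable borel" "g \<in> borel_measurable borel"
    using assms by (auto simp: square_integrable_def)
  have "integrable lborel (\<lambda>a. (cmod (f a + g a))\<^sup>2)"
  proof (rule Bochner_Integration.integrable_bound)
    show "integrable lborel (\<lambda>a. 2 * (cmod (f a))\<^sup>2 + 2 * (cmod (g a))\<^sup>2)"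
      using assms by (simp add: square_integrable_def)
    have "(cmod (f a + g a))\<^sup>2 \<le> 2 * (cmod (f a))\<^sup>2 + 2 * (cmod (g a))\<^sup>2" for a
    proof -
      have "(cmod (f a + g a))\<^sup>2 \<le> (cmod (f a) + cmod (g a))\<^sup>2"
        by (simp add: norm_triangle_ineq power_mono)
      also have "\<dots> \<le> 2 * (cmod (f a))\<^sup>2 + 2 * (cmod (g a))\<^sup>2"
        using zero_le_power2[of "cmod (f a) - cmod (g a)"]
        by (simp add: power2_eq_square algebra_simps)
      finally show ?thesis .
    qed
    then show "AE a in lborel. norm ((cmod (f a + g a))\<^sup>2) \<le>
        norm (2 * (cmod (f a))\<^sup>2 + 2 * (cmod (g a))\<^sup>2)"
      by simp
  qed simp
  then show ?thesis by (simp add: square_integrable_def)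
qed

lemma square_integrable_uminus:
  "square_integrable f \<Longrightarrow> square_integrable (\<lambda>a. - f a)"
  using square_integrable_mult_left[of f "-1"] by simp

lemma square_integrable_diff:
  "square_integrable f \<Longrightarrow> square_integrable g \<Longrightarrow> square_integrable (\<lambda>a. f a - g a)"
  using square_integrable_add[OF _ square_integrable_uminus, of f g] by simp

lemma borel_measurable_cnj [measurable]:
  "f \<in> borel_measurable M \<Longrightarrow> (\<lambda>a. cnj (f a)) \<in> borel_measurable M"
  by (rule borel_measurable_continuous_on) (auto intro: continuous_intros)

lemma cnj_mult_self: "cnj z * z = complex_of_real ((cmod z)\<^sup>2)"
  by (simp add: complex_norm_square mult.commute[of z] del: of_real_power)

lemma integrable_cnj_mult:
  assumes "square_integrable f" "square_integrable g"
  shows "integrable lborel (\<lambda>a. cnj (f a) * g a)"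
proof (rule Bochner_Integration.integrable_bound)
  have [measurable]: "f \<in> borel_measurable borel" "g \<in> borel_measurable borel"
    using assms by (auto simp: square_integrable_def)
  show "integrable lborel (\<lambda>a. (cmod (f a))\<^sup>2 + (cmod (g a))\<^sup>2)"
    using assms by (simp add: square_integrable_def)
  show "(\<lambda>a. cnj (f a) * g a) \<in> borel_measurable lborel"
    by (simp add: borel_measurable_cnj)
  have "cmod (f a) * cmod (g a) \<le> (cmod (f a))\<^sup>2 + (cmod (g a))\<^sup>2" for a
  proof -
    have "2 * (cmod (f a) * cmod (g a)) \<le> (cmod (f a))\<^sup>2 + (cmod (g a))\<^sup>2"
      using zero_le_power2[of "cmod (f a) - cmod (g a)"]
      by (simp add: power2_eq_square algebra_simps)
    moreover have "0 \<le> cmod (f a) * cmod (g a)" by simp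
    ultimately show ?thesis by linarith
  qed
  then show "AE a in lborel. norm (cnj (f a) * g a) \<le> norm ((cmod (f a))\<^sup>2 + (cmod (g a))\<^sup>2)"
    by (simp add: norm_mult)
qed

quotient_type 'n l2 = "real^('n::finite) \<Rightarrow> complex" / partial:
  "\<lambda>f g. square_integrable f \<and> square_integrable g \<and> (AE a in lborel. f a = g a)"
  morphisms rep_l2 l2_of
proof (rule part_equivpI)
  show "\<exists>f::real^'n \<Rightarrow> complex.
      square_integrable f \<and> square_integrable f \<and> (AE a in lborel. f a = f a)"
    by (rule exI[of _ "\<lambda>a. 0"]) simp
  show "symp (\<lambda>f g::real^'n \<Rightarrow> complex.
      square_integrable f \<and> square_integrable g \<and> (AE a in lborel. f a = g a))"
    by (rule sympI) (auto elim!: eventually_mono)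
  show "transp (\<lambda>f g::real^'n \<Rightarrow> complex.
      square_integrable f \<and> square_integrable g \<and> (AE a in lborel. f a = g a))"
    by (rule transpI) (auto elim: eventually_elim2)
qed

text \<open>The inner product is conjugate-linear in the first argument.\<close>

lift_definition cinner :: "'n::finite l2 \<Rightarrow> 'n l2 \<Rightarrow> complex" is
  "\<lambda>f g. LINT a|lborel. cnj (f a) * g a"
proof -
  fix f f' g g' :: "real^'n \<Rightarrow> complex"
  assume f: "square_integrable f \<and> square_integrable f' \<and> (AE a in lborel. f a = f' a)"
    and g: "square_integrable g \<and> square_integrable g' \<and> (AE a in lborel. g a = g' a)"
  have [measurable]: "f \<in> borel_measurable borel" "g \<in> borel_measurable borel"
      "f' \<in> borel_measurable borel" "g' \<in> borel_measurable borel"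
    using f g by (auto simp: square_integrable_def)
  show "(LINT a|lborel. cnj (f a) * g a) = (LINT a|lborel. cnj (f' a) * g' a)"
    using f g by (intro integral_cong_AE) (auto elim: eventually_elim2)
qed

lift_definition scaleC :: "complex \<Rightarrow> 'n::finite l2 \<Rightarrow> 'n l2" (infixr \<open>*\<^sub>C\<close> 75) is
  "\<lambda>c f a. c * f a"
  by (auto intro: square_integrable_mult_left elim: eventually_mono)

instantiation l2 :: (finite) real_vector
begin

lift_definition zero_l2 :: "'a l2" is "\<lambda>a. 0"
  by simp

lift_definition plus_l2 :: "'a l2 \<Rightarrow> 'a l2 \<Rightarrow> 'a l2" is "\<lambda>f g a. f a + g a"
  by (auto intro: square_integrable_add elim: eventually_elim2)

lift_definition minus_l2 :: "'a l2 \<Rightarrow> 'a l2 \<Rightarrow> 'a l2" is "\<lambda>f g a. f a - g a"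
  by (auto intro: square_integrable_diff elim: eventually_elim2)

lift_definition uminus_l2 :: "'a l2 \<Rightarrow> 'a l2" is "\<lambda>f a. - f a"
  by (auto intro: square_integrable_uminus)

definition scaleR_l2 :: "real \<Rightarrow> 'a l2 \<Rightarrow> 'a l2" where
  "scaleR_l2 r u = of_real r *\<^sub>C u"

instance
proof
  fix u v w :: "'a l2" and r s :: real
  show "u + v + w = u + (v + w)"
    by transfer (auto intro!: square_integrable_add simp: add.assoc)
  show "u + v = v + u"
    by transfer (auto intro!: square_integrable_add simp: add.commute)
  show "0 + u = u"
    by transfer auto
  show "- u + u = 0"
    by transfer auto
  show "u - v = u + - v"
    by transfer (auto intro!: square_integrable_diff square_integrable_add square_integrable_uminus)
  show "r *\<^sub>R (u + v) = r *\<^sub>R u + r *\<^sub>R v"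
    unfolding scaleR_l2_def
    by transfer (auto intro!: square_integrable_add square_integrable_mult_left simp: ring_distribs)
  show "(r + s) *\<^sub>R u = r *\<^sub>R u + s *\<^sub>R u"
    unfolding scaleR_l2_def
    by transfer (auto intro!: square_integrable_add square_integrable_mult_left simp: ring_distribs)
  show "r *\<^sub>R s *\<^sub>R u = (r * s) *\<^sub>R u"
    unfolding scaleR_l2_def
    by transfer (auto intro!: square_integrable_mult_left simp: mult.assoc)
  show "1 *\<^sub>R u = u"
    unfolding scaleR_l2_def by transfer auto
qed

end

instantiation l2 :: (finite) real_inner
begin

definition inner_l2 :: "'a l2 \<Rightarrow> 'a l2 \<Rightarrow> real" where
  "inner_l2 u v = Re (cinner u v)"

definition norm_l2 :: "'a l2 \<Rightarrow> real" where
  "norm_l2 u = sqrt (inner u u)"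

definition sgn_l2 :: "'a l2 \<Rightarrow> 'a l2" where
  "sgn_l2 u = u /\<^sub>R norm u"

definition dist_l2 :: "'a l2 \<Rightarrow> 'a l2 \<Rightarrow> real" where
  "dist_l2 u v = norm (u - v)"

definition uniformity_l2 :: "('a l2 \<times> 'a l2) filter" where
  "uniformity_l2 = (INF e\<in>{0<..}. principal {(u, v). dist u v < e})"

definition open_l2 :: "'a l2 set \<Rightarrow> bool" where
  "open_l2 U = (\<forall>u\<in>U. \<forall>\<^sub>F (u', v) in uniformity. u' = u \<longrightarrow> v \<in> U)"

instance
proof
  fix u v w :: "'a l2" and r :: real
  show "sgn u = u /\<^sub>R norm u"
    by (rule sgn_l2_def)
  show "dist u v = norm (u - v)"
    by (rule dist_l2_def)
  show "(uniformity :: ('a l2 \<times> 'a l2) filter) = (INF e\<in>{0<..}. principal {(u, v). dist u v < e})"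
    by (rule uniformity_l2_def)
  show "open U = (\<forall>u\<in>U. \<forall>\<^sub>F (u', v) in uniformity. u' = u \<longrightarrow> v \<in> U)" for U :: "'a l2 set"
    by (rule open_l2_def)
  have "cinner v u = cnj (cinner u v)"
  proof transfer
    fix f g :: "real^'a \<Rightarrow> complex"
    have "cnj (f a) * g a = cnj (cnj (g a) * f a)" for a
      by simp
    then show "(LINT a|lborel. cnj (f a) * g a) = cnj (LINT a|lborel. cnj (g a) * f a)"
      by (simp only: Bochner_Integration.integral_cnj)
  qed
  then show "inner u v = inner v u"
    by (simp add: inner_l2_def)
  have "cinner (u + v) w = cinner u w + cinner v w"
    by transfer (simp add: ring_distribs integrable_cnj_mult)
  then show "inner (u + v) w = inner u w + inner v w"
    by (simp add: inner_l2_def)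
  have "cinner (of_real r *\<^sub>C u) v = of_real r * cinner u v"
    by transfer (simp add: mult.assoc)
  then show "inner (r *\<^sub>R u) v = r * inner u v"
    by (simp add: inner_l2_def scaleR_l2_def)
  have *: "cinner u u = of_real (LINT a|lborel. (cmod (rep_l2 u a))\<^sup>2)"
    unfolding cinner.rep_eq
    by (simp only: cnj_mult_self integral_complex_of_real)
  show "0 \<le> inner u u"
    by (simp add: inner_l2_def *)
  show "inner u u = 0 \<longleftrightarrow> u = 0"
  proof
    assume "inner u u = 0"
    then have "cinner u u = 0"
      by (simp add: inner_l2_def *)
    then show "u = 0"
    proof transfer
      fix f :: "real^'a \<Rightarrow> complex"
      assume f: "square_integrable f \<and> square_integrable f \<and> (AE a in lborel. f a = f a)"
        and 0: "(LINT a|lborel. cnj (f a) * f a) = 0"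
      have "complex_of_real (LINT a|lborel. (cmod (f a))\<^sup>2) = (LINT a|lborel. cnj (f a) * f a)"
        by (simp only: cnj_mult_self integral_complex_of_real)
      then have "(LINT a|lborel. (cmod (f a))\<^sup>2) = 0"
        using 0 by simp
      then have "AE a in lborel. (cmod (f a))\<^sup>2 = 0"
        using f by (subst (asm) integral_nonneg_eq_0_iff_AE) (auto simp: square_integrable_def)
      then show "square_integrable f \<and> square_integrable (\<lambda>a::real^'a. 0) \<and>
          (AE a in lborel. f a = 0)"
        using f by simp
    qed
  next
    assume "u = 0"
    moreover have "cinner 0 (0::'a l2) = 0"
      by transfer simp
    ultimately show "inner u u = 0"
      by (simp add: inner_l2_def)
  qed
  show "norm u = sqrt (inner u u)"
    by (rule norm_l2_def)
qed

end

section \<open>Unbounded operators and the Borel functional calculus\<close>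

text \<open>A partially defined operator is given by its graph.\<close>

type_synonym 'n operator = "('n l2 \<times> 'n l2) set"

definition apply_op :: "'n::finite operator \<Rightarrow> 'n l2 \<Rightarrow> 'n l2" where
  "apply_op T u = (THE v. (u, v) \<in> T)"

definition linear_op :: "'n::finite operator \<Rightarrow> bool" where
  "linear_op T \<longleftrightarrow> single_valued T \<and> (0, 0) \<in> T \<and>
     (\<forall>(u, u')\<in>T. \<forall>(v, v')\<in>T. (u + v, u' + v') \<in> T) \<and>
     (\<forall>c. \<forall>(u, u')\<in>T. (c *\<^sub>C u, c *\<^sub>C u') \<in> T)"

definition adjoint_op :: "'n::finite operator \<Rightarrow> 'n operator" where
  "adjoint_op T = {(v, v'). \<forall>(u, u')\<in>T. cinner v u' = cinner v' u}"

definition self_adjoint :: "'n::finite operator \<Rightarrow> bool" where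
  "self_adjoint T \<longleftrightarrow> linear_op T \<and> closure (Domain T) = UNIV \<and> adjoint_op T = T"

text \<open>Meaningful for essentially self-adjoint operators, which have exactly one such extension.\<close>

definition self_adjoint_extension :: "'n::finite operator \<Rightarrow> 'n operator" where
  "self_adjoint_extension S = (THE T. S \<subseteq> T \<and> self_adjoint T)"

definition orthogonal_projection :: "('n::finite l2 \<Rightarrow> 'n l2) \<Rightarrow> bool" where
  "orthogonal_projection P \<longleftrightarrow>
     (\<forall>u v. P (u + v) = P u + P v) \<and> (\<forall>c u. P (c *\<^sub>C u) = c *\<^sub>C P u) \<and>
     (\<forall>u. P (P u) = P u) \<and> (\<forall>u v. cinner (P u) v = cinner u (P v))"

definition projection_valued_measure :: "(real set \<Rightarrow> 'n::finite l2 \<Rightarrow> 'n l2) \<Rightarrow> bool" where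
  "projection_valued_measure E \<longleftrightarrow>
     (\<forall>A\<in>sets borel. orthogonal_projection (E A)) \<and>
     E UNIV = id \<and>
     (\<forall>A\<in>sets borel. \<forall>B\<in>sets borel. E (A \<inter> B) = E A \<circ> E B) \<and>
     (\<forall>A. range A \<subseteq> sets borel \<longrightarrow> disjoint_family A \<longrightarrow>
        (\<forall>u. (\<lambda>k::nat. E (A k) u) sums E (\<Union>k. A k) u))"

definition scalar_spectral_measure ::
    "(real set \<Rightarrow> 'n::finite l2 \<Rightarrow> 'n l2) \<Rightarrow> 'n l2 \<Rightarrow> real measure" where
  "scalar_spectral_measure E u = measure_of UNIV (sets borel) (\<lambda>A. ennreal ((norm (E A u))\<^sup>2))"

text \<open>
  \<open>is_spectral_integral E f T\<close> says that \<open>T = \<integral> f dE\<close>. Prescribing the values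
  \<open>\<langle>u, T u\<rangle>\<close> on the domain of the integral determines \<open>T\<close>, by polarization and density
  of that domain.
\<close>

definition is_spectral_integral ::
    "(real set \<Rightarrow> 'n::finite l2 \<Rightarrow> 'n l2) \<Rightarrow> (real \<Rightarrow> complex) \<Rightarrow> 'n operator \<Rightarrow> bool" where
  "is_spectral_integral E f T \<longleftrightarrow>
     linear_op T \<and>
     Domain T = {u. integrable (scalar_spectral_measure E u) (\<lambda>x. (cmod (f x))\<^sup>2)} \<and>
     (\<forall>(u, v)\<in>T. cinner u v = (LINT x|scalar_spectral_measure E u. f x))"

text \<open>Meaningful for self-adjoint \<open>T\<close> and Borel \<open>f\<close>; the spectral theorem gives the (on Borel sets
  unique) \<open>E\<close>.\<close>

definition functional_calculus :: "(real \<Rightarrow> complex) \<Rightarrow> 'n::finite operator \<Rightarrow> 'n operator" where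
  "functional_calculus f T =
     (THE F. \<exists>E. projection_valued_measure E \<and>
        is_spectral_integral E complex_of_real T \<and> is_spectral_integral E f F)"

section \<open>The Schroedinger representation\<close>

definition complex_polynomial_fun :: "(real^'n::finite \<Rightarrow> complex) \<Rightarrow> bool" where
  "complex_polynomial_fun P \<longleftrightarrow>
     (\<exists>(M :: ('n \<Rightarrow> nat) set) c. finite M \<and>
        P = (\<lambda>a. \<Sum>m\<in>M. c m * (\<Prod>i\<in>UNIV. complex_of_real (a $ i) ^ m i)))"

definition gaussian_fun :: "(real^'n::finite \<Rightarrow> complex) \<Rightarrow> bool" where
  "gaussian_fun f \<longleftrightarrow>
     (\<exists>(\<alpha> :: 'n \<Rightarrow> complex) \<beta> P. (\<forall>i. Re (\<alpha> i) > 0) \<and> complex_polynomial_fun P \<and>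
        f = (\<lambda>a. exp (- (\<Sum>i\<in>UNIV. \<alpha> i * (of_real (a $ i))\<^sup>2 + \<beta> i * of_real (a $ i))) * P a))"

text \<open>The domain \<open>D\<^sub>\<Gamma>\<close>, as a space of functions; it depends only on the rank.\<close>

definition gaussian_space :: "(real^'n::finite \<Rightarrow> complex) set" where
  "gaussian_space =
     {f. \<exists>(N::nat) c g. (\<forall>k<N. gaussian_fun (g k)) \<and> f = (\<lambda>a. \<Sum>k<N. c k * g k a)}"

definition q_op :: "'n::finite \<Rightarrow> (real^'n \<Rightarrow> complex) \<Rightarrow> (real^'n \<Rightarrow> complex)" where
  "q_op i f = (\<lambda>a. of_real (a $ i) * f a)"

definition p_op :: "real \<Rightarrow> 'n::finite \<Rightarrow> (real^'n \<Rightarrow> complex) \<Rightarrow> (real^'n \<Rightarrow> complex)" where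
  "p_op hb i f = (\<lambda>a. 2 * of_real pi * \<i> * of_real hb *
     vector_derivative (\<lambda>t. f (a + t *\<^sub>R axis i 1)) (at 0))"

definition x_fun ::
    "real \<Rightarrow> 'n::finite seed \<Rightarrow> 'n \<Rightarrow> (real^'n \<Rightarrow> complex) \<Rightarrow> (real^'n \<Rightarrow> complex)" where
  "x_fun hb \<Gamma> i f = (\<lambda>a. 1 / 2 * (1 / of_int (symm \<Gamma> i)) * p_op hb i f a
     - (\<Sum>j\<in>UNIV. of_int (exch \<Gamma> i j) * q_op j f a))"

definition x_tilde_fun ::
    "real \<Rightarrow> 'n::finite seed \<Rightarrow> 'n \<Rightarrow> (real^'n \<Rightarrow> complex) \<Rightarrow> (real^'n \<Rightarrow> complex)" where
  "x_tilde_fun hb \<Gamma> i f = (\<lambda>a. 1 / 2 * (1 / of_int (symm \<Gamma> i)) * p_op hb i f a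
     + (\<Sum>j\<in>UNIV. of_int (exch \<Gamma> i j) * q_op j f a))"

definition x_op :: "real \<Rightarrow> 'n::finite seed \<Rightarrow> 'n \<Rightarrow> 'n operator" where
  "x_op hb \<Gamma> i =
     self_adjoint_extension ((\<lambda>f. (l2_of f, l2_of (x_fun hb \<Gamma> i f))) ` gaussian_space)"

definition x_tilde_op :: "real \<Rightarrow> 'n::finite seed \<Rightarrow> 'n \<Rightarrow> 'n operator" where
  "x_tilde_op hb \<Gamma> i =
     self_adjoint_extension ((\<lambda>f. (l2_of f, l2_of (x_tilde_fun hb \<Gamma> i f))) ` gaussian_space)"

section \<open>The quantum dilogarithm\<close>

definition qdilog_integrand :: "real \<Rightarrow> real \<Rightarrow> complex \<Rightarrow> complex" where
  "qdilog_integrand h z p =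
     exp (- (\<i> * p * of_real z)) / (sinh (of_real pi * p) * sinh (of_real pi * of_real h * p)) / p"

text \<open>
  The contour runs along the real line, except that \<open>[-r, r]\<close> is replaced by the upper half
  circle, run through clockwise. The nonzero poles of the integrand are \<open>\<i> m\<close> and \<open>\<i> m / h\<close> with
  \<open>m\<close> a nonzero integer, so every \<open>r < min 1 (1 / h)\<close> gives the same value.
\<close>

definition qdilog_integral :: "real \<Rightarrow> real \<Rightarrow> complex" where
  "qdilog_integral h z =
     (let r = min 1 (1 / h) / 2 in
        (LINT p:{..- r}|lborel. qdilog_integrand h z (of_real p))
        + contour_integral (part_circlepath 0 r pi 0) (qdilog_integrand h z)
        + (LINT p:{r..}|lborel. qdilog_integrand h z (of_real p)))"

definition qdilog :: "real \<Rightarrow> real \<Rightarrow> complex" where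
  "qdilog h z = exp (- (1 / 4) * qdilog_integral h z)"

section \<open>Intertwiners\<close>

text \<open>Used only with invertible linear \<open>\<tau>\<close>, for which the choice of representative is immaterial.\<close>

definition pullback :: "(real^'n::finite \<Rightarrow> real^'n) \<Rightarrow> 'n l2 \<Rightarrow> 'n l2" where
  "pullback \<tau> f = l2_of (\<lambda>a. rep_l2 f (\<tau> a))"

definition K_prime :: "'n::finite seed \<Rightarrow> 'n \<Rightarrow> 'n l2 \<Rightarrow> 'n l2" where
  "K_prime \<Gamma> k = pullback (\<lambda>a. \<chi> i. if i = k
     then - (a $ k) + (\<Sum>j\<in>UNIV. of_int (pos_part (- exch \<Gamma> k j)) * a $ j)
     else a $ i)"

text \<open>
  The intertwiner from the space of \<open>mutate k \<Gamma>\<close> to that of \<open>\<Gamma>\<close>, both of which are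
  \<open>L\<^sup>2(\<real>\<^sup>n)\<close>. The inverse of an operator is the converse of its graph.
\<close>

definition K_op :: "real \<Rightarrow> 'n::finite seed \<Rightarrow> 'n \<Rightarrow> 'n l2 \<Rightarrow> 'n l2" where
  "K_op hb \<Gamma> k =
     (let hk = hb / of_int (symm \<Gamma> k) in
        apply_op (functional_calculus (qdilog hk) (x_op hb \<Gamma> k))
        \<circ> apply_op ((functional_calculus (qdilog hk) (x_tilde_op hb \<Gamma> k))\<inverse>)
        \<circ> K_prime \<Gamma> k)"

definition P_op :: "('n::finite \<Rightarrow> 'n) \<Rightarrow> 'n l2 \<Rightarrow> 'n l2" where
  "P_op \<sigma> = pullback (\<lambda>a. \<chi> i. a $ inv \<sigma> i)"

end

theory Submission
  imports Defs "HOL-Probability.Characteristic_Functions" "HOL-Probability.Sinc_Integral"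
begin

text \<open>
  Far out in phase space an intertwiner is just a linear substitution, and this pins down the constant.

  Take the Fourier transform in the mutated coordinate \<open>k\<close>, and let \<open>\<xi>\<close> have the momentum as its
  \<open>k\<close>-th coordinate. With \<open>\<ell>(\<xi>) = \<Sum>\<^sub>j \<epsilon>\<^sub>k\<^sub>j \<xi>\<^sub>j\<close>, a form that does not involve \<open>\<xi>\<^sub>k\<close>, the two
  self-adjoint operators of the seed become multiplication by \<open>- \<pi>\<hbar>\<^sub>k \<xi>\<^sub>k \<mp> \<ell>(\<xi>)\<close>, so that the
  dilogarithm part of the intertwiner is multiplication by the phase
  \<open>\<Phi>(- \<pi>\<hbar>\<^sub>k \<xi>\<^sub>k - \<ell>) / \<Phi>(- \<pi>\<hbar>\<^sub>k \<xi>\<^sub>k + \<ell>)\<close>. Two properties of \<open>\<Phi>\<close> matter.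

  \<^item> \<open>\<Phi>(z) \<rightarrow> 1\<close> as \<open>z \<rightarrow> - \<infinity>\<close> (\<open>qdilog_tendsto_1\<close>, a Riemann-Lebesgue argument). So the phase tends
    to 1 as \<open>\<xi>\<^sub>k \<rightarrow> \<infinity>\<close>, and there the intertwiner acts as the substitution \<open>K'\<close>.
  \<^item> \<open>\<Phi>(z) \<Phi>(- z) = C exp (- i z\<^sup>2 / 4\<pi>\<hbar>\<^sub>k)\<close> (\<open>qdilog_inversion\<close>, a residue). So as \<open>\<xi>\<^sub>k \<rightarrow> - \<infinity>\<close>
    the phase behaves like \<open>exp (- i \<xi>\<^sub>k \<ell>(\<xi>))\<close>. In position space this factor is a shear, and it
    changes \<open>K'\<close> into the tropical mutation of the opposite sign. The constant \<open>C\<close> cancels, because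
    \<open>\<Phi>\<close> enters an intertwiner once directly and once inverted.

  Hence, for either sign \<open>s\<close>, an intertwiner applied to \<open>exp (i n \<Lambda>) g\<close>, with \<open>\<Lambda>\<close> a linear form
  and \<open>g\<close> a Gaussian, differs from the pullback along the tropical mutation of sign \<open>s\<close> by an error
  that vanishes as \<open>n \<rightarrow> \<infinity>\<close>, provided that the \<open>k\<close>-th momentum of the result has sign \<open>s\<close>
  (\<open>K_op_asymptotics\<close>). For \<open>s = - \<epsilon>\<^sub>i\<^sub>j\<close> there is one form \<open>\<Lambda>\<close> that meets this condition at all
  five intertwiners, and the two composites of tropical mutations of sign \<open>s\<close> agree up to the
  transposition of \<open>i\<close> and \<open>j\<close> (\<open>trop_pentagon\<close>). The two sides of the relation thus have the same
  leading term, which has constant nonzero norm; comparing them gives \<open>c = 1\<close>.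

  Most of the text establishes the first claim from the definitions. The operators are given as
  self-adjoint extensions and their functions by an arbitrary spectral measure. An operator that is
  unitarily equivalent to multiplication by a real function has only one spectral measure
  (\<open>E_eq_E0\<close>), and Gaussians are total in \<open>L\<^sup>2\<close> (\<open>gauss_total\<close>). Totality yields the unitary partial
  Fourier transform and shows that the operators of a seed, restricted to the Gaussian domain, have
  these multiplication operators as their only self-adjoint extensions.
\<close>

no_notation fps_nth (infixl \<open>$\<close> 75)

section \<open>The Hilbert space of square integrable functions\<close>

lemma square_integrable_rep_l2 [simp]: "square_integrable (rep_l2 u)"
  using Quotient_rep_reflp[OF Quotient_l2, of u] by simp

lemma l2_of_rep_l2 [simp]: "l2_of (rep_l2 u) = u"
  by (rule Quotient_abs_rep[OF Quotient_l2])

lemma rep_l2_of: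
  assumes "square_integrable f"
  shows "AE a in lborel. rep_l2 (l2_of f) a = f a"
  using Quotient_rep_abs[OF Quotient_l2, of f] assms by simp

lemma l2_of_eq_iff:
  assumes "square_integrable f" "square_integrable g"
  shows "l2_of f = l2_of g \<longleftrightarrow> (AE a in lborel. f a = g a)"
  using Quotient_rel_abs2[OF Quotient_l2] Quotient_rel[OF Quotient_l2, of f g] assms by auto

lemma l2_eq_iff: "u = v \<longleftrightarrow> (AE a in lborel. rep_l2 u a = rep_l2 v a)"
  using l2_of_eq_iff[of "rep_l2 u" "rep_l2 v"] by simp

lemma rep_l2_measurable [measurable]: "rep_l2 u \<in> borel_measurable borel"
  using square_integrable_rep_l2[of u] by (auto simp: square_integrable_def)

lemma l2_of_add:
  "square_integrable f \<Longrightarrow> square_integrable g \<Longrightarrow> l2_of f + l2_of g = l2_of (\<lambda>a. f a + g a)"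
  by (simp add: plus_l2.abs_eq)

lemma l2_of_diff:
  "square_integrable f \<Longrightarrow> square_integrable g \<Longrightarrow> l2_of f - l2_of g = l2_of (\<lambda>a. f a - g a)"
  by (simp add: minus_l2.abs_eq)

lemma l2_of_scaleC: "square_integrable f \<Longrightarrow> c *\<^sub>C l2_of f = l2_of (\<lambda>a. c * f a)"
  by (simp add: scaleC.abs_eq)

lemma l2_of_0: "l2_of (\<lambda>a. 0) = 0"
  by (simp add: zero_l2_def)

lemma cinner_l2_of:
  "square_integrable f \<Longrightarrow> square_integrable g \<Longrightarrow>
    cinner (l2_of f) (l2_of g) = (LINT a|lborel. cnj (f a) * g a)"
  by (simp add: cinner.abs_eq)

lemma norm_l2_of:
  assumes "square_integrable f"
  shows "(norm (l2_of f))\<^sup>2 = (LINT a|lborel. (cmod (f a))\<^sup>2)"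
proof -
  have "cinner (l2_of f) (l2_of f) = complex_of_real (LINT a|lborel. (cmod (f a))\<^sup>2)"
    using assms by (simp only: cinner_l2_of cnj_mult_self integral_complex_of_real)
  then show ?thesis
    by (simp add: norm_l2_def inner_l2_def)
qed

lemma norm_l2_rep: "(norm u)\<^sup>2 = (LINT a|lborel. (cmod (rep_l2 u a))\<^sup>2)"
  using norm_l2_of[of "rep_l2 u"] by simp

lemma nn_integral_norm_l2_of:
  assumes "square_integrable f"
  shows "(\<integral>\<^sup>+a. ennreal ((cmod (f a))\<^sup>2) \<partial>lborel) = ennreal ((norm (l2_of f))\<^sup>2)"
  unfolding norm_l2_of[OF assms]
  using assms by (intro nn_integral_eq_integral) (auto simp: square_integrable_def)

lemma rep_l2_add: "AE a in lborel. rep_l2 (u + v) a = rep_l2 u a + rep_l2 v a"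
  using rep_l2_of[OF square_integrable_add, of "rep_l2 u" "rep_l2 v"]
  by (simp add: l2_of_add[symmetric])

lemma rep_l2_diff: "AE a in lborel. rep_l2 (u - v) a = rep_l2 u a - rep_l2 v a"
  using rep_l2_of[OF square_integrable_diff, of "rep_l2 u" "rep_l2 v"]
  by (simp add: l2_of_diff[symmetric])

lemma rep_l2_scaleC: "AE a in lborel. rep_l2 (c *\<^sub>C u) a = c * rep_l2 u a"
  using rep_l2_of[OF square_integrable_mult_left, of "rep_l2 u" c]
  by (simp add: l2_of_scaleC[symmetric])

lemma scaleR_scaleC: "r *\<^sub>R u = of_real r *\<^sub>C u"
  by (simp add: scaleR_l2_def)

lemma scaleC_simps:
  "c *\<^sub>C (u + v) = c *\<^sub>C u + c *\<^sub>C v" "c *\<^sub>C (u - v) = c *\<^sub>C u - c *\<^sub>C v"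
  "(c + d) *\<^sub>C u = c *\<^sub>C u + d *\<^sub>C u" "(c - d) *\<^sub>C u = c *\<^sub>C u - d *\<^sub>C u"
  "c *\<^sub>C d *\<^sub>C u = (c * d) *\<^sub>C u" "1 *\<^sub>C u = u" "0 *\<^sub>C u = 0" "c *\<^sub>C 0 = (0::'n::finite l2)"
  "(- 1) *\<^sub>C u = - u" "c *\<^sub>C (- u) = - (c *\<^sub>C u)" "(- c) *\<^sub>C u = - (c *\<^sub>C u)"
  for u v :: "'n::finite l2"
  by (transfer; auto intro!: square_integrable_add square_integrable_diff square_integrable_mult_left
      square_integrable_uminus simp: algebra_simps)+

lemma cinner_commute: "cinner u v = cnj (cinner v u)"
proof (transfer)
  fix f g :: "real^'a \<Rightarrow> complex"
  have "cnj (f a) * g a = cnj (cnj (g a) * f a)" for a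
    by simp
  then show "(LINT a|lborel. cnj (f a) * g a) = cnj (LINT a|lborel. cnj (g a) * f a)"
    by (simp only: Bochner_Integration.integral_cnj)
qed

lemma cinner_add_right: "cinner u (v + w) = cinner u v + cinner u w"
  by transfer (simp add: ring_distribs integrable_cnj_mult)

lemma cinner_scaleC_right: "cinner u (c *\<^sub>C v) = c * cinner u v"
  by transfer (simp add: mult.left_commute)

lemma cinner_add_left: "cinner (u + v) w = cinner u w + cinner v w"
  by transfer (simp add: ring_distribs integrable_cnj_mult)

lemma cinner_scaleC_left: "cinner (c *\<^sub>C u) v = cnj c * cinner u v"
  by transfer (simp add: mult.assoc)

lemma cinner_uminus_right: "cinner u (- v) = - cinner u v"
  using cinner_scaleC_right[of u "-1" v] by (simp add: scaleC_simps)

lemma cinner_uminus_left: "cinner (- u) v = - cinner u v"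
  using cinner_scaleC_left[of "-1" u v] by (simp add: scaleC_simps)

lemma cinner_diff_right: "cinner u (v - w) = cinner u v - cinner u w"
  using cinner_add_right[of u v "- w"] by (simp add: cinner_uminus_right)

lemma cinner_diff_left: "cinner (u - v) w = cinner u w - cinner v w"
  using cinner_add_left[of u "- v" w] by (simp add: cinner_uminus_left)

lemma cinner_zero [simp]: "cinner 0 v = 0" "cinner v 0 = 0"
  using cinner_scaleC_left[of 0 v v] cinner_scaleC_right[of v 0 v] by (simp_all add: scaleC_simps)

lemmas cinner_simps = cinner_add_right cinner_add_left cinner_scaleC_right cinner_scaleC_left
  cinner_uminus_right cinner_uminus_left cinner_diff_right cinner_diff_left

lemma cinner_self: "cinner u u = of_real ((norm u)\<^sup>2)"
proof -
  have "cinner u u = of_real (LINT a|lborel. (cmod (rep_l2 u a))\<^sup>2)"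
    unfolding cinner.rep_eq by (simp only: cnj_mult_self integral_complex_of_real)
  then show ?thesis by (simp add: norm_l2_rep)
qed

lemma inner_l2_cinner: "inner u v = Re (cinner u v)" for u v :: "'n::finite l2"
  by (rule inner_l2_def)

lemma norm_scaleC: "norm (c *\<^sub>C u) = cmod c * norm u"
proof -
  have "complex_of_real ((norm (c *\<^sub>C u))\<^sup>2) = of_real ((cmod c)\<^sup>2 * (norm u)\<^sup>2)"
    unfolding cinner_self[symmetric] cinner_simps of_real_mult complex_norm_square by simp
  then have "(norm (c *\<^sub>C u))\<^sup>2 = (cmod c * norm u)\<^sup>2"
    by (simp only: of_real_eq_iff power_mult_distrib)
  then show ?thesis by simp
qed

text \<open>The imaginary part of the inner product is the real inner product with \<open>\<i> u\<close>.\<close>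

lemma Im_cinner: "Im (cinner u v) = inner (\<i> *\<^sub>C u) v"
  by (simp add: inner_l2_cinner cinner_simps)

lemma norm_cinner_le: "cmod (cinner u v) \<le> norm u * norm v"
proof (cases "cinner u v = 0")
  case False
  \<comment> \<open>a phase that makes the inner product real, so that the real Cauchy-Schwarz inequality applies\<close>
  define c where "c = cnj (cinner u v) / cmod (cinner u v)"
  have 1: "cmod c = 1" using False by (simp add: c_def norm_divide)
  have "of_real ((cmod (cinner u v))\<^sup>2) = cinner u v * cnj (cinner u v)"
    by (rule complex_norm_square)
  then have "complex_of_real (cmod (cinner u v)) = c * cinner u v"
    using False by (simp add: c_def power2_eq_square field_simps)
  also have "\<dots> = cinner u (c *\<^sub>C v)" by (simp add: cinner_simps)
  finally have "cmod (cinner u v) = inner u (c *\<^sub>C v)"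
    by (simp add: inner_l2_cinner) (metis Re_complex_of_real)
  also have "\<dots> \<le> norm u * norm (c *\<^sub>C v)" by (rule norm_cauchy_schwarz)
  finally show ?thesis using 1 by (simp add: norm_scaleC)
qed simp

lemma cinner_eqI: "(\<And>w. cinner w u = cinner w v) \<Longrightarrow> u = v"
proof -
  assume "\<And>w. cinner w u = cinner w v"
  then have "cinner (u - v) (u - v) = 0"
    by (simp only: cinner_diff_right[of "u - v" u v] diff_self)
  then show "u = v"
    by (simp add: cinner_self)
qed

text \<open>Riesz-Fischer. Along a subsequence with geometrically small steps the representatives converge
  almost everywhere, and Fatou's lemma controls the distance to the limit.\<close>

lemma l2_Cauchy_limit:
  fixes X :: "nat \<Rightarrow> 'n::finite l2"
  assumes C: "Cauchy X"
  shows "\<exists>L. X \<longlonglongrightarrow> L"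
proof -
  have "\<exists>r::nat \<Rightarrow> nat. strict_mono r \<and> (\<forall>n. norm (X (r (Suc n)) - X (r n)) < (1/4)^n)"
  proof -
    have ex: "\<exists>N. \<forall>m\<ge>N. \<forall>k\<ge>N. norm (X m - X k) < (1/4)^n" for n
      using C[unfolded Cauchy_iff] by (auto simp: zero_less_power)
    then obtain N where N: "\<And>n m k. m \<ge> N n \<Longrightarrow> k \<ge> N n \<Longrightarrow> norm (X m - X k) < (1/4)^n"
      by metis
    define r where "r n = (\<Sum>i\<le>n. Suc (N i))" for n
    have "strict_mono r" by (rule strict_mono_Suc_iff[THEN iffD2]) (simp add: r_def)
    moreover have "N n \<le> r n" for n
      unfolding r_def by (rule order_trans[OF _ member_le_sum[of n]]) auto
    moreover have "N n \<le> r (Suc n)" for n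
      using \<open>N n \<le> r n\<close> by (simp add: r_def)
    ultimately show ?thesis using N by blast
  qed
  then obtain r :: "nat \<Rightarrow> nat" where r: "strict_mono r"
    and fast: "\<And>n. norm (X (r (Suc n)) - X (r n)) < (1/4)^n" by blast
  define f where "f n = rep_l2 (X (r n))" for n
  have [measurable]: "f n \<in> borel_measurable borel" for n unfolding f_def by measurable
  have sq: "square_integrable (f n)" for n by (simp add: f_def)
  have nrm: "(\<integral>\<^sup>+a. ennreal ((cmod (f m a - f n a))\<^sup>2) \<partial>lborel) = ennreal ((norm (X (r m) - X (r n)))\<^sup>2)" for m n
    using nn_integral_norm_l2_of[OF square_integrable_diff[OF sq sq], of m n]
    by (simp add: l2_of_diff[OF sq sq, symmetric]) (simp add: f_def)
  define h where "h n a = cmod (f (Suc n) a - f n a)" for n a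
  have [measurable]: "h n \<in> borel_measurable borel" for n unfolding h_def by measurable
  have "(\<integral>\<^sup>+a. (\<Sum>n. ennreal (2^n * (h n a)\<^sup>2)) \<partial>lborel) = (\<Sum>n. \<integral>\<^sup>+a. ennreal (2^n * (h n a)\<^sup>2) \<partial>lborel)"
    by (rule nn_integral_suminf) measurable
  also have "\<dots> \<le> (\<Sum>n. ennreal ((1/8)^n))"
  proof (rule suminf_le)
    fix n
    have "(\<integral>\<^sup>+a. ennreal (2^n * (h n a)\<^sup>2) \<partial>lborel) = ennreal (2^n) * ennreal ((norm (X (r (Suc n)) - X (r n)))\<^sup>2)"
      unfolding nrm[symmetric] h_def by (subst nn_integral_cmult[symmetric]) (auto simp: ennreal_mult')
    also have "\<dots> = ennreal (2^n * (norm (X (r (Suc n)) - X (r n)))\<^sup>2)"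
      by (simp add: ennreal_mult')
    also have "\<dots> \<le> ennreal ((1/8)^n)"
    proof (rule ennreal_leI)
      have "2^n * (norm (X (r (Suc n)) - X (r n)))\<^sup>2 \<le> 2^n * ((1/4)^n)\<^sup>2"
        using fast[of n] by (intro mult_left_mono power_mono) auto
      also have "\<dots> = (1/8)^n"
        by (simp add: power2_eq_square power_mult_distrib[symmetric])
      finally show "2^n * (norm (X (r (Suc n)) - X (r n)))\<^sup>2 \<le> (1/8)^n" .
    qed
    finally show "(\<integral>\<^sup>+a. ennreal (2^n * (h n a)\<^sup>2) \<partial>lborel) \<le> ennreal ((1/8)^n)" .
  qed auto
  also have "\<dots> < \<infinity>"
    by (subst suminf_ennreal2) (auto intro!: summable_geometric)
  finally have "AE a in lborel. (\<Sum>n. ennreal (2^n * (h n a)\<^sup>2)) \<noteq> \<infinity>"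
    by (intro nn_integral_noteq_infinite) auto
  then have conv: "AE a in lborel. convergent (\<lambda>n. f n a)"
  proof (eventually_elim)
    fix a assume "(\<Sum>n. ennreal (2^n * (h n a)\<^sup>2)) \<noteq> \<infinity>"
    then have S: "summable (\<lambda>n. 2^n * (h n a)\<^sup>2)"
      by (intro summable_suminf_not_top) auto
    have "summable (\<lambda>n. 2^n * (h n a)\<^sup>2 + (1/2)^n)"
      by (intro summable_add S summable_geometric) simp
    \<comment> \<open>either \<open>h n a \<le> 2\<^sup>-\<^sup>n\<close> or \<open>h n a \<le> 2\<^sup>n (h n a)\<^sup>2\<close>\<close>
    then have "summable (\<lambda>n. h n a)"
    proof (rule summable_comparison_test_ev[rotated], intro always_eventually allI)
      fix n
      have h0: "0 \<le> h n a" by (simp add: h_def)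
      show "norm (h n a) \<le> 2^n * (h n a)\<^sup>2 + (1/2)^n"
      proof (cases "h n a \<le> (1/2)^n")
        case True then show ?thesis using h0 by (simp add: add_increasing)
      next
        case False
        then have "(2::real)^n * (1/2)^n \<le> 2^n * h n a" by simp
        then have "1 \<le> 2^n * h n a" by (simp add: power_mult_distrib[symmetric])
        then have "h n a * 1 \<le> h n a * (2^n * h n a)" using h0 by (intro mult_left_mono) auto
        then show ?thesis using h0 by (simp add: power2_eq_square mult_ac add_increasing2)
      qed
    qed
    then have "summable (\<lambda>n. f (Suc n) a - f n a)"
      unfolding h_def by (rule summable_norm_cancel)
    then have "convergent (\<lambda>n. \<Sum>i<n. f (Suc i) a - f i a)"
      by (simp add: summable_iff_convergent)
    moreover have "(\<Sum>i<n. f (Suc i) a - f i a) = f n a - f 0 a" for n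
      by (induction n) auto
    ultimately have "convergent (\<lambda>n. f n a - f 0 a)" by simp
    then show "convergent (\<lambda>n. f n a)"
      using convergent_add[OF _ convergent_const[of "f 0 a"]] by fastforce
  qed
  define g where "g a = lim (\<lambda>n. f n a)" for a
  have [measurable]: "g \<in> borel_measurable borel"
    unfolding g_def by (rule borel_measurable_lim_metric) measurable
  have lim: "AE a in lborel. (\<lambda>n. f n a) \<longlonglongrightarrow> g a"
    using conv by eventually_elim (auto simp: g_def convergent_LIMSEQ_iff)
  have bound: "(\<integral>\<^sup>+a. ennreal ((cmod (g a - f n a))\<^sup>2) \<partial>lborel) \<le> ennreal (e\<^sup>2)"
    if e: "\<And>m. m \<ge> n \<Longrightarrow> norm (X (r m) - X (r n)) \<le> e" for n e
  proof -
    have "(\<integral>\<^sup>+a. ennreal ((cmod (g a - f n a))\<^sup>2) \<partial>lborel)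
        = (\<integral>\<^sup>+a. liminf (\<lambda>m. ennreal ((cmod (f m a - f n a))\<^sup>2)) \<partial>lborel)"
    proof (rule nn_integral_cong_AE)
      from lim show "AE a in lborel. ennreal ((cmod (g a - f n a))\<^sup>2) = liminf (\<lambda>m. ennreal ((cmod (f m a - f n a))\<^sup>2))"
      proof eventually_elim
        fix a assume "(\<lambda>m. f m a) \<longlonglongrightarrow> g a"
        then have "(\<lambda>m. ennreal ((cmod (f m a - f n a))\<^sup>2)) \<longlonglongrightarrow> ennreal ((cmod (g a - f n a))\<^sup>2)"
          by (intro tendsto_ennrealI tendsto_intros)
        then show "ennreal ((cmod (g a - f n a))\<^sup>2) = liminf (\<lambda>m. ennreal ((cmod (f m a - f n a))\<^sup>2))"
          by (rule lim_imp_Liminf[OF trivial_limit_sequentially, symmetric])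
      qed
    qed
    also have "\<dots> \<le> liminf (\<lambda>m. \<integral>\<^sup>+a. ennreal ((cmod (f m a - f n a))\<^sup>2) \<partial>lborel)"
      by (rule nn_integral_liminf) measurable
    also have "\<dots> \<le> ennreal (e\<^sup>2)"
    proof (rule Liminf_le[OF _ ])
      show "\<forall>\<^sub>F m in sequentially. (\<integral>\<^sup>+a. ennreal ((cmod (f m a - f n a))\<^sup>2) \<partial>lborel) \<le> ennreal (e\<^sup>2)"
        unfolding eventually_sequentially nrm using e
        by (intro exI[of _ n] allI impI ennreal_leI power_mono) auto
    qed auto
    finally show ?thesis .
  qed
  have sqd: "square_integrable (\<lambda>a. g a - f n a)" and near: "norm (l2_of (\<lambda>a. g a - f n a)) \<le> e"
    if e: "\<And>m. m \<ge> n \<Longrightarrow> norm (X (r m) - X (r n)) \<le> e" and "e \<ge> 0" for n e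
  proof -
    show sq': "square_integrable (\<lambda>a. g a - f n a)"
      unfolding square_integrable_def
      using bound[OF e] by (auto intro!: integrableI_bounded intro: le_less_trans)
    show "norm (l2_of (\<lambda>a. g a - f n a)) \<le> e"
      using bound[OF e] nn_integral_norm_l2_of[OF sq'] \<open>e \<ge> 0\<close> by (auto intro: power2_le_imp_le)
  qed
  obtain N1 where N1: "\<And>m k. m \<ge> N1 \<Longrightarrow> k \<ge> N1 \<Longrightarrow> norm (X m - X k) < 1"
    using C[unfolded Cauchy_iff, rule_format, of 1] by auto
  have "norm (X (r m) - X (r N1)) \<le> 1" if "m \<ge> N1" for m
    using N1[of "r m" "r N1"] seq_suble[OF r, of m] seq_suble[OF r, of N1] that by simp
  then have "square_integrable (\<lambda>a. g a - f N1 a)" by (intro sqd[of _ 1]) auto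
  then have "square_integrable (\<lambda>a. (g a - f N1 a) + f N1 a)"
    by (intro square_integrable_add sq)
  then have sqg: "square_integrable g" by simp
  have "(\<lambda>n. X (r n)) \<longlonglongrightarrow> l2_of g"
  proof (rule LIMSEQ_I)
    fix e :: real assume "0 < e"
    then obtain N where N: "\<And>m k. m \<ge> N \<Longrightarrow> k \<ge> N \<Longrightarrow> norm (X m - X k) < e/2"
      using C[unfolded Cauchy_iff, rule_format, of "e/2"] by auto
    have "norm (X (r n) - l2_of g) < e" if "n \<ge> N" for n
    proof -
      have "norm (X (r m) - X (r n)) \<le> e/2" if "m \<ge> n" for m
        using N[of "r m" "r n"] seq_suble[OF r, of m] seq_suble[OF r, of n] that \<open>n \<ge> N\<close> by simp
      then have "norm (l2_of (\<lambda>a. g a - f n a)) \<le> e/2"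
        using \<open>0 < e\<close> by (intro near) auto
      moreover have "l2_of (\<lambda>a. g a - f n a) = l2_of g - X (r n)"
        using l2_of_diff[OF sqg sq, of n] by (simp add: f_def)
      ultimately show ?thesis using \<open>0 < e\<close> by (simp add: norm_minus_commute)
    qed
    then show "\<exists>no. \<forall>n\<ge>no. norm (X (r n) - l2_of g) < e" by blast
  qed
  then have "X \<longlonglongrightarrow> l2_of g"
    using Cauchy_converges_subseq[OF C r] by (simp add: o_def)
  then show ?thesis by blast
qed

instance l2 :: (finite) complete_space
proof
  fix X :: "nat \<Rightarrow> 'a l2"
  assume "Cauchy X"
  then show "convergent X" unfolding convergent_def by (rule l2_Cauchy_limit)
qed

instance l2 :: (finite) banach ..

text \<open>The vector is \<open>x\<close> minus its nearest point in \<open>S\<close>. Contrapositively, a closed subspace without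
  orthogonal complement is everything; this is how surjectivity of unitary extensions is obtained.\<close>

lemma orthogonal_vector_exists:
  fixes S :: "'h::{real_inner, complete_space} set"
  assumes S: "subspace S" "closed S" and x: "x \<notin> S"
  shows "\<exists>y. y \<noteq> 0 \<and> (\<forall>z\<in>S. inner z y = 0)"
proof -
  define d where "d = infdist x S"
  have ne: "S \<noteq> {}" using subspace_0[OF S(1)] by auto
  have "\<exists>z\<in>S. dist x z < sqrt (d\<^sup>2 + 1 / Suc n)" for n
  proof -
    have "d < sqrt (d\<^sup>2 + 1 / Suc n)"
      by (rule real_less_rsqrt) simp
    moreover have "sqrt (d\<^sup>2 + 1 / Suc n) \<le> d" if "\<not> (\<exists>z\<in>S. dist x z < sqrt (d\<^sup>2 + 1 / Suc n))"
      unfolding d_def[unfolded infdist_notempty[OF ne]] using that ne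
      by (intro cINF_greatest) (auto simp: d_def infdist_notempty not_less)
    ultimately have "\<exists>z\<in>S. dist x z < sqrt (d\<^sup>2 + 1 / Suc n)" by linarith
    then show ?thesis .
  qed
  then obtain z where zS: "\<And>n. z n \<in> S" and z: "\<And>n. dist x (z n) < sqrt (d\<^sup>2 + 1 / Suc n)" by metis
  have zb: "(norm (x - z n))\<^sup>2 < d\<^sup>2 + 1 / Suc n" for n
  proof -
    have "(norm (x - z n))\<^sup>2 < (sqrt (d\<^sup>2 + 1 / Suc n))\<^sup>2"
      using z[of n] unfolding dist_norm by (intro power_strict_mono) auto
    then show ?thesis by simp
  qed
  have lb: "d \<le> norm (x - s)" if "s \<in> S" for s
    using infdist_le[OF that, of x] by (simp add: d_def dist_norm)
  have d0: "d \<ge> 0" by (simp add: d_def infdist_nonneg)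
  \<comment> \<open>by the parallelogram law, as the midpoint of two points of \<open>S\<close> has distance at least \<open>d\<close> from \<open>x\<close>\<close>
  have par: "(norm (z m - z n))\<^sup>2 \<le> 2 / Suc m + 2 / Suc n" for m n
  proof -
    have "(1/2) *\<^sub>R (z m + z n) \<in> S" using S(1) zS by (simp add: subspace_add subspace_scale)
    then have "d\<^sup>2 \<le> (norm (x - (1/2) *\<^sub>R (z m + z n)))\<^sup>2" using lb d0 by (intro power_mono) auto
    then have "4 * d\<^sup>2 \<le> (norm ((x - z m) + (x - z n)))\<^sup>2"
    proof -
      have "(x - z m) + (x - z n) = 2 *\<^sub>R (x - (1/2) *\<^sub>R (z m + z n))"
        by (simp add: scaleR_right_diff_distrib scaleR_2)
      then show ?thesis using \<open>d\<^sup>2 \<le> _\<close> by (simp add: power_mult_distrib)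
    qed
    moreover have "(norm (z m - z n))\<^sup>2 + (norm ((x - z m) + (x - z n)))\<^sup>2
        = 2 * (norm (x - z m))\<^sup>2 + 2 * (norm (x - z n))\<^sup>2"
      unfolding power2_norm_eq_inner by (simp add: inner_simps inner_commute algebra_simps)
    ultimately show ?thesis using zb[of m] zb[of n] by simp
  qed
  have "Cauchy z"
  proof (rule CauchyI)
    fix e :: real assume e: "0 < e"
    obtain N where N: "1 / real (Suc N) < e\<^sup>2 / 4"
      using nat_approx_posE[of "e\<^sup>2/4"] e by auto
    have "norm (z m - z n) < e" if "m \<ge> N" "n \<ge> N" for m n
    proof -
      have "1 / real (Suc m) \<le> 1 / real (Suc N)" "1 / real (Suc n) \<le> 1 / real (Suc N)"
        using that by (auto intro!: divide_left_mono)
      then have "(norm (z m - z n))\<^sup>2 < e\<^sup>2" using par[of m n] N by simp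
      then show ?thesis using e by (meson less_imp_le power2_less_imp_less)
    qed
    then show "\<exists>M. \<forall>m\<ge>M. \<forall>n\<ge>M. norm (z m - z n) < e" by blast
  qed
  then obtain p where p: "z \<longlonglongrightarrow> p" by (auto simp: Cauchy_convergent_iff convergent_def)
  then have pS: "p \<in> S" using S(2) zS by (auto simp: closed_sequential_limits)
  have "(norm (x - p))\<^sup>2 \<le> d\<^sup>2 + 0"
  proof (rule LIMSEQ_le)
    show "(\<lambda>n. (norm (x - z n))\<^sup>2) \<longlonglongrightarrow> (norm (x - p))\<^sup>2" by (intro tendsto_intros p)
    show "(\<lambda>n. d\<^sup>2 + 1 / Suc n) \<longlonglongrightarrow> d\<^sup>2 + 0"
      by (intro tendsto_intros LIMSEQ_Suc[OF lim_inverse_n'])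
    show "\<exists>N. \<forall>n\<ge>N. (norm (x - z n))\<^sup>2 \<le> d\<^sup>2 + 1 / Suc n" using zb by (meson less_imp_le)
  qed
  then have pm: "(norm (x - p))\<^sup>2 \<le> (norm (x - s))\<^sup>2" if "s \<in> S" for s
    using lb[OF that] d0 power_mono[of d "norm (x - s)" 2] by simp
  have "inner s (x - p) = 0" if s: "s \<in> S" for s
  proof (cases "s = 0")
    case False
    define t where "t = inner s (x - p) / inner s s"
    have "p + t *\<^sub>R s \<in> S" using S(1) pS s by (simp add: subspace_add subspace_scale)
    then have "(norm (x - p))\<^sup>2 \<le> (norm (x - p - t *\<^sub>R s))\<^sup>2" using pm by (metis diff_diff_add)
    also have "\<dots> = (norm (x - p))\<^sup>2 - 2 * t * inner s (x - p) + t\<^sup>2 * inner s s"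
      unfolding power2_norm_eq_inner by (simp add: inner_simps inner_commute algebra_simps power2_eq_square)
    finally have "2 * t * inner s (x - p) \<le> t\<^sup>2 * inner s s" by simp
    moreover have "t * inner s s = inner s (x - p)" using False by (simp add: t_def)
    ultimately have "2 * t * (t * inner s s) \<le> t\<^sup>2 * inner s s" by simp
    then have "t\<^sup>2 * inner s s \<le> 0" by (simp add: power2_eq_square)
    moreover have "0 < inner s s" using False by simp
    ultimately have "t\<^sup>2 \<le> 0" by (metis mult_pos_pos not_le)
    then have "t = 0" by simp
    then show ?thesis using False by (simp add: t_def)
  qed simp
  moreover have "x - p \<noteq> 0" using x pS by auto
  ultimately show ?thesis by blast
qed

definition unitary_l2 :: "('n::finite l2 \<Rightarrow> 'n l2) \<Rightarrow> bool" where
  "unitary_l2 W \<longleftrightarrow> bij W \<and> (\<forall>u v. W (u + v) = W u + W v) \<and> (\<forall>c u. W (c *\<^sub>C u) = c *\<^sub>C W u) \<and>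
     (\<forall>u. norm (W u) = norm u)"

definition total_family :: "('i \<Rightarrow> 'n::finite l2) \<Rightarrow> bool" where
  "total_family g \<longleftrightarrow> (\<forall>u. (\<forall>i. cinner (g i) u = 0) \<longrightarrow> u = 0)"

text \<open>The graph of the extension is the closure of the span of the given pairs. The two
  components of a pair in it have the same norm, so each projection is injective with closed range, and totality makes the ranges
  everything.\<close>

lemma unitary_extension:
  fixes g h :: "'i \<Rightarrow> 'n::finite l2"
  assumes gram: "\<And>i j. cinner (g i) (g j) = cinner (h i) (h j)"
    and tot: "total_family g" "total_family h"
  shows "\<exists>W. unitary_l2 W \<and> (\<forall>i. W (g i) = h i)"
proof -
  define B where "B = {(c *\<^sub>C g i, c *\<^sub>C h i) | c i. True}"
  define R where "R = closure (span B)"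
  have sR: "subspace R" unfolding R_def
  proof (rule subspaceI)
    show "0 \<in> closure (span B)" using span_0 closure_subset by blast
    show "x + y \<in> closure (span B)" if x: "x \<in> closure (span B)" and y: "y \<in> closure (span B)" for x y
    proof -
      obtain a where "\<And>n. a n \<in> span B" "a \<longlonglongrightarrow> x"
        using x by (auto simp: closure_sequential)
      moreover obtain b where "\<And>n. b n \<in> span B" "b \<longlonglongrightarrow> y"
        using y by (auto simp: closure_sequential)
      ultimately show ?thesis unfolding closure_sequential
        by (intro exI[of _ "\<lambda>n. a n + b n"]) (auto intro!: tendsto_intros span_add)
    qed
    show "c *\<^sub>R x \<in> closure (span B)" if x: "x \<in> closure (span B)" for x c
    proof -
      obtain a where "\<And>n. a n \<in> span B" "a \<longlonglongrightarrow> x"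
        using x by (auto simp: closure_sequential)
      then show ?thesis unfolding closure_sequential
        by (intro exI[of _ "\<lambda>n. c *\<^sub>R a n"]) (auto intro!: tendsto_intros span_scale)
    qed
  qed
  have innB: "inner (fst p) (fst q) = inner (snd p) (snd q)" if "p \<in> B" "q \<in> B" for p q
    using that gram by (auto simp: B_def inner_l2_cinner cinner_simps)
  have innS: "inner (fst p) (fst q) = inner (snd p) (snd q)" if "p \<in> B" "q \<in> span B" for p q
    using that(2)
    by (induction rule: span_induct_alt) (auto simp: inner_simps innB[OF that(1)])
  have innS2: "inner (fst p) (fst q) = inner (snd p) (snd q)" if "p \<in> span B" "q \<in> span B" for p q
    using that(1)
    by (induction rule: span_induct_alt) (auto simp: inner_simps innS[OF _ that(2)])
  have isoR: "norm (fst p) = norm (snd p)" if p: "p \<in> R" for p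
  proof -
    obtain a where a: "\<And>n. a n \<in> span B" "a \<longlonglongrightarrow> p"
      using p unfolding R_def by (auto simp: closure_sequential)
    have "norm (fst (a n)) = norm (snd (a n))" for n
      using innS2[OF a(1) a(1), of n n] by (simp add: norm_eq_sqrt_inner)
    moreover have "(\<lambda>n. norm (fst (a n))) \<longlonglongrightarrow> norm (fst p)" "(\<lambda>n. norm (snd (a n))) \<longlonglongrightarrow> norm (snd p)"
      by (intro tendsto_intros a)+
    ultimately show ?thesis using LIMSEQ_unique by auto
  qed
  have clR: "closed R" by (simp add: R_def)
  have full: "P ` R = UNIV" if P: "P = fst \<or> P = snd" and tt: "\<And>u. (\<And>i c. inner (P (c *\<^sub>C g i, c *\<^sub>C h i)) u = 0) \<Longrightarrow> u = 0"
    for P :: "'n l2 \<times> 'n l2 \<Rightarrow> 'n l2"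
  proof -
    have lin: "P (p + q) = P p + P q" "P (r *\<^sub>R p) = r *\<^sub>R P p" "P (p - q) = P p - P q" "P 0 = 0" for p q r
      using P by auto
    have nP: "norm p = sqrt 2 * norm (P p)" if "p \<in> R" for p
      using isoR[OF that] P by (auto simp: norm_prod_def real_sqrt_mult)
    have "subspace (P ` R)"
    proof (rule subspaceI)
      show "0 \<in> P ` R" by (rule image_eqI[of _ _ 0]) (simp_all only: lin subspace_0[OF sR])
      show "x + y \<in> P ` R" if "x \<in> P ` R" "y \<in> P ` R" for x y
      proof -
        obtain p q where "p \<in> R" "q \<in> R" "x = P p" "y = P q" using \<open>x \<in> P ` R\<close> \<open>y \<in> P ` R\<close> by auto
        then show ?thesis
          by (intro image_eqI[of _ _ "p + q"]) (simp_all only: lin subspace_add[OF sR])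
      qed
      show "c *\<^sub>R x \<in> P ` R" if "x \<in> P ` R" for c x
      proof -
        obtain p where "p \<in> R" "x = P p" using \<open>x \<in> P ` R\<close> by auto
        then show ?thesis
          by (intro image_eqI[of _ _ "c *\<^sub>R p"]) (simp_all only: lin subspace_scale[OF sR])
      qed
    qed
    moreover have "closed (P ` R)"
    proof (rule closed_sequential_limits[THEN iffD2], intro allI impI, elim conjE)
      fix x l assume x: "\<forall>n. x n \<in> P ` R" and xl: "x \<longlonglongrightarrow> l"
      have "\<forall>n. \<exists>p. p \<in> R \<and> x n = P p" using x by (simp only: image_iff) blast
      from choice[OF this] obtain p where p': "\<forall>n. p n \<in> R \<and> x n = P (p n)" ..
      then have p: "\<And>n. p n \<in> R" "\<And>n. x n = P (p n)" by simp_all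
      have "Cauchy p"
      proof (rule CauchyI)
        fix e :: real assume "e > 0"
        then have "e / sqrt 2 > 0" by simp
        then obtain M where M: "\<And>m n. m \<ge> M \<Longrightarrow> n \<ge> M \<Longrightarrow> norm (x m - x n) < e / sqrt 2"
          using LIMSEQ_imp_Cauchy[OF xl, unfolded Cauchy_iff] by blast
        have "norm (p m - p n) < e" if "m \<ge> M" "n \<ge> M" for m n
        proof -
          have "norm (p m - p n) = sqrt 2 * norm (x m - x n)"
            using nP[OF subspace_diff[OF sR p(1) p(1)], of m n] by (simp only: lin p(2))
          also have "\<dots> < sqrt 2 * (e / sqrt 2)" using M[OF that] by (intro mult_strict_left_mono) auto
          finally show ?thesis by simp
        qed
        then show "\<exists>M. \<forall>m\<ge>M. \<forall>n\<ge>M. norm (p m - p n) < e" by blast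
      qed
      then obtain q where q: "p \<longlonglongrightarrow> q" by (auto simp: Cauchy_convergent_iff convergent_def)
      have "q \<in> R" using clR p(1) q unfolding closed_sequential_limits by blast
      moreover have "(\<lambda>n. P (p n)) \<longlonglongrightarrow> P q" using P tendsto_fst[OF q] tendsto_snd[OF q] by (elim disjE) simp_all
      then have "l = P q" using xl unfolding p(2)[symmetric] by (rule LIMSEQ_unique[rotated])
      ultimately show "l \<in> P ` R" by blast
    qed
    moreover have "(c *\<^sub>C g i, c *\<^sub>C h i) \<in> R" for c i
      unfolding R_def B_def by (intro subsetD[OF closure_subset] span_base) auto
    ultimately show ?thesis
      using orthogonal_vector_exists[of "P ` R"] tt by (metis UNIV_eq_I imageI)
  qed
  have orth: "u = 0" if "total_family f" "\<And>i c. inner (c *\<^sub>C f i) u = 0" for f :: "'i \<Rightarrow> 'n l2" and u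
  proof -
    have "cinner (f i) u = 0" for i
      using that(2)[of 1 i] that(2)[of \<i> i] Im_cinner[of "f i" u]
      by (simp add: complex_eq_iff inner_l2_cinner scaleC_simps)
    then show ?thesis using that(1) by (simp add: total_family_def)
  qed
  have fR: "fst ` R = UNIV" by (rule full) (use orth[OF tot(1)] in auto)
  have sndR: "snd ` R = UNIV" by (rule full) (use orth[OF tot(2)] in auto)
  have uniq: "v = w" if "(u, v) \<in> R" "(u, w) \<in> R" for u v w
    using isoR[OF subspace_diff[OF sR that]] by simp
  have uniq': "v = w" if "(v, u) \<in> R" "(w, u) \<in> R" for u v w
    using isoR[OF subspace_diff[OF sR that]] by simp
  have cR: "(c *\<^sub>C u, c *\<^sub>C v) \<in> R" if x: "(u, v) \<in> R" for c u v
  proof -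
    have cs: "(c *\<^sub>C fst p, c *\<^sub>C snd p) \<in> span B" if "p \<in> span B" for p
      using that
    proof (induction rule: span_induct_alt)
      case base then show ?case using span_0[of B] by (simp add: scaleC_simps zero_prod_def)
    next
      case (step r b p)
      then obtain c' i where b: "b = (c' *\<^sub>C g i, c' *\<^sub>C h i)" by (auto simp: B_def)
      have "((c * c') *\<^sub>C g i, (c * c') *\<^sub>C h i) \<in> span B" by (intro span_base) (auto simp: B_def)
      from span_add[OF span_scale[OF this, of r] step.IH] show ?case
        by (simp add: b scaleR_scaleC scaleC_simps mult_ac)
    qed
    obtain a where a: "\<And>n. a n \<in> span B" "a \<longlonglongrightarrow> (u, v)"
      using x unfolding R_def by (auto simp: closure_sequential)
    have lc: "(\<lambda>n. c *\<^sub>C f n) \<longlonglongrightarrow> c *\<^sub>C l" if "f \<longlonglongrightarrow> l" for f :: "nat \<Rightarrow> 'n l2" and l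
    proof -
      have "(\<lambda>n. cmod c * norm (f n - l)) \<longlonglongrightarrow> 0"
        using tendsto_mult_right_zero[OF tendsto_norm_zero[OF Lim_null[THEN iffD1, OF that]]] .
      then have "(\<lambda>n. norm (c *\<^sub>C f n - c *\<^sub>C l)) \<longlonglongrightarrow> 0"
        by (simp only: norm_scaleC scaleC_simps(2)[symmetric])
      from Lim_null[THEN iffD2, OF tendsto_norm_zero_cancel[OF this]] show ?thesis .
    qed
    have "(\<lambda>n. (c *\<^sub>C fst (a n), c *\<^sub>C snd (a n))) \<longlonglongrightarrow> (c *\<^sub>C u, c *\<^sub>C v)"
      using lc[OF tendsto_fst[OF a(2)]] lc[OF tendsto_snd[OF a(2)]] by (intro tendsto_Pair) simp_all
    then show ?thesis unfolding R_def closure_sequential using cs[OF a(1)]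
      by (intro exI[of _ "\<lambda>n. (c *\<^sub>C fst (a n), c *\<^sub>C snd (a n))"] conjI allI)
  qed
  define W where "W u = (SOME v. (u, v) \<in> R)" for u
  have WR: "(u, W u) \<in> R" for u
  proof -
    have "u \<in> fst ` R" using fR by simp
    then have "\<exists>v. (u, v) \<in> R" by force
    then show ?thesis unfolding W_def by (rule someI_ex)
  qed
  have Weq: "W u = v" if "(u, v) \<in> R" for u v using uniq[OF WR that] .
  have "W (u + v) = W u + W v" for u v
    using Weq subspace_add[OF sR WR[of u] WR[of v]] by simp
  moreover have "W (c *\<^sub>C u) = c *\<^sub>C W u" for c u using Weq cR[OF WR] by blast
  moreover have "norm (W u) = norm u" for u using isoR[OF WR[of u]] by simp
  moreover have "W (g i) = h i" for i
  proof (rule Weq)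
    have "(1 *\<^sub>C g i, 1 *\<^sub>C h i) \<in> R"
      unfolding R_def B_def by (intro subsetD[OF closure_subset] span_base) blast
    then show "(g i, h i) \<in> R" by (simp add: scaleC_simps)
  qed
  moreover have "bij W"
  proof (rule bijI)
    show "inj W" by (rule injI) (metis WR uniq')
    show "surj W"
    proof (rule surjI)
      fix v
      have "v \<in> snd ` R" using sndR by simp
      then have "\<exists>u. (u, v) \<in> R" by force
      then show "W (SOME u. (u, v) \<in> R) = v" by (intro Weq) (rule someI_ex)
    qed
  qed
  ultimately show ?thesis unfolding unitary_l2_def by blast
qed

lemma unitary_l2_simps:
  assumes "unitary_l2 W"
  shows "W (u + v) = W u + W v" "W (c *\<^sub>C u) = c *\<^sub>C W u" "norm (W u) = norm u"
    "W (u - v) = W u - W v" "W 0 = 0" "W (- u) = - W u"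
    "cinner (W u) (W v) = cinner u v" "W (inv W u) = u" "inv W (W u) = u" "W u = W v \<longleftrightarrow> u = v"
proof -
  show 1: "W (u + v) = W u + W v" "W (c *\<^sub>C u) = c *\<^sub>C W u" "norm (W u) = norm u" for u v c
    using assms by (auto simp: unitary_l2_def)
  show 2: "W (- u) = - W u" for u using 1(2)[of "-1" u] by (simp add: scaleC_simps)
  show "W (u - v) = W u - W v" for u v using 1(1)[of u "- v"] 2 by simp
  show "W 0 = 0" using 1(2)[of 0 0] by (simp add: scaleC_simps)
  have re: "inner (W u) (W v) = inner u v" for u v
  proof -
    have "(norm (W u + W v))\<^sup>2 = (norm (u + v))\<^sup>2" by (simp flip: 1(1) add: 1(3))
    moreover have "(norm (W u))\<^sup>2 = (norm u)\<^sup>2" "(norm (W v))\<^sup>2 = (norm v)\<^sup>2" by (simp_all add: 1(3))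
    ultimately show ?thesis
      unfolding power2_norm_eq_inner by (simp add: inner_simps inner_commute)
  qed
  show "cinner (W u) (W v) = cinner u v"
    using re[of u v] re[of "\<i> *\<^sub>C u" v]
    by (simp add: complex_eq_iff Im_cinner inner_l2_cinner[symmetric] 1(2))
  show "W (inv W u) = u" "inv W (W u) = u" "W u = W v \<longleftrightarrow> u = v"
    using assms by (auto simp: unitary_l2_def bij_def surj_f_inv_f inj_def)
qed

lemma unitary_l2_inv:
  assumes "unitary_l2 W"
  shows "unitary_l2 (inv W)"
proof -
  note W = unitary_l2_simps[OF assms]
  have b: "bij W" using assms by (simp add: unitary_l2_def)
  have 1: "inv W (u + v) = inv W u + inv W v" for u v
    by (subst W(10)[symmetric]) (simp only: W)
  have 2: "inv W (c *\<^sub>C u) = c *\<^sub>C inv W u" for c u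
    by (subst W(10)[symmetric]) (simp only: W)
  have 3: "norm (inv W u) = norm u" for u
    using W(3)[of "inv W u"] by (simp only: W)
  show ?thesis unfolding unitary_l2_def using b 1 2 3 by (simp add: bij_imp_bij_inv)
qed

lemma unitary_l2_bounded_linear:
  assumes "unitary_l2 W" shows "bounded_linear W"
  by (rule bounded_linear_intro[of _ 1])
    (simp_all add: unitary_l2_simps(1-3)[OF assms] scaleR_scaleC)

section \<open>Multiplication operators\<close>

definition bounded_borel :: "(real^'n::finite \<Rightarrow> complex) \<Rightarrow> bool" where
  "bounded_borel m \<longleftrightarrow> m \<in> borel_measurable borel \<and> (\<exists>B. \<forall>a. cmod (m a) \<le> B)"

definition mult_l2 :: "(real^'n::finite \<Rightarrow> complex) \<Rightarrow> 'n l2 \<Rightarrow> 'n l2" where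
  "mult_l2 m u = l2_of (\<lambda>a. m a * rep_l2 u a)"

lemma square_integrable_mono:
  assumes "f \<in> borel_measurable borel" "square_integrable g" "AE a in lborel. cmod (f a) \<le> cmod (g a)"
  shows "square_integrable f"
  unfolding square_integrable_def
proof (rule conjI[OF assms(1)], rule Bochner_Integration.integrable_bound)
  show "integrable lborel (\<lambda>a. (cmod (g a))\<^sup>2)" using assms(2) by (simp add: square_integrable_def)
  show "AE a in lborel. norm ((cmod (f a))\<^sup>2) \<le> norm ((cmod (g a))\<^sup>2)"
    using assms(3) by eventually_elim (simp add: power_mono)
qed (use assms(1) in measurable)

lemma norm_l2_of_mono:
  assumes "square_integrable f" "square_integrable g" "AE a in lborel. cmod (f a) \<le> cmod (g a)"
  shows "norm (l2_of f) \<le> norm (l2_of g)"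
proof (rule power2_le_imp_le)
  show "(norm (l2_of f))\<^sup>2 \<le> (norm (l2_of g))\<^sup>2"
    unfolding norm_l2_of[OF assms(1)] norm_l2_of[OF assms(2)]
  proof (rule integral_mono_AE)
    show "integrable lborel (\<lambda>a. (cmod (f a))\<^sup>2)" "integrable lborel (\<lambda>a. (cmod (g a))\<^sup>2)"
      using assms by (simp_all add: square_integrable_def)
    show "AE a in lborel. (cmod (f a))\<^sup>2 \<le> (cmod (g a))\<^sup>2"
      using assms(3) by eventually_elim (simp add: power_mono)
  qed
qed simp

lemma square_integrable_mult:
  assumes "bounded_borel m" "square_integrable f"
  shows "square_integrable (\<lambda>a. m a * f a)"
proof -
  obtain B where B: "\<And>a. cmod (m a) \<le> B" using assms(1) by (auto simp: bounded_borel_def)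
  have [measurable]: "m \<in> borel_measurable borel" "f \<in> borel_measurable borel"
    using assms by (auto simp: bounded_borel_def square_integrable_def)
  show ?thesis
  proof (rule square_integrable_mono)
    show "square_integrable (\<lambda>a. of_real B * f a)" by (rule square_integrable_mult_left[OF assms(2)])
    have "cmod (m a) \<le> \<bar>B\<bar>" for a using B[of a] by linarith
    then show "AE a in lborel. cmod (m a * f a) \<le> cmod (of_real B * f a)"
      by (simp add: norm_mult mult_right_mono)
  qed measurable
qed

lemma rep_mult_l2: "bounded_borel m \<Longrightarrow> AE a in lborel. rep_l2 (mult_l2 m u) a = m a * rep_l2 u a"
  unfolding mult_l2_def by (rule rep_l2_of[OF square_integrable_mult]) simp_all

lemma mult_l2_of:
  assumes "bounded_borel m" "square_integrable f"
  shows "mult_l2 m (l2_of f) = l2_of (\<lambda>a. m a * f a)"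
proof -
  have "AE a in lborel. m a * rep_l2 (l2_of f) a = m a * f a"
    using rep_l2_of[OF assms(2)] by eventually_elim simp
  then show ?thesis
    unfolding mult_l2_def by (simp add: l2_of_eq_iff square_integrable_mult assms)
qed

lemma bounded_borel_mult: "bounded_borel m \<Longrightarrow> bounded_borel k \<Longrightarrow> bounded_borel (\<lambda>a. m a * k a)"
proof -
  assume "bounded_borel m" "bounded_borel k"
  then obtain A B where m: "m \<in> borel_measurable borel" "k \<in> borel_measurable borel"
    and AB: "\<And>a. cmod (m a) \<le> A" "\<And>a. cmod (k a) \<le> B" by (auto simp: bounded_borel_def)
  have "cmod (m a * k a) \<le> A * B" for a
    unfolding norm_mult using AB[of a] order_trans[OF norm_ge_zero AB(1)[of a]] by (intro mult_mono) simp_all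
  with borel_measurable_times[OF m] show ?thesis unfolding bounded_borel_def by blast
qed

lemma bounded_borel_cnj: "bounded_borel m \<Longrightarrow> bounded_borel (\<lambda>a. cnj (m a))"
  unfolding bounded_borel_def by (simp add: borel_measurable_cnj)

lemma mult_l2_add: "bounded_borel m \<Longrightarrow> mult_l2 m (u + v) = mult_l2 m u + mult_l2 m v"
proof -
  assume m: "bounded_borel m"
  show ?thesis
    unfolding l2_eq_iff
    using rep_mult_l2[OF m, of "u + v"] rep_mult_l2[OF m, of u] rep_mult_l2[OF m, of v]
      rep_l2_add[of u v] rep_l2_add[of "mult_l2 m u" "mult_l2 m v"]
    by eventually_elim (simp add: algebra_simps)
qed

lemma mult_l2_scaleC: "bounded_borel m \<Longrightarrow> mult_l2 m (c *\<^sub>C u) = c *\<^sub>C mult_l2 m u"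
proof -
  assume m: "bounded_borel m"
  show ?thesis
    unfolding l2_eq_iff
    using rep_mult_l2[OF m, of "c *\<^sub>C u"] rep_mult_l2[OF m, of u]
      rep_l2_scaleC[of c u] rep_l2_scaleC[of c "mult_l2 m u"]
    by eventually_elim simp
qed

lemma mult_l2_mult:
  assumes m: "bounded_borel m" and k: "bounded_borel k"
  shows "mult_l2 m (mult_l2 k u) = mult_l2 (\<lambda>a. m a * k a) u"
  unfolding l2_eq_iff
  using rep_mult_l2[OF m, of "mult_l2 k u"] rep_mult_l2[OF k, of u] rep_mult_l2[OF bounded_borel_mult[OF m k], of u]
  by eventually_elim simp

lemma mult_l2_1: "mult_l2 (\<lambda>a. 1) u = u"
  by (simp add: mult_l2_def)

lemma cinner_mult_l2:
  assumes m: "bounded_borel m"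
  shows "cinner (mult_l2 m u) v = cinner u (mult_l2 (\<lambda>a. cnj (m a)) v)"
  unfolding cinner.rep_eq
proof (rule integral_cong_AE)
  show "AE a in lborel. cnj (rep_l2 (mult_l2 m u) a) * rep_l2 v a =
      cnj (rep_l2 u a) * rep_l2 (mult_l2 (\<lambda>a. cnj (m a)) v) a"
    using rep_mult_l2[OF m, of u] rep_mult_l2[OF bounded_borel_cnj[OF m], of v]
    by eventually_elim simp
qed (simp_all add: borel_measurable_cnj)

text \<open>Dominated convergence: multipliers that are uniformly bounded and converge pointwise give
  operators that converge strongly.\<close>

lemma mult_l2_tendsto:
  fixes w :: "'n::finite l2"
  assumes [measurable]: "\<And>n. m n \<in> borel_measurable borel" "m' \<in> borel_measurable borel"
    and B: "\<And>n a. cmod (m n a) \<le> B" and lim: "AE a in lborel. (\<lambda>n::nat. m n a) \<longlonglongrightarrow> m' a"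
    and B': "\<And>a. cmod (m' a) \<le> B"
  shows "(\<lambda>n. mult_l2 (m n) w) \<longlonglongrightarrow> mult_l2 m' w"
proof -
  have bb: "bounded_borel (m n)" "bounded_borel m'" for n
    using B B' by (auto simp: bounded_borel_def)
  have eq: "(norm (mult_l2 (m n) w - mult_l2 m' w))\<^sup>2 = (LINT a|lborel. (cmod (m n a - m' a))\<^sup>2 * (cmod (rep_l2 w a))\<^sup>2)" for n
    unfolding norm_l2_rep
    using rep_l2_diff[of "mult_l2 (m n) w" "mult_l2 m' w"] rep_mult_l2[OF bb(1), of n w] rep_mult_l2[OF bb(2), of w]
  proof (intro integral_cong_AE, goal_cases)
    case 3
    then show ?case by eventually_elim (simp add: left_diff_distrib[symmetric] norm_mult power_mult_distrib)
  qed measurable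
  have "(\<lambda>n. (LINT a|lborel. (cmod (m n a - m' a))\<^sup>2 * (cmod (rep_l2 w a))\<^sup>2)) \<longlonglongrightarrow> (LINT (a::real^'n)|lborel. (0::real))"
  proof (rule integral_dominated_convergence)
    show "integrable lborel (\<lambda>a. (2 * B)\<^sup>2 * (cmod (rep_l2 w a))\<^sup>2)"
      using square_integrable_rep_l2[of w] by (auto simp: square_integrable_def)
    show "AE a in lborel. (\<lambda>n. (cmod (m n a - m' a))\<^sup>2 * (cmod (rep_l2 w a))\<^sup>2) \<longlonglongrightarrow> 0"
      using lim
    proof eventually_elim
      fix a assume "(\<lambda>n. m n a) \<longlonglongrightarrow> m' a"
      then have "(\<lambda>n. (cmod (m n a - m' a))\<^sup>2 * (cmod (rep_l2 w a))\<^sup>2) \<longlonglongrightarrow> (cmod (m' a - m' a))\<^sup>2 * (cmod (rep_l2 w a))\<^sup>2"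
        by (intro tendsto_intros)
      then show "(\<lambda>n. (cmod (m n a - m' a))\<^sup>2 * (cmod (rep_l2 w a))\<^sup>2) \<longlonglongrightarrow> 0" by simp
    qed
    show "AE a in lborel. norm ((cmod (m n a - m' a))\<^sup>2 * (cmod (rep_l2 w a))\<^sup>2) \<le> (2 * B)\<^sup>2 * (cmod (rep_l2 w a))\<^sup>2" for n
    proof (rule AE_I2)
      fix a
      have "cmod (m n a - m' a) \<le> 2 * B" using norm_triangle_ineq4[of "m n a" "m' a"] B[of n a] B'[of a] by linarith
      then have "(cmod (m n a - m' a))\<^sup>2 \<le> (2 * B)\<^sup>2" by (intro power_mono) auto
      then show "norm ((cmod (m n a - m' a))\<^sup>2 * (cmod (rep_l2 w a))\<^sup>2) \<le> (2 * B)\<^sup>2 * (cmod (rep_l2 w a))\<^sup>2"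
        by (simp add: mult_right_mono)
    qed
  qed measurable
  then have "(\<lambda>n. (norm (mult_l2 (m n) w - mult_l2 m' w))\<^sup>2) \<longlonglongrightarrow> 0" by (simp only: eq) simp
  then have "(\<lambda>n. norm (mult_l2 (m n) w - mult_l2 m' w)) \<longlonglongrightarrow> 0" by simp
  from Lim_null[THEN iffD2, OF tendsto_norm_zero_cancel[OF this]] show ?thesis .
qed

section \<open>Projection-valued measures\<close>

context
  fixes E :: "real set \<Rightarrow> 'n::finite l2 \<Rightarrow> 'n l2"
  assumes E: "projection_valued_measure E"
begin

lemma pvm_proj:
  assumes "A \<in> sets borel"
  shows "E A (u + v) = E A u + E A v" "E A (c *\<^sub>C u) = c *\<^sub>C E A u" "E A (E A u) = E A u"
    "cinner (E A u) v = cinner u (E A v)"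
proof -
  have P: "orthogonal_projection (E A)"
    using E assms unfolding projection_valued_measure_def by simp
  show "E A (u + v) = E A u + E A v" "E A (c *\<^sub>C u) = c *\<^sub>C E A u" "E A (E A u) = E A u"
    "cinner (E A u) v = cinner u (E A v)"
    using P unfolding orthogonal_projection_def by simp_all
qed

lemma pvm_diff:
  assumes "A \<in> sets borel"
  shows "E A (u - v) = E A u - E A v"
  using pvm_proj(1)[OF assms, of u "(-1) *\<^sub>C v"] pvm_proj(2)[OF assms, of "-1" v] by (simp add: scaleC_simps)

lemma pvm_UNIV: "E UNIV u = u"
  using E unfolding projection_valued_measure_def by simp

lemma pvm_Int: "A \<in> sets borel \<Longrightarrow> B \<in> sets borel \<Longrightarrow> E A (E B u) = E (A \<inter> B) u"
proof -
  assume "A \<in> sets borel" "B \<in> sets borel"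
  then have "E (A \<inter> B) = E A \<circ> E B" using E unfolding projection_valued_measure_def by simp
  then show ?thesis by simp
qed

lemma pvm_sums: "range A \<subseteq> sets borel \<Longrightarrow> disjoint_family A \<Longrightarrow> (\<lambda>k::nat. E (A k) u) sums E (\<Union>k. A k) u"
  using E unfolding projection_valued_measure_def by simp

lemma pvm_empty: "E {} u = 0"
proof -
  have "(\<lambda>k::nat. E {} u) sums E {} u"
    using pvm_sums[of "\<lambda>k. {}" u] by (simp add: disjoint_family_on_def)
  then have "(\<lambda>k::nat. E {} u) \<longlonglongrightarrow> 0" by (intro summable_LIMSEQ_zero sums_summable)
  then show ?thesis by (simp add: LIMSEQ_const_iff)
qed

lemma pvm_Un:
  assumes "A \<in> sets borel" "B \<in> sets borel" "A \<inter> B = {}"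
  shows "E (A \<union> B) u = E A u + E B u"
proof -
  have "(\<lambda>k. E (binaryset A B k) u) sums E (\<Union>k. binaryset A B k) u"
    using assms by (intro pvm_sums) (auto simp: range_binaryset_eq disjoint_family_on_def binaryset_def)
  moreover have "(\<lambda>k. E (binaryset A B k) u) sums (E A u + E B u)"
    using binaryset_sums[of "\<lambda>A. E A u" A B] by (simp add: pvm_empty)
  ultimately show ?thesis unfolding UN_binaryset_eq by (rule sums_unique2)
qed

lemma pvm_Compl: "A \<in> sets borel \<Longrightarrow> E (- A) u = u - E A u"
  using pvm_Un[of A "- A" u] pvm_UNIV[of u] by (simp add: algebra_simps)

lemma pvm_norm: "A \<in> sets borel \<Longrightarrow> of_real ((norm (E A u))\<^sup>2) = cinner u (E A u)"
  unfolding cinner_self[symmetric] by (simp only: pvm_proj)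

lemma pvm_norm_le:
  assumes "A \<in> sets borel" shows "norm (E A u) \<le> norm u"
proof (cases "E A u = 0")
  case False
  have "(norm (E A u))\<^sup>2 = Re (cinner u (E A u))"
    using arg_cong[OF pvm_norm[OF assms, of u], of Re] by (simp only: Re_complex_of_real)
  also have "\<dots> \<le> norm u * norm (E A u)"
    by (rule order_trans[OF complex_Re_le_cmod norm_cinner_le])
  finally show ?thesis using False by (simp add: power2_eq_square)
qed simp

lemma pvm_bounded_linear: "A \<in> sets borel \<Longrightarrow> bounded_linear (E A)"
  by (rule bounded_linear_intro[of _ 1]) (simp_all add: pvm_proj scaleR_scaleC pvm_norm_le)

lemma sets_scalar_spectral_measure [simp]: "sets (scalar_spectral_measure E u) = sets borel"
  "space (scalar_spectral_measure E u) = UNIV"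
  using sets.sigma_sets_eq[of "borel :: real measure"] by (simp_all add: scalar_spectral_measure_def)

lemma emeasure_scalar_spectral_measure:
  assumes A: "A \<in> sets borel"
  shows "emeasure (scalar_spectral_measure E u) A = ennreal ((norm (E A u))\<^sup>2)"
  unfolding scalar_spectral_measure_def
proof (rule emeasure_measure_of_sigma)
  show "sigma_algebra UNIV (sets (borel :: real measure))"
    using sets.sigma_algebra_axioms[of "borel :: real measure"] by simp
  show "positive (sets borel) (\<lambda>A. ennreal ((norm (E A u))\<^sup>2))" by (simp add: positive_def pvm_empty)
  show "countably_additive (sets borel) (\<lambda>A. ennreal ((norm (E A u))\<^sup>2))"
  proof (rule countably_additiveI)
    fix A :: "nat \<Rightarrow> real set"
    assume A: "range A \<subseteq> sets borel" "disjoint_family A" "\<Union> (range A) \<in> sets borel"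
    have "(\<lambda>k. inner u (E (A k) u)) sums inner u (E (\<Union> (range A)) u)"
      by (rule bounded_linear.sums[OF bounded_linear_inner_right pvm_sums[OF A(1,2)]])
    moreover have "inner u (E B u) = (norm (E B u))\<^sup>2" if "B \<in> sets borel" for B
      unfolding inner_l2_cinner pvm_norm[OF that, symmetric] by (rule Re_complex_of_real)
    ultimately have "(\<lambda>k. (norm (E (A k) u))\<^sup>2) sums (norm (E (\<Union> (range A)) u))\<^sup>2"
      using A by auto
    then show "(\<Sum>i. ennreal ((norm (E (A i) u))\<^sup>2)) = ennreal ((norm (E (\<Union> (range A)) u))\<^sup>2)"
      by (intro suminf_ennreal_eq) auto
  qed
qed (use A in simp)

lemma finite_scalar_spectral_measure: "finite_measure (scalar_spectral_measure E u)"
  by (rule finite_measureI) (simp add: emeasure_scalar_spectral_measure)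

text \<open>Holds because \<open>E B (E A u) = E (A \<inter> B) u\<close>. Splitting integrals over \<open>A\<close> and its complement thus
  corresponds to splitting the vector.\<close>

lemma scalar_spectral_measure_restrict:
  assumes A: "A \<in> sets borel"
  shows "scalar_spectral_measure E (E A u) = density (scalar_spectral_measure E u) (indicator A)"
proof -
  define M where "M = scalar_spectral_measure E u"
  have sM: "sets M = sets borel" by (simp only: M_def sets_scalar_spectral_measure)
  have em: "emeasure (scalar_spectral_measure E (E A u)) B = emeasure (density M (indicator A)) B"
    if B: "B \<in> sets borel" for B
  proof -
    have "emeasure (density M (indicator A)) B = (\<integral>\<^sup>+x. indicator A x * indicator B x \<partial>M)"
      using A B by (intro emeasure_density borel_measurable_indicator) (simp_all only: sM)
    also have "\<dots> = (\<integral>\<^sup>+x. indicator (A \<inter> B) x \<partial>M)"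
      by (intro nn_integral_cong) (auto simp: indicator_def)
    also have "\<dots> = emeasure M (A \<inter> B)"
      using A B by (intro nn_integral_indicator) (simp only: sM sets.Int)
    also have "\<dots> = ennreal ((norm (E (A \<inter> B) u))\<^sup>2)"
      unfolding M_def using A B by (intro emeasure_scalar_spectral_measure sets.Int)
    also have "E (A \<inter> B) u = E B (E A u)"
      using pvm_Int[OF B A, of u] by (simp only: Int_commute)
    finally show ?thesis
      unfolding emeasure_scalar_spectral_measure[OF B] ..
  qed
  show ?thesis unfolding M_def[symmetric]
    by (rule measure_eqI) (simp_all only: sets_density sM sets_scalar_spectral_measure em)
qed

lemma AE_scalar_spectral_measure:
  assumes A: "A \<in> sets borel" and u: "E A u = u"
  shows "AE x in scalar_spectral_measure E u. x \<in> A"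
proof -
  have "AE x in density (scalar_spectral_measure E u) (indicator A). x \<in> A"
  proof (subst AE_density)
    show "(indicator A :: real \<Rightarrow> ennreal) \<in> borel_measurable (scalar_spectral_measure E u)"
      using A by (intro borel_measurable_indicator) simp
    show "AE x in scalar_spectral_measure E u. (0::ennreal) < indicator A x \<longrightarrow> x \<in> A"
      by (rule AE_I2) (simp add: indicator_def)
  qed
  then show ?thesis by (subst scalar_spectral_measure_restrict[OF A, of u, unfolded u])
qed

end

section \<open>Functional calculus of an operator diagonalized by a unitary map\<close>

text \<open>A real multiplication operator in disguise. Below, \<open>T\<close> is multiplication by \<open>t\<close> on its maximal
  domain, transported by \<open>W\<close>; \<open>fc f\<close> is the transported multiplication by \<open>f \<circ> t\<close>, and \<open>E0\<close> the
  evident spectral measure.\<close>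

locale diagonalized =
  fixes W :: "'n::finite l2 \<Rightarrow> 'n l2" and t :: "real^'n \<Rightarrow> real"
  assumes W: "unitary_l2 W" and t_measurable [measurable]: "t \<in> borel_measurable borel"
begin

definition T :: "'n operator" where
  "T = {(u, v). AE a in lborel. of_real (t a) * rep_l2 (W u) a = rep_l2 (W v) a}"

definition fc :: "(real \<Rightarrow> complex) \<Rightarrow> 'n l2 \<Rightarrow> 'n l2" where
  "fc f u = inv W (mult_l2 (\<lambda>a. f (t a)) (W u))"

definition E0 :: "real set \<Rightarrow> 'n l2 \<Rightarrow> 'n l2" where
  "E0 A = fc (indicator A)"

lemmas Ws = unitary_l2_simps(1-9)[OF W]
lemmas iWs = unitary_l2_simps(1-7)[OF unitary_l2_inv[OF W]]

lemma W_inj: "W u = W v \<longleftrightarrow> u = v"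
  by (rule unitary_l2_simps(10)[OF W])

lemma W_fc: "W (fc f u) = mult_l2 (\<lambda>a. f (t a)) (W u)"
  by (simp add: fc_def Ws)

lemma bounded_borel_t:
  assumes [measurable]: "f \<in> borel_measurable borel" and "\<And>x. cmod (f x) \<le> B"
  shows "bounded_borel (\<lambda>a. f (t a))"
  unfolding bounded_borel_def using assms(2) by (intro conjI exI[of _ B]) auto

lemma bounded_borel_indicator_t:
  assumes "A \<in> sets borel"
  shows "bounded_borel (\<lambda>a. indicator A (t a) :: complex)"
  using assms by (intro bounded_borel_t[of _ 1] borel_measurable_indicator) (auto simp: indicator_def)

lemma linear_T: "linear_op T"
  unfolding linear_op_def
proof (intro conjI ballI allI)
  show "single_valued T"
  proof (rule single_valuedI)
    fix u v w assume "(u, v) \<in> T" "(u, w) \<in> T"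
    then have "AE a in lborel. of_real (t a) * rep_l2 (W u) a = rep_l2 (W v) a"
      "AE a in lborel. of_real (t a) * rep_l2 (W u) a = rep_l2 (W w) a" by (simp_all add: T_def)
    then have "AE a in lborel. rep_l2 (W v) a = rep_l2 (W w) a" by eventually_elim simp
    then show "v = w" using W_inj l2_eq_iff by blast
  qed
  show "(0, 0) \<in> T"
  proof -
    have "AE a in lborel. rep_l2 (0::'n l2) a = 0"
      using rep_l2_of[OF square_integrable_0] by (simp add: l2_of_0)
    then have "AE a in lborel. of_real (t a) * rep_l2 (0::'n l2) a = rep_l2 (0::'n l2) a"
      by eventually_elim simp
    then show ?thesis by (simp add: T_def Ws)
  qed
  show "case p of (u, u') \<Rightarrow> \<forall>(v, v')\<in>T. (u + v, u' + v') \<in> T" if "p \<in> T" for p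
  proof (clarify)
    fix u u' v v' assume "p = (u, u')" and v: "(v, v') \<in> T"
    with that have u: "(u, u') \<in> T" by simp
    have "AE a in lborel. of_real (t a) * rep_l2 (W u + W v) a = rep_l2 (W u' + W v') a"
      using u[unfolded T_def, simplified] v[unfolded T_def, simplified] rep_l2_add[of "W u" "W v"] rep_l2_add[of "W u'" "W v'"]
      by eventually_elim (simp add: algebra_simps)
    then show "(u + v, u' + v') \<in> T" by (simp add: T_def Ws)
  qed
  show "case p of (u, u') \<Rightarrow> (c *\<^sub>C u, c *\<^sub>C u') \<in> T" if "p \<in> T" for p c
  proof (clarify)
    fix u u' assume "p = (u, u')"
    with that have u: "(u, u') \<in> T" by simp
    have "AE a in lborel. of_real (t a) * rep_l2 (c *\<^sub>C W u) a = rep_l2 (c *\<^sub>C W u') a"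
      using u[unfolded T_def, simplified] rep_l2_scaleC[of c "W u"] rep_l2_scaleC[of c "W u'"]
      by eventually_elim simp
    then show "(c *\<^sub>C u, c *\<^sub>C u') \<in> T" by (simp add: T_def Ws)
  qed
qed

lemma T_symmetric:
  assumes "(u, u') \<in> T" "(v, v') \<in> T"
  shows "cinner u v' = cinner u' v"
proof -
  have "cinner (W u) (W v') = cinner (W u') (W v)"
    unfolding cinner.rep_eq
  proof (rule integral_cong_AE)
    show "AE a in lborel. cnj (rep_l2 (W u) a) * rep_l2 (W v') a = cnj (rep_l2 (W u') a) * rep_l2 (W v) a"
      using assms[unfolded T_def, simplified]
    proof eventually_elim
      fix a assume "of_real (t a) * rep_l2 (W u) a = rep_l2 (W u') a"
        and "of_real (t a) * rep_l2 (W v) a = rep_l2 (W v') a"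
      then show "cnj (rep_l2 (W u) a) * rep_l2 (W v') a = cnj (rep_l2 (W u') a) * rep_l2 (W v) a"
        by (simp flip: \<open>of_real (t a) * rep_l2 (W u) a = rep_l2 (W u') a\<close> \<open>of_real (t a) * rep_l2 (W v) a = rep_l2 (W v') a\<close>)
    qed
  qed (simp_all add: borel_measurable_cnj)
  then show ?thesis by (simp only: Ws)
qed

lemma T_I:
  assumes v: "square_integrable g" and eq: "AE a in lborel. of_real (t a) * rep_l2 (W u) a = g a"
  shows "(u, inv W (l2_of g)) \<in> T"
proof -
  have "AE a in lborel. of_real (t a) * rep_l2 (W u) a = rep_l2 (l2_of g) a"
    using eq rep_l2_of[OF v] by eventually_elim simp
  then show ?thesis by (simp add: T_def Ws)
qed

lemma Domain_T: "Domain T = {u. square_integrable (\<lambda>a. of_real (t a) * rep_l2 (W u) a)}"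
proof (intro set_eqI iffI)
  fix u assume "u \<in> Domain T"
  then obtain v where v: "(u, v) \<in> T" by blast
  have "square_integrable (\<lambda>a. of_real (t a) * rep_l2 (W u) a)"
  proof (rule square_integrable_mono)
    show "square_integrable (rep_l2 (W v))" by simp
    show "AE a in lborel. cmod (of_real (t a) * rep_l2 (W u) a) \<le> cmod (rep_l2 (W v) a)"
      using v[unfolded T_def, simplified] by eventually_elim simp
  qed measurable
  then show "u \<in> {u. square_integrable (\<lambda>a. of_real (t a) * rep_l2 (W u) a)}" by simp
next
  fix u assume "u \<in> {u. square_integrable (\<lambda>a. of_real (t a) * rep_l2 (W u) a)}"
  then have "(u, inv W (l2_of (\<lambda>a. of_real (t a) * rep_l2 (W u) a))) \<in> T" by (intro T_I) auto
  then show "u \<in> Domain T" by blast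
qed

text \<open>Cutting \<open>W u\<close> down to a set where \<open>t\<close> is bounded moves \<open>u\<close> into the domain.\<close>

lemma cutoff_in_Domain:
  assumes A: "A \<in> sets borel" and b: "\<And>x. x \<in> A \<Longrightarrow> \<bar>x\<bar> \<le> B"
  shows "(E0 A u, fc (\<lambda>x. of_real x * indicator A x) u) \<in> T"
proof -
  have bb: "bounded_borel (\<lambda>a. of_real (t a) * indicator A (t a) :: complex)"
  proof (rule bounded_borel_t[where f = "\<lambda>x. of_real x * indicator A x" and B = "\<bar>B\<bar>"])
    show "(\<lambda>x. complex_of_real x * indicator A x) \<in> borel_measurable borel"
      using A by measurable
    show "cmod (of_real x * indicator A x) \<le> \<bar>B\<bar>" for x
      using b[of x] by (auto simp: indicator_def)
  qed
  have "AE a in lborel. of_real (t a) * rep_l2 (W (E0 A u)) a = rep_l2 (W (fc (\<lambda>x. of_real x * indicator A x) u)) a"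
    unfolding E0_def W_fc
    using rep_mult_l2[OF bounded_borel_indicator_t[OF A], of "W u"] rep_mult_l2[OF bb, of "W u"]
    by eventually_elim simp
  then show ?thesis by (simp add: T_def)
qed

lemma E0_cutoff_tendsto: "(\<lambda>n. E0 {- real n..real n} u) \<longlonglongrightarrow> u"
proof -
  have "(\<lambda>n. mult_l2 (\<lambda>a. indicator {- real n..real n} (t a)) (W u)) \<longlonglongrightarrow> mult_l2 (\<lambda>a. 1) (W u)"
  proof (rule mult_l2_tendsto[where B = 1])
    have "(\<lambda>n. indicator {- real n..real n} (t a) :: complex) \<longlonglongrightarrow> 1" for a
    proof (rule tendsto_eventually, unfold eventually_sequentially, intro exI allI impI)
      fix n assume "nat \<lceil>\<bar>t a\<bar>\<rceil> \<le> n"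
      then have "\<bar>t a\<bar> \<le> real n" by linarith
      then show "indicator {- real n..real n} (t a) = (1::complex)" by (simp add: indicator_def abs_le_iff)
    qed
    then show "AE a in lborel. (\<lambda>n. indicator {- real n..real n} (t a) :: complex) \<longlonglongrightarrow> 1" by simp
  qed (auto simp: indicator_def)
  then have "(\<lambda>n. inv W (mult_l2 (\<lambda>a. indicator {- real n..real n} (t a)) (W u))) \<longlonglongrightarrow> inv W (W u)"
    unfolding mult_l2_1 by (intro bounded_linear.tendsto[OF unitary_l2_bounded_linear[OF unitary_l2_inv[OF W]]])
  then show ?thesis by (simp add: E0_def fc_def Ws)
qed

lemma dense_Domain_T: "closure (Domain T) = UNIV"
proof -
  have "u \<in> closure (Domain T)" for u
    unfolding closure_sequential
  proof (intro exI conjI allI)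
    show "(\<lambda>n. E0 {- real n..real n} u) \<longlonglongrightarrow> u" by (rule E0_cutoff_tendsto)
    show "E0 {- real n..real n} u \<in> Domain T" for n
      using cutoff_in_Domain[of "{- real n..real n}" "real n" u] by (force simp: Domain_iff)
  qed
  then show ?thesis by blast
qed

text \<open>Testing the adjoint relation on vectors whose transform is cut off to \<open>\<bar>t\<bar> \<le> n\<close> identifies the
  adjoint there, and the sets \<open>\<bar>t\<bar> \<le> n\<close> exhaust the space.\<close>

lemma self_adjoint_T: "self_adjoint T"
  unfolding self_adjoint_def
proof (intro conjI linear_T dense_Domain_T equalityI)
  show "T \<subseteq> adjoint_op T"
    unfolding adjoint_op_def using T_symmetric by auto
  show "adjoint_op T \<subseteq> T"
  proof (clarify)
    fix v v' assume "(v, v') \<in> adjoint_op T"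
    then have adj: "cinner v u' = cinner v' u" if "(u, u') \<in> T" for u u'
      using that by (auto simp: adjoint_op_def)
    have cut: "mult_l2 (\<lambda>a. of_real (t a) * indicator {- real n..real n} (t a)) (W v)
        = mult_l2 (\<lambda>a. indicator {- real n..real n} (t a)) (W v')" for n :: nat
    proof (rule cinner_eqI)
      fix w
      let ?A = "{- real n..real n}"
      have bb: "bounded_borel (\<lambda>a. of_real (t a) * indicator ?A (t a) :: complex)"
        by (rule bounded_borel_t[where f = "\<lambda>x. of_real x * indicator ?A x" and B = "real n"])
          (auto simp: indicator_def)
      have bi: "bounded_borel (\<lambda>a. indicator ?A (t a) :: complex)" by (rule bounded_borel_indicator_t) simp
      have sa: "cinner (mult_l2 m x) y = cinner x (mult_l2 m y)" if "bounded_borel m" "\<And>a. cnj (m a) = m a" for m x y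
        using cinner_mult_l2[OF that(1), of x y] that(2) by simp
      have "cinner v (fc (\<lambda>x. of_real x * indicator ?A x) (inv W w)) = cinner v' (E0 ?A (inv W w))"
        by (rule adj, rule cutoff_in_Domain[of ?A "real n"]) auto
      then have "cinner (W v) (W (fc (\<lambda>x. of_real x * indicator ?A x) (inv W w))) = cinner (W v') (W (E0 ?A (inv W w)))"
        by (simp only: Ws(7))
      then have *: "cinner (W v) (mult_l2 (\<lambda>a. of_real (t a) * indicator ?A (t a)) w) = cinner (W v') (mult_l2 (\<lambda>a. indicator ?A (t a)) w)"
        by (simp only: W_fc E0_def Ws(8))
      have "cinner (mult_l2 (\<lambda>a. of_real (t a) * indicator ?A (t a)) (W v)) w = cinner (W v) (mult_l2 (\<lambda>a. of_real (t a) * indicator ?A (t a)) w)"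
        by (rule sa[OF bb]) (simp add: indicator_def)
      moreover have "cinner (mult_l2 (\<lambda>a. indicator ?A (t a)) (W v')) w = cinner (W v') (mult_l2 (\<lambda>a. indicator ?A (t a)) w)"
        by (rule sa[OF bi]) (simp add: indicator_def)
      ultimately have "cinner (mult_l2 (\<lambda>a. of_real (t a) * indicator ?A (t a)) (W v)) w = cinner (mult_l2 (\<lambda>a. indicator ?A (t a)) (W v')) w"
        using * by simp
      then show "cinner w (mult_l2 (\<lambda>a. of_real (t a) * indicator ?A (t a)) (W v)) = cinner w (mult_l2 (\<lambda>a. indicator ?A (t a)) (W v'))"
        using cinner_commute[of w] by simp
    qed
    have "AE a in lborel. \<forall>n::nat. of_real (t a) * indicator {- real n..real n} (t a) * rep_l2 (W v) a
        = indicator {- real n..real n} (t a) * rep_l2 (W v') a"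
      unfolding AE_all_countable
    proof
      fix n :: nat
      let ?A = "{- real n..real n}"
      have bb: "bounded_borel (\<lambda>a. of_real (t a) * indicator ?A (t a) :: complex)"
        by (rule bounded_borel_t[where f = "\<lambda>x. of_real x * indicator ?A x" and B = "real n"])
          (auto simp: indicator_def)
      have bi: "bounded_borel (\<lambda>a. indicator ?A (t a) :: complex)" by (rule bounded_borel_indicator_t) simp
      show "AE a in lborel. of_real (t a) * indicator ?A (t a) * rep_l2 (W v) a = indicator ?A (t a) * rep_l2 (W v') a"
        using rep_mult_l2[OF bb, of "W v"] rep_mult_l2[OF bi, of "W v'"] unfolding cut[of n]
        by eventually_elim (simp only:)
    qed
    then have "AE a in lborel. of_real (t a) * rep_l2 (W v) a = rep_l2 (W v') a"
    proof eventually_elim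
      fix a assume *: "\<forall>n::nat. of_real (t a) * indicator {- real n..real n} (t a) * rep_l2 (W v) a
        = indicator {- real n..real n} (t a) * rep_l2 (W v') a"
      have "\<bar>t a\<bar> \<le> real (nat \<lceil>\<bar>t a\<bar>\<rceil>)" by linarith
      then have "t a \<in> {- real (nat \<lceil>\<bar>t a\<bar>\<rceil>)..real (nat \<lceil>\<bar>t a\<bar>\<rceil>)}"
        unfolding atLeastAtMost_iff by linarith
      then show "of_real (t a) * rep_l2 (W v) a = rep_l2 (W v') a"
        using *[rule_format, of "nat \<lceil>\<bar>t a\<bar>\<rceil>"] by simp
    qed
    then show "(v, v') \<in> T" by (simp add: T_def)
  qed
qed

text \<open>A symmetric operator whose adjoint lies in the self-adjoint operator \<open>T\<close> is essentially
  self-adjoint with closure \<open>T\<close>: any self-adjoint extension lies between the two.\<close>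

lemma self_adjoint_extension_eq:
  assumes "S \<subseteq> T" "adjoint_op S \<subseteq> T"
  shows "self_adjoint_extension S = T"
  unfolding self_adjoint_extension_def
proof (rule the_equality)
  show "S \<subseteq> T \<and> self_adjoint T" using assms(1) self_adjoint_T by simp
  fix R :: "'n operator" assume R: "S \<subseteq> R \<and> self_adjoint R"
  have anti: "adjoint_op B \<subseteq> adjoint_op A" if "A \<subseteq> B" for A B :: "'n operator"
    using that unfolding adjoint_op_def by blast
  have "R = adjoint_op R" "T = adjoint_op T" using R self_adjoint_T by (simp_all add: self_adjoint_def)
  moreover have "adjoint_op R \<subseteq> adjoint_op S" using R anti by blast
  ultimately have "R \<subseteq> T" using assms(2) by blast
  moreover have "T \<subseteq> R" using anti[OF \<open>R \<subseteq> T\<close>] \<open>R = adjoint_op R\<close> \<open>T = adjoint_op T\<close> by simp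
  ultimately show "R = T" by blast
qed

lemma fc_linear:
  assumes "bounded_borel (\<lambda>a. f (t a))"
  shows "fc f (u + v) = fc f u + fc f v" "fc f (c *\<^sub>C u) = c *\<^sub>C fc f u"
  by (simp_all add: fc_def Ws iWs mult_l2_add[OF assms] mult_l2_scaleC[OF assms])

lemma pvm_E0: "projection_valued_measure E0"
  unfolding projection_valued_measure_def
proof (intro conjI ballI allI impI)
  fix A B :: "real set" assume A: "A \<in> sets borel" and B: "B \<in> sets borel"
  note bA = bounded_borel_indicator_t[OF A] and bB = bounded_borel_indicator_t[OF B]
  show "orthogonal_projection (E0 A)"
    unfolding orthogonal_projection_def
  proof (intro conjI allI)
    show "E0 A (u + v) = E0 A u + E0 A v" for u v unfolding E0_def by (rule fc_linear[OF bA])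
    show "E0 A (c *\<^sub>C u) = c *\<^sub>C E0 A u" for c u unfolding E0_def by (rule fc_linear[OF bA])
    show "E0 A (E0 A u) = E0 A u" for u
    proof -
      have "indicator A x * indicator A x = (indicator A x :: complex)" for x :: real
        by (simp add: indicator_def)
      then show ?thesis
        unfolding E0_def fc_def by (simp only: Ws mult_l2_mult[OF bA bA])
    qed
    show "cinner (E0 A u) v = cinner u (E0 A v)" for u v
    proof -
      have "cinner (mult_l2 (\<lambda>a. indicator A (t a)) (W u)) (W v) = cinner (W u) (mult_l2 (\<lambda>a. indicator A (t a)) (W v))"
      proof -
        have "cnj (indicator A x) = indicator A x" for x :: real by (simp add: indicator_def)
        then show ?thesis using cinner_mult_l2[OF bA, of "W u" "W v"] by simp
      qed
      then have "cinner (W (E0 A u)) (W v) = cinner (W u) (W (E0 A v))" by (simp add: E0_def W_fc)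
      then show ?thesis by (simp only: Ws)
    qed
  qed
  show "E0 (A \<inter> B) = E0 A \<circ> E0 B"
    by (rule ext) (simp add: E0_def fc_def Ws mult_l2_mult[OF bA bB] indicator_inter_arith)
next
  show "E0 UNIV = id"
    by (rule ext) (simp add: E0_def fc_def mult_l2_1 Ws)
next
  fix A :: "nat \<Rightarrow> real set" and u
  assume A: "range A \<subseteq> sets borel" and d: "disjoint_family A"
  have bA: "bounded_borel (\<lambda>a. indicator (A k) (t a) :: complex)" for k
    using A by (intro bounded_borel_indicator_t) auto
  have ps: "bounded_borel (\<lambda>a. (\<Sum>k<n. indicator (A k) (t a)) :: complex)
      \<and> (\<Sum>k<n. mult_l2 (\<lambda>a. indicator (A k) (t a)) w) = mult_l2 (\<lambda>a. \<Sum>k<n. indicator (A k) (t a)) w" for n w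
  proof (induction n)
    case 0
    then show ?case by (auto simp: bounded_borel_def mult_l2_def l2_of_0)
  next
    case (Suc n)
    have "bounded_borel (\<lambda>a. (\<Sum>k<Suc n. indicator (A k) (t a)) :: complex)"
    proof -
      have "cmod (\<Sum>k<Suc n. indicator (A k) (t a)) \<le> real (Suc n)" for a
        by (rule order_trans[OF norm_sum order_trans[OF sum_bounded_above[of _ _ 1]]]) (auto simp: indicator_def)
      moreover have "(\<lambda>a. (\<Sum>k<Suc n. indicator (A k) (t a)) :: complex) \<in> borel_measurable borel"
        using bA by (intro borel_measurable_sum) (simp add: bounded_borel_def)
      ultimately show ?thesis unfolding bounded_borel_def by blast
    qed
    moreover have "mult_l2 (\<lambda>a. \<Sum>k<n. indicator (A k) (t a)) w + mult_l2 (\<lambda>a. indicator (A n) (t a)) w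
        = mult_l2 (\<lambda>a. \<Sum>k<Suc n. indicator (A k) (t a)) w"
      unfolding l2_eq_iff
      using rep_mult_l2[OF Suc[THEN conjunct1], of w] rep_mult_l2[OF bA, of n w] rep_mult_l2[OF calculation, of w]
        rep_l2_add[of "mult_l2 (\<lambda>a. \<Sum>k<n. indicator (A k) (t a)) w" "mult_l2 (\<lambda>a. indicator (A n) (t a)) w"]
      by eventually_elim (simp add: algebra_simps)
    ultimately show ?case using Suc by simp
  qed
  have ind: "(\<Sum>k<n. indicator (A k) x :: complex) = indicator (\<Union>k<n. A k) x" for n x
    using d by (subst indicator_UN_disjoint) (auto intro: disjoint_family_on_mono)
  have "(\<lambda>n. mult_l2 (\<lambda>a. \<Sum>k<n. indicator (A k) (t a)) (W u)) \<longlonglongrightarrow> mult_l2 (\<lambda>a. indicator (\<Union>k. A k) (t a)) (W u)"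
  proof (rule mult_l2_tendsto[where B = 1])
    show "(\<lambda>a. (\<Sum>k<n. indicator (A k) (t a)) :: complex) \<in> borel_measurable borel" for n
      using ps[of n] by (simp add: bounded_borel_def)
    show "(\<lambda>a. indicator (\<Union>k. A k) (t a) :: complex) \<in> borel_measurable borel"
      using bounded_borel_indicator_t[of "\<Union>k. A k"] A by (auto simp: bounded_borel_def)
    show "AE a in lborel. (\<lambda>n. (\<Sum>k<n. indicator (A k) (t a)) :: complex) \<longlonglongrightarrow> indicator (\<Union>k. A k) (t a)"
      unfolding ind using LIMSEQ_indicator_UN[of A] by (intro AE_I2)
    have ci: "cmod (indicator S x) \<le> 1" for S and x :: real by (simp add: indicator_def)
    show "cmod (\<Sum>k<n. indicator (A k) (t a)) \<le> 1" for n a unfolding ind by (rule ci)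
    show "cmod (indicator (\<Union>k. A k) (t a)) \<le> 1" for a by (rule ci)
  qed
  then have "(\<lambda>k. mult_l2 (\<lambda>a. indicator (A k) (t a)) (W u)) sums mult_l2 (\<lambda>a. indicator (\<Union>k. A k) (t a)) (W u)"
    unfolding sums_def using ps by simp
  then show "(\<lambda>k. E0 (A k) u) sums E0 (\<Union>k. A k) u"
    unfolding E0_def fc_def
    by (rule bounded_linear.sums[OF unitary_l2_bounded_linear[OF unitary_l2_inv[OF W]]])
qed

lemma norm_E0:
  assumes A: "A \<in> sets borel"
  shows "ennreal ((norm (E0 A u))\<^sup>2) = (\<integral>\<^sup>+a. ennreal ((cmod (rep_l2 (W u) a))\<^sup>2) * indicator A (t a) \<partial>lborel)"
proof -
  have "norm (E0 A u) = norm (l2_of (\<lambda>a. indicator A (t a) * rep_l2 (W u) a))"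
    unfolding E0_def fc_def iWs by (simp add: mult_l2_def)
  also have "ennreal (\<dots>\<^sup>2) = (\<integral>\<^sup>+a. ennreal ((cmod (indicator A (t a) * rep_l2 (W u) a))\<^sup>2) \<partial>lborel)"
    by (rule nn_integral_norm_l2_of[symmetric]) (simp add: square_integrable_mult bounded_borel_indicator_t[OF A])
  also have "\<dots> = (\<integral>\<^sup>+a. ennreal ((cmod (rep_l2 (W u) a))\<^sup>2) * indicator A (t a) \<partial>lborel)"
    by (intro nn_integral_cong) (auto simp: indicator_def)
  finally show ?thesis .
qed

lemma scalar_spectral_measure_E0:
  "scalar_spectral_measure E0 u = distr (density lborel (\<lambda>a. ennreal ((cmod (rep_l2 (W u) a))\<^sup>2))) borel t"
proof (rule measure_eqI)
  fix A assume "A \<in> sets (scalar_spectral_measure E0 u)"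
  then have A [measurable]: "A \<in> sets borel" by (simp add: sets_scalar_spectral_measure[OF pvm_E0])
  have "emeasure (distr (density lborel (\<lambda>a. ennreal ((cmod (rep_l2 (W u) a))\<^sup>2))) borel t) A
      = (\<integral>\<^sup>+a. ennreal ((cmod (rep_l2 (W u) a))\<^sup>2) * indicator (t -` A) a \<partial>lborel)"
  proof -
    have "t -` A \<in> sets borel" using measurable_sets[OF t_measurable A] by simp
    then show ?thesis by (subst emeasure_distr) (simp_all add: emeasure_density)
  qed
  also have "\<dots> = ennreal ((norm (E0 A u))\<^sup>2)"
    unfolding norm_E0[OF A] by (intro nn_integral_cong) (auto simp: indicator_def)
  finally show "emeasure (scalar_spectral_measure E0 u) A = emeasure (distr (density lborel (\<lambda>a. ennreal ((cmod (rep_l2 (W u) a))\<^sup>2))) borel t) A"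
    by (simp add: emeasure_scalar_spectral_measure[OF pvm_E0 A])
qed (simp add: sets_scalar_spectral_measure[OF pvm_E0])

lemma integral_scalar_spectral_measure_E0:
  fixes f :: "real \<Rightarrow> 'b::{banach, second_countable_topology}"
  assumes [measurable]: "f \<in> borel_measurable borel"
  shows "integrable (scalar_spectral_measure E0 u) f \<longleftrightarrow> integrable lborel (\<lambda>a. (cmod (rep_l2 (W u) a))\<^sup>2 *\<^sub>R f (t a))"
    "integral\<^sup>L (scalar_spectral_measure E0 u) f = (LINT a|lborel. (cmod (rep_l2 (W u) a))\<^sup>2 *\<^sub>R f (t a))"
  unfolding scalar_spectral_measure_E0
  by (simp_all add: integrable_distr_eq integral_distr integrable_density integral_density)

lemma spectral_integral_T: "is_spectral_integral E0 complex_of_real T"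
  unfolding is_spectral_integral_def
proof (intro conjI linear_T ballI)
  have cm: "complex_of_real \<in> borel_measurable borel" by measurable
  show "Domain T = {u. integrable (scalar_spectral_measure E0 u) (\<lambda>x. (cmod (complex_of_real x))\<^sup>2)}"
    unfolding Domain_T by (auto simp: integral_scalar_spectral_measure_E0 square_integrable_def norm_mult
        power_mult_distrib mult.commute)
  fix p assume "p \<in> T"
  show "case p of (u, v) \<Rightarrow> cinner u v = (LINT x|scalar_spectral_measure E0 u. complex_of_real x)"
  proof (clarify)
    fix u v assume "p = (u, v)"
    with \<open>p \<in> T\<close> have uv: "AE a in lborel. of_real (t a) * rep_l2 (W u) a = rep_l2 (W v) a" by (simp add: T_def)
    have "cinner (W u) (W v) = (LINT a|lborel. (cmod (rep_l2 (W u) a))\<^sup>2 *\<^sub>R complex_of_real (t a))"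
      unfolding cinner.rep_eq
    proof (rule integral_cong_AE)
      show "AE a in lborel. cnj (rep_l2 (W u) a) * rep_l2 (W v) a = (cmod (rep_l2 (W u) a))\<^sup>2 *\<^sub>R complex_of_real (t a)"
        using uv
      proof eventually_elim
        fix a assume *: "of_real (t a) * rep_l2 (W u) a = rep_l2 (W v) a"
        show "cnj (rep_l2 (W u) a) * rep_l2 (W v) a = (cmod (rep_l2 (W u) a))\<^sup>2 *\<^sub>R complex_of_real (t a)"
          unfolding *[symmetric] scaleR_conv_of_real complex_norm_square by simp
      qed
    qed (simp_all add: borel_measurable_cnj)
    then show "cinner u v = (LINT x|scalar_spectral_measure E0 u. complex_of_real x)"
      by (simp only: Ws integral_scalar_spectral_measure_E0(2)[OF cm])
  qed
qed

lemma spectral_integral_fc: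
  assumes f [measurable]: "f \<in> borel_measurable borel" and B: "\<And>x. cmod (f x) \<le> B"
  shows "is_spectral_integral E0 f {(u, fc f u) | u. True}"
proof -
  note bf = bounded_borel_t[OF assms]
  have lin: "linear_op {(u, fc f u) | u. True}"
  proof -
    have "fc f 0 = 0" using fc_linear(2)[OF bf, of 0 0] by (simp add: scaleC_simps)
    then show ?thesis
      unfolding linear_op_def by (auto simp: single_valued_def fc_linear[OF bf])
  qed
  have dom: "integrable (scalar_spectral_measure E0 u) (\<lambda>x. (cmod (f x))\<^sup>2)" for u
  proof (rule finite_measure.integrable_const_bound[OF finite_scalar_spectral_measure[OF pvm_E0], of _ "B\<^sup>2"])
    show "AE x in scalar_spectral_measure E0 u. norm ((cmod (f x))\<^sup>2) \<le> B\<^sup>2"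
      using B by (intro AE_I2) (simp add: power_mono)
    show "(\<lambda>x. (cmod (f x))\<^sup>2) \<in> borel_measurable (scalar_spectral_measure E0 u)"
      by (simp add: scalar_spectral_measure_E0)
  qed
  have val: "cinner u (fc f u) = (LINT x|scalar_spectral_measure E0 u. f x)" for u
  proof -
    have "cinner (W u) (W (fc f u)) = (LINT a|lborel. (cmod (rep_l2 (W u) a))\<^sup>2 *\<^sub>R f (t a))"
      unfolding cinner.rep_eq W_fc
    proof (rule integral_cong_AE)
      show "AE a in lborel. cnj (rep_l2 (W u) a) * rep_l2 (mult_l2 (\<lambda>a. f (t a)) (W u)) a = (cmod (rep_l2 (W u) a))\<^sup>2 *\<^sub>R f (t a)"
        using rep_mult_l2[OF bf, of "W u"]
      proof eventually_elim
        fix a assume *: "rep_l2 (mult_l2 (\<lambda>a. f (t a)) (W u)) a = f (t a) * rep_l2 (W u) a"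
        show "cnj (rep_l2 (W u) a) * rep_l2 (mult_l2 (\<lambda>a. f (t a)) (W u)) a = (cmod (rep_l2 (W u) a))\<^sup>2 *\<^sub>R f (t a)"
          unfolding * scaleR_conv_of_real complex_norm_square by simp
      qed
    qed (simp_all add: borel_measurable_cnj)
    then show ?thesis by (simp only: Ws integral_scalar_spectral_measure_E0(2)[OF f])
  qed
  show ?thesis unfolding is_spectral_integral_def using lin dom val by auto
qed

end

section \<open>Uniqueness of the spectral measure\<close>

lemma sum_density_indicator_integral:
  fixes f :: "real \<Rightarrow> complex"
  assumes [measurable]: "A \<in> sets M" and f: "integrable M f"
  shows "integral\<^sup>L M f = integral\<^sup>L (density M (indicator A)) f + integral\<^sup>L (density M (indicator (space M - A))) f"
proof -
  have [measurable]: "f \<in> borel_measurable M" using f by simp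
  have d: "integral\<^sup>L (density M (indicator B)) f = (LINT x|M. indicator B x *\<^sub>R f x)" if [measurable]: "B \<in> sets M" for B
    unfolding ennreal_indicator[symmetric] by (rule integral_density) auto
  have i: "integrable M (\<lambda>x. indicator B x *\<^sub>R f x)" if "B \<in> sets M" for B
    using integrable_mult_indicator[OF that f] .
  have "integral\<^sup>L M f = (LINT x|M. indicator A x *\<^sub>R f x + indicator (space M - A) x *\<^sub>R f x)"
    by (intro Bochner_Integration.integral_cong) (auto simp: indicator_def)
  also have "\<dots> = (LINT x|M. indicator A x *\<^sub>R f x) + (LINT x|M. indicator (space M - A) x *\<^sub>R f x)"
    by (intro Bochner_Integration.integral_add i) auto
  finally show ?thesis by (simp add: d)
qed

text \<open>Let \<open>E\<close> be any spectral measure of \<open>T\<close>. All that is known about it is the domain and the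
  quadratic form of \<open>T\<close> in terms of \<open>E\<close>. From these it follows that \<open>T\<close> preserves the ranges of
  \<open>E\<close> and that \<open>T - s\<close> has norm at most \<open>r\<close> on the range of \<open>E [s - r, s + r]\<close>. Powers of \<open>T - s\<close>
  then show that this range lives where \<open>\<bar>t - s\<bar> \<le> r\<close>, that is, in the range of \<open>E0 [s - r, s + r]\<close>.\<close>

context diagonalized
begin

context
  fixes E :: "real set \<Rightarrow> 'n l2 \<Rightarrow> 'n l2"
  assumes E: "projection_valued_measure E" and sp: "is_spectral_integral E complex_of_real T"
begin

lemma Domain_T_iff: "u \<in> Domain T \<longleftrightarrow> integrable (scalar_spectral_measure E u) (\<lambda>x. x\<^sup>2)"
proof -
  have "Domain T = {u. integrable (scalar_spectral_measure E u) (\<lambda>x. (cmod (complex_of_real x))\<^sup>2)}"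
    using sp unfolding is_spectral_integral_def by simp
  then show ?thesis by simp
qed

lemma cinner_T: "(u, v) \<in> T \<Longrightarrow> cinner u v = (LINT x|scalar_spectral_measure E u. complex_of_real x)"
  using sp unfolding is_spectral_integral_def by blast

lemma measure_spectral_UNIV: "measure (scalar_spectral_measure E u) UNIV = (norm u)\<^sup>2"
  using emeasure_scalar_spectral_measure[OF E, of UNIV u] by (simp add: measure_def pvm_UNIV[OF E])

lemma spectral_measurable: "f \<in> borel_measurable borel \<Longrightarrow> f \<in> borel_measurable (scalar_spectral_measure E u)"
  by (subst measurable_cong_sets[OF sets_scalar_spectral_measure(1)[OF E] refl])

lemma bounded_in_Domain:
  assumes A: "A \<in> sets borel" and B: "\<And>x. x \<in> A \<Longrightarrow> \<bar>x\<bar> \<le> B" and u: "E A u = u"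
  shows "u \<in> Domain T"
  unfolding Domain_T_iff
proof (rule finite_measure.integrable_const_bound[OF finite_scalar_spectral_measure[OF E], of _ "B\<^sup>2"])
  show "AE x in scalar_spectral_measure E u. norm (x\<^sup>2) \<le> B\<^sup>2"
    using AE_scalar_spectral_measure[OF E A u]
  proof eventually_elim
    fix x assume "x \<in> A"
    from B[OF this] have "\<bar>x\<bar>\<^sup>2 \<le> B\<^sup>2" by (intro power_mono) auto
    then show "norm (x\<^sup>2) \<le> B\<^sup>2" by simp
  qed
qed (intro spectral_measurable, measurable)

lemma integrable_spectral:
  assumes "u \<in> Domain T"
  shows "integrable (scalar_spectral_measure E u) complex_of_real"
proof (rule Bochner_Integration.integrable_bound)
  interpret finite_measure "scalar_spectral_measure E u" by (rule finite_scalar_spectral_measure[OF E])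
  show "integrable (scalar_spectral_measure E u) (\<lambda>x. 1 + x\<^sup>2)"
    using assms unfolding Domain_T_iff by (intro Bochner_Integration.integrable_add) auto
  have "\<bar>x\<bar> \<le> 1 + x\<^sup>2" for x :: real
    using zero_le_power2[of "\<bar>x\<bar> - 1"] by (simp add: power2_diff)
  then show "AE x in scalar_spectral_measure E u. norm (complex_of_real x) \<le> norm (1 + x\<^sup>2)"
    by (intro AE_I2) (simp add: abs_of_nonneg)
qed (intro spectral_measurable, measurable)

lemma spectral_integral_split:
  assumes A: "A \<in> sets borel" and p: "p \<in> Domain T"
  shows "(LINT x|scalar_spectral_measure E p. complex_of_real x) =
    (LINT x|scalar_spectral_measure E (E A p). complex_of_real x) +
    (LINT x|scalar_spectral_measure E (E (- A) p). complex_of_real x)"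
proof -
  have mA: "- A \<in> sets borel" using A by (simp add: borel_comp)
  have sA: "A \<in> sets (scalar_spectral_measure E p)" using A by (simp only: sets_scalar_spectral_measure[OF E])
  show ?thesis
    unfolding scalar_spectral_measure_restrict[OF E A] scalar_spectral_measure_restrict[OF E mA]
    using sum_density_indicator_integral[OF sA integrable_spectral[OF p]]
    by (simp only: sets_scalar_spectral_measure[OF E] Compl_eq_Diff_UNIV)
qed

lemma T_add_scaleC: "(u, u') \<in> T \<Longrightarrow> (v, v') \<in> T \<Longrightarrow> (u + c *\<^sub>C v, u' + c *\<^sub>C v') \<in> T"
proof -
  assume u: "(u, u') \<in> T" and v: "(v, v') \<in> T"
  have "(c *\<^sub>C v, c *\<^sub>C v') \<in> T" using linear_T v unfolding linear_op_def by blast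
  with u show ?thesis using linear_T unfolding linear_op_def by blast
qed

text \<open>The quadratic form of \<open>T\<close> is an integral, which splits over \<open>A\<close> and \<open>- A\<close>. So it has no cross
  terms between the ranges of \<open>E A\<close> and \<open>E (- A)\<close>.\<close>

lemma T_cross_zero:
  assumes A: "A \<in> sets borel" and w: "E A w = w" "(w, v) \<in> T" and y: "E A y = 0" "(y, z) \<in> T"
  shows "cinner y v = 0"
proof -
  have key: "c * cinner w z + cnj c * cinner y v = 0" for c
  proof -
    let ?p = "w + c *\<^sub>C y"
    have pT: "(?p, v + c *\<^sub>C z) \<in> T" by (rule T_add_scaleC[OF w(2) y(2)])
    have cT: "(c *\<^sub>C y, c *\<^sub>C z) \<in> T" using linear_T y(2) unfolding linear_op_def by blast
    have 1: "E A ?p = w" by (simp add: pvm_proj[OF E A] w y scaleC_simps)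
    then have 2: "E (- A) ?p = c *\<^sub>C y" by (simp add: pvm_Compl[OF E A])
    have "cinner ?p (v + c *\<^sub>C z) = cinner w v + cinner (c *\<^sub>C y) (c *\<^sub>C z)"
      using spectral_integral_split[OF A, of ?p] pT
      unfolding 1 2 cinner_T[OF pT, symmetric] cinner_T[OF w(2), symmetric] cinner_T[OF cT, symmetric] by blast
    then show ?thesis by (simp add: cinner_simps algebra_simps)
  qed
  from key[of 1] key[of \<i>] show ?thesis by (simp add: algebra_simps)
qed

text \<open>The component of \<open>v\<close> in the range of \<open>E (- A)\<close> is a sum of pieces of bounded spectrum. These lie in
  the domain of \<open>T\<close>, hence are orthogonal to \<open>v\<close> for lack of cross terms.\<close>

lemma T_preserves_range:
  assumes A: "A \<in> sets borel" and w: "E A w = w" "(w, v) \<in> T"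
  shows "E A v = v"
proof -
  define y where "y = v - E A v"
  have Ay: "E A y = 0" by (simp add: y_def pvm_diff[OF E A] pvm_proj[OF E A])
  define I where "I n = {- real n..real n}" for n
  define D where "D = disjointed I"
  have DB: "D n \<in> sets borel" for n unfolding D_def
  proof -
    have "range I \<subseteq> sets borel" by (auto simp: I_def)
    from sets.range_disjointed_sets[OF this] show "disjointed I n \<in> sets borel" by blast
  qed
  have DI: "D n \<subseteq> I n" for n unfolding D_def by (rule disjointed_subset)
  have UD: "(\<Union>n. D n) = UNIV"
  proof -
    have "x \<in> (\<Union>n. I n)" for x
    proof -
      have "x \<in> I (nat \<lceil>\<bar>x\<bar>\<rceil>)" unfolding I_def atLeastAtMost_iff by linarith
      then show ?thesis by blast
    qed
    then show ?thesis unfolding D_def UN_disjointed_eq by blast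
  qed
  have "(\<lambda>n. E (D n) y) sums E (\<Union>n. D n) y"
    using DB by (intro pvm_sums[OF E]) (auto simp: D_def disjoint_family_disjointed)
  then have "(\<lambda>n. E (D n) y) sums y" by (simp add: UD pvm_UNIV[OF E])
  then have "(\<lambda>n. inner v (E (D n) y)) sums inner v y"
    by (rule bounded_linear.sums[OF bounded_linear_inner_right])
  moreover have "inner v (E (D n) y) = 0" for n
  proof -
    have 1: "E (D n) (E (D n) y) = E (D n) y" by (rule pvm_proj[OF E DB])
    have "\<bar>x\<bar> \<le> real n" if "x \<in> D n" for x
    proof -
      have "x \<in> I n" using DI[of n] that by blast
      then show ?thesis unfolding I_def atLeastAtMost_iff by linarith
    qed
    then have "E (D n) y \<in> Domain T" using bounded_in_Domain[OF DB _ 1] by blast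
    then obtain z where z: "(E (D n) y, z) \<in> T" by blast
    have "E A (E (D n) y) = E (D n) (E A y)"
      by (simp only: pvm_Int[OF E A DB] pvm_Int[OF E DB A] Int_commute)
    also have "\<dots> = 0" using pvm_proj(2)[OF E DB, of n 0 0] by (simp add: Ay scaleC_simps)
    finally have "cinner (E (D n) y) v = 0" using T_cross_zero[OF A w _ z] by blast
    then show ?thesis by (subst inner_commute) (simp add: inner_l2_cinner)
  qed
  ultimately have "inner v y = 0"
    by (simp add: sums_iff)
  moreover have "inner (E A v) y = 0"
  proof -
    have "cinner (E A v) y = cinner v (E A y)" by (rule pvm_proj[OF E A])
    then show ?thesis by (simp add: Ay inner_l2_cinner)
  qed
  ultimately have "inner y y = 0" unfolding y_def by (simp add: inner_diff_left)
  then show ?thesis by (simp add: y_def)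
qed

lemma T_numerical_range:
  assumes r: "r \<ge> 0" and w: "E {s - r..s + r} w = w" "(w, v) \<in> T"
  shows "cmod (cinner w (v - of_real s *\<^sub>C w)) \<le> r * (norm w)\<^sup>2"
proof -
  let ?M = "scalar_spectral_measure E w"
  interpret finite_measure ?M by (rule finite_scalar_spectral_measure[OF E])
  have sp: "space ?M = UNIV" by (rule sets_scalar_spectral_measure[OF E])
  have ii: "integrable ?M complex_of_real" using w(2) by (intro integrable_spectral) blast
  have "cinner w (v - of_real s *\<^sub>C w) = (LINT x|?M. complex_of_real x) - of_real s * complex_of_real ((norm w)\<^sup>2)"
    using cinner_T[OF w(2)] by (simp add: cinner_simps cinner_self)
  also have "complex_of_real s * complex_of_real ((norm w)\<^sup>2) = (LINT x|?M. complex_of_real s)"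
    by (simp add: sp measure_spectral_UNIV scaleR_conv_of_real)
  also have "(LINT x|?M. complex_of_real x) - \<dots> = (LINT x|?M. complex_of_real x - complex_of_real s)"
    by (rule Bochner_Integration.integral_diff[symmetric]) (simp_all add: ii)
  finally have eq: "cinner w (v - of_real s *\<^sub>C w) = (LINT x|?M. complex_of_real x - complex_of_real s)" .
  have "cmod (LINT x|?M. complex_of_real x - complex_of_real s) \<le> (LINT x|?M. cmod (complex_of_real x - complex_of_real s))"
    by (rule integral_norm_bound)
  also have "\<dots> \<le> (LINT x|?M. r)"
  proof (rule integral_mono_AE)
    show "integrable ?M (\<lambda>x. cmod (complex_of_real x - complex_of_real s))"
      using ii by (intro integrable_norm Bochner_Integration.integrable_diff) auto
    show "AE x in ?M. cmod (complex_of_real x - complex_of_real s) \<le> r"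
      using AE_scalar_spectral_measure[OF E _ w(1)]
    proof -
      have "AE x in ?M. x \<in> {s - r..s + r}" by (rule AE_scalar_spectral_measure[OF E _ w(1)]) simp
      then show ?thesis
      proof eventually_elim
        fix x assume "x \<in> {s - r..s + r}"
        then have "\<bar>x - s\<bar> \<le> r" by auto
        then show "cmod (complex_of_real x - complex_of_real s) \<le> r"
          by (simp only: of_real_diff[symmetric] norm_of_real)
      qed
    qed
  qed simp
  also have "\<dots> = r * (norm w)\<^sup>2" by (simp add: sp measure_spectral_UNIV)
  finally show ?thesis unfolding eq .
qed

text \<open>On the range of \<open>E [s - r, s + r]\<close> the numerical radius of the symmetric operator \<open>T - s\<close>
  is at most \<open>r\<close>, hence so is its norm.\<close>

lemma T_norm_le:
  assumes r: "r \<ge> 0" and w: "E {s - r..s + r} w = w" "(w, v) \<in> T"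
  shows "norm (v - of_real s *\<^sub>C w) \<le> r * norm w"
proof (cases "v - of_real s *\<^sub>C w = 0 \<or> w = 0")
  case True
  moreover have "v = 0" if "w = 0"
    using linear_T w(2) that unfolding linear_op_def single_valued_def by blast
  ultimately show ?thesis using r by (auto simp: scaleC_simps)
next
  case False
  let ?A = "{s - r..s + r}"
  have A: "?A \<in> sets borel" by simp
  define b where "b = v - of_real s *\<^sub>C w"
  have b0: "norm b > 0" "norm w > 0" using False by (auto simp: b_def)
  \<comment> \<open>polarization, as in the proof that a symmetric operator is bounded by its numerical radius\<close>
  define c where "c = norm w / norm b"
  define y where "y = of_real c *\<^sub>C b"
  have "norm y = \<bar>c\<bar> * norm b" unfolding y_def norm_scaleC norm_of_real ..
  then have ny: "norm y = norm w" using b0 by (simp add: c_def)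
  have Ev: "E ?A v = v" by (rule T_preserves_range[OF A w])
  have Ey: "E ?A y = y" unfolding y_def b_def by (simp add: pvm_proj[OF E A] pvm_diff[OF E A] Ev w)
  have "y \<in> Domain T"
    by (rule bounded_in_Domain[OF A _ Ey, of "\<bar>s\<bar> + r"]) auto
  then obtain z where z: "(y, z) \<in> T" by blast
  define B where "B p q = q - of_real s *\<^sub>C p" for p q :: "'n l2"
  have num: "\<bar>Re (cinner (w + e *\<^sub>C y) (B (w + e *\<^sub>C y) (v + e *\<^sub>C z)))\<bar> \<le> r * (norm (w + e *\<^sub>C y))\<^sup>2" for e
  proof -
    have "E ?A (w + e *\<^sub>C y) = w + e *\<^sub>C y" by (simp add: pvm_proj[OF E A] w Ey)
    from T_numerical_range[OF r this T_add_scaleC[OF w(2) z]] show ?thesis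
      unfolding B_def by (meson abs_Re_le_cmod order_trans)
  qed
  have sym: "cinner w (B y z) = cinner b y"
    using T_symmetric[OF w(2) z] by (simp add: B_def b_def cinner_simps)
  have par: "(norm (w + 1 *\<^sub>C y))\<^sup>2 + (norm (w + (- 1) *\<^sub>C y))\<^sup>2 = 4 * (norm w)\<^sup>2"
  proof -
    have "inner y y = inner w w" using ny unfolding power2_norm_eq_inner[symmetric] by simp
    then show ?thesis unfolding power2_norm_eq_inner
      by (simp add: scaleC_simps inner_simps inner_commute)
  qed
  have d: "cinner (w + 1 *\<^sub>C y) (B (w + 1 *\<^sub>C y) (v + 1 *\<^sub>C z)) - cinner (w + (- 1) *\<^sub>C y) (B (w + (- 1) *\<^sub>C y) (v + (- 1) *\<^sub>C z))
      = 2 * (cinner w (B y z) + cinner y b)"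
    by (simp add: B_def b_def cinner_simps scaleC_simps algebra_simps)
  have "cinner y b = of_real (norm w * norm b)"
    using b0 by (simp add: y_def cinner_simps cinner_self c_def power2_eq_square)
  moreover have "cinner b y = of_real (norm w * norm b)"
    using b0 by (simp add: y_def cinner_simps cinner_self c_def power2_eq_square)
  ultimately have "Re (cinner (w + 1 *\<^sub>C y) (B (w + 1 *\<^sub>C y) (v + 1 *\<^sub>C z))) - Re (cinner (w + (- 1) *\<^sub>C y) (B (w + (- 1) *\<^sub>C y) (v + (- 1) *\<^sub>C z)))
      = 4 * (norm w * norm b)"
    using arg_cong[OF d, of Re] unfolding sym by simp
  then have "4 * (norm w * norm b) \<le> r * (norm (w + 1 *\<^sub>C y))\<^sup>2 + r * (norm (w + (- 1) *\<^sub>C y))\<^sup>2"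
    using num[of 1] num[of "- 1"] by linarith
  also have "\<dots> = norm w * (4 * (r * norm w))"
    using par by (simp add: ring_distribs(1)[symmetric] power2_eq_square)
  finally have "norm b \<le> r * norm w" using b0 by (simp add: mult.left_commute)
  then show ?thesis by (simp add: b_def)
qed

text \<open>Iterating the bound gives \<open>\<parallel>(T - s)\<^sup>k w\<parallel> \<le> r\<^sup>k \<parallel>w\<parallel>\<close>. Where \<open>\<bar>t - s\<bar> \<ge> r + d\<close>, however, \<open>(T - s)\<^sup>k\<close>
  multiplies by at least \<open>(r + d)\<^sup>k\<close> in absolute value, so \<open>W w\<close> vanishes there.\<close>

lemma range_E_subset_E0:
  assumes r: "r \<ge> 0" and w: "E {s - r..s + r} w = w"
  shows "E0 {s - r..s + r} w = w"
proof -
  let ?A = "{s - r..s + r}"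
  have A: "?A \<in> sets borel" by simp
  have step: "\<exists>w'. E ?A w' = w' \<and> norm w' \<le> r * norm u \<and>
      (AE a in lborel. rep_l2 (W w') a = of_real (t a - s) * rep_l2 (W u) a)" if u: "E ?A u = u" for u
  proof -
    have "u \<in> Domain T" by (rule bounded_in_Domain[OF A _ u, of "\<bar>s\<bar> + r"]) auto
    then obtain v where v: "(u, v) \<in> T" by blast
    define w' where "w' = v - of_real s *\<^sub>C u"
    have "E ?A w' = w'" unfolding w'_def
      by (simp add: pvm_diff[OF E A] pvm_proj[OF E A] T_preserves_range[OF A u v] u)
    moreover have "norm w' \<le> r * norm u" unfolding w'_def by (rule T_norm_le[OF r u v])
    moreover have "AE a in lborel. rep_l2 (W w') a = of_real (t a - s) * rep_l2 (W u) a"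
    proof -
      have eq: "W w' = W v - of_real s *\<^sub>C W u" unfolding w'_def by (simp only: Ws)
      have "AE a in lborel. of_real (t a) * rep_l2 (W u) a = rep_l2 (W v) a" using v by (simp add: T_def)
      then show ?thesis
        using rep_l2_diff[of "W v" "of_real s *\<^sub>C W u"] rep_l2_scaleC[of "of_real s" "W u"]
        unfolding eq
      proof eventually_elim
        fix a assume a: "of_real (t a) * rep_l2 (W u) a = rep_l2 (W v) a"
          "rep_l2 (W v - of_real s *\<^sub>C W u) a = rep_l2 (W v) a - rep_l2 (of_real s *\<^sub>C W u) a"
          "rep_l2 (of_real s *\<^sub>C W u) a = of_real s * rep_l2 (W u) a"
        show "rep_l2 (W v - of_real s *\<^sub>C W u) a = of_real (t a - s) * rep_l2 (W u) a"
          unfolding a(2,3) a(1)[symmetric] by (simp add: algebra_simps)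
      qed
    qed
    ultimately show ?thesis by blast
  qed
  have iter: "\<exists>wk. E ?A wk = wk \<and> norm wk \<le> r ^ k * norm w \<and>
      (AE a in lborel. rep_l2 (W wk) a = of_real ((t a - s) ^ k) * rep_l2 (W w) a)" for k
  proof (induction k)
    case 0
    show ?case using w by (intro exI[of _ w]) simp
  next
    case (Suc k)
    then obtain wk where wk: "E ?A wk = wk" "norm wk \<le> r ^ k * norm w"
      "AE a in lborel. rep_l2 (W wk) a = of_real ((t a - s) ^ k) * rep_l2 (W w) a" by blast
    from step[OF wk(1)] obtain w' where w': "E ?A w' = w'" "norm w' \<le> r * norm wk"
      "AE a in lborel. rep_l2 (W w') a = of_real (t a - s) * rep_l2 (W wk) a" by blast
    have "norm w' \<le> r ^ Suc k * norm w"
      using w'(2) mult_left_mono[OF wk(2) r] by (simp add: mult.assoc)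
    moreover have "AE a in lborel. rep_l2 (W w') a = of_real ((t a - s) ^ Suc k) * rep_l2 (W w) a"
      using w'(3) wk(3) by eventually_elim simp
    ultimately show ?case using w'(1) by blast
  qed
  have zero: "AE a in lborel. \<bar>t a - s\<bar> \<ge> r + d \<longrightarrow> rep_l2 (W w) a = 0" if d: "d > 0" for d
  proof -
    define S where "S = {x. \<bar>x - s\<bar> \<ge> r + d}"
    have S: "S \<in> sets borel" unfolding S_def by measurable
    note bS = bounded_borel_indicator_t[OF S]
    define g where "g = mult_l2 (\<lambda>a. indicator S (t a)) (W w)"
    have ng: "norm g \<le> (r / (r + d)) ^ k * norm w" for k
    proof -
      obtain wk where wk: "norm wk \<le> r ^ k * norm w"
        "AE a in lborel. rep_l2 (W wk) a = of_real ((t a - s) ^ k) * rep_l2 (W w) a" using iter[of k] by blast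
      define R where "R = (r + d) ^ k"
      have R0: "R \<ge> 0" using r d by (simp add: R_def)
      have "norm (l2_of (rep_l2 (of_real R *\<^sub>C g))) \<le> norm (l2_of (rep_l2 (W wk)))"
      proof (rule norm_l2_of_mono)
        show "AE a in lborel. cmod (rep_l2 (of_real R *\<^sub>C g) a) \<le> cmod (rep_l2 (W wk) a)"
          using wk(2) rep_l2_scaleC[of "of_real R" g] rep_mult_l2[OF bS, of "W w", folded g_def]
        proof eventually_elim
          fix a assume a: "rep_l2 (W wk) a = of_real ((t a - s) ^ k) * rep_l2 (W w) a"
            "rep_l2 (of_real R *\<^sub>C g) a = of_real R * rep_l2 g a"
            "rep_l2 g a = indicator S (t a) * rep_l2 (W w) a"
          show "cmod (rep_l2 (of_real R *\<^sub>C g) a) \<le> cmod (rep_l2 (W wk) a)"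
          proof (cases "t a \<in> S")
            case True
            then have "R \<le> \<bar>t a - s\<bar> ^ k" using r d unfolding R_def by (intro power_mono) (auto simp: S_def)
            then have "R * cmod (rep_l2 (W w) a) \<le> \<bar>t a - s\<bar> ^ k * cmod (rep_l2 (W w) a)"
              by (rule mult_right_mono) simp
            moreover have "cmod (rep_l2 (of_real R *\<^sub>C g) a) = R * cmod (rep_l2 (W w) a)"
              unfolding a using True R0 by (simp add: norm_mult)
            moreover have "cmod (rep_l2 (W wk) a) = \<bar>t a - s\<bar> ^ k * cmod (rep_l2 (W w) a)"
              unfolding a norm_mult norm_of_real power_abs ..
            ultimately show ?thesis by simp
          next
            case False
            then have "rep_l2 (of_real R *\<^sub>C g) a = 0" unfolding a by simp
            then show ?thesis by simp
          qed
        qed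
      qed simp_all
      then have "R * norm g \<le> norm wk"
        using R0 by (simp add: norm_scaleC Ws(3))
      also note wk(1)
      finally have "(r + d) ^ k * norm g \<le> r ^ k * norm w" unfolding R_def .
      moreover have "(r + d) ^ k > 0" using r d by simp
      ultimately show ?thesis by (simp add: power_divide pos_le_divide_eq mult.commute)
    qed
    have "(\<lambda>k. (r / (r + d)) ^ k * norm w) \<longlonglongrightarrow> 0 * norm w"
      using r d by (intro tendsto_intros LIMSEQ_realpow_zero) auto
    then have "norm g \<le> 0 * norm w" by (rule LIMSEQ_le_const) (use ng in auto)
    then have "g = 0" by simp
    have "AE a in lborel. rep_l2 g a = 0"
      unfolding \<open>g = 0\<close> using rep_l2_of[OF square_integrable_0, unfolded l2_of_0] .
    then have "AE a in lborel. indicator S (t a) * rep_l2 (W w) a = 0"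
      using rep_mult_l2[OF bS, of "W w", folded g_def]
    proof eventually_elim
      fix a assume "rep_l2 g a = 0" "rep_l2 g a = indicator S (t a) * rep_l2 (W w) a"
      then show "indicator S (t a) * rep_l2 (W w) a = 0" by metis
    qed
    then show ?thesis by eventually_elim (auto simp: S_def)
  qed
  have "AE a in lborel. \<forall>n::nat. \<bar>t a - s\<bar> \<ge> r + 1 / Suc n \<longrightarrow> rep_l2 (W w) a = 0"
    unfolding AE_all_countable using zero by simp
  then have ae: "AE a in lborel. indicator ?A (t a) * rep_l2 (W w) a = rep_l2 (W w) a"
  proof eventually_elim
    fix a assume *: "\<forall>n::nat. \<bar>t a - s\<bar> \<ge> r + 1 / Suc n \<longrightarrow> rep_l2 (W w) a = 0"
    show "indicator ?A (t a) * rep_l2 (W w) a = rep_l2 (W w) a"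
    proof (cases "t a \<in> ?A")
      case False
      then have "\<bar>t a - s\<bar> - r > 0" by auto
      then obtain n where "1 / real (Suc n) < \<bar>t a - s\<bar> - r" using nat_approx_posE by blast
      then have "\<bar>t a - s\<bar> \<ge> r + 1 / Suc n" by linarith
      then have "rep_l2 (W w) a = 0" using * by blast
      then show ?thesis by simp
    qed simp
  qed
  have "mult_l2 (\<lambda>a. indicator ?A (t a)) (W w) = W w"
    unfolding l2_eq_iff using ae rep_mult_l2[OF bounded_borel_indicator_t[OF A], of "W w"]
    by eventually_elim simp
  then show ?thesis by (simp add: E0_def fc_def Ws)
qed

lemma range_E_subset_E0_Union:
  assumes I: "\<And>n::nat. I n = {a n..b n}" "\<And>n. a n \<le> b n" and A: "A = (\<Union>n. I n)"
  shows "E0 A (E A u) = E A u"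
proof -
  have IB: "I n \<in> sets borel" for n by (simp add: I)
  have AB: "A \<in> sets borel" unfolding A using IB by auto
  define D where "D = disjointed I"
  have DB: "D n \<in> sets borel" for n unfolding D_def
  proof -
    have "range I \<subseteq> sets borel" using IB by auto
    from sets.range_disjointed_sets[OF this] show "disjointed I n \<in> sets borel" by blast
  qed
  have DI: "D n \<subseteq> I n" for n unfolding D_def by (rule disjointed_subset)
  have "(\<lambda>n. E (D n) u) sums E (\<Union>n. D n) u"
    using DB by (intro pvm_sums[OF E]) (auto simp: D_def disjoint_family_disjointed)
  then have s: "(\<lambda>n. E (D n) u) sums E A u" unfolding D_def UN_disjointed_eq A .
  have "E0 A (E (D n) u) = E (D n) u" for n
  proof -
    have "E (I n) (E (D n) u) = E (D n) u"
      using DI[of n] by (simp only: pvm_Int[OF E IB DB] Int_absorb1)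
    then have "E0 (I n) (E (D n) u) = E (D n) u"
      using range_E_subset_E0[of "(b n - a n) / 2" "(a n + b n) / 2" "E (D n) u"] I
      by (simp add: field_simps)
    moreover have "E0 A (E0 (I n) (E (D n) u)) = E0 (I n) (E (D n) u)"
      using pvm_Int[OF pvm_E0 AB IB, of n "E (D n) u"] by (simp add: A Int_absorb1 UN_upper)
    ultimately show ?thesis by simp
  qed
  then have "(\<lambda>n. E (D n) u) sums E0 A (E A u)"
    using bounded_linear.sums[OF pvm_bounded_linear[OF pvm_E0 AB] s] by simp
  with s show ?thesis using sums_unique2 by blast
qed

text \<open>Both \<open>{..s}\<close> and its complement are countable unions of compact intervals, so for both of them the
  range of \<open>E\<close> is contained in the range of \<open>E0\<close>. For complementary projections this forces equality.\<close>

lemma E_eq_E0_atMost: "E {..s} u = E0 {..s} u"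
proof -
  have B: "{..s} \<in> sets borel" "{s<..} \<in> sets borel" by simp_all
  have c: "- {..s} = {s<..}" by auto
  have 1: "E0 {..s} (E {..s} u) = E {..s} u" for u
  proof (rule range_E_subset_E0_Union[where I = "\<lambda>n. {s - real n..s}"])
    show "{..s} = (\<Union>n. {s - real n..s})"
    proof (intro set_eqI iffI)
      fix x assume "x \<in> {..s}"
      then have "s - real (nat \<lceil>s - x\<rceil>) \<le> x" "x \<le> s" by (auto, linarith)
      then show "x \<in> (\<Union>n. {s - real n..s})" by (intro UN_I[of "nat \<lceil>s - x\<rceil>"]) auto
    qed auto
  qed auto
  have 2: "E0 {s<..} (E {s<..} u) = E {s<..} u" for u
  proof (rule range_E_subset_E0_Union[where I = "\<lambda>n. {s + 1 / Suc n..s + 1 + n}"])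
    show "{s<..} = (\<Union>n. {s + 1 / Suc n..s + 1 + n})"
    proof (intro set_eqI iffI)
      fix x assume x: "x \<in> {s<..}"
      then obtain m where m: "1 / real (Suc m) < x - s" using nat_approx_posE[of "x - s"] by auto
      define k where "k = max m (nat \<lceil>x - s\<rceil>)"
      have "1 / real (Suc k) \<le> 1 / real (Suc m)" by (intro divide_left_mono) (auto simp: k_def)
      moreover have "x - s \<le> real k" unfolding k_def by linarith
      ultimately show "x \<in> (\<Union>n. {s + 1 / Suc n..s + 1 + n})" using m by (intro UN_I[of k]) auto
    next
      fix x assume "x \<in> (\<Union>n. {s + 1 / Suc n..s + 1 + n})"
      then obtain n where "s + 1 / real (Suc n) \<le> x" by auto
      moreover have "0 < 1 / real (Suc n)" by simp
      ultimately show "x \<in> {s<..}" unfolding greaterThan_iff by linarith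
    qed
    show "s + 1 / real (Suc n) \<le> s + 1 + real n" for n
    proof -
      have "1 / real (Suc n) \<le> 1" by simp
      then show ?thesis by linarith
    qed
  qed auto
  have "E {s<..} u = u - E {..s} u" using pvm_Compl[OF E B(1), of u] by (simp add: c)
  then have "E0 {..s} u - E0 {..s} (E {..s} u) = E0 {..s} (E0 {s<..} (E {s<..} u))"
    unfolding 2 by (simp add: pvm_diff[OF pvm_E0 B(1)])
  also have "\<dots> = 0"
  proof -
    have "{..s} \<inter> {s<..} = {}" by auto
    then show ?thesis
      using pvm_Int[OF pvm_E0 B, of "E {s<..} u"] pvm_empty[OF pvm_E0, of "E {s<..} u"] by simp
  qed
  finally show ?thesis unfolding 1 by simp
qed

lemma E_eq_E0:
  assumes A: "A \<in> sets borel"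
  shows "E A u = E0 A u"
proof -
  have G: "sets borel = sigma_sets UNIV (range (\<lambda>s::real. {..s}))"
    unfolding borel_eq_atMost by (rule sets_measure_of) auto
  have "Int_stable (range (\<lambda>s::real. {..s}))"
    by (auto simp: Int_stable_def)
  moreover have "range (\<lambda>s::real. {..s}) \<subseteq> Pow UNIV" by simp
  moreover have "A \<in> sigma_sets UNIV (range (\<lambda>s::real. {..s}))" using A by (simp only: G)
  ultimately show ?thesis
  proof (induction rule: sigma_sets_induct_disjoint)
    case (basic B)
    then show ?case using E_eq_E0_atMost by auto
  next
    case empty
    show ?case by (simp only: pvm_empty[OF E] pvm_empty[OF pvm_E0])
  next
    case (compl B)
    then have "B \<in> sets borel" unfolding G by simp
    then show ?case using compl pvm_Compl[OF E, of B u] pvm_Compl[OF pvm_E0, of B u]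
      by (simp add: Compl_eq_Diff_UNIV)
  next
    case (union B)
    have rB: "range B \<subseteq> sets borel" unfolding G by (rule union)
    have "(\<lambda>k. E (B k) u) sums E (\<Union>k. B k) u" by (rule pvm_sums[OF E rB union(1)])
    moreover have "(\<lambda>k. E (B k) u) sums E0 (\<Union>k. B k) u"
      using pvm_sums[OF pvm_E0 rB union(1), of u] union(3) by simp
    ultimately show ?case by (rule sums_unique2)
  qed
qed

end

text \<open>The spectral measure being unique, so is the operator that it assigns to a bounded function: the
  operator is everywhere defined, and its quadratic form determines it by polarization.\<close>

lemma functional_calculus_T:
  assumes f: "f \<in> borel_measurable borel" and B: "\<And>x. cmod (f x) \<le> B"
  shows "functional_calculus f T = {(u, fc f u) | u. True}"
  unfolding functional_calculus_def
proof (rule the_equality)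
  show "\<exists>E. projection_valued_measure E \<and> is_spectral_integral E complex_of_real T \<and>
      is_spectral_integral E f {(u, fc f u) | u. True}"
    using pvm_E0 spectral_integral_T spectral_integral_fc[OF assms] by blast
  fix F assume "\<exists>E. projection_valued_measure E \<and> is_spectral_integral E complex_of_real T \<and> is_spectral_integral E f F"
  then obtain E where E: "projection_valued_measure E" "is_spectral_integral E complex_of_real T"
    and F: "is_spectral_integral E f F" by blast
  have mu: "scalar_spectral_measure E u = scalar_spectral_measure E0 u" for u
  proof (rule measure_eqI)
    fix A assume "A \<in> sets (scalar_spectral_measure E u)"
    then have "A \<in> sets borel" by (simp only: sets_scalar_spectral_measure[OF E(1)])
    then show "emeasure (scalar_spectral_measure E u) A = emeasure (scalar_spectral_measure E0 u) A"
      by (simp only: emeasure_scalar_spectral_measure[OF E(1)] emeasure_scalar_spectral_measure[OF pvm_E0] E_eq_E0[OF E])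
  qed (simp only: sets_scalar_spectral_measure[OF E(1)] sets_scalar_spectral_measure[OF pvm_E0])
  have G: "is_spectral_integral E0 f {(u, fc f u) | u. True}" by (rule spectral_integral_fc[OF assms])
  have dF: "Domain F = UNIV"
  proof -
    have "Domain F = Domain {(u, fc f u) | u. True}"
      using F G unfolding is_spectral_integral_def mu by simp
    then show ?thesis by auto
  qed
  have lF: "linear_op F" using F by (simp add: is_spectral_integral_def)
  define H where "H u = (SOME v. (u, v) \<in> F)" for u
  have HF: "(u, H u) \<in> F" for u
  proof -
    have "u \<in> Domain F" using dF by simp
    then have "\<exists>v. (u, v) \<in> F" by (simp add: Domain_iff)
    then show ?thesis unfolding H_def by (rule someI_ex)
  qed
  have H: "H u = v" if "(u, v) \<in> F" for u v
  proof (rule single_valuedD[OF _ HF that])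
    show "single_valued F" using lF by (simp add: linear_op_def)
  qed
  have Hadd: "H (u + v) = H u + H v" for u v
  proof (rule H)
    have "\<forall>p\<in>F. case p of (u, u') \<Rightarrow> \<forall>(v, v')\<in>F. (u + v, u' + v') \<in> F"
      using lF by (simp add: linear_op_def)
    from bspec[OF this HF[of u]] HF[of v] show "(u + v, H u + H v) \<in> F" by auto
  qed
  have Hsc: "H (c *\<^sub>C u) = c *\<^sub>C H u" for c u
  proof (rule H)
    have "\<forall>p\<in>F. case p of (u, u') \<Rightarrow> (c *\<^sub>C u, c *\<^sub>C u') \<in> F"
      using lF by (simp add: linear_op_def)
    from bspec[OF this HF[of u]] show "(c *\<^sub>C u, c *\<^sub>C H u) \<in> F" by simp
  qed
  define D where "D u = H u - fc f u" for u
  note bf = bounded_borel_t[OF assms]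
  have Dlin: "D (u + v) = D u + D v" "D (c *\<^sub>C u) = c *\<^sub>C D u" for u v c
    by (simp_all add: D_def Hadd Hsc fc_linear[OF bf] scaleC_simps)
  have D0: "cinner u (D u) = 0" for u
  proof -
    have "(u, H u) \<in> F" by (rule HF)
    then have "cinner u (H u) = (LINT x|scalar_spectral_measure E0 u. f x)"
      using F unfolding is_spectral_integral_def mu by blast
    moreover have "cinner u (fc f u) = (LINT x|scalar_spectral_measure E0 u. f x)"
      using G unfolding is_spectral_integral_def by blast
    ultimately show ?thesis by (simp add: D_def cinner_simps)
  qed
  have "D v = 0" for v
  proof (rule cinner_eqI)
    fix u
    have "cinner u (D v) + cinner v (D u) = 0"
      using D0[of "u + v"] D0[of u] D0[of v] by (simp add: Dlin cinner_simps add.commute)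
    moreover have "\<i> * cinner u (D v) - \<i> * cinner v (D u) = 0"
      using D0[of "u + \<i> *\<^sub>C v"] D0[of u] D0[of v] by (simp add: Dlin cinner_simps)
    ultimately show "cinner u (D v) = cinner u 0"
      by (simp add: right_diff_distrib[symmetric] del: right_diff_distrib')
  qed
  then have "H v = fc f v" for v by (simp add: D_def)
  then have HF': "(u, v) \<in> F \<longleftrightarrow> v = fc f u" for u v using H[of u v] HF[of u] by auto
  then show "F = {(u, fc f u) | u. True}" by auto
qed

end

section \<open>Gaussian functions\<close>

text \<open>A real quadratic and a complex linear coefficient: up to scalars, this family is closed under products,
  conjugation and the Fourier transform.\<close>

definition gauss1 :: "real \<Rightarrow> complex \<Rightarrow> real \<Rightarrow> complex" where
  "gauss1 \<alpha> b s = exp (- of_real (\<alpha> / 2) * (of_real s)\<^sup>2 + b * of_real s)"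

lemma gauss1_measurable [measurable]: "gauss1 \<alpha> b \<in> borel_measurable borel"
  unfolding gauss1_def by (intro borel_measurable_continuous_onI continuous_intros)

text \<open>The characteristic function of the standard normal distribution.\<close>

lemma gauss1_standard:
  "integrable lborel (\<lambda>x. gauss1 1 (\<i> * of_real v) x)"
  "(LINT x|lborel. gauss1 1 (\<i> * of_real v) x) = of_real (sqrt (2 * pi) * exp (- v\<^sup>2 / 2))"
proof -
  have g: "gauss1 1 (\<i> * of_real v) x = sqrt (2 * pi) *\<^sub>R (std_normal_density x *\<^sub>R exp (\<i> * of_real (v * x)))" for x
  proof -
    have "gauss1 1 (\<i> * of_real v) x = exp (of_real (- x\<^sup>2 / 2)) * exp (\<i> * of_real (v * x))"
      unfolding gauss1_def exp_add[symmetric] by (simp add: mult.assoc)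
    then show ?thesis
      by (simp add: std_normal_density_def scaleR_conv_of_real exp_of_real[symmetric])
  qed
  have m: "(\<lambda>x. exp (\<i> * complex_of_real (v * x))) \<in> borel_measurable borel"
    by (intro borel_measurable_continuous_onI continuous_intros)
  interpret prob_space std_normal_distribution by (rule prob_space_normal_density) simp
  have "integrable std_normal_distribution (\<lambda>x. exp (\<i> * complex_of_real (v * x)))"
    using m by (intro integrable_const_bound[of _ 1]) (auto simp: norm_exp_i_times)
  then have i: "integrable lborel (\<lambda>x. std_normal_density x *\<^sub>R exp (\<i> * of_real (v * x)))"
    using m by (subst (asm) integrable_density) auto
  then show "integrable lborel (\<lambda>x. gauss1 1 (\<i> * of_real v) x)"
    unfolding g by (rule integrable_scaleR_right)
  have "(LINT x|lborel. std_normal_density x *\<^sub>R exp (\<i> * of_real (v * x))) = char std_normal_distribution v"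
    unfolding char_def using m by (subst integral_density) auto
  then show "(LINT x|lborel. gauss1 1 (\<i> * of_real v) x) = of_real (sqrt (2 * pi) * exp (- v\<^sup>2 / 2))"
    unfolding g integral_scaleR_right by (simp add: char_std_normal_distribution scaleR_conv_of_real)
qed

text \<open>Completing the square with the real part of \<open>b\<close> reduces to the standard Gaussian; the imaginary part
  is the argument of its characteristic function.\<close>

lemma gauss1_integral:
  assumes "\<alpha> > 0"
  shows "integrable lborel (gauss1 \<alpha> b)"
    "(LINT s|lborel. gauss1 \<alpha> b s) = of_real (sqrt (2 * pi / \<alpha>)) * exp (b\<^sup>2 / of_real (2 * \<alpha>))"
proof -
  define u v r where "u = Re b" and "v = Im b" and "r = sqrt \<alpha>"
  have r: "r > 0" "r * r = \<alpha>" using assms by (auto simp: r_def)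
  have b: "b = of_real u + \<i> * of_real v" by (simp add: u_def v_def complex_eq_iff)
  define C where "C = exp (of_real (u\<^sup>2 / (2 * \<alpha>)) + \<i> * of_real (u * v / \<alpha>))"
  have sub: "gauss1 \<alpha> b (u / \<alpha> + (1 / r) * x) = C * gauss1 1 (\<i> * of_real (v / r)) x" for x
  proof -
    have 1: "- (\<alpha> / 2) * (u / \<alpha> + (1 / r) * x)\<^sup>2 + u * (u / \<alpha> + (1 / r) * x) = u\<^sup>2 / (2 * \<alpha>) - x\<^sup>2 / 2"
    proof -
      define A y where "A = u / \<alpha>" and "y = (1 / r) * x"
      have u: "u = \<alpha> * A" using assms by (simp add: A_def)
      have "\<alpha> * y\<^sup>2 = x\<^sup>2" unfolding y_def r(2)[symmetric] using r(1) by (simp add: power2_eq_square)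
      moreover have "- (\<alpha> / 2) * (A + y)\<^sup>2 + u * (A + y) = \<alpha> * A\<^sup>2 / 2 - \<alpha> * y\<^sup>2 / 2"
        unfolding u power2_eq_square by (simp add: algebra_simps)
      moreover have "u\<^sup>2 / (2 * \<alpha>) = \<alpha> * A\<^sup>2 / 2"
        unfolding u using assms by (simp add: power2_eq_square)
      ultimately show ?thesis unfolding A_def y_def by simp
    qed
    have 2: "v * (u / \<alpha> + (1 / r) * x) = u * v / \<alpha> + v / r * x"
      using r(1) by (simp add: ring_distribs)
    have "- of_real (\<alpha> / 2) * (of_real (u / \<alpha> + (1 / r) * x))\<^sup>2 + b * of_real (u / \<alpha> + (1 / r) * x)
        = of_real (- (\<alpha> / 2) * (u / \<alpha> + (1 / r) * x)\<^sup>2 + u * (u / \<alpha> + (1 / r) * x)) + \<i> * of_real (v * (u / \<alpha> + (1 / r) * x))"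
    proof -
      have "- of_real (\<alpha> / 2) * (of_real z)\<^sup>2 + b * of_real z = of_real (- (\<alpha> / 2) * z\<^sup>2 + u * z) + \<i> * of_real (v * z)" for z
        unfolding b by (simp add: ring_distribs)
      then show ?thesis .
    qed
    also have "\<dots> = of_real (u\<^sup>2 / (2 * \<alpha>)) + \<i> * of_real (u * v / \<alpha>) + (- of_real (1 / 2) * (of_real x)\<^sup>2 + \<i> * of_real (v / r) * of_real x)"
      unfolding 1 2 by (simp add: ring_distribs)
    finally show ?thesis unfolding gauss1_def C_def exp_add[symmetric] by simp
  qed
  have r0: "1 / r \<noteq> 0" using r by simp
  have "integrable lborel (\<lambda>x. gauss1 \<alpha> b (u / \<alpha> + (1 / r) * x))"
    unfolding sub by (intro integrable_mult_right gauss1_standard)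
  then show "integrable lborel (gauss1 \<alpha> b)"
    using lborel_integrable_real_affine_iff[OF r0, of "gauss1 \<alpha> b"] by blast
  have "(LINT s|lborel. gauss1 \<alpha> b s) = (1 / r) *\<^sub>R (LINT x|lborel. gauss1 \<alpha> b (u / \<alpha> + (1 / r) * x))"
    using lborel_integral_real_affine[OF r0, of "gauss1 \<alpha> b" "u / \<alpha>"] r by simp
  also have "\<dots> = of_real (1 / r * sqrt (2 * pi)) * (C * exp (of_real (- (v / r)\<^sup>2 / 2)))"
    unfolding sub integral_mult_right_zero gauss1_standard(2)
    by (simp add: scaleR_conv_of_real exp_of_real[symmetric])
  also have "C * exp (of_real (- (v / r)\<^sup>2 / 2)) = exp (b\<^sup>2 / of_real (2 * \<alpha>))"
  proof -
    have "of_real (u\<^sup>2 / (2 * \<alpha>)) + \<i> * of_real (u * v / \<alpha>) + of_real (- (v / r)\<^sup>2 / 2) = b\<^sup>2 / of_real (2 * \<alpha>)"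
    proof -
      have "(v / r)\<^sup>2 = v\<^sup>2 / \<alpha>" by (simp add: power2_eq_square r(2))
      then show ?thesis unfolding b using assms
        by (simp only:) (simp add: power2_eq_square field_simps)
    qed
    then show ?thesis unfolding C_def exp_add[symmetric] by simp
  qed
  also have "1 / r * sqrt (2 * pi) = sqrt (2 * pi / \<alpha>)" by (simp add: r_def real_sqrt_divide)
  finally show "(LINT s|lborel. gauss1 \<alpha> b s) = of_real (sqrt (2 * pi / \<alpha>)) * exp (b\<^sup>2 / of_real (2 * \<alpha>))" .
qed

lemma integral_prod_vec:
  fixes f :: "'n::finite \<Rightarrow> real \<Rightarrow> complex"
  assumes f: "\<And>i. integrable lborel (f i)"
  shows "integrable lborel (\<lambda>a::real^'n. \<Prod>i\<in>UNIV. f i (a $ i))"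
    "(LINT a|lborel. (\<Prod>i\<in>UNIV. f i ((a::real^'n) $ i))) = (\<Prod>i\<in>UNIV. integral\<^sup>L lborel (f i))"
proof -
  have [measurable]: "f i \<in> borel_measurable borel" for i using f[of i] by simp
  interpret product_sigma_finite "\<lambda>b::real^'n. lborel :: real measure" by standard
  \<comment> \<open>the factors indexed by basis vectors, since Lebesgue measure is the image of a product over the basis\<close>
  define h :: "real^'n \<Rightarrow> real \<Rightarrow> complex" where "h b = f (THE i. b = axis i 1)" for b
  have ax: "(THE j. axis i 1 = (axis j 1 :: real^'n)) = i" for i :: 'n
    by (rule the_equality) (auto simp: axis_eq_axis)
  have Bs: "(Basis :: (real^'n) set) = (\<lambda>i. axis i 1) ` UNIV" by (auto simp: Basis_vec_def)
  have inj: "inj (\<lambda>i. axis i 1 :: real^'n)" by (auto simp: inj_def axis_eq_axis)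
  have int_h: "integrable lborel (h b)" for b using f by (simp add: h_def)
  have hp: "(\<Prod>i\<in>UNIV. f i (a $ i)) = (\<Prod>b\<in>Basis. h b (a \<bullet> b))" for a :: "real^'n"
    unfolding Bs prod.reindex[OF inj] by (simp add: h_def ax cart_eq_inner_axis)
  have co: "(\<Sum>b\<in>Basis. x b *\<^sub>R b) \<bullet> c = x c" if "c \<in> Basis" for x and c :: "real^'n"
    using that by (simp add: inner_sum_left inner_Basis if_distrib cong: if_cong)
  have m: "(\<lambda>x. \<Sum>b\<in>Basis. x b *\<^sub>R b) \<in> measurable (\<Pi>\<^sub>M b\<in>(Basis::(real^'n) set). lborel) (borel :: (real^'n) measure)"
    by measurable
  have g: "(\<lambda>a::real^'n. \<Prod>i\<in>UNIV. f i (a $ i)) \<in> borel_measurable borel"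
    unfolding cart_eq_inner_axis by measurable
  have eq: "(\<Prod>i\<in>UNIV. f i ((\<Sum>b\<in>(Basis::(real^'n) set). x b *\<^sub>R b) $ i)) = (\<Prod>b\<in>(Basis::(real^'n) set). h b (x b))" for x
    unfolding hp by (rule prod.cong) (simp_all add: co)
  have "integrable (distr (\<Pi>\<^sub>M b\<in>(Basis::(real^'n) set). lborel) borel (\<lambda>x. \<Sum>b\<in>Basis. x b *\<^sub>R b)) (\<lambda>a::real^'n. \<Prod>i\<in>UNIV. f i (a $ i))"
    unfolding integrable_distr_eq[OF m g] eq by (rule product_integrable_prod) (simp_all add: int_h)
  then show "integrable lborel (\<lambda>a::real^'n. \<Prod>i\<in>UNIV. f i (a $ i))" by (simp only: lborel_eq[symmetric])
  have "(LINT a|distr (\<Pi>\<^sub>M b\<in>(Basis::(real^'n) set). lborel) borel (\<lambda>x. \<Sum>b\<in>Basis. x b *\<^sub>R b). (\<Prod>i\<in>UNIV. f i ((a::real^'n) $ i)))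
      = (\<Prod>b\<in>(Basis::(real^'n) set). integral\<^sup>L lborel (h b))"
    unfolding integral_distr[OF m g] eq by (rule product_integral_prod) (simp_all add: int_h)
  also have "\<dots> = (\<Prod>i\<in>UNIV. integral\<^sup>L lborel (f i))"
    unfolding Bs prod.reindex[OF inj] by (simp add: h_def ax)
  finally show "(LINT a|lborel. (\<Prod>i\<in>UNIV. f i ((a::real^'n) $ i))) = (\<Prod>i\<in>UNIV. integral\<^sup>L lborel (f i))"
    by (simp only: lborel_eq[symmetric])
qed

definition gauss :: "('n::finite \<Rightarrow> real) \<Rightarrow> ('n \<Rightarrow> complex) \<Rightarrow> real^'n \<Rightarrow> complex" where
  "gauss \<alpha> b a = (\<Prod>i\<in>UNIV. gauss1 (\<alpha> i) (b i) (a $ i))"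

lemma gauss_measurable [measurable]: "gauss \<alpha> b \<in> borel_measurable borel"
  unfolding gauss_def cart_eq_inner_axis by measurable

lemma gauss_integral:
  assumes "\<And>i. \<alpha> i > 0"
  shows "integrable lborel (gauss \<alpha> b)"
    "(LINT a|lborel. gauss \<alpha> b a) = (\<Prod>i\<in>UNIV. of_real (sqrt (2 * pi / \<alpha> i)) * exp ((b i)\<^sup>2 / of_real (2 * \<alpha> i)))"
  using integral_prod_vec[of "\<lambda>i. gauss1 (\<alpha> i) (b i)"] assms
  by (simp_all add: gauss_def[abs_def] gauss1_integral)

lemma gauss1_mult: "cnj (gauss1 \<alpha> b s) * gauss1 \<alpha>' b' s = gauss1 (\<alpha> + \<alpha>') (cnj b + b') s"
  unfolding gauss1_def by (simp add: exp_cnj exp_add[symmetric]) (simp add: algebra_simps add_divide_distrib)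

lemma gauss_mult: "cnj (gauss \<alpha> b a) * gauss \<alpha>' b' a = gauss (\<lambda>i. \<alpha> i + \<alpha>' i) (\<lambda>i. cnj (b i) + b' i) a"
  by (simp add: gauss_def gauss1_mult flip: prod.distrib)

lemma square_integrable_gauss:
  assumes "\<And>i. \<alpha> i > 0"
  shows "square_integrable (gauss \<alpha> b)"
proof -
  have "integrable lborel (\<lambda>a. cnj (gauss \<alpha> b a) * gauss \<alpha> b a)"
    unfolding gauss_mult by (rule gauss_integral) (simp add: assms add_pos_pos)
  then have "integrable lborel (\<lambda>a. complex_of_real ((cmod (gauss \<alpha> b a))\<^sup>2))" by (simp only: cnj_mult_self)
  then have "integrable lborel (\<lambda>a. (cmod (gauss \<alpha> b a))\<^sup>2)" by (rule complex_of_real_integrable_eq[THEN iffD1])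
  then show ?thesis by (simp add: square_integrable_def)
qed

lemma cinner_gauss:
  assumes "\<And>i. \<alpha> i > 0" "\<And>i. \<alpha>' i > 0"
  shows "cinner (l2_of (gauss \<alpha> b)) (l2_of (gauss \<alpha>' b')) =
    (\<Prod>i\<in>UNIV. of_real (sqrt (2 * pi / (\<alpha> i + \<alpha>' i))) * exp ((cnj (b i) + b' i)\<^sup>2 / of_real (2 * (\<alpha> i + \<alpha>' i))))"
  by (simp add: cinner_l2_of square_integrable_gauss assms gauss_mult gauss_integral add_pos_pos)

lemma gauss_norm: "gauss (\<lambda>_. \<alpha>) (\<lambda>_. 0) a = of_real (exp (- (\<alpha> / 2) * (norm a)\<^sup>2))"
proof -
  have "(norm a)\<^sup>2 = (\<Sum>i\<in>UNIV. (a $ i)\<^sup>2)"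
    unfolding power2_norm_eq_inner inner_vec_def by (simp add: power2_eq_square)
  then show ?thesis
    by (simp add: gauss_def gauss1_def exp_sum[symmetric] exp_of_real[symmetric] sum_distrib_left)
qed

text \<open>A fixed Gaussian times one of width \<open>1 / \<surd>N\<close> centred at \<open>c\<close> is again, up to a constant factor, a
  member of the family. Orthogonality to the family is thus a statement about convolutions.\<close>

lemma gauss_shift:
  fixes a c :: "real^'n::finite"
  shows "gauss (\<lambda>_. 1 + N) (\<lambda>i. of_real (N * c $ i)) a =
    of_real (exp (N / 2 * (norm c)\<^sup>2)) * (of_real (exp (- (1/2) * (norm a)\<^sup>2)) * of_real (exp (- (N / 2) * (norm (a - c))\<^sup>2)))"
proof -
  have nn: "(norm (a - c))\<^sup>2 = (norm a)\<^sup>2 - 2 * (\<Sum>i\<in>UNIV. a $ i * c $ i) + (norm c)\<^sup>2"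
    unfolding power2_norm_eq_inner by (simp add: inner_diff inner_commute[of c a]) (simp add: inner_vec_def)
  have na: "(norm a)\<^sup>2 = (\<Sum>i\<in>UNIV. (a $ i)\<^sup>2)"
    unfolding power2_norm_eq_inner inner_vec_def by (simp add: power2_eq_square)
  have "gauss (\<lambda>_. 1 + N) (\<lambda>i. of_real (N * c $ i)) a = of_real (exp (\<Sum>i\<in>UNIV. - ((1 + N) / 2) * (a $ i)\<^sup>2 + N * c $ i * a $ i))"
    by (simp add: gauss_def gauss1_def exp_sum exp_of_real[symmetric])
  also have "(\<Sum>i\<in>UNIV. - ((1 + N) / 2) * (a $ i)\<^sup>2 + N * c $ i * a $ i)
      = N / 2 * (norm c)\<^sup>2 + (- (1/2) * (norm a)\<^sup>2 + - (N / 2) * (norm (a - c))\<^sup>2)"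
    unfolding nn na by (simp add: sum.distrib sum_distrib_left sum_distrib_right sum_subtractf sum_divide_distrib sum_negf algebra_simps add_divide_distrib)
  finally show ?thesis by (simp only: exp_add of_real_mult)
qed

text \<open>All convolutions of \<open>h\<close>, damped to be integrable, with Gaussians vanish. Letting their width tend
  to 0, the integral of the damped \<open>h\<close> against every bounded continuous function vanishes, hence over
  every open set, hence over every Borel set.\<close>

lemma gauss_total:
  fixes h :: "real^'n::finite \<Rightarrow> complex"
  assumes h [measurable]: "h \<in> borel_measurable borel"
    and int: "\<And>\<alpha> b. (\<And>i. \<alpha> i > 0) \<Longrightarrow> integrable lborel (\<lambda>a. gauss \<alpha> b a * h a)"
    and zero: "\<And>\<alpha> b. (\<And>i. \<alpha> i > 0) \<Longrightarrow> (LINT a|lborel. gauss \<alpha> b a * h a) = 0"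
  shows "AE a in lborel. h a = 0"
proof -
  define H where "H a = of_real (exp (- (1/2) * (norm a)\<^sup>2)) * h a" for a
  have H [measurable]: "H \<in> borel_measurable borel" unfolding H_def by measurable
  have iH: "integrable lborel H"
    using int[of "\<lambda>_::'n. 1" "\<lambda>_. 0"] unfolding gauss_norm H_def by simp
  define G where "G y = exp (- (1/2) * (norm y)\<^sup>2)" for y :: "real^'n"
  have G [measurable]: "G \<in> borel_measurable borel" unfolding G_def by measurable
  have G0: "G y > 0" for y by (simp add: G_def)
  have gG: "gauss (\<lambda>_. 1) (\<lambda>_. 0) = (\<lambda>y. of_real (G y))" by (rule ext) (simp add: gauss_norm G_def)
  have iG: "integrable lborel G"
    using gauss_integral(1)[of "\<lambda>_::'n. 1" "\<lambda>_. 0"] unfolding gG by (simp add: complex_of_real_integrable_eq)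
  have G1: "(LINT y|lborel. G y) \<noteq> 0"
  proof
    assume "(LINT y|lborel. G y) = 0"
    then have "(LINT y|lborel. complex_of_real (G y)) = 0" by simp
    then show False using gauss_integral(2)[of "\<lambda>_. 1" "\<lambda>_::'n. 0"] unfolding gG by simp
  qed
  \<comment> \<open>the convolution of \<open>H\<close> with a Gaussian of width \<open>e\<close>, by \<open>gauss_shift\<close> with \<open>N = 1 / e\<^sup>2\<close>\<close>
  have conv0: "(LINT y|lborel. of_real (G y) * H (c - e *\<^sub>R y)) = 0" if e: "e > 0" for e c
  proof -
    define N where "N = 1 / e\<^sup>2"
    have N: "N > 0" using e by (simp add: N_def)
    define F where "F a = H a * of_real (exp (- (N / 2) * (norm (a - c))\<^sup>2))" for a
    have F [measurable]: "F \<in> borel_measurable borel" unfolding F_def by measurable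
    have "(LINT a|lborel. of_real (exp (N / 2 * (norm c)\<^sup>2)) * F a) = (LINT a|lborel. gauss (\<lambda>_. 1 + N) (\<lambda>i. of_real (N * c $ i)) a * h a)"
      by (rule Bochner_Integration.integral_cong) (simp_all only: gauss_shift F_def H_def mult_ac)
    also have "\<dots> = 0" using N by (intro zero) simp
    finally have F0: "(LINT a|lborel. F a) = 0" by simp
    have e0: "- e \<noteq> 0" using e by simp
    have "(LINT a|lborel. F a) = (LINT a|density (distr lborel borel (\<lambda>x. c + (- e) *\<^sub>R x)) (\<lambda>_. ennreal (\<bar>- e\<bar> ^ DIM(real^'n))). F a)"
      using lborel_affine[OF e0, of c] by (simp add: ennreal_power)
    also have "\<dots> = (LINT y|lborel. (\<bar>- e\<bar> ^ DIM(real^'n)) *\<^sub>R F (c + (- e) *\<^sub>R y))"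
      using e by (subst integral_density) (auto simp: integral_distr)
    finally have "(LINT y|lborel. F (c + (- e) *\<^sub>R y)) = 0" using F0 e by simp
    moreover have "F (c + (- e) *\<^sub>R y) = of_real (G y) * H (c - e *\<^sub>R y)" for y
    proof -
      have "(N / 2) * (norm (- e *\<^sub>R y))\<^sup>2 = (1 / 2) * (norm y)\<^sup>2" using e by (simp add: N_def power_mult_distrib)
      then show ?thesis by (simp add: F_def G_def)
    qed
    ultimately show ?thesis by simp
  qed
  have cont0: "(LINT a|lborel. H a * of_real (\<phi> a)) = 0"
    if \<phi>: "continuous_on UNIV \<phi>" and b: "\<And>a. \<bar>\<phi> a\<bar> \<le> 1" for \<phi> :: "real^'n \<Rightarrow> real"
  proof -
    have \<phi>m [measurable]: "\<phi> \<in> borel_measurable borel" using \<phi> by (rule borel_measurable_continuous_onI)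
    \<comment> \<open>averaging \<open>\<Psi>\<close> over a Gaussian of width \<open>e\<close> is, by Fubini, a pairing of \<open>\<phi>\<close> with \<open>conv0\<close>; then let \<open>e\<close> tend to 0\<close>
    define \<Psi> where "\<Psi> z = (LINT a|lborel. H a * of_real (\<phi> (a + z)))" for z
    have bH: "cmod (H a * of_real (\<phi> z)) \<le> cmod (H a)" for a z
      using mult_left_mono[OF b[of z], of "cmod (H a)"] by (simp add: norm_mult)
    have iHp: "integrable lborel (\<lambda>a. H a * of_real (\<phi> (a + z)))" for z
      by (rule Bochner_Integration.integrable_bound[OF iH]) (use bH in \<open>auto\<close>)
    have b\<Psi>: "cmod (\<Psi> z) \<le> (LINT a|lborel. cmod (H a))" for z
    proof -
      have "cmod (\<Psi> z) \<le> (LINT a|lborel. cmod (H a * of_real (\<phi> (a + z))))"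
        unfolding \<Psi>_def by (rule integral_norm_bound)
      also have "\<dots> \<le> (LINT a|lborel. cmod (H a))"
        by (intro integral_mono integrable_norm iH iHp bH)
      finally show ?thesis .
    qed
    have lim\<Psi>: "(\<lambda>n. \<Psi> ((1 / Suc n) *\<^sub>R y)) \<longlonglongrightarrow> \<Psi> 0" for y
      unfolding \<Psi>_def
    proof (rule integral_dominated_convergence[where w = "\<lambda>a. cmod (H a)"])
      show "AE a in lborel. (\<lambda>n. H a * of_real (\<phi> (a + (1 / Suc n) *\<^sub>R y))) \<longlonglongrightarrow> H a * of_real (\<phi> (a + 0))"
      proof (intro AE_I2 tendsto_intros)
        fix a
        have "(\<lambda>n. a + (1 / real (Suc n)) *\<^sub>R y) \<longlonglongrightarrow> a + 0 *\<^sub>R y"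
          by (intro tendsto_intros LIMSEQ_Suc[OF lim_inverse_n'])
        then show "(\<lambda>n. \<phi> (a + (1 / real (Suc n)) *\<^sub>R y)) \<longlonglongrightarrow> \<phi> (a + 0)"
          using \<phi> by (intro isCont_tendsto_compose[of _ \<phi>]) (simp_all add: continuous_on_eq_continuous_at)
      qed
    qed (use iH bH in auto)
    have "(\<lambda>n. LINT y|lborel. of_real (G y) * \<Psi> ((1 / Suc n) *\<^sub>R y)) \<longlonglongrightarrow> (LINT y|lborel. of_real (G y) * \<Psi> 0)"
    proof (rule integral_dominated_convergence[where w = "\<lambda>y. G y * (LINT a|lborel. cmod (H a))"])
      show "AE y in lborel. (\<lambda>n. complex_of_real (G y) * \<Psi> ((1 / real (Suc n)) *\<^sub>R y)) \<longlonglongrightarrow> of_real (G y) * \<Psi> 0"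
        by (intro AE_I2 tendsto_intros lim\<Psi>)
      show "AE y in lborel. cmod (complex_of_real (G y) * \<Psi> ((1 / real (Suc n)) *\<^sub>R y)) \<le> G y * (LINT a|lborel. cmod (H a))" for n
        using G0 b\<Psi> by (intro AE_I2) (simp add: norm_mult less_imp_le mult_left_mono)
      show "integrable lborel (\<lambda>y. G y * (LINT a|lborel. cmod (H a)))" using iG by simp
      show "(\<lambda>y. complex_of_real (G y) * \<Psi> ((1 / real (Suc n)) *\<^sub>R y)) \<in> borel_measurable lborel" for n
        unfolding \<Psi>_def by measurable
    qed measurable
    moreover have "(LINT y|lborel. of_real (G y) * \<Psi> (e *\<^sub>R y)) = 0" if e: "e > 0" for e
    proof -
      define K where "K y c = of_real (G y) * (H (c - e *\<^sub>R y) * of_real (\<phi> c))" for y c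
      have K [measurable]: "(\<lambda>(y, c). K y c) \<in> borel_measurable (lborel \<Otimes>\<^sub>M lborel)"
        unfolding K_def by measurable
      have tr: "(LINT c|lborel. f (c - e *\<^sub>R y)) = (LINT a|lborel. f a)" "integrable lborel (\<lambda>c. f (c - e *\<^sub>R y)) = integrable lborel f"
        if [measurable]: "f \<in> borel_measurable borel" for f :: "real^'n \<Rightarrow> 'z::{banach, second_countable_topology}" and y
      proof -
        have "(+) (- (e *\<^sub>R y)) = (\<lambda>c. c - e *\<^sub>R y)" by auto
        then have d: "distr lborel borel (\<lambda>c. c - e *\<^sub>R y) = lborel"
          using lborel_distr_plus[of "- (e *\<^sub>R y)"] by simp
        show "(LINT c|lborel. f (c - e *\<^sub>R y)) = (LINT a|lborel. f a)" "integrable lborel (\<lambda>c. f (c - e *\<^sub>R y)) = integrable lborel f"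
          using integral_distr[of "\<lambda>c. c - e *\<^sub>R y" lborel borel f]
            integrable_distr_eq[of "\<lambda>c. c - e *\<^sub>R y" lborel borel f] by (simp_all add: d)
      qed
      have bK: "cmod (K y c) \<le> G y * cmod (H (c - e *\<^sub>R y))" for y c
        using bH[of "c - e *\<^sub>R y" c] G0[of y] by (simp add: K_def norm_mult mult_left_mono)
      have i1: "integrable lborel (\<lambda>c. G y * cmod (H (c - e *\<^sub>R y)))" for y
        using tr(2)[of "\<lambda>a. cmod (H a)" y] iH by (intro integrable_mult_right) simp
      have i2: "integrable lborel (K y)" for y
        by (rule Bochner_Integration.integrable_bound[OF i1[of y]]) (use bK G0 in \<open>auto simp: abs_mult less_imp_le\<close>)
      have i3: "integrable lborel (\<lambda>y. LINT c|lborel. norm (K y c))"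
      proof (rule Bochner_Integration.integrable_bound)
        show "integrable lborel (\<lambda>y. G y * (LINT a|lborel. cmod (H a)))" using iG by simp
        have "(LINT c|lborel. cmod (K y c)) \<le> (LINT c|lborel. G y * cmod (H (c - e *\<^sub>R y)))" for y
          by (intro integral_mono integrable_norm i1 i2 bK)
        also have "\<dots> y = G y * (LINT a|lborel. cmod (H a))" for y
          using tr(1)[of "\<lambda>a. cmod (H a)" y] by simp
        finally show "AE y in lborel. norm (LINT c|lborel. norm (K y c)) \<le> norm (G y * (LINT a|lborel. cmod (H a)))"
          using G0 by (intro AE_I2) (simp add: abs_mult less_imp_le integral_nonneg)
      qed measurable
      have iK: "integrable (lborel \<Otimes>\<^sub>M lborel) (\<lambda>(y, c). K y c)"
        by (rule lborel_pair.Fubini_integrable) (use i2 i3 in auto)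
      have "(LINT y|lborel. of_real (G y) * \<Psi> (e *\<^sub>R y)) = (LINT y|lborel. LINT c|lborel. K y c)"
      proof (rule Bochner_Integration.integral_cong[OF refl])
        fix y
        have "\<Psi> (e *\<^sub>R y) = (LINT c|lborel. H (c - e *\<^sub>R y) * of_real (\<phi> c))"
          using tr(1)[of "\<lambda>a. H a * of_real (\<phi> (a + e *\<^sub>R y))" y] by (simp add: \<Psi>_def)
        then show "of_real (G y) * \<Psi> (e *\<^sub>R y) = (LINT c|lborel. K y c)" by (simp add: K_def)
      qed
      also have "\<dots> = (LINT c|lborel. LINT y|lborel. K y c)"
        using lborel_pair.Fubini_integral[OF iK] by simp
      also have "\<dots> = (LINT c|lborel. of_real (\<phi> c) * (LINT y|lborel. of_real (G y) * H (c - e *\<^sub>R y)))"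
        by (simp add: K_def mult_ac flip: integral_mult_right_zero)
      finally show ?thesis by (simp add: conv0[OF e])
    qed
    ultimately have "(LINT y|lborel. of_real (G y) * \<Psi> 0) = 0" by (simp add: LIMSEQ_const_iff)
    then have "\<Psi> 0 = 0" using G1 by simp
    then show ?thesis by (simp add: \<Psi>_def)
  qed
  have open0: "(LINT a|lborel. indicator U a *\<^sub>R H a) = 0" if U: "open U" for U
  proof (cases "U = UNIV")
    case True
    then show ?thesis using cont0[of "\<lambda>_. 1"] by simp
  next
    case False
    then have ne: "- U \<noteq> {}" by auto
    \<comment> \<open>continuous functions that increase to the indicator of \<open>U\<close>\<close>
    define \<phi> where "\<phi> n a = min 1 (real n * infdist a (- U))" for n a
    have b: "\<bar>\<phi> n a\<bar> \<le> 1" "0 \<le> \<phi> n a" for n a by (auto simp: \<phi>_def infdist_nonneg)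
    have c: "continuous_on UNIV (\<phi> n)" for n unfolding \<phi>_def by (intro continuous_intros)
    have [measurable]: "\<phi> n \<in> borel_measurable borel" for n using c by (rule borel_measurable_continuous_onI)
    have "(\<lambda>n. LINT a|lborel. H a * of_real (\<phi> n a)) \<longlonglongrightarrow> (LINT a|lborel. H a * of_real (indicator U a))"
    proof (rule integral_dominated_convergence[where w = "\<lambda>a. cmod (H a)"])
      show "AE a in lborel. (\<lambda>n. H a * of_real (\<phi> n a)) \<longlonglongrightarrow> H a * of_real (indicator U a)"
      proof (intro AE_I2 tendsto_intros)
        fix a
        show "(\<lambda>n. \<phi> n a) \<longlonglongrightarrow> indicator U a"
        proof (cases "a \<in> U")
          case True
          then have p: "infdist a (- U) > 0"
            using U ne in_closed_iff_infdist_zero[of "- U" a] infdist_nonneg[of a "- U"] by (auto simp: closed_def)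
          obtain k where k: "1 < real k * infdist a (- U)" using p reals_Archimedean3 by blast
          have "\<phi> n a = 1" if "n \<ge> k" for n
          proof -
            have "real k * infdist a (- U) \<le> real n * infdist a (- U)" using that p by (intro mult_right_mono) auto
            then show ?thesis using k by (simp add: \<phi>_def)
          qed
          then show ?thesis using True by (intro tendsto_eventually) (auto simp: eventually_sequentially)
        next
          case False
          then show ?thesis by (simp add: \<phi>_def)
        qed
      qed
      show "AE a in lborel. cmod (H a * of_real (\<phi> n a)) \<le> cmod (H a)" for n
        using mult_left_mono[OF b(1)[of n], of "cmod (H _)"] by (intro AE_I2) (simp add: norm_mult)
    qed (use iH U in auto)
    then have "(LINT a|lborel. H a * of_real (indicator U a)) = 0"
      using cont0[OF c b(1)] by (simp add: LIMSEQ_const_iff)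
    then show ?thesis by (simp add: scaleR_conv_of_real mult.commute)
  qed
  have borel0: "set_lebesgue_integral lborel A H = 0" if "A \<in> sets borel" for A
  proof -
    have "Int_stable {S :: (real^'n) set. open S}" by (auto simp: Int_stable_def)
    moreover have "{S :: (real^'n) set. open S} \<subseteq> Pow UNIV" by simp
    moreover have "A \<in> sigma_sets UNIV {S. open S}" using that by (simp add: borel_def)
    ultimately show ?thesis
    proof (induction rule: sigma_sets_induct_disjoint)
      case (basic U)
      then show ?case using open0[of U] by (simp add: set_lebesgue_integral_def)
    next
      case empty
      show ?case by (simp add: set_lebesgue_integral_def)
    next
      case (compl A)
      have A [measurable]: "A \<in> sets borel" using compl(1) by (simp add: borel_def)
      have iA: "integrable lborel (\<lambda>a. indicator A a *\<^sub>R H a)"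
        by (rule integrable_mult_indicator[OF _ iH]) simp
      have "set_lebesgue_integral lborel (UNIV - A) H = (LINT a|lborel. H a - indicator A a *\<^sub>R H a)"
        unfolding set_lebesgue_integral_def by (rule Bochner_Integration.integral_cong) (auto simp: indicator_def)
      also have "\<dots> = (LINT a|lborel. H a) - (LINT a|lborel. indicator A a *\<^sub>R H a)"
        by (rule Bochner_Integration.integral_diff[OF iH iA])
      also have "\<dots> = 0" using compl(2) open0[of UNIV] by (simp add: set_lebesgue_integral_def)
      finally show ?case .
    next
      case (union A)
      have A: "A i \<in> sets lborel" for i using union(2) by (auto simp: borel_def)
      have "set_lebesgue_integral lborel (\<Union>i. A i) H = (\<Sum>i. set_lebesgue_integral lborel (A i) H)"
      proof (rule lebesgue_integral_countable_add[OF A])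
        show "A i \<inter> A j = {}" if "i \<noteq> j" for i j using union(1) that by (auto simp: disjoint_family_on_def)
        show "set_integrable lborel (\<Union>i. A i) H"
          unfolding set_integrable_def using A by (intro integrable_mult_indicator iH) auto
      qed
      also have "\<dots> = 0" using union(3) by simp
      finally show ?case .
    qed
  qed
  have "AE a in lborel. H a = 0"
    by (rule sigma_finite_measure.density_zero[OF sigma_finite_lborel iH]) (simp add: borel0)
  then show ?thesis by eventually_elim (simp add: H_def)
qed

section \<open>The Fourier transform in one coordinate\<close>

text \<open>Gaussian decay makes every integral below absolutely convergent, and it survives multiplication by
  polynomials and invertible linear substitutions.\<close>

definition rapidly_decaying :: "(real^'n::finite \<Rightarrow> complex) \<Rightarrow> bool" where
  "rapidly_decaying f \<longleftrightarrow> continuous_on UNIV f \<and>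
     (\<exists>C \<delta>. \<delta> > 0 \<and> (\<forall>a. cmod (f a) \<le> C * exp (- \<delta> * (norm a)\<^sup>2)))"

lemma integrable_exp_norm:
  assumes "\<delta> > 0"
  shows "integrable lborel (\<lambda>a::real^'n::finite. exp (- \<delta> * (norm a)\<^sup>2))"
proof -
  have "integrable lborel (gauss (\<lambda>_::'n. 2 * \<delta>) (\<lambda>_. 0))" using assms by (intro gauss_integral) simp
  then have "integrable lborel (\<lambda>a::real^'n. complex_of_real (exp (- \<delta> * (norm a)\<^sup>2)))"
    by (simp add: gauss_norm[abs_def])
  then show ?thesis by (rule complex_of_real_integrable_eq[THEN iffD1])
qed

lemma integrable_exp_square:
  assumes "\<delta> > 0"
  shows "integrable lborel (\<lambda>s::real. exp (- \<delta> * s\<^sup>2))"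
proof -
  have "integrable lborel (gauss1 (2 * \<delta>) 0)" using assms by (intro gauss1_integral) simp
  moreover have "gauss1 (2 * \<delta>) 0 s = complex_of_real (exp (- \<delta> * s\<^sup>2))" for s
    by (simp add: gauss1_def exp_of_real[symmetric])
  ultimately have "integrable lborel (\<lambda>s. complex_of_real (exp (- \<delta> * s\<^sup>2)))"
    by (simp add: fun_eq_iff[symmetric] cong: Bochner_Integration.integrable_cong)
  then show ?thesis by (rule complex_of_real_integrable_eq[THEN iffD1])
qed

lemma rapidly_decaying_measurable: "rapidly_decaying f \<Longrightarrow> f \<in> borel_measurable borel"
  unfolding rapidly_decaying_def by (intro borel_measurable_continuous_onI) simp

lemma rapidly_decayingE:
  assumes "rapidly_decaying f"
  obtains C \<delta> where "C > 0" "\<delta> > 0" "\<And>a. cmod (f a) \<le> C * exp (- \<delta> * (norm a)\<^sup>2)"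
proof -
  obtain C \<delta> where C: "\<delta> > 0" "\<And>a. cmod (f a) \<le> C * exp (- \<delta> * (norm a)\<^sup>2)"
    using assms unfolding rapidly_decaying_def by blast
  have "cmod (f a) \<le> (\<bar>C\<bar> + 1) * exp (- \<delta> * (norm a)\<^sup>2)" for a
    by (rule order_trans[OF C(2)]) (intro mult_right_mono, auto)
  then show ?thesis using C(1) that[of "\<bar>C\<bar> + 1" \<delta>] by auto
qed

lemma rapidly_decayingI:
  assumes "continuous_on UNIV f" "\<delta> > 0" "\<And>a. cmod (f a) \<le> C * exp (- \<delta> * (norm a)\<^sup>2)"
  shows "rapidly_decaying f"
  using assms unfolding rapidly_decaying_def by blast

lemma rapidly_decaying_integrable:
  fixes f :: "real^'n::finite \<Rightarrow> complex"
  assumes f: "rapidly_decaying f"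
  shows "integrable lborel f"
proof -
  obtain C \<delta> where C: "C > 0" "\<delta> > 0" "\<And>a. cmod (f a) \<le> C * exp (- \<delta> * (norm a)\<^sup>2)"
    using rapidly_decayingE[OF f] by blast
  show ?thesis
  proof (rule Bochner_Integration.integrable_bound)
    show "integrable lborel (\<lambda>a::real^'n. C * exp (- \<delta> * (norm a)\<^sup>2))"
      by (intro integrable_mult_right integrable_exp_norm C)
    show "AE a in lborel. cmod (f a) \<le> norm (C * exp (- \<delta> * (norm a)\<^sup>2))"
      using C by (intro AE_I2) (simp add: abs_mult)
  qed (simp add: rapidly_decaying_measurable[OF f])
qed

lemma rapidly_decaying_bounded_mult:
  assumes f: "rapidly_decaying f" and g: "continuous_on UNIV g" "\<And>a. cmod (g a) \<le> B"
  shows "rapidly_decaying (\<lambda>a. g a * f a)"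
proof -
  obtain C \<delta> where C: "C > 0" "\<delta> > 0" "\<And>a. cmod (f a) \<le> C * exp (- \<delta> * (norm a)\<^sup>2)"
    using rapidly_decayingE[OF f] by blast
  show ?thesis
  proof (rule rapidly_decayingI[OF _ C(2)])
    show "continuous_on UNIV (\<lambda>a. g a * f a)"
      using f g by (auto simp: rapidly_decaying_def intro!: continuous_intros)
    show "cmod (g a * f a) \<le> (\<bar>B\<bar> * C) * exp (- \<delta> * (norm a)\<^sup>2)" for a
    proof -
      have "cmod (g a) * cmod (f a) \<le> \<bar>B\<bar> * (C * exp (- \<delta> * (norm a)\<^sup>2))"
        using g(2)[of a] C(3)[of a] by (intro mult_mono) auto
      then show ?thesis by (simp add: norm_mult)
    qed
  qed
qed

lemma rapidly_decaying_bounded: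
  assumes f: "rapidly_decaying f"
  shows "\<exists>B. \<forall>a. cmod (f a) \<le> B"
proof -
  obtain C \<delta> where C: "C > 0" "\<delta> > 0" "\<And>a. cmod (f a) \<le> C * exp (- \<delta> * (norm a)\<^sup>2)"
    using rapidly_decayingE[OF f] by blast
  have "cmod (f a) \<le> C" for a
  proof -
    have "exp (- \<delta> * (norm a)\<^sup>2) \<le> 1" using C(2) by simp
    then have "C * exp (- \<delta> * (norm a)\<^sup>2) \<le> C * 1" using C(1) by (intro mult_left_mono) auto
    then show ?thesis using C(3)[of a] by linarith
  qed
  then show ?thesis by blast
qed

lemma rapidly_decaying_square_integrable:
  assumes f: "rapidly_decaying f"
  shows "square_integrable f"
proof -
  obtain B where B: "\<And>a. cmod (f a) \<le> B" using rapidly_decaying_bounded[OF f] by blast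
  have "rapidly_decaying (\<lambda>a. cnj (f a) * f a)"
    using f B by (intro rapidly_decaying_bounded_mult[of _ _ B])
      (auto simp: rapidly_decaying_def intro!: continuous_intros)
  then have "integrable lborel (\<lambda>a. complex_of_real ((cmod (f a))\<^sup>2))"
    unfolding cnj_mult_self by (rule rapidly_decaying_integrable)
  then have "integrable lborel (\<lambda>a. (cmod (f a))\<^sup>2)" by (rule complex_of_real_integrable_eq[THEN iffD1])
  then show ?thesis by (simp add: square_integrable_def rapidly_decaying_measurable[OF f])
qed

lemma rapidly_decaying_add:
  fixes f g :: "real^'n::finite \<Rightarrow> complex"
  assumes f: "rapidly_decaying f" and g: "rapidly_decaying g"
  shows "rapidly_decaying (\<lambda>a. f a + g a)"
proof -
  obtain C \<delta> where C: "C > 0" "\<delta> > 0" "\<And>a. cmod (f a) \<le> C * exp (- \<delta> * (norm a)\<^sup>2)"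
    using rapidly_decayingE[OF f] by blast
  obtain D \<epsilon> where D: "D > 0" "\<epsilon> > 0" "\<And>a. cmod (g a) \<le> D * exp (- \<epsilon> * (norm a)\<^sup>2)"
    using rapidly_decayingE[OF g] by blast
  show ?thesis
  proof (rule rapidly_decayingI[where \<delta> = "min \<delta> \<epsilon>"])
    show "continuous_on UNIV (\<lambda>a. f a + g a)"
      using f g by (auto simp: rapidly_decaying_def intro!: continuous_intros)
    show "min \<delta> \<epsilon> > 0" using C D by simp
    fix a :: "real^'n"
    have e: "exp (- \<delta> * (norm a)\<^sup>2) \<le> exp (- min \<delta> \<epsilon> * (norm a)\<^sup>2)" "exp (- \<epsilon> * (norm a)\<^sup>2) \<le> exp (- min \<delta> \<epsilon> * (norm a)\<^sup>2)"
      by (auto intro!: mult_right_mono)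
    have "cmod (f a + g a) \<le> C * exp (- \<delta> * (norm a)\<^sup>2) + D * exp (- \<epsilon> * (norm a)\<^sup>2)"
      using norm_triangle_ineq[of "f a" "g a"] C(3)[of a] D(3)[of a] by linarith
    also have "\<dots> \<le> C * exp (- min \<delta> \<epsilon> * (norm a)\<^sup>2) + D * exp (- min \<delta> \<epsilon> * (norm a)\<^sup>2)"
      using e C D by (intro add_mono mult_left_mono) auto
    finally show "cmod (f a + g a) \<le> (C + D) * exp (- min \<delta> \<epsilon> * (norm a)\<^sup>2)" by (simp add: algebra_simps)
  qed
qed

lemma rapidly_decaying_gauss:
  fixes \<alpha> :: "'n::finite \<Rightarrow> real"
  assumes \<alpha>: "\<And>i. \<alpha> i > 0"
  shows "rapidly_decaying (gauss \<alpha> b)"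
proof (rule rapidly_decayingI)
  define \<delta> where "\<delta> = Min (range \<alpha>) / 4"
  have \<delta>: "\<delta> \<le> \<alpha> i / 4" for i unfolding \<delta>_def by (simp add: Min_le)
  have "Min (range \<alpha>) \<in> range \<alpha>" by (rule Min_in) auto
  then show "\<delta> > 0" using \<alpha> by (auto simp: \<delta>_def)
  show "continuous_on UNIV (gauss \<alpha> b)"
    unfolding gauss_def[abs_def] gauss1_def by (intro continuous_intros)
  fix a :: "real^'n"
  have 1: "cmod (gauss1 (\<alpha> i) (b i) s) \<le> exp ((Re (b i))\<^sup>2 / \<alpha> i) * exp (- \<delta> * s\<^sup>2)" for i s
  proof -
    define p where "p = Re (b i)"
    have "0 \<le> (2 * p - \<alpha> i * s)\<^sup>2 / (4 * \<alpha> i)" using \<alpha>[of i] by simp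
    then have "p * s \<le> p\<^sup>2 / \<alpha> i + (\<alpha> i / 4) * s\<^sup>2"
      using \<alpha>[of i] by (simp add: power2_eq_square field_simps)
    moreover have "\<delta> * s\<^sup>2 \<le> (\<alpha> i / 4) * s\<^sup>2" using \<delta>[of i] by (intro mult_right_mono) auto
    ultimately have "- (\<alpha> i / 2) * s\<^sup>2 + p * s \<le> p\<^sup>2 / \<alpha> i + - \<delta> * s\<^sup>2" by simp
    moreover have "Re (- of_real (\<alpha> i / 2) * (of_real s)\<^sup>2 + b i * of_real s) = - (\<alpha> i / 2) * s\<^sup>2 + p * s"
      unfolding p_def of_real_power[symmetric] of_real_minus[symmetric] of_real_mult[symmetric] plus_complex.sel by simp
    ultimately show ?thesis unfolding gauss1_def norm_exp_eq_Re p_def by (simp flip: exp_add)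
  qed
  have na: "(norm a)\<^sup>2 = (\<Sum>i\<in>UNIV. (a $ i)\<^sup>2)"
    unfolding power2_norm_eq_inner inner_vec_def by (simp add: power2_eq_square)
  have "cmod (gauss \<alpha> b a) \<le> (\<Prod>i\<in>UNIV. exp ((Re (b i))\<^sup>2 / \<alpha> i) * exp (- \<delta> * (a $ i)\<^sup>2))"
    unfolding gauss_def prod_norm[symmetric] by (rule prod_mono) (use 1 in auto)
  also have "\<dots> = (\<Prod>i\<in>UNIV. exp ((Re (b i))\<^sup>2 / \<alpha> i)) * exp (- \<delta> * (norm a)\<^sup>2)"
    unfolding na sum_distrib_left exp_sum[OF finite] by (simp add: prod.distrib)
  finally show "cmod (gauss \<alpha> b a) \<le> (\<Prod>i\<in>UNIV. exp ((Re (b i))\<^sup>2 / \<alpha> i)) * exp (- \<delta> * (norm a)\<^sup>2)" .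
qed

text \<open>For varying \<open>s\<close> this runs through the line through \<open>a\<close> in the \<open>k\<close>-th direction.\<close>

definition upd :: "'n \<Rightarrow> real^'n::finite \<Rightarrow> real \<Rightarrow> real^'n" where
  "upd k a s = a + (s - a $ k) *\<^sub>R axis k 1"

lemma upd_nth: "upd k a s $ i = (if i = k then s else a $ i)"
  by (simp add: upd_def axis_def)

lemma upd_upd: "upd k (upd k a s) r = upd k a r" "upd k a (a $ k) = a"
  by (simp_all add: vec_eq_iff upd_nth)

lemma norm_upd: "s\<^sup>2 \<le> (norm (upd k a s))\<^sup>2"
  using component_le_norm_cart[of "upd k a s" k] by (simp add: upd_nth abs_le_square_iff[symmetric])

lemma continuous_upd: "continuous_on UNIV (\<lambda>p. upd k (fst p) (snd p))"
  unfolding upd_def by (intro continuous_intros)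

lemma upd_measurable [measurable]:
  "(\<lambda>p. upd k (fst p) (snd p)) \<in> borel_measurable (lborel \<Otimes>\<^sub>M lborel)"
  "upd k a \<in> borel_measurable borel"
proof -
  show "(\<lambda>p. upd k (fst p) (snd p)) \<in> borel_measurable (lborel \<Otimes>\<^sub>M lborel)"
    unfolding lborel_prod by (simp add: borel_measurable_continuous_onI[OF continuous_upd])
  show "upd k a \<in> borel_measurable borel"
    unfolding upd_def[abs_def] by (intro borel_measurable_continuous_onI continuous_intros)
qed

text \<open>The argument \<open>\<xi>\<close> is mixed: its \<open>k\<close>-th coordinate is a momentum, the others are positions.\<close>

definition partial_fourier :: "'n \<Rightarrow> (real^'n::finite \<Rightarrow> complex) \<Rightarrow> real^'n \<Rightarrow> complex" where
  "partial_fourier k u \<xi> = of_real (1 / sqrt (2 * pi)) * (LINT s|lborel. u (upd k \<xi> s) * exp (- \<i> * of_real (\<xi> $ k * s)))"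

lemma lborel_distr_basis_permutation:
  fixes f :: "'a::euclidean_space \<Rightarrow> 'a"
  assumes sym: "\<And>x y. f x \<bullet> y = x \<bullet> f y" and inv: "\<And>x. f (f x) = x"
    and B: "f ` Basis \<subseteq> Basis" and f: "f \<in> borel_measurable borel"
  shows "distr lborel borel f = lborel"
proof (rule lborel_eqI[symmetric])
  fix l u :: 'a assume lu: "\<And>b. b \<in> Basis \<Longrightarrow> l \<bullet> b \<le> u \<bullet> b"
  have fb: "f b \<in> Basis" if "b \<in> Basis" for b using B that by blast
  have pre: "f -` box l u = box (f l) (f u)"
  proof (intro set_eqI iffI)
    fix x assume "x \<in> f -` box l u"
    then have *: "l \<bullet> b < f x \<bullet> b \<and> f x \<bullet> b < u \<bullet> b" if "b \<in> Basis" for b using that by (auto simp: mem_box)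
    show "x \<in> box (f l) (f u)" unfolding mem_box using *[OF fb] by (simp add: sym inv)
  next
    fix x assume "x \<in> box (f l) (f u)"
    then have *: "f l \<bullet> b < x \<bullet> b \<and> x \<bullet> b < f u \<bullet> b" if "b \<in> Basis" for b using that by (auto simp: mem_box)
    show "x \<in> f -` box l u" unfolding vimage_eq mem_box using *[OF fb] by (simp add: sym inv)
  qed
  have bij: "bij_betw f Basis Basis"
  proof (rule bij_betw_imageI)
    show "inj_on f Basis" by (rule inj_onI) (metis inv)
    show "f ` Basis = Basis" using B by (metis image_subset_iff inv subsetI subset_antisym image_eqI)
  qed
  have "emeasure (distr lborel borel f) (box l u) = emeasure lborel (box (f l) (f u))"
    using f by (subst emeasure_distr) (auto simp: pre)
  also have "\<dots> = ennreal (\<Prod>b\<in>Basis. (f u - f l) \<bullet> b)"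
  proof (rule emeasure_lborel_box)
    fix b :: 'a assume "b \<in> Basis"
    then show "f l \<bullet> b \<le> f u \<bullet> b" using lu[OF fb] by (simp add: sym)
  qed
  also have "(\<Prod>b\<in>Basis. (f u - f l) \<bullet> b) = (\<Prod>b\<in>Basis. (u - l) \<bullet> f b)"
    by (rule prod.cong) (simp_all add: inner_diff_left sym)
  also have "\<dots> = (\<Prod>b\<in>Basis. (u - l) \<bullet> b)" by (rule prod.reindex_bij_betw[OF bij])
  finally show "emeasure (distr lborel borel f) (box l u) = ennreal (\<Prod>b\<in>Basis. (u - l) \<bullet> b)" .
qed simp

text \<open>Exchanges the \<open>k\<close>-th coordinate with an additional real variable. Since this preserves Lebesgue
  measure, Fubini's theorem for the additional variable gives iterated integration over the \<open>k\<close>-th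
  coordinate without splitting the space into a product.\<close>

definition swap_coord :: "'n \<Rightarrow> (real^'n::finite) \<times> real \<Rightarrow> (real^'n) \<times> real" where
  "swap_coord k p = (upd k (fst p) (snd p), fst p $ k)"

lemma swap_coord_measurable: "swap_coord k \<in> borel_measurable borel"
  unfolding swap_coord_def[abs_def] upd_def by (intro borel_measurable_continuous_onI continuous_intros)

lemma lborel_distr_swap_coord: "distr lborel borel (swap_coord k) = (lborel :: ((real^'n::finite) \<times> real) measure)"
proof (rule lborel_distr_basis_permutation)
  show "swap_coord k x \<bullet> y = x \<bullet> swap_coord k y" for x y :: "(real^'n) \<times> real"
    by (cases x; cases y) (simp add: swap_coord_def upd_def inner_add_left inner_add_right
        inner_axis inner_axis' algebra_simps)
  show "swap_coord k (swap_coord k x) = x" for x :: "(real^'n) \<times> real"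
    by (cases x) (simp add: swap_coord_def upd_upd upd_nth)
  show "swap_coord k ` Basis \<subseteq> (Basis :: ((real^'n) \<times> real) set)"
  proof (rule image_subsetI)
    fix p :: "(real^'n) \<times> real" assume "p \<in> Basis"
    obtain a s where p: "p = (a, s)" by (cases p)
    have "swap_coord k (a, s) \<in> Basis"
    proof -
    from \<open>p \<in> Basis\<close> consider i where "a = axis i 1" "s = 0" | "a = 0" "s = 1"
      unfolding p by (auto simp: Basis_prod_def Basis_vec_def)
    then show "swap_coord k (a, s) \<in> Basis"
    proof cases
      case 1
      show ?thesis
      proof (cases "i = k")
        case True
        have "upd k (axis k 1) 0 = 0" by (simp add: vec_eq_iff upd_nth axis_def)
        then show ?thesis using 1 True by (simp add: swap_coord_def Basis_prod_def axis_def)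
      next
        case False
        then have "upd k (axis i 1) 0 = axis i (1::real)" by (auto simp: vec_eq_iff upd_nth axis_def)
        then show ?thesis using 1 False by (auto simp: swap_coord_def Basis_prod_def Basis_vec_def axis_def)
      qed
    next
      case 2
      have "upd k 0 1 = axis k (1::real)" by (simp add: vec_eq_iff upd_nth axis_def)
      then show ?thesis using 2 by (auto simp: swap_coord_def Basis_prod_def Basis_vec_def)
    qed
    qed
    then show "swap_coord k p \<in> Basis" by (simp only: p)
  qed
qed (rule swap_coord_measurable)

lemma fiber_integrable:
  assumes u: "rapidly_decaying u"
  shows "integrable lborel (\<lambda>s. u (upd k \<xi> s) * exp (- \<i> * of_real (\<xi> $ k * s)))"
proof -
  obtain C \<delta> where C: "C > 0" "\<delta> > 0" "\<And>a. cmod (u a) \<le> C * exp (- \<delta> * (norm a)\<^sup>2)"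
    using rapidly_decayingE[OF u] by blast
  have [measurable]: "u \<in> borel_measurable borel" by (rule rapidly_decaying_measurable[OF u])
  show ?thesis
  proof (rule Bochner_Integration.integrable_bound)
    show "integrable lborel (\<lambda>s. C * exp (- \<delta> * s\<^sup>2))" by (intro integrable_mult_right integrable_exp_square C)
    have "cmod (u (upd k \<xi> s)) \<le> C * exp (- \<delta> * s\<^sup>2)" for s
    proof (rule order_trans[OF C(3)])
      show "C * exp (- \<delta> * (norm (upd k \<xi> s))\<^sup>2) \<le> C * exp (- \<delta> * s\<^sup>2)"
        using C norm_upd[of s k \<xi>] by simp
    qed
    then show "AE s in lborel. cmod (u (upd k \<xi> s) * exp (- \<i> * of_real (\<xi> $ k * s))) \<le> norm (C * exp (- \<delta> * s\<^sup>2))"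
      using C by (intro AE_I2) (simp add: norm_mult norm_exp_eq_Re)
  qed measurable
qed

lemma partial_fourier_measurable:
  assumes u: "rapidly_decaying u"
  shows "partial_fourier k u \<in> borel_measurable borel"
proof -
  have [measurable]: "u \<in> borel_measurable borel" by (rule rapidly_decaying_measurable[OF u])
  have "(\<lambda>p. u (upd k (fst p) (snd p)) * exp (- \<i> * of_real (fst p $ k * snd p))) \<in> borel_measurable (lborel \<Otimes>\<^sub>M lborel)"
    unfolding cart_eq_inner_axis by measurable
  then have "(\<lambda>\<xi>. LINT s|lborel. u (upd k \<xi> s) * exp (- \<i> * of_real (\<xi> $ k * s))) \<in> borel_measurable lborel"
    using lborel.borel_measurable_lebesgue_integral[of "\<lambda>\<xi> s. u (upd k \<xi> s) * exp (- \<i> * of_real (\<xi> $ k * s))" lborel]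
    by (simp add: case_prod_beta')
  then show ?thesis unfolding partial_fourier_def[abs_def] by simp
qed

lemma partial_fourier_bounded:
  assumes u: "rapidly_decaying u"
  shows "\<exists>B. \<forall>\<xi>. cmod (partial_fourier k u \<xi>) \<le> B"
proof -
  obtain C \<delta> where C: "C > 0" "\<delta> > 0" "\<And>a. cmod (u a) \<le> C * exp (- \<delta> * (norm a)\<^sup>2)"
    using rapidly_decayingE[OF u] by blast
  have i: "integrable lborel (\<lambda>s. C * exp (- \<delta> * s\<^sup>2))" by (intro integrable_mult_right integrable_exp_square C)
  have "cmod (LINT s|lborel. u (upd k \<xi> s) * exp (- \<i> * of_real (\<xi> $ k * s))) \<le> (LINT s|lborel. C * exp (- \<delta> * s\<^sup>2))" for \<xi>
  proof (rule order_trans[OF integral_norm_bound integral_mono])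
    show "cmod (u (upd k \<xi> s) * exp (- \<i> * of_real (\<xi> $ k * s))) \<le> C * exp (- \<delta> * s\<^sup>2)" for s
      using order_trans[OF C(3)[of "upd k \<xi> s"], of "C * exp (- \<delta> * s\<^sup>2)"] C norm_upd[of s k \<xi>]
      by (simp add: norm_mult norm_exp_eq_Re)
  qed (intro integrable_norm fiber_integrable u i)+
  then show ?thesis unfolding partial_fourier_def norm_mult
    by (intro exI[of _ "cmod (of_real (1 / sqrt (2 * pi))) * (LINT s|lborel. C * exp (- \<delta> * s\<^sup>2))"] allI mult_left_mono) auto
qed

text \<open>The multiplication formula of Fourier analysis. The kernel \<open>exp (- i \<xi>\<^sub>k s)\<close> is symmetric in the two
  variables that \<open>swap_coord\<close> exchanges.\<close>

lemma partial_fourier_selfdual: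
  assumes u: "rapidly_decaying u" and \<phi>: "rapidly_decaying \<phi>"
  shows "(LINT \<xi>|lborel. \<phi> \<xi> * partial_fourier k u \<xi>) = (LINT a|lborel. u a * partial_fourier k \<phi> a)"
proof -
  define f where "f v w p = v (fst p) * (w (upd k (fst p) (snd p)) * exp (- \<i> * of_real (fst p $ k * snd p)))"
    for v w :: "real^'a \<Rightarrow> complex" and p :: "(real^'a) \<times> real"
  have int: "integrable (lborel \<Otimes>\<^sub>M lborel) (f v w)"
    and eq: "(LINT \<xi>|lborel. v \<xi> * partial_fourier k w \<xi>) = of_real (1 / sqrt (2 * pi)) * integral\<^sup>L (lborel \<Otimes>\<^sub>M lborel) (f v w)"
    if v: "rapidly_decaying v" and w: "rapidly_decaying w" for v w
  proof -
    obtain C \<delta> where C: "C > 0" "\<delta> > 0" "\<And>a. cmod (w a) \<le> C * exp (- \<delta> * (norm a)\<^sup>2)"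
      using rapidly_decayingE[OF w] by blast
    have [measurable]: "v \<in> borel_measurable borel" "w \<in> borel_measurable borel"
      by (rule rapidly_decaying_measurable[OF v], rule rapidly_decaying_measurable[OF w])
    have m: "f v w \<in> borel_measurable (lborel \<Otimes>\<^sub>M lborel)" unfolding f_def cart_eq_inner_axis by measurable
    show int: "integrable (lborel \<Otimes>\<^sub>M lborel) (f v w)"
    proof (rule Bochner_Integration.integrable_bound)
      show "integrable (lborel \<Otimes>\<^sub>M lborel) (\<lambda>p. cmod (v (fst p)) * (C * exp (- \<delta> * (snd p)\<^sup>2)))"
      proof -
        have e: "integrable lborel (\<lambda>y::real. C * exp (- \<delta> * y\<^sup>2))" by (intro integrable_mult_right integrable_exp_square C)
        have "integrable (lborel \<Otimes>\<^sub>M lborel) (\<lambda>(x, y). cmod (v x) * (C * exp (- \<delta> * y\<^sup>2)))"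
        proof (rule lborel_pair.Fubini_integrable)
          show "integrable lborel (\<lambda>x. LINT y|lborel. norm (case (x, y) of (x, y) \<Rightarrow> cmod (v x) * (C * exp (- \<delta> * y\<^sup>2))))"
            using rapidly_decaying_integrable[OF v] by (simp add: abs_mult)
          show "AE x in lborel. integrable lborel (\<lambda>y. case (x, y) of (x, y) \<Rightarrow> cmod (v x) * (C * exp (- \<delta> * y\<^sup>2)))"
            using e by simp
        qed measurable
        then show ?thesis by (simp add: case_prod_beta')
      qed
      have "cmod (f v w p) \<le> cmod (v (fst p)) * (C * exp (- \<delta> * (snd p)\<^sup>2))" for p
      proof -
        have "cmod (w (upd k (fst p) (snd p))) \<le> C * exp (- \<delta> * (snd p)\<^sup>2)"
          by (rule order_trans[OF C(3)]) (use C norm_upd[of "snd p" k "fst p"] in simp)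
        then show ?thesis unfolding f_def norm_mult by (simp add: norm_exp_eq_Re mult_left_mono)
      qed
      then show "AE p in lborel \<Otimes>\<^sub>M lborel. norm (f v w p) \<le> norm (cmod (v (fst p)) * (C * exp (- \<delta> * (snd p)\<^sup>2)))"
        using C by (intro AE_I2) (simp add: abs_mult)
    qed (rule m)
    have "integral\<^sup>L (lborel \<Otimes>\<^sub>M lborel) (f v w) = (LINT \<xi>|lborel. LINT s|lborel. f v w (\<xi>, s))"
      by (rule lborel_pair.integral_fst'[OF int, symmetric])
    then show "(LINT \<xi>|lborel. v \<xi> * partial_fourier k w \<xi>) = of_real (1 / sqrt (2 * pi)) * integral\<^sup>L (lborel \<Otimes>\<^sub>M lborel) (f v w)"
      unfolding partial_fourier_def f_def by (simp add: mult.left_commute)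
  qed
  have "integral\<^sup>L (lborel \<Otimes>\<^sub>M lborel) (f \<phi> u) = integral\<^sup>L (distr lborel borel (swap_coord k)) (f \<phi> u)"
    by (simp only: lborel_distr_swap_coord lborel_prod)
  also have "\<dots> = (LINT p|lborel. f \<phi> u (swap_coord k p))"
    using int[OF \<phi> u] swap_coord_measurable[of k] unfolding lborel_prod
    by (intro integral_distr) simp_all
  also have "\<dots> = (LINT p|lborel. f u \<phi> p)"
    by (simp add: f_def swap_coord_def upd_upd upd_nth mult_ac)
  finally show ?thesis unfolding eq[OF \<phi> u] eq[OF u \<phi>] lborel_prod by simp
qed

lemma partial_fourier_gauss:
  assumes \<alpha>: "\<And>i. \<alpha> i > 0"
  shows "partial_fourier k (gauss \<alpha> b) \<xi> = of_real (1 / sqrt (\<alpha> k)) * exp ((b k)\<^sup>2 / of_real (2 * \<alpha> k)) *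
    gauss (\<alpha>(k := 1 / \<alpha> k)) (b(k := - \<i> * b k / of_real (\<alpha> k))) \<xi>"
proof -
  define R where "R = (\<Prod>i\<in>UNIV - {k}. gauss1 (\<alpha> i) (b i) (\<xi> $ i))"
  have split: "gauss \<alpha>' b' a = gauss1 (\<alpha>' k) (b' k) (a $ k) * (\<Prod>i\<in>UNIV - {k}. gauss1 (\<alpha>' i) (b' i) (a $ i))" for \<alpha>' b' a
    unfolding gauss_def by (rule prod.remove) auto
  have 1: "gauss \<alpha> b (upd k \<xi> s) = gauss1 (\<alpha> k) (b k) s * R" for s
    unfolding split R_def by (simp add: upd_nth cong: prod.cong_simp)
  have 2: "gauss (\<alpha>(k := 1 / \<alpha> k)) (b(k := - \<i> * b k / of_real (\<alpha> k))) \<xi> = gauss1 (1 / \<alpha> k) (- \<i> * b k / of_real (\<alpha> k)) (\<xi> $ k) * R"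
    unfolding split R_def by (simp cong: prod.cong_simp)
  have 3: "gauss1 (\<alpha> k) (b k) s * exp (- \<i> * of_real (\<xi> $ k * s)) = gauss1 (\<alpha> k) (b k - \<i> * of_real (\<xi> $ k)) s" for s
    unfolding gauss1_def exp_add[symmetric] by (simp add: algebra_simps)
  have "(LINT s|lborel. gauss \<alpha> b (upd k \<xi> s) * exp (- \<i> * of_real (\<xi> $ k * s)))
      = (LINT s|lborel. R * gauss1 (\<alpha> k) (b k - \<i> * of_real (\<xi> $ k)) s)"
    unfolding 1 3[symmetric] by (simp add: mult_ac)
  also have "\<dots> = R * (of_real (sqrt (2 * pi / \<alpha> k)) * exp ((b k - \<i> * of_real (\<xi> $ k))\<^sup>2 / of_real (2 * \<alpha> k)))"
    by (simp add: gauss1_integral[OF \<alpha>])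
  also have "exp ((b k - \<i> * of_real (\<xi> $ k))\<^sup>2 / of_real (2 * \<alpha> k))
      = exp ((b k)\<^sup>2 / of_real (2 * \<alpha> k)) * gauss1 (1 / \<alpha> k) (- \<i> * b k / of_real (\<alpha> k)) (\<xi> $ k)"
    unfolding gauss1_def exp_add[symmetric] using \<alpha>[of k]
    by (simp add: power2_eq_square field_simps)
  finally show ?thesis
    unfolding partial_fourier_def 2 by (simp add: real_sqrt_divide real_sqrt_mult mult_ac)
qed

lemma partial_fourier_cmult: "partial_fourier k (\<lambda>a. c * u a) \<xi> = c * partial_fourier k u \<xi>"
  by (simp add: partial_fourier_def mult.assoc)

text \<open>Up to scalars the Fourier transform permutes the Gaussians, so their transforms are total as well.\<close>

lemma gauss_eq_partial_fourier:
  assumes \<alpha>: "\<And>i. \<alpha> i > 0"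
  shows "gauss \<alpha> b a = of_real (1 / sqrt (\<alpha> k)) * exp ((b k)\<^sup>2 / of_real (2 * \<alpha> k)) *
    partial_fourier k (gauss (\<alpha>(k := 1 / \<alpha> k)) (b(k := \<i> * b k / of_real (\<alpha> k)))) a"
proof -
  have p: "(\<alpha>(k := 1 / \<alpha> k)) i > 0" for i using \<alpha> by simp
  have 1: "((\<alpha>(k := 1 / \<alpha> k))(k := 1 / (\<alpha>(k := 1 / \<alpha> k)) k)) = \<alpha>" by auto
  have 2: "((b(k := \<i> * b k / of_real (\<alpha> k)))(k := - \<i> * (b(k := \<i> * b k / of_real (\<alpha> k))) k / of_real ((\<alpha>(k := 1 / \<alpha> k)) k))) = b"
    using \<alpha>[of k] by auto
  have 3: "exp ((b k)\<^sup>2 / of_real (2 * \<alpha> k)) * exp ((\<i> * b k / of_real (\<alpha> k))\<^sup>2 / of_real (2 * (1 / \<alpha> k))) = 1"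
    unfolding exp_add[symmetric] using \<alpha>[of k] by (simp add: power2_eq_square field_simps)
  have 4: "complex_of_real (1 / sqrt (\<alpha> k)) * of_real (1 / sqrt (1 / \<alpha> k)) = 1"
    using \<alpha>[of k] by (simp add: real_sqrt_divide flip: of_real_mult)
  have "of_real (1 / sqrt (\<alpha> k)) * exp ((b k)\<^sup>2 / of_real (2 * \<alpha> k)) *
      partial_fourier k (gauss (\<alpha>(k := 1 / \<alpha> k)) (b(k := \<i> * b k / of_real (\<alpha> k)))) a
    = (complex_of_real (1 / sqrt (\<alpha> k)) * of_real (1 / sqrt (1 / \<alpha> k))) *
      (exp ((b k)\<^sup>2 / of_real (2 * \<alpha> k)) * exp ((\<i> * b k / of_real (\<alpha> k))\<^sup>2 / of_real (2 * (1 / \<alpha> k)))) * gauss \<alpha> b a"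
    unfolding partial_fourier_gauss[OF p] 1 2 by (simp add: mult_ac)
  then show ?thesis unfolding 3 4 by simp
qed

lemma cnj_gauss: "cnj (gauss \<alpha> b a) = gauss \<alpha> (\<lambda>i. cnj (b i)) a"
  by (simp add: gauss_def gauss1_def exp_cnj)

text \<open>Fourier inversion, written with complex conjugation in place of the inverse transform.\<close>

lemma partial_fourier_inverse_gauss:
  assumes \<alpha>: "\<And>i. \<alpha> i > 0"
  shows "partial_fourier k (\<lambda>\<xi>. cnj (partial_fourier k (gauss \<alpha> b) \<xi>)) a = cnj (gauss \<alpha> b a)"
proof -
  have e: "(\<lambda>i. cnj ((b(k := - \<i> * b k / of_real (\<alpha> k))) i)) = (\<lambda>i. cnj (b i))(k := \<i> * cnj (b k) / of_real (\<alpha> k))"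
    by auto
  have "partial_fourier k (\<lambda>\<xi>. cnj (partial_fourier k (gauss \<alpha> b) \<xi>)) a =
    of_real (1 / sqrt (\<alpha> k)) * exp ((cnj (b k))\<^sup>2 / of_real (2 * \<alpha> k)) *
      partial_fourier k (gauss (\<alpha>(k := 1 / \<alpha> k)) ((\<lambda>i. cnj (b i))(k := \<i> * cnj (b k) / of_real (\<alpha> k)))) a"
    unfolding partial_fourier_gauss[OF \<alpha>] complex_cnj_mult cnj_gauss e partial_fourier_cmult
    by (simp add: exp_cnj)
  also have "\<dots> = gauss \<alpha> (\<lambda>i. cnj (b i)) a"
    by (rule gauss_eq_partial_fourier[OF \<alpha>, where b = "\<lambda>i. cnj (b i)", symmetric])
  finally show ?thesis by (simp add: cnj_gauss)
qed

lemma rapidly_decaying_mono: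
  assumes g: "rapidly_decaying g" and f: "continuous_on UNIV f" "\<And>a. cmod (f a) \<le> cmod (g a)"
  shows "rapidly_decaying f"
proof -
  obtain C \<delta> where C: "C > 0" "\<delta> > 0" "\<And>a. cmod (g a) \<le> C * exp (- \<delta> * (norm a)\<^sup>2)"
    using rapidly_decayingE[OF g] by blast
  show ?thesis by (rule rapidly_decayingI[OF f(1) C(2)]) (rule order_trans[OF f(2) C(3)])
qed

lemma rapidly_decaying_cmult: "rapidly_decaying f \<Longrightarrow> rapidly_decaying (\<lambda>a. c * f a)"
  by (rule rapidly_decaying_bounded_mult[of f "\<lambda>_. c" "cmod c"]) auto

lemma rapidly_decaying_partial_fourier_gauss:
  assumes \<alpha>: "\<And>i. \<alpha> i > 0"
  shows "rapidly_decaying (partial_fourier k (gauss \<alpha> b))"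
proof -
  have "(\<alpha>(k := 1 / \<alpha> k)) i > 0" for i using \<alpha> by simp
  then show ?thesis
    unfolding partial_fourier_gauss[OF \<alpha>, abs_def] by (intro rapidly_decaying_cmult rapidly_decaying_gauss)
qed

lemma rapidly_decaying_cnj: "rapidly_decaying f \<Longrightarrow> rapidly_decaying (\<lambda>a. cnj (f a))"
  by (rule rapidly_decaying_mono[of f]) (auto simp: rapidly_decaying_def intro!: continuous_intros)

lemma cinner_eq_0_all_gauss:
  assumes "\<And>\<alpha> b. (\<And>i. \<alpha> i > 0) \<Longrightarrow> cinner (l2_of (gauss \<alpha> b)) u = 0"
  shows "u = 0"
proof -
  have i: "integrable lborel (\<lambda>a. gauss \<alpha> b a * rep_l2 u a)" and "(LINT a|lborel. gauss \<alpha> b a * rep_l2 u a) = 0"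
    if p: "\<And>i. \<alpha> i > 0" for \<alpha> b
  proof -
    have e: "gauss \<alpha> b a = cnj (gauss \<alpha> (\<lambda>i. cnj (b i)) a)" for a by (simp add: cnj_gauss)
    show "integrable lborel (\<lambda>a. gauss \<alpha> b a * rep_l2 u a)"
      unfolding e by (intro integrable_cnj_mult square_integrable_gauss p square_integrable_rep_l2)
    have "(LINT a|lborel. gauss \<alpha> b a * rep_l2 u a) = cinner (l2_of (gauss \<alpha> (\<lambda>i. cnj (b i)))) (l2_of (rep_l2 u))"
      unfolding e by (rule cinner_l2_of[symmetric]) (simp_all add: square_integrable_gauss p del: l2_of_rep_l2)
    then show "(LINT a|lborel. gauss \<alpha> b a * rep_l2 u a) = 0" using assms[OF p] by simp
  qed
  then have "AE a in lborel. rep_l2 u a = 0" by (intro gauss_total) auto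
  moreover have "AE a in lborel. rep_l2 (0::'a l2) a = 0"
    using rep_l2_of[OF square_integrable_0] by (simp add: l2_of_0)
  ultimately have "AE a in lborel. rep_l2 u a = rep_l2 0 a" by eventually_elim simp
  then show ?thesis by (simp add: l2_eq_iff)
qed

text \<open>Parseval's identity for two Gaussians follows from the multiplication formula and inversion, and
  both the Gaussians and their transforms are total.\<close>

lemma partial_fourier_unitary_exists:
  fixes k :: "'n::finite"
  shows "\<exists>W. unitary_l2 W \<and> (\<forall>\<alpha> b. (\<forall>i. \<alpha> i > 0) \<longrightarrow>
    W (l2_of (gauss \<alpha> b)) = l2_of (partial_fourier k (gauss \<alpha> b)))"
proof -
  \<comment> \<open>coefficients \<open>exp (\<beta> i)\<close> instead of \<open>\<alpha> i > 0\<close>, so that the index set is a whole type\<close>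
  define g where "g = (\<lambda>(\<beta>, b). l2_of (gauss (\<lambda>i::'n. exp (\<beta> i)) b))"
  define h where "h = (\<lambda>(\<beta>, b). l2_of (partial_fourier k (gauss (\<lambda>i::'n. exp (\<beta> i)) b)))"
  have ln: "\<alpha> = (\<lambda>i. exp (ln (\<alpha> i)))" if "\<And>i. \<alpha> i > 0" for \<alpha> :: "'n \<Rightarrow> real"
    using that by auto
  have gram: "cinner (g p) (g q) = cinner (h p) (h q)" for p q
  proof -
    obtain \<beta> b \<beta>' b' where pq: "p = (\<beta>, b)" "q = (\<beta>', b')" by (cases p; cases q)
    define u v where "u = gauss (\<lambda>i. exp (\<beta> i)) b" and "v = gauss (\<lambda>i. exp (\<beta>' i)) b'"
    have uv: "rapidly_decaying u" "rapidly_decaying v" unfolding u_def v_def by (intro rapidly_decaying_gauss; simp)+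
    have r: "rapidly_decaying (partial_fourier k u)" "rapidly_decaying (partial_fourier k v)"
      unfolding u_def v_def by (intro rapidly_decaying_partial_fourier_gauss; simp)+
    have "cinner (h p) (h q) = (LINT \<xi>|lborel. cnj (partial_fourier k u \<xi>) * partial_fourier k v \<xi>)"
      unfolding h_def pq using r by (simp add: cinner_l2_of rapidly_decaying_square_integrable u_def v_def)
    also have "\<dots> = (LINT a|lborel. v a * partial_fourier k (\<lambda>\<xi>. cnj (partial_fourier k u \<xi>)) a)"
      by (intro partial_fourier_selfdual uv rapidly_decaying_cnj r)
    also have "\<dots> = (LINT a|lborel. cnj (u a) * v a)"
      unfolding u_def by (subst partial_fourier_inverse_gauss) (simp_all add: mult.commute)
    also have "\<dots> = cinner (g p) (g q)"
      unfolding g_def pq using uv by (simp add: cinner_l2_of rapidly_decaying_square_integrable u_def v_def)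
    finally show ?thesis ..
  qed
  have tg: "total_family g"
    unfolding total_family_def
  proof (intro allI impI)
    fix u assume 0: "\<forall>i. cinner (g i) u = 0"
    show "u = 0"
    proof (rule cinner_eq_0_all_gauss)
      fix \<alpha> :: "'n \<Rightarrow> real" and b :: "'n \<Rightarrow> complex" assume "\<And>i. \<alpha> i > 0"
      then show "cinner (l2_of (gauss \<alpha> b)) u = 0" using 0[rule_format, of "(\<lambda>i. ln (\<alpha> i), b)"] by (simp add: g_def)
    qed
  qed
  have th: "total_family h"
    unfolding total_family_def
  proof (intro allI impI)
    fix u assume 0: "\<forall>i. cinner (h i) u = 0"
    show "u = 0"
    proof (rule cinner_eq_0_all_gauss)
      fix \<alpha> :: "'n \<Rightarrow> real" and b :: "'n \<Rightarrow> complex" assume \<alpha>: "\<And>i. \<alpha> i > 0"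
      define \<alpha>' b' where "\<alpha>' = \<alpha>(k := 1 / \<alpha> k)" and "b' = b(k := \<i> * b k / of_real (\<alpha> k))"
      have \<alpha>': "\<alpha>' i > 0" for i using \<alpha> by (simp add: \<alpha>'_def)
      have "l2_of (gauss \<alpha> b) = (of_real (1 / sqrt (\<alpha> k)) * exp ((b k)\<^sup>2 / of_real (2 * \<alpha> k))) *\<^sub>C l2_of (partial_fourier k (gauss \<alpha>' b'))"
      proof -
        have "gauss \<alpha> b = (\<lambda>a. (of_real (1 / sqrt (\<alpha> k)) * exp ((b k)\<^sup>2 / of_real (2 * \<alpha> k))) * partial_fourier k (gauss \<alpha>' b') a)"
          unfolding \<alpha>'_def b'_def by (rule ext) (rule gauss_eq_partial_fourier[OF \<alpha>])
        then show ?thesis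
          by (simp only: l2_of_scaleC rapidly_decaying_square_integrable rapidly_decaying_partial_fourier_gauss \<alpha>')
      qed
      moreover have "cinner (l2_of (partial_fourier k (gauss \<alpha>' b'))) u = 0"
        using 0[rule_format, of "(\<lambda>i. ln (\<alpha>' i), b')"] \<alpha>' by (simp add: h_def)
      ultimately show "cinner (l2_of (gauss \<alpha> b)) u = 0" by (simp add: cinner_simps)
    qed
  qed
  obtain W where W: "unitary_l2 W" "\<And>p. W (g p) = h p" using unitary_extension[OF gram tg th] by blast
  have "W (l2_of (gauss \<alpha> b)) = l2_of (partial_fourier k (gauss \<alpha> b))" if "\<forall>i. \<alpha> i > 0" for \<alpha> b
    using W(2)[of "(\<lambda>i. ln (\<alpha> i), b)"] that by (simp add: g_def h_def)
  then show ?thesis using W(1) by blast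
qed

definition fourier_l2 :: "'n::finite \<Rightarrow> 'n l2 \<Rightarrow> 'n l2" where
  "fourier_l2 k = (SOME W. unitary_l2 W \<and> (\<forall>\<alpha> b. (\<forall>i. \<alpha> i > 0) \<longrightarrow>
    W (l2_of (gauss \<alpha> b)) = l2_of (partial_fourier k (gauss \<alpha> b))))"

lemma unitary_fourier_l2: "unitary_l2 (fourier_l2 k)"
  and fourier_l2_gauss: "(\<And>i. \<alpha> i > 0) \<Longrightarrow> fourier_l2 k (l2_of (gauss \<alpha> b)) = l2_of (partial_fourier k (gauss \<alpha> b))"
  using someI_ex[OF partial_fourier_unitary_exists[of k]] unfolding fourier_l2_def[symmetric] by auto

lemma bounded_mult_gauss_integrable:
  assumes "\<And>i. \<alpha> i > 0" "f \<in> borel_measurable borel" "\<And>a. cmod (f a) \<le> B"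
  shows "integrable lborel (\<lambda>a. gauss \<alpha> b a * f a)"
proof (rule Bochner_Integration.integrable_bound)
  show "integrable lborel (\<lambda>a. of_real B * gauss \<alpha> b a)"
    by (intro integrable_mult_right gauss_integral assms)
  have "cmod (f a) \<le> \<bar>B\<bar>" for a using assms(3)[of a] by linarith
  then show "AE a in lborel. cmod (gauss \<alpha> b a * f a) \<le> cmod (of_real B * gauss \<alpha> b a)"
    by (intro AE_I2) (simp add: norm_mult mult.commute mult_right_mono)
qed (use assms(2) in measurable)

text \<open>Both sides have the same integral against every Gaussian: on the left by unitarity, on the right by
  the multiplication formula.\<close>

lemma fourier_l2_rapidly_decaying:
  assumes u: "rapidly_decaying u"
  shows "AE \<xi> in lborel. rep_l2 (fourier_l2 k (l2_of u)) \<xi> = partial_fourier k u \<xi>"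
proof -
  note Ws = unitary_l2_simps(1-9)[OF unitary_fourier_l2[of k]]
  have su: "square_integrable u" by (rule rapidly_decaying_square_integrable[OF u])
  define V where "V = rep_l2 (fourier_l2 k (l2_of u))"
  have V: "square_integrable V" and lV: "l2_of V = fourier_l2 k (l2_of u)" by (simp_all add: V_def)
  obtain B where B: "\<And>\<xi>. cmod (partial_fourier k u \<xi>) \<le> B" using partial_fourier_bounded[OF u] by blast
  have m: "partial_fourier k u \<in> borel_measurable borel" by (rule partial_fourier_measurable[OF u])
  have [measurable]: "V \<in> borel_measurable borel" "partial_fourier k u \<in> borel_measurable borel"
    using m by (simp_all add: V_def)
  have "AE \<xi> in lborel. V \<xi> - partial_fourier k u \<xi> = 0"
  proof (rule gauss_total)
    show "(\<lambda>\<xi>. V \<xi> - partial_fourier k u \<xi>) \<in> borel_measurable borel" by measurable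
    fix \<alpha> :: "'a \<Rightarrow> real" and b :: "'a \<Rightarrow> complex" assume \<alpha>: "\<And>i. \<alpha> i > 0"
    define c where "c = (\<lambda>i. cnj (b i))"
    define \<alpha>' b' where "\<alpha>' = \<alpha>(k := 1 / \<alpha> k)" and "b' = c(k := \<i> * c k / of_real (\<alpha> k))"
    define C where "C = complex_of_real (1 / sqrt (\<alpha> k)) * exp ((c k)\<^sup>2 / of_real (2 * \<alpha> k))"
    have \<alpha>': "\<alpha>' i > 0" for i using \<alpha> by (simp add: \<alpha>'_def)
    have gc: "gauss \<alpha> c = (\<lambda>a. C * partial_fourier k (gauss \<alpha>' b') a)"
      unfolding C_def \<alpha>'_def b'_def by (rule ext) (rule gauss_eq_partial_fourier[OF \<alpha>])
    have gb: "gauss \<alpha> b a = cnj (gauss \<alpha> c a)" for a by (simp add: cnj_gauss c_def)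
    have i1: "integrable lborel (\<lambda>a. gauss \<alpha> b a * V a)"
      unfolding gb by (intro integrable_cnj_mult square_integrable_gauss \<alpha> V)
    have i2: "integrable lborel (\<lambda>a. gauss \<alpha> b a * partial_fourier k u a)"
      by (rule bounded_mult_gauss_integrable[OF \<alpha> m B])
    show "integrable lborel (\<lambda>a. gauss \<alpha> b a * (V a - partial_fourier k u a))"
      using i1 i2 by (simp add: right_diff_distrib)
    have "(LINT a|lborel. gauss \<alpha> b a * V a) = cinner (l2_of (gauss \<alpha> c)) (fourier_l2 k (l2_of u))"
      unfolding gb lV[symmetric] by (rule cinner_l2_of[symmetric]) (intro square_integrable_gauss \<alpha> V)+
    also have "l2_of (gauss \<alpha> c) = C *\<^sub>C fourier_l2 k (l2_of (gauss \<alpha>' b'))"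
      unfolding gc fourier_l2_gauss[OF \<alpha>']
      by (intro l2_of_scaleC[symmetric] rapidly_decaying_square_integrable rapidly_decaying_partial_fourier_gauss \<alpha>')
    also have "cinner (C *\<^sub>C fourier_l2 k (l2_of (gauss \<alpha>' b'))) (fourier_l2 k (l2_of u)) = cnj C * cinner (l2_of (gauss \<alpha>' b')) (l2_of u)"
      by (simp only: cinner_simps Ws)
    also have "\<dots> = cnj C * (LINT a|lborel. cnj (gauss \<alpha>' b' a) * u a)"
      by (simp add: cinner_l2_of square_integrable_gauss \<alpha>' su)
    also have "\<dots> = (LINT a|lborel. u a * partial_fourier k (gauss \<alpha> b) a)"
    proof -
      have "partial_fourier k (gauss \<alpha> b) a = cnj C * cnj (gauss \<alpha>' b' a)" for a
      proof -
        have "gauss \<alpha> b = (\<lambda>a. cnj C * cnj (partial_fourier k (gauss \<alpha>' b') a))"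
          by (rule ext) (simp add: gb gc)
        then show ?thesis by (simp only: partial_fourier_cmult partial_fourier_inverse_gauss[OF \<alpha>'])
      qed
      then show ?thesis by (simp add: mult_ac flip: integral_mult_right_zero)
    qed
    also have "\<dots> = (LINT a|lborel. gauss \<alpha> b a * partial_fourier k u a)"
      by (intro partial_fourier_selfdual[symmetric] u rapidly_decaying_gauss \<alpha>)
    finally show "(LINT a|lborel. gauss \<alpha> b a * (V a - partial_fourier k u a)) = 0"
      using i1 i2 by (simp add: right_diff_distrib)
  qed
  then show ?thesis unfolding V_def by eventually_elim simp
qed

lemma square_integrable_partial_fourier:
  assumes u: "rapidly_decaying u"
  shows "square_integrable (partial_fourier k u)" "fourier_l2 k (l2_of u) = l2_of (partial_fourier k u)"
proof -
  show s: "square_integrable (partial_fourier k u)"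
    using fourier_l2_rapidly_decaying[OF u, of k]
    by (intro square_integrable_mono[OF partial_fourier_measurable[OF u] square_integrable_rep_l2[of "fourier_l2 k (l2_of u)"]])
      (auto elim!: eventually_mono)
  show "fourier_l2 k (l2_of u) = l2_of (partial_fourier k u)"
    unfolding l2_eq_iff using fourier_l2_rapidly_decaying[OF u, of k] rep_l2_of[OF s]
    by eventually_elim simp
qed

lemma tendsto_rapidly_decaying_fiber:
  assumes u: "rapidly_decaying u" and F: "filterlim (\<lambda>s::real. s\<^sup>2) at_top F"
  shows "((\<lambda>s. u (upd k \<xi> s) * exp (- \<i> * of_real (\<xi> $ k * s))) \<longlongrightarrow> 0) F"
proof -
  obtain C \<delta> where C: "C > 0" "\<delta> > 0" "\<And>a. cmod (u a) \<le> C * exp (- \<delta> * (norm a)\<^sup>2)"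
    using rapidly_decayingE[OF u] by blast
  show ?thesis
  proof (rule Lim_null_comparison)
    have "cmod (u (upd k \<xi> s)) \<le> C * exp (- (\<delta> * s\<^sup>2))" for s
      by (rule order_trans[OF C(3)]) (use C norm_upd[of s k \<xi>] in simp)
    then show "\<forall>\<^sub>F s in F. norm (u (upd k \<xi> s) * exp (- \<i> * of_real (\<xi> $ k * s))) \<le> C * exp (- (\<delta> * s\<^sup>2))"
      by (intro always_eventually allI) (simp add: norm_mult norm_exp_eq_Re)
    have "filterlim (\<lambda>s. \<delta> * s\<^sup>2) at_top F"
      by (rule filterlim_tendsto_pos_mult_at_top[OF tendsto_const C(2) F])
    then have "((\<lambda>s. exp (- (\<delta> * s\<^sup>2))) \<longlongrightarrow> 0) F"
      by (rule filterlim_compose[OF exp_at_bot filterlim_compose[OF filterlim_uminus_at_bot_at_top]])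
    then show "((\<lambda>s. C * exp (- (\<delta> * s\<^sup>2))) \<longlongrightarrow> 0) F" by (rule tendsto_mult_right_zero)
  qed
qed

text \<open>Integration by parts along the \<open>k\<close>-th direction.\<close>

lemma partial_fourier_derivative:
  assumes u: "rapidly_decaying u" and u': "rapidly_decaying u'"
    and D: "\<And>a. ((\<lambda>t. u (a + t *\<^sub>R axis k 1)) has_vector_derivative u' a) (at 0)"
  shows "partial_fourier k u' \<xi> = \<i> * of_real (\<xi> $ k) * partial_fourier k u \<xi>"
proof -
  define e where "e s = exp (- \<i> * of_real (\<xi> $ k * s))" for s
  define f where "f s = u (upd k \<xi> s) * (- \<i> * of_real (\<xi> $ k) * e s) + u' (upd k \<xi> s) * e s" for s
  have De: "(e has_vector_derivative (- \<i> * of_real (\<xi> $ k) * e s)) (at s)" for s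
  proof -
    define c where "c = - \<i> * of_real (\<xi> $ k)"
    have "((\<lambda>z. exp (c * z)) has_field_derivative c * exp (c * of_real s)) (at (of_real s))"
      by (auto intro!: derivative_eq_intros)
    from has_vector_derivative_real_field[OF this]
    show ?thesis by (simp add: e_def[abs_def] c_def mult.assoc)
  qed
  have Du: "((\<lambda>s. u (upd k \<xi> s)) has_vector_derivative u' (upd k \<xi> s)) (at s)" for s
  proof -
    have "((\<lambda>r. r - s) has_vector_derivative 1) (at s)" by (auto intro!: derivative_eq_intros)
    moreover have "((\<lambda>t. u (upd k \<xi> s + t *\<^sub>R axis k 1)) has_vector_derivative u' (upd k \<xi> s)) (at (s - s))"
      using D[of "upd k \<xi> s"] by simp
    ultimately have "((\<lambda>t. u (upd k \<xi> s + t *\<^sub>R axis k 1)) \<circ> (\<lambda>r. r - s) has_vector_derivative 1 *\<^sub>R u' (upd k \<xi> s)) (at s)"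
      by (rule vector_diff_chain_at)
    moreover have "(\<lambda>t. u (upd k \<xi> s + t *\<^sub>R axis k 1)) \<circ> (\<lambda>r. r - s) = (\<lambda>r. u (upd k \<xi> r))"
      by (rule ext) (simp add: upd_def algebra_simps)
    ultimately show ?thesis by simp
  qed
  have DF: "((\<lambda>s. u (upd k \<xi> s) * e s) has_vector_derivative f s) (at s)" for s
    unfolding f_def by (rule has_vector_derivative_mult[OF Du De])
  have cu: "continuous_on UNIV u" "continuous_on UNIV u'" using u u' by (auto simp: rapidly_decaying_def)
  have cupd: "continuous_on UNIV (upd k \<xi>)" unfolding upd_def[abs_def] by (intro continuous_intros)
  have cc: "isCont (\<lambda>s. v (upd k \<xi> s)) s" if "continuous_on UNIV v" for v :: "real^'a \<Rightarrow> complex" and s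
    using continuous_on_compose2[OF that cupd] by (simp add: continuous_on_eq_continuous_at)
  have ce: "isCont e s" for s unfolding e_def by (intro continuous_intros)
  have contf: "isCont f s" for s
    unfolding f_def by (intro continuous_intros cc cu ce)
  have iu: "integrable lborel (\<lambda>s. u (upd k \<xi> s) * e s)" and iu': "integrable lborel (\<lambda>s. u' (upd k \<xi> s) * e s)"
    unfolding e_def by (rule fiber_integrable[OF u], rule fiber_integrable[OF u'])
  have fe: "f = (\<lambda>s. - \<i> * of_real (\<xi> $ k) * (u (upd k \<xi> s) * e s) + u' (upd k \<xi> s) * e s)"
    by (rule ext) (simp add: f_def)
  have intf: "integrable lborel f"
    unfolding fe by (intro Bochner_Integration.integrable_add integrable_mult_right iu iu')
  have lt: "((\<lambda>s. u (upd k \<xi> s) * e s) \<longlongrightarrow> 0) at_top" "((\<lambda>s. u (upd k \<xi> s) * e s) \<longlongrightarrow> 0) at_bot"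
    unfolding e_def
    by (intro tendsto_rapidly_decaying_fiber u filterlim_pow_at_top filterlim_ident; simp)
      (intro tendsto_rapidly_decaying_fiber u filterlim_pow_at_bot_even filterlim_ident; simp)
  have "(LBINT s=-\<infinity>..\<infinity>. f s) = 0 - 0"
  proof (rule interval_integral_FTC_integrable[where F = "\<lambda>s. u (upd k \<xi> s) * e s"])
    show "((\<lambda>s. u (upd k \<xi> s) * e s) has_vector_derivative f x) (at x)" for x by (rule DF)
    show "set_integrable lborel (einterval (-\<infinity>) \<infinity>) f" using intf by (simp add: set_integrable_def)
    show "(((\<lambda>s. u (upd k \<xi> s) * e s) \<circ> real_of_ereal) \<longlongrightarrow> 0) (at_right (-\<infinity>))"
      using lt(2) by (simp add: ereal_tendsto_simps)
    show "(((\<lambda>s. u (upd k \<xi> s) * e s) \<circ> real_of_ereal) \<longlongrightarrow> 0) (at_left \<infinity>)"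
      using lt(1) by (simp add: ereal_tendsto_simps)
  qed (use contf in auto)
  then have "(LINT s|lborel. f s) = 0"
    by (simp add: interval_lebesgue_integral_def set_lebesgue_integral_def)
  then have "- \<i> * of_real (\<xi> $ k) * (LINT s|lborel. u (upd k \<xi> s) * e s) + (LINT s|lborel. u' (upd k \<xi> s) * e s) = 0"
    unfolding fe using iu iu' by (subst (asm) Bochner_Integration.integral_add) auto
  then have "(LINT s|lborel. u' (upd k \<xi> s) * e s) = \<i> * of_real (\<xi> $ k) * (LINT s|lborel. u (upd k \<xi> s) * e s)"
    by (simp add: eq_neg_iff_add_eq_0 add.commute)
  then show ?thesis unfolding partial_fourier_def e_def by simp
qed

section \<open>The operators of a seed in the Fourier picture\<close>

lemma rapidly_decaying_coord:
  fixes f :: "real^'n::finite \<Rightarrow> complex"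
  assumes f: "rapidly_decaying f"
  shows "rapidly_decaying (\<lambda>a. of_real (a $ i) * f a)"
proof -
  obtain C \<delta> where C: "C > 0" "\<delta> > 0" "\<And>a. cmod (f a) \<le> C * exp (- \<delta> * (norm a)\<^sup>2)"
    using rapidly_decayingE[OF f] by blast
  show ?thesis
  proof (rule rapidly_decayingI[where \<delta> = "\<delta> / 2"])
    show "continuous_on UNIV (\<lambda>a. of_real (a $ i) * f a)"
      using f by (auto simp: rapidly_decaying_def intro!: continuous_intros)
    show "\<delta> / 2 > 0" using C by simp
    fix a :: "real^'n"
    have "\<bar>a $ i\<bar> \<le> norm a" by (rule component_le_norm_cart)
    also have "norm a \<le> 1 + (norm a)\<^sup>2"
    proof -
      have "0 \<le> (norm a - 1)\<^sup>2" by simp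
      moreover have "(norm a - 1)\<^sup>2 = (norm a)\<^sup>2 - 2 * norm a + 1" by (simp add: power2_eq_square algebra_simps)
      ultimately show ?thesis using norm_ge_zero[of a] by linarith
    qed
    also have "\<dots> \<le> (1 + 2 / \<delta>) * (1 + \<delta> / 2 * (norm a)\<^sup>2)"
      using C(2) by (simp add: field_simps)
    also have "\<dots> \<le> (1 + 2 / \<delta>) * exp (\<delta> / 2 * (norm a)\<^sup>2)"
      using C(2) by (intro mult_left_mono exp_ge_add_one_self) auto
    finally have "\<bar>a $ i\<bar> * cmod (f a) \<le> ((1 + 2 / \<delta>) * exp (\<delta> / 2 * (norm a)\<^sup>2)) * (C * exp (- \<delta> * (norm a)\<^sup>2))"
      using C by (intro mult_mono) auto
    also have "\<dots> = ((1 + 2 / \<delta>) * C) * (exp (\<delta> / 2 * (norm a)\<^sup>2) * exp (- \<delta> * (norm a)\<^sup>2))"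
      by (simp add: mult_ac)
    also have "exp (\<delta> / 2 * (norm a)\<^sup>2) * exp (- \<delta> * (norm a)\<^sup>2) = exp (- (\<delta> / 2) * (norm a)\<^sup>2)"
      unfolding exp_add[symmetric] by (simp add: algebra_simps)
    finally show "cmod (of_real (a $ i) * f a) \<le> ((1 + 2 / \<delta>) * C) * exp (- (\<delta> / 2) * (norm a)\<^sup>2)"
      by (simp add: norm_mult)
  qed
qed

definition decaying_derivative :: "'n::finite \<Rightarrow> (real^'n \<Rightarrow> complex) \<Rightarrow> (real^'n \<Rightarrow> complex) \<Rightarrow> bool" where
  "decaying_derivative k f f' \<longleftrightarrow> rapidly_decaying f \<and> rapidly_decaying f' \<and>
     (\<forall>a. ((\<lambda>t. f (a + t *\<^sub>R axis k 1)) has_vector_derivative f' a) (at 0))"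

lemma decaying_derivative_0: "decaying_derivative k (\<lambda>a. 0) (\<lambda>a. 0)"
  using rapidly_decaying_cmult[OF rapidly_decaying_gauss[of "\<lambda>_. 1" "\<lambda>_. 0"], of 0]
  by (simp add: decaying_derivative_def)

lemma decaying_derivative_add:
  "decaying_derivative k f f' \<Longrightarrow> decaying_derivative k g g' \<Longrightarrow> decaying_derivative k (\<lambda>a. f a + g a) (\<lambda>a. f' a + g' a)"
  unfolding decaying_derivative_def by (auto intro!: rapidly_decaying_add has_vector_derivative_add)

lemma decaying_derivative_cmult:
  "decaying_derivative k f f' \<Longrightarrow> decaying_derivative k (\<lambda>a. c * f a) (\<lambda>a. c * f' a)"
  unfolding decaying_derivative_def by (auto intro!: rapidly_decaying_cmult has_vector_derivative_mult_right)

lemma decaying_derivative_sum: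
  assumes "finite I" "\<And>i. i \<in> I \<Longrightarrow> \<exists>f'. decaying_derivative k (f i) f'"
  shows "\<exists>f'. decaying_derivative k (\<lambda>a. \<Sum>i\<in>I. f i a) f'"
  using assms
proof (induction I rule: finite_induct)
  case empty
  then show ?case using decaying_derivative_0 by auto
next
  case (insert i I)
  then obtain g g' where "decaying_derivative k (f i) g" "decaying_derivative k (\<lambda>a. \<Sum>i\<in>I. f i a) g'" by blast
  from decaying_derivative_add[OF this] insert(1,2) show ?case by auto
qed

lemma decaying_derivative_coord:
  assumes f: "decaying_derivative k f f'"
  shows "decaying_derivative k (\<lambda>a. of_real (a $ i) * f a) (\<lambda>a. of_real (a $ i) * f' a + (if i = k then 1 else 0) * f a)"
  unfolding decaying_derivative_def
proof (intro conjI allI)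
  show "rapidly_decaying (\<lambda>a. of_real (a $ i) * f a)"
    "rapidly_decaying (\<lambda>a. of_real (a $ i) * f' a + (if i = k then 1 else 0) * f a)"
    using f unfolding decaying_derivative_def
    by (auto intro!: rapidly_decaying_coord rapidly_decaying_add rapidly_decaying_cmult)
  fix a
  have 1: "((\<lambda>t. complex_of_real ((a + t *\<^sub>R axis k 1) $ i)) has_vector_derivative (if i = k then 1 else 0)) (at 0)"
  proof (cases "i = k")
    case True
    have "((\<lambda>t. complex_of_real (a $ i + t)) has_vector_derivative of_real 1) (at 0)"
      by (intro has_vector_derivative_of_real) (auto intro!: derivative_eq_intros simp flip: has_real_derivative_iff_has_vector_derivative)
    then show ?thesis using True by (simp add: axis_def)
  qed (simp add: axis_def)
  have 2: "((\<lambda>t. f (a + t *\<^sub>R axis k 1)) has_vector_derivative f' a) (at 0)"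
    using f by (simp add: decaying_derivative_def)
  from has_vector_derivative_mult[OF 1 2]
  show "((\<lambda>t. of_real ((a + t *\<^sub>R axis k 1) $ i) * f (a + t *\<^sub>R axis k 1)) has_vector_derivative
      of_real (a $ i) * f' a + (if i = k then 1 else 0) * f a) (at 0)"
    by simp
qed

lemma decaying_derivative_monomial:
  assumes "finite I" "\<exists>f'. decaying_derivative k f f'"
  shows "\<exists>f'. decaying_derivative k (\<lambda>a. (\<Prod>i\<in>I. of_real (a $ i) ^ m i) * f a) f'"
  using assms(1)
proof (induction I rule: finite_induct)
  case empty
  then show ?case using assms(2) by simp
next
  case (insert i I)
  have "\<exists>f'. decaying_derivative k (\<lambda>a. of_real (a $ i) ^ r * ((\<Prod>i\<in>I. of_real (a $ i) ^ m i) * f a)) f'" for r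
  proof (induction r)
    case 0
    then show ?case using insert by simp
  next
    case (Suc r)
    then obtain f' where "decaying_derivative k (\<lambda>a. of_real (a $ i) ^ r * ((\<Prod>i\<in>I. of_real (a $ i) ^ m i) * f a)) f'" by blast
    from decaying_derivative_coord[OF this, of i] show ?case by (auto simp: mult.assoc)
  qed
  from this[of "m i"] insert(1,2) show ?case by (simp add: mult.assoc)
qed

lemma decaying_derivative_exp:
  fixes \<alpha> \<beta> :: "'n::finite \<Rightarrow> complex"
  assumes \<alpha>: "\<And>i. Re (\<alpha> i) > 0"
  shows "\<exists>f'. decaying_derivative k (\<lambda>a. exp (- (\<Sum>i\<in>UNIV. \<alpha> i * (of_real (a $ i))\<^sup>2 + \<beta> i * of_real (a $ i)))) f'"
proof -
  define f where "f a = exp (- (\<Sum>i\<in>UNIV. \<alpha> i * (of_real (a $ i))\<^sup>2 + \<beta> i * of_real (a $ i)))" for a :: "real^'n"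
  have rf: "rapidly_decaying f"
  proof (rule rapidly_decaying_mono)
    show "rapidly_decaying (gauss (\<lambda>i. 2 * Re (\<alpha> i)) (\<lambda>i. - of_real (Re (\<beta> i))))"
      using \<alpha> by (intro rapidly_decaying_gauss) simp
    show "continuous_on UNIV f" unfolding f_def by (intro continuous_intros)
    fix a :: "real^'n"
    have "Re (\<alpha> i * (of_real x)\<^sup>2 + \<beta> i * of_real x) = Re (\<alpha> i) * x\<^sup>2 + Re (\<beta> i) * x" for i x
      by (simp add: power2_eq_square flip: of_real_mult)
    then have "cmod (f a) = exp (\<Sum>i\<in>UNIV. - (Re (\<alpha> i) * (a $ i)\<^sup>2 + Re (\<beta> i) * a $ i))"
      unfolding f_def norm_exp_eq_Re by (simp add: sum_negf[symmetric])
    also have "\<dots> = cmod (gauss (\<lambda>i. 2 * Re (\<alpha> i)) (\<lambda>i. - of_real (Re (\<beta> i))) a)"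
    proof -
      have "gauss (\<lambda>i. 2 * Re (\<alpha> i)) (\<lambda>i. - of_real (Re (\<beta> i))) a = of_real (exp (\<Sum>i\<in>UNIV. - (Re (\<alpha> i) * (a $ i)\<^sup>2 + Re (\<beta> i) * a $ i)))"
        by (simp add: gauss_def gauss1_def exp_sum exp_of_real[symmetric])
      then show ?thesis by simp
    qed
    finally show "cmod (f a) \<le> cmod (gauss (\<lambda>i. 2 * Re (\<alpha> i)) (\<lambda>i. - of_real (Re (\<beta> i))) a)" by simp
  qed
  define f' where "f' a = - 2 * \<alpha> k * (of_real (a $ k) * f a) + (- \<beta> k) * f a" for a
  have "decaying_derivative k f f'"
    unfolding decaying_derivative_def
  proof (intro conjI allI rf)
    show "rapidly_decaying f'"
      unfolding f'_def by (intro rapidly_decaying_add rapidly_decaying_cmult rapidly_decaying_coord rf)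
    fix a
    define h where "h i x = \<alpha> i * (of_real x)\<^sup>2 + \<beta> i * of_real x" for i and x :: real
    define R where "R = (\<Sum>i\<in>UNIV - {k}. h i (a $ i))"
    have s: "(\<Sum>i\<in>UNIV. h i (b $ i)) = h k (b $ k) + (\<Sum>i\<in>UNIV - {k}. h i (b $ i))" for b
      by (rule sum.remove) auto
    have e: "f (a + t *\<^sub>R axis k 1) = exp (- (h k (a $ k + t) + R))" for t
    proof -
      have "(\<Sum>i\<in>UNIV - {k}. h i ((a + t *\<^sub>R axis k 1) $ i)) = R"
        unfolding R_def by (rule sum.cong) (auto simp: axis_def)
      then show ?thesis unfolding f_def h_def[symmetric] s by (simp add: axis_def)
    qed
    have "((\<lambda>z. exp (- (\<alpha> k * (of_real (a $ k) + z)\<^sup>2 + \<beta> k * (of_real (a $ k) + z) + R))) has_field_derivative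
        exp (- (\<alpha> k * (of_real (a $ k) + of_real 0)\<^sup>2 + \<beta> k * (of_real (a $ k) + of_real 0) + R)) * (- (2 * \<alpha> k * of_real (a $ k) + \<beta> k))) (at (of_real 0))"
      by (auto intro!: derivative_eq_intros)
    from has_vector_derivative_real_field[OF this]
    have "((\<lambda>t. exp (- (h k (a $ k + t) + R))) has_vector_derivative exp (- (h k (a $ k + 0) + R)) * (- (2 * \<alpha> k * of_real (a $ k) + \<beta> k))) (at 0)"
      by (simp add: h_def)
    moreover have "exp (- (h k (a $ k + 0) + R)) = f a" using e[of 0] by simp
    ultimately show "((\<lambda>t. f (a + t *\<^sub>R axis k 1)) has_vector_derivative f' a) (at 0)"
      unfolding e f'_def by (simp add: algebra_simps)
  qed
  then show ?thesis unfolding f_def by blast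
qed

lemma gaussian_space_derivative:
  fixes f :: "real^'n::finite \<Rightarrow> complex"
  assumes "f \<in> gaussian_space"
  shows "\<exists>f'. decaying_derivative k f f'"
proof -
  have g: "\<exists>f'. decaying_derivative k g f'" if gf: "gaussian_fun g" for g :: "real^'n \<Rightarrow> complex"
  proof -
    obtain \<alpha> \<beta> P where \<alpha>: "\<And>i. Re (\<alpha> i) > 0" and P: "complex_polynomial_fun P"
      and g: "g = (\<lambda>a. exp (- (\<Sum>i\<in>UNIV. \<alpha> i * (of_real (a $ i))\<^sup>2 + \<beta> i * of_real (a $ i))) * P a)"
      using gf unfolding gaussian_fun_def by blast
    obtain M :: "('n \<Rightarrow> nat) set" and c where M: "finite M"
      and P: "P = (\<lambda>a. \<Sum>m\<in>M. c m * (\<Prod>i\<in>UNIV. complex_of_real (a $ i) ^ m i))"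
      using P unfolding complex_polynomial_fun_def by blast
    define e where "e a = exp (- (\<Sum>i\<in>UNIV. \<alpha> i * (of_real (a $ i))\<^sup>2 + \<beta> i * of_real (a $ i)))" for a :: "real^'n"
    have ex: "\<exists>f'. decaying_derivative k e f'" unfolding e_def by (rule decaying_derivative_exp[OF \<alpha>])
    have "\<exists>f'. decaying_derivative k (\<lambda>a. c m * ((\<Prod>i\<in>UNIV. complex_of_real (a $ i) ^ m i) * e a)) f'" for m
    proof -
      obtain h where "decaying_derivative k (\<lambda>a. (\<Prod>i\<in>UNIV. complex_of_real (a $ i) ^ m i) * e a) h"
        using decaying_derivative_monomial[OF finite ex] by blast
      from decaying_derivative_cmult[OF this] show ?thesis by blast
    qed
    then have "\<exists>f'. decaying_derivative k (\<lambda>a. \<Sum>m\<in>M. c m * ((\<Prod>i\<in>UNIV. complex_of_real (a $ i) ^ m i) * e a)) f'"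
      by (rule decaying_derivative_sum[OF M])
    moreover have "g = (\<lambda>a. \<Sum>m\<in>M. c m * ((\<Prod>i\<in>UNIV. complex_of_real (a $ i) ^ m i) * e a))"
      unfolding g P e_def[symmetric] by (rule ext) (simp add: sum_distrib_left mult_ac)
    ultimately show ?thesis by simp
  qed
  obtain N :: nat and c g' where *: "\<forall>i<N. gaussian_fun (g' i)" and f: "f = (\<lambda>a. \<Sum>i<N. c i * g' i a)"
    using assms unfolding gaussian_space_def by blast
  have "\<exists>f'. decaying_derivative k (\<lambda>a. c i * g' i a) f'" if "i \<in> {..<N}" for i
  proof -
    have "gaussian_fun (g' i)" using * that by simp
    from g[OF this] obtain h where "decaying_derivative k (g' i) h" by blast
    from decaying_derivative_cmult[OF this] show ?thesis by blast
  qed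
  then show ?thesis unfolding f by (rule decaying_derivative_sum[OF finite_lessThan])
qed

lemma gauss_in_gaussian_space:
  assumes "\<And>i. \<alpha> i > 0"
  shows "gauss \<alpha> b \<in> gaussian_space"
proof -
  have "complex_polynomial_fun (\<lambda>_::real^'a. 1)"
    unfolding complex_polynomial_fun_def by (rule exI[of _ "{\<lambda>_. 0}"], rule exI[of _ "\<lambda>_. 1"]) simp
  moreover have "gauss \<alpha> b = (\<lambda>a. exp (- (\<Sum>i\<in>UNIV. of_real (\<alpha> i / 2) * (of_real (a $ i))\<^sup>2 + (- b i) * of_real (a $ i))) * 1)"
    by (rule ext) (simp add: gauss_def gauss1_def exp_sum[symmetric] sum_negf[symmetric] del: exp_sum)
  moreover have "Re (of_real (\<alpha> i / 2)) > 0" for i using assms by simp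
  ultimately have "gaussian_fun (gauss \<alpha> b)"
    unfolding gaussian_fun_def by (intro exI[of _ "\<lambda>i. of_real (\<alpha> i / 2)"] exI[of _ "\<lambda>i. - b i"] exI[of _ "\<lambda>_. 1"]) auto
  then show ?thesis
    unfolding gaussian_space_def by (intro CollectI exI[of _ 1] exI[of _ "\<lambda>_. 1"] exI[of _ "\<lambda>_. gauss \<alpha> b"]) auto
qed

text \<open>The linear form \<open>\<ell>\<close> that enters the two operators of a seed with opposite signs. Since \<open>\<epsilon>\<^sub>k\<^sub>k = 0\<close>, it is constant
  along the \<open>k\<close>-th direction.\<close>

definition row :: "'n::finite seed \<Rightarrow> 'n \<Rightarrow> real^'n \<Rightarrow> real" where
  "row \<Gamma> k a = (\<Sum>j\<in>UNIV. of_int (exch \<Gamma> k j) * a $ j)"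

lemma row_add: "row \<Gamma> k (a + b) = row \<Gamma> k a + row \<Gamma> k b"
  and row_scaleR: "row \<Gamma> k (r *\<^sub>R a) = r * row \<Gamma> k a"
  and row_axis: "row \<Gamma> k (axis i 1) = of_int (exch \<Gamma> k i)"
  by (simp_all add: row_def ring_distribs sum.distrib sum_distrib_left mult_ac axis_def if_distrib cong: if_cong)

lemma continuous_row: "continuous_on S (row \<Gamma> k)"
  unfolding row_def by (intro continuous_intros)

lemma row_measurable [measurable]: "row \<Gamma> k \<in> borel_measurable borel"
  by (intro borel_measurable_continuous_onI continuous_row)

lemma row_upd: "exch \<Gamma> k k = 0 \<Longrightarrow> row \<Gamma> k (upd k a s) = row \<Gamma> k a"
  by (simp add: upd_def row_add row_scaleR row_axis)

lemma D_seed_diag: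
  assumes "D_seed \<Gamma>"
  shows "exch \<Gamma> k k = 0" "symm \<Gamma> k > 0"
proof -
  have "exch \<Gamma> k k * symm \<Gamma> k = - (exch \<Gamma> k k * symm \<Gamma> k)" "symm \<Gamma> k > 0"
    using assms unfolding D_seed_iff by blast+
  then show "exch \<Gamma> k k = 0" "symm \<Gamma> k > 0" by auto
qed

text \<open>The Fourier multiplier of \<open>d\<^sub>k\<^sup>-\<^sup>1 p\<^sub>k / 2 + \<sigma> \<Sum>\<^sub>j \<epsilon>\<^sub>k\<^sub>j q\<^sub>j\<close> when \<open>\<kappa> = \<pi>\<hbar>\<^sub>k\<close>: the derivative
  \<open>p\<^sub>k = 2\<pi>i\<hbar> \<partial>\<^sub>k\<close> turns into multiplication by \<open>- 2\<pi>\<hbar> \<xi>\<^sub>k\<close>.\<close>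

definition symbol :: "real \<Rightarrow> real \<Rightarrow> 'n::finite seed \<Rightarrow> 'n \<Rightarrow> real^'n \<Rightarrow> real" where
  "symbol \<sigma> \<kappa> \<Gamma> k \<xi> = - \<kappa> * \<xi> $ k + \<sigma> * row \<Gamma> k \<xi>"

lemma symbol_measurable [measurable]: "symbol \<sigma> \<kappa> \<Gamma> k \<in> borel_measurable borel"
  unfolding symbol_def[abs_def] cart_eq_inner_axis by measurable

lemma diagonalized_symbol: "diagonalized (fourier_l2 k) (symbol \<sigma> \<kappa> \<Gamma> k)"
  by unfold_locales (simp_all add: unitary_fourier_l2)

lemma rapidly_decaying_row: "rapidly_decaying f \<Longrightarrow> rapidly_decaying (\<lambda>a. of_real (row \<Gamma> k a) * f a)"
proof -
  assume f: "rapidly_decaying f"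
  have z: "rapidly_decaying (\<lambda>a. 0 :: complex)" using decaying_derivative_0 by (simp add: decaying_derivative_def)
  have "rapidly_decaying (\<lambda>a. \<Sum>j\<in>J. of_int (exch \<Gamma> k j) * (of_real (a $ j) * f a))" if "finite J" for J
    using that
  proof (induction J rule: finite_induct)
    case (insert j J)
    then show ?case
      using rapidly_decaying_add[OF rapidly_decaying_cmult[OF rapidly_decaying_coord[OF f, of j], of "of_int (exch \<Gamma> k j)"] insert.IH]
      by simp
  qed (simp add: z)
  from this[of UNIV] show ?thesis
    by (simp add: row_def sum_distrib_right mult.assoc)
qed

text \<open>On the Gaussian domain the operator is multiplication by its symbol, by the formula for the Fourier
  transform of a derivative. A pair in the adjoint satisfies the same relation when integrated against
  the transforms of Gaussians, and these are total.\<close>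

lemma operator_extension:
  fixes \<Gamma> :: "'n::finite seed"
  assumes \<Gamma>: "D_seed \<Gamma>" and \<kappa>: "\<kappa> = pi * hb / of_int (symm \<Gamma> k)"
    and X: "\<And>f a. X f a = 1 / 2 * (1 / of_int (symm \<Gamma> k)) * p_op hb k f a + of_real \<sigma> * (\<Sum>j\<in>UNIV. of_int (exch \<Gamma> k j) * q_op j f a)"
  shows "self_adjoint_extension ((\<lambda>f. (l2_of f, l2_of (X f))) ` gaussian_space) =
    diagonalized.T (fourier_l2 k) (symbol \<sigma> \<kappa> \<Gamma> k)"
proof -
  interpret diagonalized "fourier_l2 k" "symbol \<sigma> \<kappa> \<Gamma> k" by (rule diagonalized_symbol)
  note diag = D_seed_diag[OF \<Gamma>, of k]
  have key: "rapidly_decaying f \<and> rapidly_decaying (X f) \<and>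
      (\<forall>\<xi>. partial_fourier k (X f) \<xi> = of_real (symbol \<sigma> \<kappa> \<Gamma> k \<xi>) * partial_fourier k f \<xi>)"
    if fG: "f \<in> gaussian_space" for f
  proof -
    obtain f' where f': "decaying_derivative k f f'" using gaussian_space_derivative[OF fG] by blast
    then have r: "rapidly_decaying f" "rapidly_decaying f'"
      and D: "\<And>a. ((\<lambda>t. f (a + t *\<^sub>R axis k 1)) has_vector_derivative f' a) (at 0)"
      by (auto simp: decaying_derivative_def)
    have Xf: "X f = (\<lambda>a. \<i> * of_real \<kappa> * f' a + of_real \<sigma> * (of_real (row \<Gamma> k a) * f a))"
    proof
      fix a
      have "p_op hb k f a = 2 * of_real pi * \<i> * of_real hb * f' a"
        unfolding p_op_def vector_derivative_at[OF D] ..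
      moreover have "(\<Sum>j\<in>UNIV. of_int (exch \<Gamma> k j) * q_op j f a) = of_real (row \<Gamma> k a) * f a"
        by (simp add: q_op_def row_def sum_distrib_right mult.assoc)
      ultimately show "X f a = \<i> * of_real \<kappa> * f' a + of_real \<sigma> * (of_real (row \<Gamma> k a) * f a)"
        unfolding X \<kappa> by (simp add: field_simps)
    qed
    have rX: "rapidly_decaying (X f)"
      unfolding Xf by (intro rapidly_decaying_add rapidly_decaying_cmult rapidly_decaying_row r)
    have "partial_fourier k (X f) \<xi> = of_real (symbol \<sigma> \<kappa> \<Gamma> k \<xi>) * partial_fourier k f \<xi>" for \<xi>
    proof -
      let ?e = "\<lambda>s. exp (- \<i> * of_real (\<xi> $ k * s))"
      have "(LINT s|lborel. X f (upd k \<xi> s) * ?e s)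
        = (LINT s|lborel. \<i> * of_real \<kappa> * (f' (upd k \<xi> s) * ?e s) + of_real (\<sigma> * row \<Gamma> k \<xi>) * (f (upd k \<xi> s) * ?e s))"
        unfolding Xf by (simp add: row_upd diag algebra_simps)
      also have "\<dots> = \<i> * of_real \<kappa> * (LINT s|lborel. f' (upd k \<xi> s) * ?e s) + of_real (\<sigma> * row \<Gamma> k \<xi>) * (LINT s|lborel. f (upd k \<xi> s) * ?e s)"
        using fiber_integrable[OF r(1), of k \<xi>] fiber_integrable[OF r(2), of k \<xi>]
        by (subst Bochner_Integration.integral_add) auto
      finally have "partial_fourier k (X f) \<xi> = \<i> * of_real \<kappa> * partial_fourier k f' \<xi> + of_real (\<sigma> * row \<Gamma> k \<xi>) * partial_fourier k f \<xi>"
        unfolding partial_fourier_def by (simp add: ring_distribs mult_ac)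
      then show ?thesis
        unfolding partial_fourier_derivative[OF r D] symbol_def by (simp add: algebra_simps)
    qed
    then show ?thesis using r rX by blast
  qed
  show ?thesis
  proof (rule self_adjoint_extension_eq)
    show "(\<lambda>f. (l2_of f, l2_of (X f))) ` gaussian_space \<subseteq> T"
    proof (rule image_subsetI)
      fix f :: "real^'n \<Rightarrow> complex" assume f: "f \<in> gaussian_space"
      from key[OF f] have r: "rapidly_decaying f" "rapidly_decaying (X f)"
        and e: "\<And>\<xi>. partial_fourier k (X f) \<xi> = of_real (symbol \<sigma> \<kappa> \<Gamma> k \<xi>) * partial_fourier k f \<xi>" by auto
      have "AE \<xi> in lborel. of_real (symbol \<sigma> \<kappa> \<Gamma> k \<xi>) * rep_l2 (fourier_l2 k (l2_of f)) \<xi> = rep_l2 (fourier_l2 k (l2_of (X f))) \<xi>"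
        using fourier_l2_rapidly_decaying[OF r(1), of k] fourier_l2_rapidly_decaying[OF r(2), of k]
        by eventually_elim (simp add: e)
      then show "(l2_of f, l2_of (X f)) \<in> T" by (simp add: T_def)
    qed
    show "adjoint_op ((\<lambda>f. (l2_of f, l2_of (X f))) ` gaussian_space) \<subseteq> T"
    proof (clarify)
      fix v v' assume "(v, v') \<in> adjoint_op ((\<lambda>f. (l2_of f, l2_of (X f))) ` gaussian_space)"
      then have adj: "cinner v (l2_of (X f)) = cinner v' (l2_of f)" if "f \<in> gaussian_space" for f
        using that by (auto simp: adjoint_op_def)
      define V V' where "V = rep_l2 (fourier_l2 k v)" and "V' = rep_l2 (fourier_l2 k v')"
      have lV: "l2_of V = fourier_l2 k v" "l2_of V' = fourier_l2 k v'" and sV: "square_integrable V" "square_integrable V'"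
        by (simp_all add: V_def V'_def)
      have [measurable]: "V \<in> borel_measurable borel" "V' \<in> borel_measurable borel" by (simp_all add: V_def V'_def)
      let ?t = "symbol \<sigma> \<kappa> \<Gamma> k"
      have "AE \<xi> in lborel. cnj (of_real (?t \<xi>) * V \<xi> - V' \<xi>) = 0"
      proof (rule gauss_total)
        show "(\<lambda>\<xi>. cnj (of_real (?t \<xi>) * V \<xi> - V' \<xi>)) \<in> borel_measurable borel"
          by (rule borel_measurable_cnj) measurable
        fix \<alpha> :: "'n \<Rightarrow> real" and b :: "'n \<Rightarrow> complex" assume \<alpha>: "\<And>i. \<alpha> i > 0"
        define \<alpha>' b' where "\<alpha>' = \<alpha>(k := 1 / \<alpha> k)" and "b' = b(k := \<i> * b k / of_real (\<alpha> k))"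
        define C where "C = complex_of_real (1 / sqrt (\<alpha> k)) * exp ((b k)\<^sup>2 / of_real (2 * \<alpha> k))"
        define f where "f = gauss \<alpha>' b'"
        have \<alpha>': "\<alpha>' i > 0" for i using \<alpha> by (simp add: \<alpha>'_def)
        have gb: "gauss \<alpha> b \<xi> = C * partial_fourier k f \<xi>" for \<xi>
          unfolding C_def f_def \<alpha>'_def b'_def by (rule gauss_eq_partial_fourier[OF \<alpha>])
        have fG: "f \<in> gaussian_space" unfolding f_def by (rule gauss_in_gaussian_space[OF \<alpha>'])
        from key[OF fG] have r: "rapidly_decaying f" "rapidly_decaying (X f)"
          and e: "\<And>\<xi>. partial_fourier k (X f) \<xi> = of_real (?t \<xi>) * partial_fourier k f \<xi>" by auto
        note sq = square_integrable_partial_fourier[OF r(1), of k] square_integrable_partial_fourier[OF r(2), of k]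
        have i1: "integrable lborel (\<lambda>\<xi>. cnj (V \<xi>) * partial_fourier k (X f) \<xi>)"
          by (rule integrable_cnj_mult[OF sV(1) sq(3)])
        have i2: "integrable lborel (\<lambda>\<xi>. cnj (V' \<xi>) * partial_fourier k f \<xi>)"
          by (rule integrable_cnj_mult[OF sV(2) sq(1)])
        have split: "gauss \<alpha> b \<xi> * cnj (of_real (?t \<xi>) * V \<xi> - V' \<xi>)
          = C * (cnj (V \<xi>) * partial_fourier k (X f) \<xi> - cnj (V' \<xi>) * partial_fourier k f \<xi>)" for \<xi>
          by (simp add: gb e algebra_simps)
        show "integrable lborel (\<lambda>\<xi>. gauss \<alpha> b \<xi> * cnj (of_real (?t \<xi>) * V \<xi> - V' \<xi>))"
          unfolding split by (intro integrable_mult_right Bochner_Integration.integrable_diff i1 i2)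
        have "cinner (fourier_l2 k v) (fourier_l2 k (l2_of (X f))) = cinner (fourier_l2 k v') (fourier_l2 k (l2_of f))"
          unfolding Ws(7) by (rule adj[OF fG])
        then have "(LINT \<xi>|lborel. cnj (V \<xi>) * partial_fourier k (X f) \<xi>) = (LINT \<xi>|lborel. cnj (V' \<xi>) * partial_fourier k f \<xi>)"
          unfolding sq(2,4) lV[symmetric] by (simp only: cinner_l2_of sV sq(1,3))
        then show "(LINT \<xi>|lborel. gauss \<alpha> b \<xi> * cnj (of_real (?t \<xi>) * V \<xi> - V' \<xi>)) = 0"
          unfolding split using i1 i2 by simp
      qed
      then have "AE \<xi> in lborel. of_real (?t \<xi>) * V \<xi> = V' \<xi>"
        by eventually_elim (simp only: complex_cnj_zero_iff right_minus_eq)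
      then show "(v, v') \<in> T" by (simp add: T_def V_def V'_def)
    qed
  qed
qed

lemma x_op_eq:
  assumes "D_seed \<Gamma>" "\<kappa> = pi * hb / of_int (symm \<Gamma> k)"
  shows "x_op hb \<Gamma> k = diagonalized.T (fourier_l2 k) (symbol (- 1) \<kappa> \<Gamma> k)"
  unfolding x_op_def by (rule operator_extension[OF assms]) (simp add: x_fun_def)

lemma x_tilde_op_eq:
  assumes "D_seed \<Gamma>" "\<kappa> = pi * hb / of_int (symm \<Gamma> k)"
  shows "x_tilde_op hb \<Gamma> k = diagonalized.T (fourier_l2 k) (symbol 1 \<kappa> \<Gamma> k)"
  unfolding x_tilde_op_def by (rule operator_extension[OF assms]) (simp add: x_tilde_fun_def)

lemma (in diagonalized) apply_functional_calculus:
  assumes f: "f \<in> borel_measurable borel" and u: "\<And>x. cmod (f x) = 1"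
  shows "apply_op (functional_calculus f T) = fc f"
    "apply_op ((functional_calculus f T)\<inverse>) = fc (\<lambda>x. cnj (f x))"
proof -
  have F: "functional_calculus f T = {(u, fc f u) | u. True}"
    by (rule functional_calculus_T[OF f, of 1]) (simp add: u)
  have bf: "bounded_borel (\<lambda>a. f (t a))" by (rule bounded_borel_t[OF f, of 1]) (simp add: u)
  have bc: "bounded_borel (\<lambda>a. cnj (f (t a)))" by (rule bounded_borel_cnj[OF bf])
  have uu: "f x * cnj (f x) = 1" for x using u[of x] by (simp add: complex_norm_square[symmetric])
  have 1: "fc (\<lambda>x. cnj (f x)) (fc f v) = v" and 2: "fc f (fc (\<lambda>x. cnj (f x)) v) = v" for v
    by (simp_all add: fc_def Ws mult_l2_mult[OF bf bc] mult_l2_mult[OF bc bf] uu mult.commute[of "cnj _"] mult_l2_1)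
  show "apply_op (functional_calculus f T) = fc f"
    unfolding F apply_op_def by (rule ext) simp
  show "apply_op ((functional_calculus f T)\<inverse>) = fc (\<lambda>x. cnj (f x))"
  proof
    fix v
    have "(v, w) \<in> (functional_calculus f T)\<inverse> \<longleftrightarrow> w = fc (\<lambda>x. cnj (f x)) v" for w
      unfolding F using 1[of w] 2[of v] by auto
    then show "apply_op ((functional_calculus f T)\<inverse>) v = fc (\<lambda>x. cnj (f x)) v"
      unfolding apply_op_def by simp
  qed
qed

section \<open>The quantum dilogarithm\<close>

lemma complex_sinh_nonzero:
  fixes w :: complex
  assumes "w \<noteq> 0" "cmod w < pi"
  shows "sinh w \<noteq> 0"
proof
  assume "sinh w = 0"
  then have "exp w * exp w = 1" unfolding sinh_zero_iff by auto
  then have "exp (2 * w) = 1" by (simp add: mult_exp_exp)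
  then obtain n :: int where n: "Re w = 0" "Im w = of_int n * pi" by (auto simp: exp_eq_1)
  have "\<bar>Im w\<bar> < pi" using assms(2) abs_Im_le_cmod[of w] by linarith
  then have "\<bar>of_int n\<bar> * pi < 1 * pi" by (simp add: n abs_mult)
  then have "\<bar>real_of_int n\<bar> < 1" by (rule mult_right_less_imp_less) simp
  then have "n = 0" by linarith
  then show False using n assms(1) by (simp add: complex_eq_iff)
qed

lemma complex_sinh_of_real: "sinh (complex_of_real x) = of_real (sinh x)"
  by (simp add: sinh_field_def exp_of_real[symmetric])

definition contour_radius :: "real \<Rightarrow> real" where
  "contour_radius h = min 1 (1 / h) / 2"

text \<open>The integrand of the dilogarithm pulled back to the half circle by \<open>t \<mapsto> r exp (i t)\<close>.\<close>

definition arc_term :: "real \<Rightarrow> real \<Rightarrow> real \<Rightarrow> complex" where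
  "arc_term h z t = qdilog_integrand h z (of_real (contour_radius h) * cis t) * of_real (contour_radius h) * \<i> * cis t"

text \<open>On the real part of the contour the integrand is \<open>exp (- i p z)\<close> times this odd real kernel, which is
  integrable because it is cut off around the pole.\<close>

definition tail_kernel :: "real \<Rightarrow> real \<Rightarrow> real" where
  "tail_kernel h p = (if \<bar>p\<bar> \<ge> contour_radius h then 1 / (sinh (pi * p) * sinh (pi * h * p) * p) else 0)"

context
  fixes h :: real
  assumes h: "h > 0"
begin

lemma contour_radius_bounds: "contour_radius h > 0" "contour_radius h \<le> 1 / 2" "h * contour_radius h \<le> 1 / 2"
proof -
  have "h * min 1 (1 / h) \<le> h * (1 / h)" using h by (intro mult_left_mono) auto
  then show "contour_radius h > 0" "contour_radius h \<le> 1 / 2" "h * contour_radius h \<le> 1 / 2"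
    using h by (auto simp: contour_radius_def)
qed

lemma sinh_nonzero_disc:
  assumes "w \<noteq> 0" "cmod w < 2 * contour_radius h"
  shows "sinh (of_real pi * w) \<noteq> 0" "sinh (of_real pi * of_real h * w) \<noteq> 0"
proof -
  have "pi * cmod w < pi * 1" using assms(2) contour_radius_bounds(2) by (intro mult_strict_left_mono) auto
  then show "sinh (of_real pi * w) \<noteq> 0"
    using assms(1) by (intro complex_sinh_nonzero) (auto simp: norm_mult)
  have "h * cmod w < h * (2 * contour_radius h)" using assms(2) h by (intro mult_strict_left_mono) auto
  then have "pi * (h * cmod w) < pi * 1" using contour_radius_bounds(3) by (intro mult_strict_left_mono) auto
  then show "sinh (of_real pi * of_real h * w) \<noteq> 0"
    using assms(1) h by (intro complex_sinh_nonzero) (auto simp: norm_mult mult.assoc)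
qed

lemma circle_point:
  fixes t :: real
  defines "w \<equiv> of_real (contour_radius h) * cis t"
  shows "w \<noteq> 0" "cmod w = contour_radius h" "sinh (of_real pi * w) \<noteq> 0" "sinh (of_real pi * of_real h * w) \<noteq> 0"
proof -
  show 1: "w \<noteq> 0" "cmod w = contour_radius h" using contour_radius_bounds(1) by (auto simp: w_def norm_mult)
  show "sinh (of_real pi * w) \<noteq> 0" "sinh (of_real pi * of_real h * w) \<noteq> 0"
    using 1 contour_radius_bounds(1) by (intro sinh_nonzero_disc; simp)+
qed

lemma continuous_arc_term:
  "continuous_on UNIV (\<lambda>p. arc_term h (fst p) (snd p))" "continuous_on UNIV (arc_term h z)"
proof -
  show c: "continuous_on UNIV (\<lambda>p. arc_term h (fst p) (snd p))"
  proof -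
    define w where "w p = of_real (contour_radius h) * cis (snd p)" for p :: "real \<times> real"
    have w: "continuous_on UNIV w" unfolding w_def by (intro continuous_intros)
    have 1: "continuous_on UNIV (\<lambda>p. sinh (of_real pi * w p))" "continuous_on UNIV (\<lambda>p. sinh (of_real pi * of_real h * w p))"
      unfolding sinh_field_def by (intro continuous_intros w; simp)+
    have 2: "continuous_on UNIV (\<lambda>p. exp (- (\<i> * w p * of_real (fst p))))"
      by (intro continuous_intros w)
    have 3: "sinh (of_real pi * w p) * sinh (of_real pi * of_real h * w p) \<noteq> 0" "w p \<noteq> 0" for p
      unfolding w_def using circle_point[of "snd p"] by simp_all
    have "continuous_on UNIV (\<lambda>p. exp (- (\<i> * w p * of_real (fst p))) /
        (sinh (of_real pi * w p) * sinh (of_real pi * of_real h * w p)) / w p)"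
      by (intro continuous_on_divide continuous_on_mult 1 2 w ballI 3)
    then have "continuous_on UNIV (\<lambda>p. exp (- (\<i> * w p * of_real (fst p))) /
        (sinh (of_real pi * w p) * sinh (of_real pi * of_real h * w p)) / w p * of_real (contour_radius h) * \<i> * cis (snd p))"
      by (intro continuous_on_mult continuous_on_cis continuous_on_const continuous_on_snd continuous_on_id)
    then show ?thesis unfolding arc_term_def qdilog_integrand_def w_def .
  qed
  have "continuous_on UNIV (\<lambda>t. (\<lambda>p. arc_term h (fst p) (snd p)) (z, t))"
    by (rule continuous_on_compose2[OF c]) (auto intro!: continuous_intros)
  then show "continuous_on UNIV (arc_term h z)" by simp
qed

lemma arc_term_measurable [measurable]: "arc_term h z \<in> borel_measurable borel"
  by (rule borel_measurable_continuous_onI[OF continuous_arc_term(2)])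

lemma arc_term_set_integrable: "set_integrable lborel {a..b} (arc_term h z)"
  unfolding set_integrable_def
  by (rule borel_integrable_compact) (auto intro: continuous_on_subset[OF continuous_arc_term(2)])

lemma tail_kernel_odd: "tail_kernel h (- p) = - tail_kernel h p"
  by (simp add: tail_kernel_def)

lemma tail_kernel_measurable [measurable]: "tail_kernel h \<in> borel_measurable borel"
  unfolding tail_kernel_def[abs_def] sinh_field_def by measurable

lemma tail_kernel_bound: "\<exists>C>0. \<forall>p. \<bar>tail_kernel h p\<bar> \<le> C * exp (- (pi * \<bar>p\<bar>))"
proof -
  define r where "r = contour_radius h"
  define c1 where "c1 = (1 - exp (- 2 * pi * r)) / 2"
  define c2 where "c2 = sinh (pi * h * r)"
  have r: "r > 0" unfolding r_def by (rule contour_radius_bounds)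
  have c1: "c1 > 0" using r by (simp add: c1_def)
  have c2: "c2 > 0" using r h by (simp add: c2_def)
  define C where "C = 1 / (c1 * c2 * r)"
  have C: "C > 0" using c1 c2 r by (simp add: C_def)
  have pos: "\<bar>tail_kernel h p\<bar> \<le> C * exp (- (pi * p))" if p: "p \<ge> r" for p
  proof -
    have "exp (- 2 * pi * p) \<le> exp (- 2 * pi * r)" using p by simp
    then have "exp (pi * p) * c1 \<le> exp (pi * p) * ((1 - exp (- 2 * pi * p)) / 2)"
      unfolding c1_def by (intro mult_left_mono) auto
    also have "\<dots> = sinh (pi * p)"
      by (simp add: sinh_field_def right_diff_distrib flip: exp_add)
    finally have s1: "exp (pi * p) * c1 \<le> sinh (pi * p)" .
    have s2: "c2 \<le> sinh (pi * h * p)" unfolding c2_def using p h by simp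
    have "exp (pi * p) * c1 * c2 * r \<le> sinh (pi * p) * sinh (pi * h * p) * p"
      using s1 s2 p c1 c2 r by (intro mult_mono) (auto intro!: mult_nonneg_nonneg order_trans[OF _ s1] order_trans[OF _ s2])
    moreover have "0 < exp (pi * p) * c1 * c2 * r" using c1 c2 r by simp
    ultimately have "1 / (sinh (pi * p) * sinh (pi * h * p) * p) \<le> 1 / (exp (pi * p) * c1 * c2 * r)"
      "0 < sinh (pi * p) * sinh (pi * h * p) * p" by (auto intro!: divide_left_mono)
    then show ?thesis using p r unfolding tail_kernel_def r_def[symmetric] C_def
      by (simp add: exp_minus field_simps)
  qed
  have "\<bar>tail_kernel h p\<bar> \<le> C * exp (- (pi * \<bar>p\<bar>))" for p
  proof -
    consider "p \<ge> r" | "- p \<ge> r" | "\<bar>p\<bar> < r" by linarith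
    then show ?thesis
    proof cases
      case 1 then show ?thesis using pos[of p] r by simp
    next
      case 2 then show ?thesis using pos[of "- p"] r by (simp add: tail_kernel_odd)
    next
      case 3 then show ?thesis using C by (simp add: tail_kernel_def r_def)
    qed
  qed
  then show ?thesis using C by blast
qed

lemma integrable_exp_abs:
  assumes "u > 0" shows "integrable lborel (\<lambda>p::real. exp (- (u * \<bar>p\<bar>)))"
proof -
  define g where "g p = indicator {0<..} p * exp (- (p * u))" for p :: real
  have g: "integrable lborel g"
    using integrable_I0i_exp_mscale[OF assms] by (simp add: set_integrable_def g_def[abs_def])
  have "integrable lborel (\<lambda>p. g p + g (0 + (- 1) * p))"
    by (intro Bochner_Integration.integrable_add g lborel_integrable_real_affine) simp
  then show ?thesis
  proof (rule Bochner_Integration.integrable_bound)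
    show "AE p in lborel. norm (exp (- (u * \<bar>p\<bar>))) \<le> norm (g p + g (0 + (- 1) * p))"
      using AE_lborel_singleton[of "0::real"]
      by eventually_elim (auto simp: g_def indicator_def abs_if mult.commute)
  qed measurable
qed

lemma tail_kernel_integrable: "integrable lborel (tail_kernel h)"
proof -
  obtain C where C: "C > 0" "\<And>p. \<bar>tail_kernel h p\<bar> \<le> C * exp (- (pi * \<bar>p\<bar>))" using tail_kernel_bound by blast
  show ?thesis
    by (rule Bochner_Integration.integrable_bound[OF integrable_mult_right[OF integrable_exp_abs[of pi], of C]])
      (use C in \<open>auto simp: abs_mult\<close>)
qed

definition tail_integral :: "real \<Rightarrow> complex" where
  "tail_integral z = (LINT p|lborel. exp (- (\<i> * of_real (p * z))) * of_real (tail_kernel h p))"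

definition arc_integral :: "real \<Rightarrow> complex" where
  "arc_integral z = (LINT t:{0..pi}|lborel. arc_term h z t)"

lemma tail_integrable: "integrable lborel (\<lambda>p. exp (- (\<i> * of_real (p * z))) * of_real (tail_kernel h p))"
  by (rule Bochner_Integration.integrable_bound[OF tail_kernel_integrable]) (auto simp: norm_mult)

lemma qdilog_integral_eq: "qdilog_integral h z = tail_integral z - arc_integral z"
proof -
  define r where "r = contour_radius h"
  have r: "r > 0" unfolding r_def by (rule contour_radius_bounds)
  have rr: "min 1 (1 / h) / 2 = r" by (simp add: r_def contour_radius_def)
  define f where "f p = exp (- (\<i> * of_real (p * z))) * of_real (tail_kernel h p)" for p
  have int: "qdilog_integrand h z (of_real p) = f p" if "\<bar>p\<bar> \<ge> r" for p
    using that unfolding f_def tail_kernel_def r_def[symmetric] qdilog_integrand_def of_real_mult[symmetric] complex_sinh_of_real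
    by (simp add: mult.assoc)
  have i: "integrable lborel f" unfolding f_def by (rule tail_integrable)
  have "(LINT p:{..- r}|lborel. qdilog_integrand h z (of_real p)) = (LINT p|lborel. indicator {..- r} p *\<^sub>R f p)"
    unfolding set_lebesgue_integral_def using r
    by (intro Bochner_Integration.integral_cong) (auto simp: indicator_def int)
  moreover have "(LINT p:{r..}|lborel. qdilog_integrand h z (of_real p)) = (LINT p|lborel. indicator {r..} p *\<^sub>R f p)"
    unfolding set_lebesgue_integral_def using r
    by (intro Bochner_Integration.integral_cong) (auto simp: indicator_def int)
  moreover have "(LINT p|lborel. indicator {..- r} p *\<^sub>R f p) + (LINT p|lborel. indicator {r..} p *\<^sub>R f p) = (LINT p|lborel. f p)"
  proof -
    have "(LINT p|lborel. indicator {..- r} p *\<^sub>R f p) + (LINT p|lborel. indicator {r..} p *\<^sub>R f p)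
      = (LINT p|lborel. indicator {..- r} p *\<^sub>R f p + indicator {r..} p *\<^sub>R f p)"
      by (intro Bochner_Integration.integral_add[symmetric] integrable_mult_indicator i) auto
    also have "\<dots> = (LINT p|lborel. f p)"
    proof (intro Bochner_Integration.integral_cong refl)
      fix p
      consider "p \<ge> r" | "p \<le> - r" | "\<bar>p\<bar> < r" by linarith
      then show "indicator {..- r} p *\<^sub>R f p + indicator {r..} p *\<^sub>R f p = f p"
        using r by cases (auto simp: f_def tail_kernel_def r_def[symmetric])
    qed
    finally show ?thesis .
  qed
  moreover have "contour_integral (part_circlepath 0 r pi 0) (qdilog_integrand h z) = - arc_integral z"
  proof -
    have "contour_integral (part_circlepath 0 r pi 0) (qdilog_integrand h z) = - contour_integral (part_circlepath 0 r 0 pi) (qdilog_integrand h z)"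
      by (subst reversepath_part_circlepath[symmetric], subst contour_integral_reversepath) auto
    also have "contour_integral (part_circlepath 0 r 0 pi) (qdilog_integrand h z) = integral {0..pi} (arc_term h z)"
      by (subst contour_integral_part_circlepath_eq) (auto simp: arc_term_def[abs_def] r_def)
    also have "\<dots> = arc_integral z"
      unfolding arc_integral_def by (rule set_borel_integral_eq_integral(2)[OF arc_term_set_integrable, symmetric])
    finally show ?thesis .
  qed
  ultimately show ?thesis
    unfolding qdilog_integral_def rr Let_def tail_integral_def f_def[symmetric] by simp
qed

lemma cnj_qdilog_integrand: "cnj (qdilog_integrand h z w) = - qdilog_integrand h z (- cnj w)"
proof -
  have "cnj (sinh x) = sinh (cnj x)" for x :: complex by (simp add: sinh_field_def exp_cnj)
  then show ?thesis by (simp add: qdilog_integrand_def exp_cnj)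
qed

text \<open>The reflection \<open>p \<mapsto> - cnj p\<close> reverses the contour and turns the integrand into minus its conjugate.
  So both parts of the integral are purely imaginary.\<close>

lemma qdilog_norm: "cmod (qdilog h z) = 1"
proof -
  have t: "Re (tail_integral z) = 0"
  proof -
    have "cnj (tail_integral z) = (LINT p|lborel. exp (\<i> * of_real (p * z)) * of_real (tail_kernel h p))"
      unfolding tail_integral_def Bochner_Integration.integral_cnj[symmetric] by (simp add: exp_cnj)
    also have "\<dots> = (LINT p|lborel. exp (\<i> * of_real ((0 + (- 1) * p) * z)) * of_real (tail_kernel h (0 + (- 1) * p)))"
      by (subst lborel_integral_real_affine[where c = "- 1" and t = 0]) auto
    also have "\<dots> = - tail_integral z" unfolding tail_integral_def by (simp add: tail_kernel_odd)
    finally show ?thesis by (simp add: complex_eq_iff)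
  qed
  have a: "Re (arc_integral z) = 0"
  proof -
    have c: "cnj (arc_term h z t) = - arc_term h z (pi + (- 1) * t)" for t
    proof -
      have "cis (pi - t) = - cnj (cis t)" by (simp add: complex_eq_iff)
      then have e: "of_real (contour_radius h) * cis (pi + (- 1) * t) = - cnj (of_real (contour_radius h) * cis t)"
        "cis (pi + (- 1) * t) = - cnj (cis t)" by simp_all
      show ?thesis
        unfolding arc_term_def e complex_cnj_mult cnj_qdilog_integrand by simp
    qed
    have "cnj (arc_integral z) = (LINT t|lborel. indicator {0..pi} t *\<^sub>R (- arc_term h z (pi + (- 1) * t)))"
      unfolding arc_integral_def set_lebesgue_integral_def Bochner_Integration.integral_cnj[symmetric] c[symmetric] by simp
    also have "\<dots> = - (LINT t|lborel. indicator {0..pi} (pi + (- 1) * t) *\<^sub>R arc_term h z (pi + (- 1) * t))"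
      unfolding Bochner_Integration.integral_minus[symmetric]
      by (intro Bochner_Integration.integral_cong) (auto simp: indicator_def)
    also have "\<dots> = - arc_integral z"
      unfolding arc_integral_def set_lebesgue_integral_def
      by (subst (2) lborel_integral_real_affine[where c = "- 1" and t = pi]) auto
    finally show ?thesis by (simp add: complex_eq_iff)
  qed
  show ?thesis unfolding qdilog_def norm_exp_eq_Re qdilog_integral_eq using t a by simp
qed

lemma qdilog_measurable: "qdilog h \<in> borel_measurable borel"
proof -
  have "(\<lambda>z. LINT p|lborel. exp (- (\<i> * of_real (p * z))) * of_real (tail_kernel h p)) \<in> borel_measurable borel"
    by measurable
  moreover have [measurable]: "(\<lambda>p. arc_term h (fst p) (snd p)) \<in> borel_measurable (borel \<Otimes>\<^sub>M lborel)"
  proof -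
    have "sets (borel \<Otimes>\<^sub>M lborel) = sets (borel :: (real \<times> real) measure)"
      unfolding borel_prod[symmetric] by (rule sets_pair_measure_cong) simp_all
    from measurable_cong_sets[OF this refl] borel_measurable_continuous_onI[OF continuous_arc_term(1)]
    show ?thesis by blast
  qed
  have "(\<lambda>z. LINT t|lborel. indicator {0..pi} t *\<^sub>R arc_term h z t) \<in> borel_measurable borel"
    using lborel.borel_measurable_lebesgue_integral[of "\<lambda>z t. indicator {0..pi} t *\<^sub>R arc_term h z t" borel]
    by (simp add: case_prod_beta')
  ultimately show ?thesis
    unfolding qdilog_def[abs_def] qdilog_integral_eq tail_integral_def arc_integral_def set_lebesgue_integral_def
    by measurable
qed

end

context
  fixes h :: real
  assumes h: "h > 0"
begin

lemma arc_term_factor: "arc_term h z t = exp (- (\<i> * (of_real (contour_radius h) * cis t) * of_real z)) * arc_term h 0 t"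
  by (simp add: arc_term_def qdilog_integrand_def)

lemma cmod_arc_term: "cmod (arc_term h z t) = exp (z * (contour_radius h * sin t)) * cmod (arc_term h 0 t)"
  by (subst arc_term_factor) (simp add: norm_mult norm_exp_eq_Re)

text \<open>On the upper half circle \<open>\<bar>exp (- i p z)\<bar> = exp (z Im p)\<close> tends to 0 as \<open>z \<rightarrow> - \<infinity>\<close>, except at the two
  end points.\<close>

lemma arc_integral_tendsto:
  assumes Z: "filterlim Z at_bot sequentially"
  shows "(\<lambda>n::nat. arc_integral h (Z n)) \<longlonglongrightarrow> 0"
proof -
  define Y where "Y n = min (Z n) 0" for n
  have YZ: "\<forall>\<^sub>F n in sequentially. Y n = Z n"
    using filterlim_at_bot[THEN iffD1, OF Z, rule_format, of 0] by eventually_elim (simp add: Y_def)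
  have Y: "filterlim Y at_bot sequentially"
    using Z YZ by (rule filterlim_cong[OF refl refl, THEN iffD2, rotated])
  have r: "contour_radius h > 0" by (rule contour_radius_bounds[OF h])
  have [measurable]: "arc_term h z \<in> borel_measurable borel" for z by (rule arc_term_measurable[OF h])
  have "(\<lambda>n. LINT t|lborel. indicator {0..pi} t *\<^sub>R arc_term h (Y n) t) \<longlonglongrightarrow> (LINT (t::real)|lborel. (0::complex))"
  proof (rule integral_dominated_convergence[where w = "\<lambda>t. indicator {0..pi} t * cmod (arc_term h 0 t)"])
    have "integrable lborel (\<lambda>t. cmod (indicator {0..pi} t *\<^sub>R arc_term h 0 t))"
      using arc_term_set_integrable[OF h, of 0 pi 0] unfolding set_integrable_def by (rule integrable_norm)
    then show "integrable lborel (\<lambda>t. indicator {0..pi} t * cmod (arc_term h 0 t))" by simp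
    show "AE t in lborel. (\<lambda>n. indicator {0..pi} t *\<^sub>R arc_term h (Y n) t) \<longlonglongrightarrow> 0"
      using AE_lborel_singleton[of 0] AE_lborel_singleton[of pi]
    proof eventually_elim
      fix t :: real assume t: "t \<noteq> 0" "t \<noteq> pi"
      show "(\<lambda>n. indicator {0..pi} t *\<^sub>R arc_term h (Y n) t) \<longlonglongrightarrow> 0"
      proof (cases "t \<in> {0..pi}")
        case True
        then have s: "contour_radius h * sin t > 0" using t r by (intro mult_pos_pos sin_gt_zero) auto
        have "filterlim (\<lambda>n. Y n * (contour_radius h * sin t)) at_bot sequentially"
          using filterlim_tendsto_pos_mult_at_bot[OF tendsto_const s Y] by (simp only: mult.commute)
        then have "(\<lambda>n. exp (Y n * (contour_radius h * sin t))) \<longlonglongrightarrow> 0"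
          by (rule filterlim_compose[OF exp_at_bot])
        then have "(\<lambda>n. cmod (arc_term h (Y n) t)) \<longlonglongrightarrow> 0"
          unfolding cmod_arc_term[of "Y _"] by (rule tendsto_mult_left_zero)
        then have "(\<lambda>n. arc_term h (Y n) t) \<longlonglongrightarrow> 0" by (rule tendsto_norm_zero_cancel)
        then show ?thesis using True by simp
      qed simp
    qed
    show "AE t in lborel. cmod (indicator {0..pi} t *\<^sub>R arc_term h (Y n) t) \<le> indicator {0..pi} t * cmod (arc_term h 0 t)" for n
    proof (rule AE_I2)
      fix t :: real
      show "cmod (indicator {0..pi} t *\<^sub>R arc_term h (Y n) t) \<le> indicator {0..pi} t * cmod (arc_term h 0 t)"
      proof (cases "t \<in> {0..pi}")
        case True
        then have "0 \<le> contour_radius h * sin t" using r by (simp add: sin_ge_zero)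
        then have "Y n * (contour_radius h * sin t) \<le> 0" by (simp add: Y_def mult_nonpos_nonneg)
        then have "exp (Y n * (contour_radius h * sin t)) \<le> 1" by simp
        then have "exp (Y n * (contour_radius h * sin t)) * cmod (arc_term h 0 t) \<le> 1 * cmod (arc_term h 0 t)"
          by (intro mult_right_mono) auto
        then show ?thesis using True by (simp add: cmod_arc_term[of "Y n"])
      qed simp
    qed
  qed measurable
  then have "(\<lambda>n. arc_integral h (Y n)) \<longlonglongrightarrow> 0"
    unfolding arc_integral_def[OF h] set_lebesgue_integral_def by simp
  then show ?thesis
    by (rule Lim_transform_eventually) (use YZ in eventually_elim, simp)
qed

lemma isCont_tail_kernel:
  assumes "\<bar>p\<bar> \<noteq> contour_radius h"
  shows "isCont (tail_kernel h) p"
proof (cases "\<bar>p\<bar> < contour_radius h")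
  case True
  have o: "open {p. \<bar>p\<bar> < contour_radius h}" by (intro open_Collect_less continuous_intros)
  have "continuous_on {p. \<bar>p\<bar> < contour_radius h} (\<lambda>p. 0 :: real)" by (rule continuous_on_const)
  then have "continuous_on {p. \<bar>p\<bar> < contour_radius h} (tail_kernel h)"
    by (rule continuous_on_eq) (simp add: tail_kernel_def)
  then show ?thesis using True by (simp add: continuous_on_eq_continuous_at[OF o])
next
  case False
  have r: "contour_radius h > 0" by (rule contour_radius_bounds[OF h])
  have o: "open {p. contour_radius h < \<bar>p\<bar>}" by (intro open_Collect_less continuous_intros)
  have "continuous_on {p. contour_radius h < \<bar>p\<bar>} (\<lambda>p. 1 / (sinh (pi * p) * sinh (pi * h * p) * p))"
    using r h unfolding sinh_field_def[symmetric]
    by (intro continuous_intros ballI) auto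
  then have "continuous_on {p. contour_radius h < \<bar>p\<bar>} (tail_kernel h)"
    by (rule continuous_on_eq) (simp add: tail_kernel_def)
  then show ?thesis using False assms by (simp add: continuous_on_eq_continuous_at[OF o])
qed

text \<open>Riemann-Lebesgue: translating by half a period changes the sign of the oscillating factor.\<close>

lemma tail_integral_le:
  assumes "z \<noteq> 0"
  shows "2 * cmod (tail_integral h z) \<le> (LINT p|lborel. \<bar>tail_kernel h p - tail_kernel h (p + pi / z)\<bar>)"
proof -
  define e where "e p = exp (- (\<i> * complex_of_real (p * z)))" for p
  have ti: "integrable lborel (\<lambda>p. e p * of_real (tail_kernel h p))"
    unfolding e_def by (rule tail_integrable[OF h])
  have "integrable lborel (\<lambda>p. e (pi / z + 1 * p) * of_real (tail_kernel h (pi / z + 1 * p)))"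
    by (rule lborel_integrable_real_affine[OF ti]) simp
  moreover have ez: "e (pi / z + 1 * p) = - e p" for p
  proof -
    have "- (\<i> * complex_of_real ((pi / z + 1 * p) * z)) = - (\<i> * of_real (p * z)) - \<i> * of_real pi"
      using assms by (simp add: ring_distribs)
    then show ?thesis unfolding e_def by (simp add: exp_diff exp_pi_i)
  qed
  ultimately have ti': "integrable lborel (\<lambda>p. e p * of_real (tail_kernel h (p + pi / z)))"
    by (simp add: add.commute)
  have "tail_integral h z = (LINT p|lborel. e (pi / z + 1 * p) * of_real (tail_kernel h (pi / z + 1 * p)))"
    unfolding tail_integral_def[OF h] e_def[symmetric]
    by (subst lborel_integral_real_affine[where c = 1 and t = "pi / z"]) auto
  also have "\<dots> = - (LINT p|lborel. e p * of_real (tail_kernel h (p + pi / z)))"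
    unfolding ez by (simp add: add.commute)
  finally have "2 * tail_integral h z = tail_integral h z - (LINT p|lborel. e p * of_real (tail_kernel h (p + pi / z)))" by simp
  also have "\<dots> = (LINT p|lborel. e p * of_real (tail_kernel h p) - e p * of_real (tail_kernel h (p + pi / z)))"
    unfolding tail_integral_def[OF h] e_def[symmetric]
    by (rule Bochner_Integration.integral_diff[OF ti ti', symmetric])
  finally have "2 * cmod (tail_integral h z) = cmod (LINT p|lborel. e p * of_real (tail_kernel h p) - e p * of_real (tail_kernel h (p + pi / z)))"
    by (metis norm_mult norm_numeral)
  also have "\<dots> \<le> (LINT p|lborel. cmod (e p * of_real (tail_kernel h p) - e p * of_real (tail_kernel h (p + pi / z))))"
    by (rule integral_norm_bound)
  also have "\<dots> = (LINT p|lborel. \<bar>tail_kernel h p - tail_kernel h (p + pi / z)\<bar>)"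
    by (intro Bochner_Integration.integral_cong refl)
      (simp add: e_def norm_mult flip: right_diff_distrib of_real_diff)
  finally show ?thesis .
qed

lemma tail_integral_tendsto:
  assumes Z: "filterlim Z at_bot sequentially"
  shows "(\<lambda>n::nat. tail_integral h (Z n)) \<longlonglongrightarrow> 0"
proof -
  obtain C where C: "C > 0" "\<And>p. \<bar>tail_kernel h p\<bar> \<le> C * exp (- (pi * \<bar>p\<bar>))"
    using tail_kernel_bound[OF h] by blast
  define d where "d n = pi / Z n" for n
  have d0: "d \<longlonglongrightarrow> 0" unfolding d_def
    by (rule tendsto_divide_0[OF tendsto_const]) (rule filterlim_at_bot_imp_at_infinity[OF Z])
  define d' where "d' n = (if \<bar>d n\<bar> \<le> 1 then d n else 0)" for n
  have dd: "\<forall>\<^sub>F n in sequentially. d' n = d n"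
    using tendstoD[OF d0, of 1] by (auto simp: d'_def elim!: eventually_mono)
  have d'0: "d' \<longlonglongrightarrow> 0"
    by (rule Lim_transform_eventually[OF d0]) (use dd in eventually_elim, simp)
  have [measurable]: "tail_kernel h \<in> borel_measurable borel" by (rule tail_kernel_measurable[OF h])
  have "(\<lambda>n. LINT p|lborel. \<bar>tail_kernel h p - tail_kernel h (p + d' n)\<bar>) \<longlonglongrightarrow> (LINT (p::real)|lborel. 0)"
  proof (rule integral_dominated_convergence[where w = "\<lambda>p. (C + C * exp pi) * exp (- (pi * \<bar>p\<bar>))"])
    show "integrable lborel (\<lambda>p. (C + C * exp pi) * exp (- (pi * \<bar>p\<bar>)))"
      by (intro integrable_mult_right integrable_exp_abs[OF h]) simp
    show "AE p in lborel. (\<lambda>n. \<bar>tail_kernel h p - tail_kernel h (p + d' n)\<bar>) \<longlonglongrightarrow> 0"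
      using AE_lborel_singleton[of "contour_radius h"] AE_lborel_singleton[of "- contour_radius h"]
    proof eventually_elim
      fix p assume "p \<noteq> contour_radius h" "p \<noteq> - contour_radius h"
      then have c: "isCont (tail_kernel h) p" by (intro isCont_tail_kernel) (auto simp: abs_if split: if_splits)
      have "(\<lambda>n. p + d' n) \<longlonglongrightarrow> p + 0" by (intro tendsto_intros d'0)
      then have "(\<lambda>n. tail_kernel h (p + d' n)) \<longlonglongrightarrow> tail_kernel h p"
        using isCont_tendsto_compose[OF c] by simp
      then have "(\<lambda>n. \<bar>tail_kernel h p - tail_kernel h (p + d' n)\<bar>) \<longlonglongrightarrow> \<bar>tail_kernel h p - tail_kernel h p\<bar>"
        by (intro tendsto_intros)
      then show "(\<lambda>n. \<bar>tail_kernel h p - tail_kernel h (p + d' n)\<bar>) \<longlonglongrightarrow> 0" by simp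
    qed
    show "AE p in lborel. norm \<bar>tail_kernel h p - tail_kernel h (p + d' n)\<bar> \<le> (C + C * exp pi) * exp (- (pi * \<bar>p\<bar>))" for n
    proof (rule AE_I2)
      fix p
      have "\<bar>p\<bar> \<le> \<bar>p + d' n\<bar> + 1" using abs_triangle_ineq[of "p + d' n" "- d' n"] by (simp add: d'_def split: if_splits)
      then have "pi * \<bar>p\<bar> \<le> pi * (\<bar>p + d' n\<bar> + 1)" by (intro mult_left_mono) auto
      then have "exp (- (pi * \<bar>p + d' n\<bar>)) \<le> exp (pi + - (pi * \<bar>p\<bar>))" by (simp add: ring_distribs)
      then have "C * exp (- (pi * \<bar>p + d' n\<bar>)) \<le> C * (exp pi * exp (- (pi * \<bar>p\<bar>)))"
        unfolding exp_add using C(1) by (intro mult_left_mono) auto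
      then have "\<bar>tail_kernel h (p + d' n)\<bar> \<le> C * exp pi * exp (- (pi * \<bar>p\<bar>))"
        using C(2)[of "p + d' n"] by simp
      then have "\<bar>tail_kernel h p - tail_kernel h (p + d' n)\<bar> \<le> C * exp (- (pi * \<bar>p\<bar>)) + C * exp pi * exp (- (pi * \<bar>p\<bar>))"
        using C(2)[of p] by linarith
      then show "norm \<bar>tail_kernel h p - tail_kernel h (p + d' n)\<bar> \<le> (C + C * exp pi) * exp (- (pi * \<bar>p\<bar>))"
        by (simp add: ring_distribs)
    qed
  qed measurable
  then have lim: "(\<lambda>n. LINT p|lborel. \<bar>tail_kernel h p - tail_kernel h (p + d' n)\<bar>) \<longlonglongrightarrow> 0" by simp
  show ?thesis
  proof (rule Lim_null_comparison[OF _ lim])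
    show "\<forall>\<^sub>F n in sequentially. norm (tail_integral h (Z n)) \<le> (LINT p|lborel. \<bar>tail_kernel h p - tail_kernel h (p + d' n)\<bar>)"
      using dd filterlim_at_bot_dense[THEN iffD1, OF Z, rule_format, of 0]
    proof eventually_elim
      fix n assume "d' n = d n" "Z n < 0"
      then show "norm (tail_integral h (Z n)) \<le> (LINT p|lborel. \<bar>tail_kernel h p - tail_kernel h (p + d' n)\<bar>)"
      proof -
        assume e: "d' n = d n" and z: "Z n < 0"
        have "2 * cmod (tail_integral h (Z n)) \<le> (LINT p|lborel. \<bar>tail_kernel h p - tail_kernel h (p + d' n)\<bar>)"
          unfolding e d_def using z by (intro tail_integral_le) simp
        then show ?thesis using norm_ge_zero[of "tail_integral h (Z n)"] by linarith
      qed
    qed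
  qed
qed

lemma qdilog_tendsto_1:
  assumes Z: "filterlim Z at_bot sequentially"
  shows "(\<lambda>n::nat. qdilog h (Z n)) \<longlonglongrightarrow> 1"
proof -
  have "(\<lambda>n. exp (- (1 / 4) * (tail_integral h (Z n) - arc_integral h (Z n)))) \<longlonglongrightarrow> exp (- (1 / 4) * (0 - 0))"
    by (intro tendsto_intros tail_integral_tendsto arc_integral_tendsto Z)
  then show ?thesis unfolding qdilog_def qdilog_integral_eq[OF h] by simp
qed

lemma tail_integral_minus: "tail_integral h (- z) = - tail_integral h z"
proof -
  have "tail_integral h (- z) = (LINT p|lborel. exp (- (\<i> * of_real ((0 + (- 1) * p) * - z))) * of_real (tail_kernel h (0 + (- 1) * p)))"
    unfolding tail_integral_def[OF h] by (subst lborel_integral_real_affine[where c = "- 1" and t = 0]) auto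
  also have "\<dots> = - tail_integral h z"
    unfolding tail_integral_def[OF h] by (simp add: tail_kernel_odd[OF h])
  finally show ?thesis .
qed

text \<open>The rotation by \<open>\<pi>\<close> sends \<open>p z\<close> to \<open>p (- z)\<close>, so the upper half circle for \<open>- z\<close> is the lower half
  circle for \<open>z\<close>.\<close>

lemma arc_integral_sum:
  "arc_integral h z + arc_integral h (- z) = contour_integral (circlepath 0 (contour_radius h)) (qdilog_integrand h z)"
proof -
  have hk: "arc_integral h z' = integral {0..pi} (arc_term h z')" for z'
    unfolding arc_integral_def[OF h] by (rule set_borel_integral_eq_integral(2)[OF arc_term_set_integrable[OF h]])
  have sh: "arc_term h (- z) = arc_term h z \<circ> (+) pi"
  proof
    fix t
    have "cis (pi + t) = - cis t" by (simp add: complex_eq_iff cos_add sin_add)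
    then show "arc_term h (- z) t = (arc_term h z \<circ> (+) pi) t"
      by (simp add: arc_term_def qdilog_integrand_def)
  qed
  have "integral {0..pi} (arc_term h (- z)) = integral {pi..2 * pi} (arc_term h z)"
    unfolding sh integral_shift_Icc_real by simp
  then have "arc_integral h z + arc_integral h (- z) = integral {0..pi} (arc_term h z) + integral {pi..2 * pi} (arc_term h z)"
    unfolding hk by simp
  also have "\<dots> = integral {0..2 * pi} (arc_term h z)"
    by (rule Henstock_Kurzweil_Integration.integral_combine)
      (auto intro!: integrable_continuous_real continuous_on_subset[OF continuous_arc_term(2)[OF h]])
  also have "\<dots> = contour_integral (circlepath 0 (contour_radius h)) (qdilog_integrand h z)"
    unfolding circlepath_def by (subst contour_integral_part_circlepath_eq) (auto simp: arc_term_def[abs_def])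
  finally show ?thesis .
qed

text \<open>The integrand has a triple pole at the origin; its residue is a quadratic polynomial in \<open>z\<close>
  without linear term, because the factor multiplying the exponential is even.\<close>

lemma circle_integral:
  "\<exists>c. \<forall>z. contour_integral (circlepath 0 (contour_radius h)) (qdilog_integrand h z)
    = of_real pi * \<i> * (c - (of_real z)\<^sup>2 / of_real (pi\<^sup>2 * h))"
proof -
  define r where "r = contour_radius h"
  have r: "r > 0" unfolding r_def by (rule contour_radius_bounds[OF h])
  \<comment> \<open>the entire function \<open>sinh w / w\<close>; it removes the pole from the integrand\<close>
  define s where "s w = (if w = 0 then 1 else sinh w / w)" for w :: complex
  have s: "s holomorphic_on UNIV"
  proof (rule pole_theorem_0[where a = 0 and g = sinh])
    show "(sinh :: complex \<Rightarrow> complex) holomorphic_on UNIV"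
      unfolding sinh_field_def[abs_def] by (intro holomorphic_intros) auto
    have "(sinh has_field_derivative cosh (0::complex)) (at 0)" by (auto intro!: derivative_eq_intros)
    then show "s 0 = deriv sinh 0" by (simp add: s_def DERIV_imp_deriv)
  qed (auto simp: s_def)
  have seven: "s (- w) = s w" for w by (simp add: s_def)
  define k where "k w = 1 / (of_real (pi\<^sup>2 * h) * s (of_real pi * w) * s (of_real pi * of_real h * w))" for w
  define B where "B = ball (0::complex) (2 * r)"
  have B: "open B" "0 \<in> B" "cball 0 r \<subseteq> B" "ball 0 r \<subseteq> B" using r by (auto simp: B_def)
  have snz: "s (of_real pi * w) \<noteq> 0" "s (of_real pi * of_real h * w) \<noteq> 0" if "w \<in> B" for w
    using sinh_nonzero_disc[OF h, of w] that h by (auto simp: s_def B_def r_def)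
  have hs: "(\<lambda>w. s (c * w)) holomorphic_on B" for c
    using holomorphic_on_compose_gen[OF _ s, of "\<lambda>w. c * w" B] by (auto simp: o_def intro!: holomorphic_intros)
  have k: "k holomorphic_on B"
    unfolding k_def using h snz by (intro holomorphic_intros hs) auto
  have k0: "k 0 = 1 / of_real (pi\<^sup>2 * h)" by (simp add: k_def s_def)
  have k1: "deriv k 0 = 0"
  proof -
    have D: "(k has_field_derivative deriv k 0) (at 0)" using holomorphic_derivI[OF k B(1,2)] .
    have "((\<lambda>w. k (- w)) has_field_derivative deriv k 0 * - 1) (at 0)"
      by (rule DERIV_chain2[where g = uminus]) (use D in \<open>auto intro!: derivative_eq_intros\<close>)
    moreover have "(\<lambda>w. k (- w)) = k" by (rule ext) (simp add: k_def seven)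
    ultimately have "deriv k 0 = deriv k 0 * - 1" using D DERIV_unique by metis
    then show ?thesis by simp
  qed
  have "contour_integral (circlepath 0 r) (qdilog_integrand h z)
      = of_real pi * \<i> * ((deriv ^^ 2) k 0 - (of_real z)\<^sup>2 / of_real (pi\<^sup>2 * h))" for z
  proof -
    define c where "c = - \<i> * of_real z"
    define e where "e w = exp (c * w)" for w
    have e: "e holomorphic_on B" unfolding e_def by (intro holomorphic_intros)
    have de: "deriv e = (\<lambda>w. c * e w)" unfolding e_def
      by (intro ext DERIV_imp_deriv) (auto intro!: derivative_eq_intros)
    have dde: "deriv (\<lambda>w. c * e w) = (\<lambda>w. c * (c * e w))" unfolding e_def
      by (intro ext DERIV_imp_deriv) (auto intro!: derivative_eq_intros)
    have "(deriv ^^ 2) (\<lambda>w. e w * k w) 0 = (\<Sum>i = 0..2. of_nat (2 choose i) * (deriv ^^ i) e 0 * (deriv ^^ (2 - i)) k 0)"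
      by (rule higher_deriv_mult[OF e k B(1,2)])
    also have "\<dots> = (deriv ^^ 2) k 0 + c\<^sup>2 * k 0"
      by (simp add: numeral_2_eq_2 k1 de dde) (simp add: e_def)
    also have "c\<^sup>2 * k 0 = - ((of_real z)\<^sup>2 / of_real (pi\<^sup>2 * h))"
      by (simp add: c_def k0 power_mult_distrib)
    finally have d2: "(deriv ^^ 2) (\<lambda>w. e w * k w) 0 = (deriv ^^ 2) k 0 - (of_real z)\<^sup>2 / of_real (pi\<^sup>2 * h)" by simp
    have hol: "(\<lambda>w. e w * k w) holomorphic_on B" by (intro holomorphic_intros e k)
    have "((\<lambda>u. (e u * k u) / (u - 0) ^ Suc 2) has_contour_integral ((2 * pi * \<i>) / (fact 2) * (deriv ^^ 2) (\<lambda>w. e w * k w) 0)) (circlepath 0 r)"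
      by (rule Cauchy_has_contour_integral_higher_derivative_circlepath)
        (use hol B r in \<open>auto intro: holomorphic_on_subset holomorphic_on_imp_continuous_on\<close>)
    moreover have "(e u * k u) / (u - 0) ^ Suc 2 = qdilog_integrand h z u" if u: "u \<in> path_image (circlepath 0 r)" for u
    proof -
      have u0: "u \<noteq> 0" "u \<in> B" using u r by (auto simp: B_def)
      then have "k u = u * u / (sinh (of_real pi * u) * sinh (of_real pi * of_real h * u))"
        using h snz[of u] by (simp add: k_def s_def field_simps power2_eq_square)
      then show ?thesis
        using u0 by (simp add: qdilog_integrand_def e_def c_def eval_nat_numeral mult_ac)
    qed
    ultimately have "(qdilog_integrand h z has_contour_integral ((2 * pi * \<i>) / (fact 2) * (deriv ^^ 2) (\<lambda>w. e w * k w) 0)) (circlepath 0 r)"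
      by (rule has_contour_integral_eq)
    from contour_integral_unique[OF this] show ?thesis by (simp add: d2 fact_2)
  qed
  then show ?thesis unfolding r_def by blast
qed

text \<open>The tails at \<open>z\<close> and \<open>- z\<close> cancel since their kernel is odd, and the two half circles combine to a
  full one.\<close>

lemma qdilog_inversion:
  "\<exists>C. C \<noteq> 0 \<and> (\<forall>z. qdilog h z * qdilog h (- z) = C * exp (- (\<i> * of_real (z\<^sup>2 / (4 * pi * h)))))"
proof -
  obtain c where c: "\<And>z. contour_integral (circlepath 0 (contour_radius h)) (qdilog_integrand h z)
    = of_real pi * \<i> * (c - (of_real z)\<^sup>2 / of_real (pi\<^sup>2 * h))" using circle_integral by blast
  have "qdilog h z * qdilog h (- z) = exp (of_real pi * \<i> * c / 4) * exp (- (\<i> * of_real (z\<^sup>2 / (4 * pi * h))))" for z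
  proof -
    have "qdilog_integral h z + qdilog_integral h (- z) = - (of_real pi * \<i> * (c - (of_real z)\<^sup>2 / of_real (pi\<^sup>2 * h)))"
      unfolding qdilog_integral_eq[OF h] tail_integral_minus c[symmetric] arc_integral_sum[symmetric] by simp
    then have "- (1 / 4) * qdilog_integral h z + - (1 / 4) * qdilog_integral h (- z)
        = of_real pi * \<i> * (c - (of_real z)\<^sup>2 / of_real (pi\<^sup>2 * h)) / 4"
      unfolding distrib_left[symmetric] by (simp only:) simp
    also have "\<dots> = of_real pi * \<i> * c / 4 + - (\<i> * of_real (z\<^sup>2 / (4 * pi * h)))"
      using h by (simp add: field_simps power2_eq_square)
    finally show ?thesis unfolding qdilog_def exp_add[symmetric] by simp
  qed
  then show ?thesis by (intro exI[of _ "exp (of_real pi * \<i> * c / 4)"]) simp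
qed

end

section \<open>Pullbacks along volume preserving maps\<close>

text \<open>Tonelli's theorem in the \<open>k\<close>-th coordinate. The outer integral still runs over the whole space, so
  its \<open>k\<close>-th coordinate, on which the inner integral does not depend, is restricted to an interval of
  length 1.\<close>

lemma nn_integral_fiber:
  fixes u :: "real^'n::finite \<Rightarrow> ennreal"
  assumes [measurable]: "u \<in> borel_measurable borel"
  shows "(\<integral>\<^sup>+a. u a \<partial>lborel) = (\<integral>\<^sup>+a. indicator {0..1} (a $ k) * (\<integral>\<^sup>+s. u (upd k a s) \<partial>lborel) \<partial>lborel)"
proof -
  have mk [measurable]: "(\<lambda>a::real^'n. a $ k) \<in> borel_measurable borel"
    unfolding cart_eq_inner_axis by measurable
  define f where "f p = u (fst p) * indicator {0..1} (snd p)" for p :: "(real^'n) \<times> real"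
  have f: "f \<in> borel_measurable (lborel \<Otimes>\<^sub>M lborel)" unfolding f_def by measurable
  then have f': "f \<in> borel_measurable borel" by (simp add: lborel_prod)
  have "(\<integral>\<^sup>+p. f p \<partial>(lborel \<Otimes>\<^sub>M lborel)) = (\<integral>\<^sup>+a. \<integral>\<^sup>+s. f (a, s) \<partial>lborel \<partial>lborel)"
    by (rule lborel.nn_integral_fst[OF f, symmetric])
  also have "\<dots> = (\<integral>\<^sup>+a. u a \<partial>lborel)" by (simp add: f_def nn_integral_cmult)
  finally have 1: "(\<integral>\<^sup>+p. f p \<partial>(lborel \<Otimes>\<^sub>M lborel)) = (\<integral>\<^sup>+a. u a \<partial>lborel)" .
  have "(\<integral>\<^sup>+p. f p \<partial>(lborel \<Otimes>\<^sub>M lborel)) = (\<integral>\<^sup>+p. f p \<partial>distr lborel borel (swap_coord k))"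
    by (simp only: lborel_prod lborel_distr_swap_coord)
  also have "\<dots> = (\<integral>\<^sup>+p. f (swap_coord k p) \<partial>lborel)"
    by (rule nn_integral_distr) (use f' swap_coord_measurable in simp_all)
  also have "\<dots> = (\<integral>\<^sup>+p. f (swap_coord k p) \<partial>(lborel \<Otimes>\<^sub>M lborel))" by (simp only: lborel_prod)
  also have "\<dots> = (\<integral>\<^sup>+a. \<integral>\<^sup>+s. f (swap_coord k (a, s)) \<partial>lborel \<partial>lborel)"
  proof (rule lborel.nn_integral_fst[symmetric])
    have "(\<lambda>p. f (swap_coord k p)) \<in> borel_measurable borel"
      using measurable_compose[OF swap_coord_measurable f'] .
    then show "(\<lambda>p. f (swap_coord k p)) \<in> borel_measurable (lborel \<Otimes>\<^sub>M lborel)" by (simp add: lborel_prod)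
  qed
  also have "\<dots> = (\<integral>\<^sup>+a. indicator {0..1} (a $ k) * (\<integral>\<^sup>+s. u (upd k a s) \<partial>lborel) \<partial>lborel)"
    by (simp add: f_def swap_coord_def nn_integral_multc mult.commute)
  finally show ?thesis unfolding 1 .
qed

lemma lborel_distr_reflection_shear:
  fixes \<tau> :: "real^'n::finite \<Rightarrow> real^'n"
  assumes \<tau> [measurable]: "\<tau> \<in> borel_measurable borel"
    and fib: "\<And>a s. \<tau> (upd k a s) = upd k a (m a + c * s)" and c: "\<bar>c\<bar> = 1"
  shows "distr lborel borel \<tau> = lborel"
proof (rule measure_eqI)
  fix A :: "(real^'n) set" assume "A \<in> sets (distr lborel borel \<tau>)"
  then have [measurable]: "A \<in> sets borel" by simp
  have "emeasure (distr lborel borel \<tau>) A = (\<integral>\<^sup>+a. indicator A a \<partial>distr lborel borel \<tau>)" by simp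
  also have "\<dots> = (\<integral>\<^sup>+a. indicator A (\<tau> a) \<partial>lborel)" by (rule nn_integral_distr) simp_all
  also have "\<dots> = (\<integral>\<^sup>+a. indicator {0..1} (a $ k) * (\<integral>\<^sup>+s. indicator A (\<tau> (upd k a s)) \<partial>lborel) \<partial>lborel)"
    by (rule nn_integral_fiber) measurable
  also have "\<dots> = (\<integral>\<^sup>+a. indicator {0..1} (a $ k) * (\<integral>\<^sup>+s. indicator A (upd k a s) \<partial>lborel) \<partial>lborel)"
  proof (rule nn_integral_cong)
    fix a
    have c0: "c \<noteq> 0" using c by auto
    have [measurable]: "upd k a \<in> borel_measurable borel" by (rule upd_measurable)
    have "(\<integral>\<^sup>+s. indicator A (upd k a s) \<partial>lborel) = ennreal \<bar>c\<bar> * (\<integral>\<^sup>+s. indicator A (upd k a (m a + c * s)) \<partial>lborel)"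
      by (rule nn_integral_real_affine[OF _ c0]) measurable
    then show "indicator {0..1} (a $ k) * (\<integral>\<^sup>+s. indicator A (\<tau> (upd k a s)) \<partial>lborel) = indicator {0..1} (a $ k) * (\<integral>\<^sup>+s. indicator A (upd k a s) \<partial>lborel)"
      unfolding fib by (simp add: c)
  qed
  also have "\<dots> = (\<integral>\<^sup>+a. indicator A a \<partial>lborel)"
    by (rule nn_integral_fiber[symmetric]) measurable
  finally show "emeasure (distr lborel borel \<tau>) A = emeasure lborel A" by simp
qed simp

definition volume_preserving :: "(real^'n::finite \<Rightarrow> real^'n) \<Rightarrow> bool" where
  "volume_preserving \<tau> \<longleftrightarrow> \<tau> \<in> borel_measurable borel \<and> distr lborel borel \<tau> = lborel"

lemma square_integrable_compose:
  assumes \<tau>: "volume_preserving \<tau>" and f: "square_integrable f"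
  shows "square_integrable (\<lambda>a. f (\<tau> a))" "norm (l2_of (\<lambda>a. f (\<tau> a))) = norm (l2_of f)"
proof -
  have [measurable]: "\<tau> \<in> borel_measurable borel" "f \<in> borel_measurable borel"
    using \<tau> f by (auto simp: volume_preserving_def square_integrable_def)
  have d: "distr lborel borel \<tau> = lborel" using \<tau> by (simp add: volume_preserving_def)
  have "integrable (distr lborel borel \<tau>) (\<lambda>a. (cmod (f a))\<^sup>2)" unfolding d using f by (simp add: square_integrable_def)
  then show s: "square_integrable (\<lambda>a. f (\<tau> a))"
    unfolding square_integrable_def by (subst (asm) integrable_distr_eq) auto
  have "(LINT a|distr lborel borel \<tau>. (cmod (f a))\<^sup>2) = (LINT a|lborel. (cmod (f (\<tau> a)))\<^sup>2)"
    by (rule integral_distr) auto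
  then have "(norm (l2_of (\<lambda>a. f (\<tau> a))))\<^sup>2 = (norm (l2_of f))\<^sup>2"
    unfolding norm_l2_of[OF s] norm_l2_of[OF f] d by simp
  then show "norm (l2_of (\<lambda>a. f (\<tau> a))) = norm (l2_of f)" by simp
qed

lemma AE_compose:
  assumes \<tau>: "volume_preserving \<tau>" and P: "AE a in lborel. P a"
  shows "AE a in lborel. P (\<tau> a)"
proof (rule AE_distrD[where P = P])
  show "\<tau> \<in> measurable lborel borel" using \<tau> by (simp add: volume_preserving_def)
  show "AE a in distr lborel borel \<tau>. P a" using \<tau> P unfolding volume_preserving_def by metis
qed

lemma pullback_l2_of:
  assumes \<tau>: "volume_preserving \<tau>" and f: "square_integrable f"
  shows "pullback \<tau> (l2_of f) = l2_of (\<lambda>a. f (\<tau> a))"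
  unfolding pullback_def using AE_compose[OF \<tau> rep_l2_of[OF f]]
  by (simp add: l2_of_eq_iff square_integrable_compose[OF \<tau>] f)

lemma pullback_simps:
  assumes \<tau>: "volume_preserving \<tau>"
  shows "norm (pullback \<tau> u) = norm u" "pullback \<tau> (u - v) = pullback \<tau> u - pullback \<tau> v"
proof -
  show "norm (pullback \<tau> u) = norm u"
    unfolding pullback_def using square_integrable_compose(2)[OF \<tau> square_integrable_rep_l2[of u]] by simp
  have "pullback \<tau> (l2_of (rep_l2 u) - l2_of (rep_l2 v)) = pullback \<tau> (l2_of (rep_l2 u)) - pullback \<tau> (l2_of (rep_l2 v))"
    by (simp add: l2_of_diff pullback_l2_of[OF \<tau>] square_integrable_diff square_integrable_compose[OF \<tau>]
        del: l2_of_rep_l2)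
  then show "pullback \<tau> (u - v) = pullback \<tau> u - pullback \<tau> v" by simp
qed

text \<open>The tropical mutation of sign \<open>s\<close>. The substitution in \<open>K_prime\<close> is the one of sign \<open>1\<close>; the one
  of sign \<open>- 1\<close> governs the opposite region of phase space.\<close>

definition trop :: "int \<Rightarrow> 'n::finite seed \<Rightarrow> 'n \<Rightarrow> real^'n \<Rightarrow> real^'n" where
  "trop s \<Gamma> k a = (\<chi> i. if i = k then - (a $ k) + (\<Sum>j\<in>UNIV. of_int (pos_part (- s * exch \<Gamma> k j)) * a $ j) else a $ i)"

lemma K_prime_trop: "K_prime \<Gamma> k = pullback (trop 1 \<Gamma> k)"
  unfolding K_prime_def trop_def[abs_def] mult_minus1 ..

lemma linear_trop: "linear (trop s \<Gamma> k)"
  by (rule linearI) (auto simp: trop_def vec_eq_iff ring_distribs sum.distrib sum_distrib_left mult_ac)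

lemma trop_upd:
  assumes "exch \<Gamma> k k = 0"
  shows "trop s \<Gamma> k (upd k a r) = upd k a ((\<Sum>j\<in>UNIV. of_int (pos_part (- s * exch \<Gamma> k j)) * a $ j) + (- 1) * r)"
proof -
  have "(\<Sum>j\<in>UNIV. of_int (pos_part (- s * exch \<Gamma> k j)) * upd k a r $ j) = (\<Sum>j\<in>UNIV. real_of_int (pos_part (- s * exch \<Gamma> k j)) * a $ j)"
    by (rule sum.cong) (auto simp: upd_nth assms)
  then show ?thesis by (simp add: vec_eq_iff trop_def upd_nth)
qed

lemma volume_preserving_trop:
  assumes "exch \<Gamma> k k = 0"
  shows "volume_preserving (trop s \<Gamma> k)"
  unfolding volume_preserving_def
proof
  show m: "trop s \<Gamma> k \<in> borel_measurable borel"
    by (intro borel_measurable_continuous_onI linear_continuous_on linear_conv_bounded_linear[THEN iffD1] linear_trop)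
  show "distr lborel borel (trop s \<Gamma> k) = lborel"
    by (rule lborel_distr_reflection_shear[OF m trop_upd[OF assms]]) simp
qed

lemma trop_involution:
  assumes "exch \<Gamma> k k = 0"
  shows "trop s \<Gamma> k (trop s \<Gamma> k a) = a"
proof -
  have "trop s \<Gamma> k a = upd k a ((\<Sum>j\<in>UNIV. of_int (pos_part (- s * exch \<Gamma> k j)) * a $ j) + (- 1) * (a $ k))"
    using trop_upd[OF assms, of s a "a $ k"] by (simp add: upd_upd)
  then show ?thesis by (simp only: trop_upd[OF assms]) (simp add: upd_upd)
qed

lemma rapidly_decaying_involution:
  fixes f :: "real^'n::finite \<Rightarrow> complex"
  assumes f: "rapidly_decaying f" and \<tau>: "linear \<tau>" "\<And>a. \<tau> (\<tau> a) = a"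
  shows "rapidly_decaying (\<lambda>a. f (\<tau> a))"
proof -
  obtain C \<delta> where C: "C > 0" "\<delta> > 0" "\<And>a. cmod (f a) \<le> C * exp (- \<delta> * (norm a)\<^sup>2)"
    using rapidly_decayingE[OF f] by blast
  obtain B where B: "B > 0" "\<And>a. norm (\<tau> a) \<le> B * norm a" using linear_bounded_pos[OF \<tau>(1)] by blast
  show ?thesis
  proof (rule rapidly_decayingI[where \<delta> = "\<delta> / B\<^sup>2"])
    show "continuous_on UNIV (\<lambda>a. f (\<tau> a))"
    proof (rule continuous_on_compose2[of UNIV f])
      show "continuous_on UNIV f" using f by (simp add: rapidly_decaying_def)
      show "continuous_on UNIV \<tau>" using \<tau>(1) by (simp add: linear_continuous_on linear_conv_bounded_linear)
    qed simp
    show "\<delta> / B\<^sup>2 > 0" using C B by simp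
    fix a
    have "(norm a)\<^sup>2 \<le> (B * norm (\<tau> a))\<^sup>2" using B(2)[of "\<tau> a"] by (intro power_mono) (simp_all add: \<tau>)
    then have "\<delta> * ((norm a)\<^sup>2 / B\<^sup>2) \<le> \<delta> * (norm (\<tau> a))\<^sup>2"
      using C B by (intro mult_left_mono) (simp_all add: power_mult_distrib divide_le_eq mult.commute)
    then have "C * exp (- \<delta> * (norm (\<tau> a))\<^sup>2) \<le> C * exp (- (\<delta> / B\<^sup>2) * (norm a)\<^sup>2)"
      using C by simp
    then show "cmod (f (\<tau> a)) \<le> C * exp (- (\<delta> / B\<^sup>2) * (norm a)\<^sup>2)" using C(3)[of "\<tau> a"] by linarith
  qed
qed

section \<open>Asymptotics of an intertwiner\<close>

text \<open>For \<open>s = 1\<close> the Fourier multiplier of the dilogarithms in an intertwiner; for \<open>s = - 1\<close> the one that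
  takes its place when \<open>K_prime\<close> is replaced by the tropical mutation of sign \<open>- 1\<close>. It tends to 1 when
  \<open>s \<xi>\<^sub>k\<close> tends to infinity.\<close>

definition phase :: "int \<Rightarrow> real \<Rightarrow> 'n::finite seed \<Rightarrow> 'n \<Rightarrow> real^'n \<Rightarrow> complex" where
  "phase s h \<Gamma> k \<xi> = qdilog h (- of_int s * (pi * h) * \<xi> $ k - row \<Gamma> k \<xi>) *
     cnj (qdilog h (- of_int s * (pi * h) * \<xi> $ k + row \<Gamma> k \<xi>))"

lemma phase_norm: "h > 0 \<Longrightarrow> cmod (phase s h \<Gamma> k \<xi>) = 1"
  by (simp add: phase_def norm_mult qdilog_norm)

lemma phase_measurable: "h > 0 \<Longrightarrow> phase s h \<Gamma> k \<in> borel_measurable borel"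
proof -
  assume h: "h > 0"
  have [measurable]: "qdilog h \<in> borel_measurable borel" by (rule qdilog_measurable[OF h])
  have [measurable]: "(\<lambda>\<xi>::real^'a. \<xi> $ k) \<in> borel_measurable borel" unfolding cart_eq_inner_axis by measurable
  show ?thesis unfolding phase_def[abs_def]
    by (intro borel_measurable_times borel_measurable_cnj) measurable
qed

lemma bounded_borel_phase: "h > 0 \<Longrightarrow> bounded_borel (phase s h \<Gamma> k)"
  unfolding bounded_borel_def using phase_norm phase_measurable by (metis order_refl)

text \<open>Inversion, applied to both dilogarithms. The constant cancels between them, and of the two Gaussian
  factors there remains the difference of squares \<open>(x + \<ell>)\<^sup>2 - (x - \<ell>)\<^sup>2 = 4 x \<ell>\<close> with \<open>x = \<pi>h \<xi>\<^sub>k\<close>.\<close>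

lemma phase_flip:
  assumes h: "h > 0"
  shows "phase 1 h \<Gamma> k \<xi> = exp (- (\<i> * of_real (\<xi> $ k * row \<Gamma> k \<xi>))) * phase (- 1) h \<Gamma> k \<xi>"
proof -
  obtain C where C: "C \<noteq> 0" "\<And>z. qdilog h z * qdilog h (- z) = C * exp (- (\<i> * of_real (z\<^sup>2 / (4 * pi * h))))"
    using qdilog_inversion[OF h] by blast
  define E where "E z = exp (- (\<i> * complex_of_real (z\<^sup>2 / (4 * pi * h))))" for z
  have u: "qdilog h z * cnj (qdilog h z) = 1" for z
    using qdilog_norm[OF h, of z] by (simp add: complex_norm_square[symmetric])
  have E1: "cmod (E z) = 1" for z by (simp add: E_def norm_exp_eq_Re)
  have C1: "C * cnj C = 1"
  proof -
    have "cmod (qdilog h 0 * qdilog h (- 0)) = cmod (C * E 0)" unfolding C(2) E_def ..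
    then have "cmod C = 1" by (simp add: norm_mult qdilog_norm[OF h] E1)
    then show ?thesis by (simp add: complex_norm_square[symmetric])
  qed
  have inv: "qdilog h z = C * E z * cnj (qdilog h (- z))" for z
  proof -
    have "qdilog h z = qdilog h z * (qdilog h (- z) * cnj (qdilog h (- z)))" by (simp add: u)
    also have "\<dots> = C * E z * cnj (qdilog h (- z))" unfolding mult.assoc[symmetric] C(2) E_def ..
    finally show ?thesis .
  qed
  define x l where "x = pi * h * \<xi> $ k" and "l = row \<Gamma> k \<xi>"
  have "phase 1 h \<Gamma> k \<xi> = qdilog h (- (x + l)) * cnj (qdilog h (- (x - l)))"
  proof -
    have "- of_int 1 * (pi * h) * \<xi> $ k - row \<Gamma> k \<xi> = - (x + l)" "- of_int 1 * (pi * h) * \<xi> $ k + row \<Gamma> k \<xi> = - (x - l)"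
      by (simp_all add: x_def l_def)
    then show ?thesis unfolding phase_def by (simp only:)
  qed
  also have "\<dots> = (C * cnj C) * (E (- (x + l)) * cnj (E (- (x - l)))) * (qdilog h (x - l) * cnj (qdilog h (x + l)))"
  proof -
    have "qdilog h (- (x + l)) = C * E (- (x + l)) * cnj (qdilog h (x + l))" "qdilog h (- (x - l)) = C * E (- (x - l)) * cnj (qdilog h (x - l))"
      using inv[of "- (x + l)"] inv[of "- (x - l)"] by (simp_all only: minus_minus)
    then show ?thesis by (simp only: complex_cnj_mult complex_cnj_cnj mult_ac)
  qed
  also have "E (- (x + l)) * cnj (E (- (x - l))) = exp (- (\<i> * of_real (\<xi> $ k * row \<Gamma> k \<xi>)))"
  proof -
    have "(x + l)\<^sup>2 / (4 * pi * h) - (x - l)\<^sup>2 / (4 * pi * h) = x * l / (pi * h)"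
      using h by (simp add: power2_eq_square field_simps)
    also have "\<dots> = \<xi> $ k * row \<Gamma> k \<xi>" using h by (simp add: x_def l_def)
    finally have e: "(x - l)\<^sup>2 / (4 * pi * h) = (x + l)\<^sup>2 / (4 * pi * h) - \<xi> $ k * row \<Gamma> k \<xi>" by simp
    have s: "(- (x + l))\<^sup>2 = (x + l)\<^sup>2" "(- (x - l))\<^sup>2 = (x - l)\<^sup>2" by (rule power2_minus)+
    show ?thesis unfolding E_def exp_cnj exp_add[symmetric] s e by (simp add: ring_distribs)
  qed
  also have "qdilog h (x - l) * cnj (qdilog h (x + l)) = phase (- 1) h \<Gamma> k \<xi>"
    by (simp add: phase_def x_def l_def)
  finally show ?thesis by (simp add: C1)
qed

lemma K_op_eq:
  assumes \<Gamma>: "D_seed \<Gamma>" and hb: "hb > 0" and hk: "hk = hb / of_int (symm \<Gamma> k)"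
  shows "K_op hb \<Gamma> k u = inv (fourier_l2 k) (mult_l2 (phase 1 hk \<Gamma> k) (fourier_l2 k (K_prime \<Gamma> k u)))"
proof -
  define \<kappa> where "\<kappa> = pi * hb / of_int (symm \<Gamma> k)"
  have h: "hk > 0" using hb D_seed_diag(2)[OF \<Gamma>, of k] by (simp add: hk)
  have \<kappa>: "\<kappa> = pi * hk" by (simp add: \<kappa>_def hk)
  interpret x: diagonalized "fourier_l2 k" "symbol (- 1) \<kappa> \<Gamma> k" by (rule diagonalized_symbol)
  interpret y: diagonalized "fourier_l2 k" "symbol 1 \<kappa> \<Gamma> k" by (rule diagonalized_symbol)
  note q = qdilog_measurable[OF h] qdilog_norm[OF h]
  have bx: "bounded_borel (\<lambda>a. qdilog hk (symbol (- 1) \<kappa> \<Gamma> k a))"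
    by (rule x.bounded_borel_t[OF q(1), of 1]) (simp add: q(2))
  have by': "bounded_borel (\<lambda>a. cnj (qdilog hk (symbol 1 \<kappa> \<Gamma> k a)))"
    by (rule bounded_borel_cnj, rule y.bounded_borel_t[OF q(1), of 1]) (simp add: q(2))
  have "K_op hb \<Gamma> k u = x.fc (qdilog hk) (y.fc (\<lambda>z. cnj (qdilog hk z)) (K_prime \<Gamma> k u))"
    unfolding K_op_def Let_def hk[symmetric] x_op_eq[OF \<Gamma> \<kappa>_def] x_tilde_op_eq[OF \<Gamma> \<kappa>_def]
      x.apply_functional_calculus(1)[OF q] y.apply_functional_calculus(2)[OF q] by simp
  also have "\<dots> = inv (fourier_l2 k) (mult_l2 (\<lambda>a. qdilog hk (symbol (- 1) \<kappa> \<Gamma> k a) * cnj (qdilog hk (symbol 1 \<kappa> \<Gamma> k a))) (fourier_l2 k (K_prime \<Gamma> k u)))"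
    unfolding x.fc_def y.fc_def x.Ws mult_l2_mult[OF bx by'] ..
  also have "(\<lambda>a. qdilog hk (symbol (- 1) \<kappa> \<Gamma> k a) * cnj (qdilog hk (symbol 1 \<kappa> \<Gamma> k a))) = phase 1 hk \<Gamma> k"
    by (rule ext) (simp add: phase_def symbol_def \<kappa>)
  finally show ?thesis .
qed

lemma norm_mult_l2_unimodular:
  assumes m: "bounded_borel m" "\<And>a. cmod (m a) = 1"
  shows "norm (mult_l2 m u) = norm u"
proof -
  have "(norm (mult_l2 m u))\<^sup>2 = (norm u)\<^sup>2"
    unfolding norm_l2_rep
    by (rule integral_cong_AE) (use rep_mult_l2[OF m(1), of u] in \<open>auto elim!: eventually_mono simp: norm_mult m(2)\<close>)
  then show ?thesis by simp
qed

lemma K_op_isometry: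
  assumes \<Gamma>: "D_seed \<Gamma>" and hb: "hb > 0"
  shows "norm (K_op hb \<Gamma> k u) = norm u" "K_op hb \<Gamma> k (u - v) = K_op hb \<Gamma> k u - K_op hb \<Gamma> k v"
proof -
  define hk where "hk = hb / of_int (symm \<Gamma> k)"
  note diag = D_seed_diag[OF \<Gamma>, of k]
  have h: "hk > 0" using hb diag by (simp add: hk_def)
  note K = K_op_eq[OF \<Gamma> hb hk_def]
  note W = unitary_l2_simps(1-9)[OF unitary_fourier_l2[of k]]
  note iW = unitary_l2_simps(1-7)[OF unitary_l2_inv[OF unitary_fourier_l2[of k]]]
  note p = pullback_simps[OF volume_preserving_trop[OF diag(1), of 1]]
  note b = bounded_borel_phase[OF h, of 1 \<Gamma> k]
  show "norm (K_op hb \<Gamma> k u) = norm u"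
    unfolding K iW norm_mult_l2_unimodular[OF b phase_norm[OF h]] W K_prime_trop p ..
  have md: "mult_l2 (phase 1 hk \<Gamma> k) (x - y) = mult_l2 (phase 1 hk \<Gamma> k) x - mult_l2 (phase 1 hk \<Gamma> k) y" for x y
    using mult_l2_add[OF b, of x "(- 1) *\<^sub>C y"] mult_l2_scaleC[OF b, of "- 1" y] by (simp add: scaleC_simps)
  show "K_op hb \<Gamma> k (u - v) = K_op hb \<Gamma> k u - K_op hb \<Gamma> k v"
    unfolding K K_prime_trop p W md iW ..
qed

text \<open>The exponential in \<open>phase_flip\<close> is the Fourier image of a shear along the \<open>k\<close>-th direction. By
  \<open>trop_shear\<close> that shear turns the tropical mutation of sign \<open>1\<close> into the one of sign \<open>- 1\<close>.\<close>

lemma partial_fourier_shear: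
  assumes z: "exch \<Gamma> k k = 0"
  shows "partial_fourier k (\<lambda>a. g (a - row \<Gamma> k a *\<^sub>R axis k 1)) \<xi> = exp (- (\<i> * of_real (\<xi> $ k * row \<Gamma> k \<xi>))) * partial_fourier k g \<xi>"
proof -
  define l where "l = row \<Gamma> k \<xi>"
  have e: "upd k \<xi> s - row \<Gamma> k (upd k \<xi> s) *\<^sub>R axis k 1 = upd k \<xi> (s - l)" for s
    by (simp add: row_upd[OF z] l_def[symmetric]) (simp add: upd_def algebra_simps)
  have "(LINT s|lborel. g (upd k \<xi> (s - l)) * exp (- \<i> * of_real (\<xi> $ k * s)))
      = (LINT s|lborel. g (upd k \<xi> (l + 1 * s - l)) * exp (- \<i> * of_real (\<xi> $ k * (l + 1 * s))))"
    by (subst lborel_integral_real_affine[where c = 1 and t = l]) auto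
  also have "\<dots> = (LINT s|lborel. exp (- (\<i> * of_real (\<xi> $ k * l))) * (g (upd k \<xi> s) * exp (- \<i> * of_real (\<xi> $ k * s))))"
    by (intro Bochner_Integration.integral_cong refl) (simp add: ring_distribs exp_add exp_diff exp_minus field_simps)
  finally show ?thesis unfolding partial_fourier_def e l_def by simp
qed

lemma trop_shear: "exch \<Gamma> k k = 0 \<Longrightarrow> trop (- 1) \<Gamma> k a = trop 1 \<Gamma> k (a - row \<Gamma> k a *\<^sub>R axis k 1)"
proof -
  assume z: "exch \<Gamma> k k = 0"
  have pp: "real_of_int (pos_part t) = of_int t + of_int (pos_part (- t))" for t by (simp add: pos_part_def max_def)
  have "(\<Sum>j\<in>UNIV. real_of_int (pos_part (- exch \<Gamma> k j)) * (a - row \<Gamma> k a *\<^sub>R axis k 1) $ j)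
      = (\<Sum>j\<in>UNIV. real_of_int (pos_part (- exch \<Gamma> k j)) * a $ j)"
    by (rule sum.cong) (auto simp: axis_def z)
  moreover have "(\<Sum>j\<in>UNIV. real_of_int (pos_part (exch \<Gamma> k j)) * a $ j)
      = row \<Gamma> k a + (\<Sum>j\<in>UNIV. real_of_int (pos_part (- exch \<Gamma> k j)) * a $ j)"
    unfolding row_def by (subst pp) (simp add: ring_distribs sum.distrib)
  ultimately show ?thesis by (simp add: vec_eq_iff trop_def axis_def)
qed

lemma K_op_rapidly_decaying:
  assumes \<Gamma>: "D_seed \<Gamma>" and hb: "hb > 0" and hk: "hk = hb / of_int (symm \<Gamma> k)"
    and g: "rapidly_decaying g" and s: "s = 1 \<or> s = - 1"
  shows "K_op hb \<Gamma> k (l2_of g) = inv (fourier_l2 k) (mult_l2 (phase s hk \<Gamma> k) (l2_of (partial_fourier k (\<lambda>a. g (trop s \<Gamma> k a)))))"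
proof -
  note diag = D_seed_diag[OF \<Gamma>, of k]
  have h: "hk > 0" using hb diag by (simp add: hk)
  have r: "rapidly_decaying (\<lambda>a. g (trop s \<Gamma> k a))" for s
    by (rule rapidly_decaying_involution[OF g linear_trop trop_involution[OF diag(1)]])
  have 1: "K_op hb \<Gamma> k (l2_of g) = inv (fourier_l2 k) (mult_l2 (phase 1 hk \<Gamma> k) (l2_of (partial_fourier k (\<lambda>a. g (trop 1 \<Gamma> k a)))))"
    unfolding K_op_eq[OF \<Gamma> hb hk] K_prime_trop
      pullback_l2_of[OF volume_preserving_trop[OF diag(1)] rapidly_decaying_square_integrable[OF g]]
      square_integrable_partial_fourier(2)[OF r] ..
  show ?thesis
  proof (cases "s = 1")
    case True then show ?thesis using 1 by simp
  next
    case False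
    then have s: "s = - 1" using s by simp
    have "phase 1 hk \<Gamma> k \<xi> * partial_fourier k (\<lambda>a. g (trop 1 \<Gamma> k a)) \<xi>
        = phase (- 1) hk \<Gamma> k \<xi> * partial_fourier k (\<lambda>a. g (trop (- 1) \<Gamma> k a)) \<xi>" for \<xi>
      unfolding trop_shear[OF diag(1)] phase_flip[OF h, of \<Gamma> k]
        partial_fourier_shear[OF diag(1), of "\<lambda>a. g (trop 1 \<Gamma> k a)"] by (simp add: mult_ac)
    then show ?thesis
      unfolding 1 s mult_l2_of[OF bounded_borel_phase[OF h] square_integrable_partial_fourier(1)[OF r]] by simp
  qed
qed

text \<open>For linear \<open>\<Lambda>\<close> this is translation by \<open>n \<Lambda>\<close> in momentum space.\<close>

definition modulate :: "(real^'n::finite \<Rightarrow> real) \<Rightarrow> nat \<Rightarrow> (real^'n \<Rightarrow> complex) \<Rightarrow> real^'n \<Rightarrow> complex" where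
  "modulate \<Lambda> n g a = exp (\<i> * of_real (real n * \<Lambda> a)) * g a"

lemma rapidly_decaying_modulate:
  assumes "rapidly_decaying g" "linear \<Lambda>"
  shows "rapidly_decaying (modulate \<Lambda> n g)"
proof -
  have "continuous_on UNIV \<Lambda>" using assms(2) by (simp add: linear_continuous_on linear_conv_bounded_linear)
  then show ?thesis
    unfolding modulate_def[abs_def]
    by (intro rapidly_decaying_bounded_mult[OF assms(1), of _ 1] continuous_intros) (auto simp: norm_exp_eq_Re)
qed

lemma partial_fourier_modulate:
  assumes \<Lambda>: "linear \<Lambda>"
  shows "partial_fourier k (modulate \<Lambda> n g) \<xi> = exp (\<i> * of_real (real n * (\<Lambda> \<xi> - \<xi> $ k * \<Lambda> (axis k 1)))) *
    partial_fourier k g (\<xi> - (real n * \<Lambda> (axis k 1)) *\<^sub>R axis k 1)"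
proof -
  define c where "c = \<Lambda> (axis k 1)"
  define \<eta> where "\<eta> = \<xi> - (real n * c) *\<^sub>R axis k 1"
  have \<eta>: "upd k \<eta> s = upd k \<xi> s" "\<eta> $ k = \<xi> $ k - real n * c" for s
    by (simp_all add: \<eta>_def vec_eq_iff upd_nth axis_def)
  have L: "\<Lambda> (upd k \<xi> s) = \<Lambda> \<xi> + (s - \<xi> $ k) * c" for s
    unfolding upd_def c_def by (simp add: linear_add[OF \<Lambda>] linear_scale[OF \<Lambda>])
  have "modulate \<Lambda> n g (upd k \<xi> s) * exp (- \<i> * of_real (\<xi> $ k * s))
      = exp (\<i> * of_real (real n * (\<Lambda> \<xi> - \<xi> $ k * c))) * (g (upd k \<eta> s) * exp (- \<i> * of_real (\<eta> $ k * s)))" for s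
  proof -
    have "\<i> * complex_of_real (real n * (\<Lambda> \<xi> + (s - \<xi> $ k) * c)) + - \<i> * of_real (\<xi> $ k * s)
        = \<i> * of_real (real n * (\<Lambda> \<xi> - \<xi> $ k * c)) + - \<i> * of_real ((\<xi> $ k - real n * c) * s)"
      by (simp add: algebra_simps)
    then show ?thesis unfolding modulate_def L \<eta> by (simp add: mult_ac flip: exp_add)
  qed
  then show ?thesis unfolding partial_fourier_def c_def[symmetric] \<eta>_def[symmetric] by simp
qed

lemma phase_tendsto:
  assumes h: "h > 0" and z: "exch \<Gamma> k k = 0" and c: "of_int s * c > 0"
  shows "(\<lambda>n. phase s h \<Gamma> k (\<xi> + (real n * c) *\<^sub>R axis k 1)) \<longlonglongrightarrow> 1"
proof -
  have e: "phase s h \<Gamma> k (\<xi> + (real n * c) *\<^sub>R axis k 1) =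
      qdilog h ((- of_int s * (pi * h) * \<xi> $ k - row \<Gamma> k \<xi>) - (pi * h * (of_int s * c)) * real n) *
      cnj (qdilog h ((- of_int s * (pi * h) * \<xi> $ k + row \<Gamma> k \<xi>) - (pi * h * (of_int s * c)) * real n))" for n
  proof -
    have "row \<Gamma> k (\<xi> + (real n * c) *\<^sub>R axis k 1) = row \<Gamma> k \<xi>" by (simp add: row_add row_scaleR row_axis z)
    moreover have "(\<xi> + (real n * c) *\<^sub>R axis k 1) $ k = \<xi> $ k + real n * c" by (simp add: axis_def)
    ultimately show ?thesis unfolding phase_def by (simp add: algebra_simps)
  qed
  have p: "pi * h * (of_int s * c) > 0" using h c by simp
  have lim: "filterlim (\<lambda>n. x - (pi * h * (of_int s * c)) * real n) at_bot sequentially" for x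
  proof -
    have "filterlim (\<lambda>n. - (pi * h * (of_int s * c)) * real n) at_bot sequentially"
      by (rule filterlim_tendsto_neg_mult_at_bot[OF tendsto_const _ filterlim_real_sequentially]) (use p in simp)
    then have "filterlim (\<lambda>n. pi * h * (of_int s * c) * real n + (- x)) at_top sequentially"
      unfolding filterlim_uminus_at_bot by (intro filterlim_tendsto_add_at_top[OF tendsto_const, of _ _ "- x", unfolded add.commute[of "- x"]]) simp
    then show ?thesis unfolding filterlim_uminus_at_bot by simp
  qed
  have "(\<lambda>n. qdilog h ((- of_int s * (pi * h) * \<xi> $ k - row \<Gamma> k \<xi>) - (pi * h * (of_int s * c)) * real n) *
      cnj (qdilog h ((- of_int s * (pi * h) * \<xi> $ k + row \<Gamma> k \<xi>) - (pi * h * (of_int s * c)) * real n))) \<longlonglongrightarrow> 1 * cnj 1"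
    by (intro tendsto_intros qdilog_tendsto_1[OF h] lim)
  then show ?thesis unfolding e by simp
qed

text \<open>After the tropical mutation of sign \<open>s\<close> the \<open>k\<close>-th momentum is centred at \<open>n\<close> times a number of sign
  \<open>s\<close>. Recentring it moves the translation into the phase, which then tends to 1 pointwise.\<close>

lemma K_op_asymptotics:
  assumes \<Gamma>: "D_seed \<Gamma>" and hb: "hb > 0"
    and g: "rapidly_decaying g" and \<Lambda>: "linear \<Lambda>" and s: "s = 1 \<or> s = - 1"
    and pos: "of_int s * \<Lambda> (trop s \<Gamma> k (axis k 1)) > 0"
  shows "(\<lambda>n. K_op hb \<Gamma> k (l2_of (modulate \<Lambda> n g)) -
    l2_of (modulate (\<lambda>a. \<Lambda> (trop s \<Gamma> k a)) n (\<lambda>a. g (trop s \<Gamma> k a)))) \<longlonglongrightarrow> 0"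
proof -
  define hk where "hk = hb / of_int (symm \<Gamma> k)"
  note diag = D_seed_diag[OF \<Gamma>, of k]
  have h: "hk > 0" using hb diag by (simp add: hk_def)
  note W = unitary_l2_simps(1-9)[OF unitary_fourier_l2[of k]]
  note iW = unitary_l2_simps(1-7)[OF unitary_l2_inv[OF unitary_fourier_l2[of k]]]
  note b = bounded_borel_phase[OF h, of s \<Gamma> k]
  define M where "M = (\<lambda>a. \<Lambda> (trop s \<Gamma> k a))"
  define f where "f = (\<lambda>a. g (trop s \<Gamma> k a))"
  have M: "linear M" unfolding M_def using linear_compose[OF linear_trop \<Lambda>] by (simp add: o_def)
  have f: "rapidly_decaying f"
    unfolding f_def by (rule rapidly_decaying_involution[OF g linear_trop trop_involution[OF diag(1)]])
  define c where "c = M (axis k 1)"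
  define v where "v n = (real n * c) *\<^sub>R (axis k 1 :: real^'a)" for n :: nat
  define Q where "Q = partial_fourier k f"
  define P where "P n = partial_fourier k (modulate M n f)" for n
  have rP: "rapidly_decaying (modulate M n f)" for n by (rule rapidly_decaying_modulate[OF f M])
  have sP: "square_integrable (P n)" for n unfolding P_def by (rule square_integrable_partial_fourier(1)[OF rP])
  have sQ: "square_integrable Q" unfolding Q_def by (rule square_integrable_partial_fourier(1)[OF f])
  have [measurable]: "P n \<in> borel_measurable borel" "Q \<in> borel_measurable borel" "phase s hk \<Gamma> k \<in> borel_measurable borel" for n
    using sP sQ by (simp_all add: square_integrable_def phase_measurable[OF h])
  have eq: "norm (K_op hb \<Gamma> k (l2_of (modulate \<Lambda> n g)) - l2_of (modulate M n f))
      = norm (mult_l2 (\<lambda>\<xi>. phase s hk \<Gamma> k (\<xi> + v n)) (l2_of Q) - l2_of Q)" for n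
  proof -
    have b': "bounded_borel (\<lambda>\<xi>. phase s hk \<Gamma> k (\<xi> + v n))"
      unfolding bounded_borel_def by (intro conjI exI[of _ 1]) (simp_all add: phase_norm[OF h])
    have mf: "(\<lambda>a. modulate \<Lambda> n g (trop s \<Gamma> k a)) = modulate M n f"
      by (simp add: modulate_def[abs_def] M_def f_def)
    have K: "K_op hb \<Gamma> k (l2_of (modulate \<Lambda> n g)) = inv (fourier_l2 k) (mult_l2 (phase s hk \<Gamma> k) (l2_of (P n)))"
      unfolding K_op_rapidly_decaying[OF \<Gamma> hb hk_def rapidly_decaying_modulate[OF g \<Lambda>] s] mf P_def ..
    have I: "l2_of (modulate M n f) = inv (fourier_l2 k) (l2_of (P n))"
      unfolding P_def square_integrable_partial_fourier(2)[OF rP, symmetric] W(9) ..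
    have "(norm (K_op hb \<Gamma> k (l2_of (modulate \<Lambda> n g)) - l2_of (modulate M n f)))\<^sup>2
        = (norm (l2_of (\<lambda>\<xi>. phase s hk \<Gamma> k \<xi> * P n \<xi> - P n \<xi>)))\<^sup>2"
      unfolding K I iW(4)[symmetric] iW(3) mult_l2_of[OF b sP] l2_of_diff[OF square_integrable_mult[OF b sP] sP] ..
    also have "\<dots> = (LINT \<xi>|lborel. (cmod (phase s hk \<Gamma> k \<xi> * P n \<xi> - P n \<xi>))\<^sup>2)"
      by (rule norm_l2_of) (intro square_integrable_diff square_integrable_mult b sP)
    also have "\<dots> = (LINT \<xi>|lborel. (cmod (phase s hk \<Gamma> k (v n + (\<xi> - v n)) * Q (\<xi> - v n) - Q (\<xi> - v n)))\<^sup>2)"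
    proof (intro Bochner_Integration.integral_cong refl arg_cong[where f = "\<lambda>x. x\<^sup>2"])
      fix \<xi>
      define e where "e = exp (\<i> * of_real (real n * (M \<xi> - \<xi> $ k * M (axis k 1))))"
      have e: "P n \<xi> = e * Q (\<xi> - v n)" "cmod e = 1"
        unfolding P_def Q_def v_def c_def e_def by (rule partial_fourier_modulate[OF M], simp add: norm_exp_eq_Re)
      have "phase s hk \<Gamma> k \<xi> * P n \<xi> - P n \<xi> = e * (phase s hk \<Gamma> k (v n + (\<xi> - v n)) * Q (\<xi> - v n) - Q (\<xi> - v n))"
        unfolding e(1) by (simp add: algebra_simps)
      then show "cmod (phase s hk \<Gamma> k \<xi> * P n \<xi> - P n \<xi>) = cmod (phase s hk \<Gamma> k (v n + (\<xi> - v n)) * Q (\<xi> - v n) - Q (\<xi> - v n))"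
        by (simp only: norm_mult e(2) mult_1)
    qed
    also have "\<dots> = (LINT \<xi>|lborel. (cmod (phase s hk \<Gamma> k (v n + \<xi>) * Q \<xi> - Q \<xi>))\<^sup>2)"
    proof -
      have "(+) (- v n) = (\<lambda>\<xi>. \<xi> - v n)" by auto
      then have d: "distr lborel borel (\<lambda>\<xi>. \<xi> - v n) = lborel" using lborel_distr_plus[of "- v n"] by simp
      show ?thesis
        using integral_distr[of "\<lambda>\<xi>. \<xi> - v n" lborel borel "\<lambda>\<xi>. (cmod (phase s hk \<Gamma> k (v n + \<xi>) * Q \<xi> - Q \<xi>))\<^sup>2"]
        by (simp add: d)
    qed
    also have "\<dots> = (norm (l2_of (\<lambda>\<xi>. phase s hk \<Gamma> k (\<xi> + v n) * Q \<xi> - Q \<xi>)))\<^sup>2"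
      by (subst norm_l2_of) (auto intro!: square_integrable_diff square_integrable_mult b' sQ simp: add.commute)
    also have "l2_of (\<lambda>\<xi>. phase s hk \<Gamma> k (\<xi> + v n) * Q \<xi> - Q \<xi>) = mult_l2 (\<lambda>\<xi>. phase s hk \<Gamma> k (\<xi> + v n)) (l2_of Q) - l2_of Q"
      unfolding mult_l2_of[OF b' sQ] l2_of_diff[OF square_integrable_mult[OF b' sQ] sQ] ..
    finally show ?thesis by simp
  qed
  have "(\<lambda>n. mult_l2 (\<lambda>\<xi>. phase s hk \<Gamma> k (\<xi> + v n)) (l2_of Q)) \<longlonglongrightarrow> mult_l2 (\<lambda>_. 1) (l2_of Q)"
  proof (rule mult_l2_tendsto[where B = 1])
    have "of_int s * c > 0" using pos by (simp add: c_def M_def)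
    then show "AE \<xi> in lborel. (\<lambda>n. phase s hk \<Gamma> k (\<xi> + v n)) \<longlonglongrightarrow> 1"
      unfolding v_def by (intro AE_I2 phase_tendsto[OF h diag(1)])
  qed (simp_all add: phase_norm[OF h])
  then have "(\<lambda>n. norm (mult_l2 (\<lambda>\<xi>. phase s hk \<Gamma> k (\<xi> + v n)) (l2_of Q) - l2_of Q)) \<longlonglongrightarrow> 0"
    unfolding mult_l2_1 by (rule tendsto_norm_zero[OF Lim_null[THEN iffD1]])
  then have "(\<lambda>n. norm (K_op hb \<Gamma> k (l2_of (modulate \<Lambda> n g)) - l2_of (modulate M n f))) \<longlonglongrightarrow> 0"
    by (simp only: eq)
  then show ?thesis unfolding M_def f_def by (rule tendsto_norm_zero_cancel)
qed

section \<open>The two sides of the pentagon\<close>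

lemma volume_preserving_transposition:
  "volume_preserving (\<lambda>a::real^'n::finite. \<chi> l. a $ inv (Transposition.transpose i j) l)"
proof -
  define p :: "real^'n \<Rightarrow> real^'n" where "p a = (\<chi> l. a $ Transposition.transpose i j l)" for a
  have lin: "linear p" by (rule linearI) (auto simp: p_def vec_eq_iff)
  have m: "p \<in> borel_measurable borel"
    by (intro borel_measurable_continuous_onI linear_continuous_on linear_conv_bounded_linear[THEN iffD1] lin)
  have ax: "p (axis m 1) = axis (Transposition.transpose i j m) 1" for m
    by (auto simp: p_def vec_eq_iff axis_def transpose_eq_iff)
  have "distr lborel borel p = lborel"
  proof (rule lborel_distr_basis_permutation[OF _ _ _ m])
    fix x y :: "real^'n"
    show "p (p x) = x" by (simp add: p_def vec_eq_iff)
    have "p x \<bullet> y = (\<Sum>l\<in>UNIV. x $ Transposition.transpose i j l * y $ l)" by (simp add: p_def inner_vec_def)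
    also have "\<dots> = (\<Sum>l\<in>UNIV. x $ l * y $ Transposition.transpose i j l)"
      by (rule sum.reindex_bij_witness[of _ "Transposition.transpose i j" "Transposition.transpose i j"]) auto
    finally show "p x \<bullet> y = x \<bullet> p y" by (simp add: p_def inner_vec_def)
    show "p ` Basis \<subseteq> Basis" by (auto simp: Basis_vec_def ax)
  qed
  then have "volume_preserving p" using m by (simp add: volume_preserving_def)
  then show ?thesis by (simp add: p_def[abs_def])
qed

lemma trop_axis:
  assumes "exch \<Gamma> k k = 0"
  shows "trop s \<Gamma> k (axis m 1) = (if m = k then - axis k 1
    else axis m 1 + of_int (pos_part (- s * exch \<Gamma> k m)) *\<^sub>R axis k 1)"
proof -
  have "(\<Sum>j\<in>UNIV. real_of_int (pos_part (- s * exch \<Gamma> k j)) * axis m 1 $ j) = of_int (pos_part (- s * exch \<Gamma> k m))"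
    by (simp add: axis_def if_distrib cong: if_cong)
  then show ?thesis using assms by (auto simp: trop_def vec_eq_iff axis_def)
qed

text \<open>An intertwiner is isometric, so it does not amplify the error of an approximation of its argument.\<close>

lemma K_op_asymptotics_step:
  assumes "D_seed \<Gamma>" and "hb > 0" and "rapidly_decaying g" and "linear \<Lambda>" and "s = 1 \<or> s = - 1"
    and "of_int s * \<Lambda> (trop s \<Gamma> k (axis k 1)) > 0"
    and u: "(\<lambda>n. u n - l2_of (modulate \<Lambda> n g)) \<longlonglongrightarrow> 0"
  shows "(\<lambda>n. K_op hb \<Gamma> k (u n) -
    l2_of (modulate (\<lambda>a. \<Lambda> (trop s \<Gamma> k a)) n (\<lambda>a. g (trop s \<Gamma> k a)))) \<longlonglongrightarrow> 0"
proof -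
  have "(\<lambda>n. norm (K_op hb \<Gamma> k (u n) - K_op hb \<Gamma> k (l2_of (modulate \<Lambda> n g)))) \<longlonglongrightarrow> 0"
    unfolding K_op_isometry(2)[OF assms(1,2), symmetric] K_op_isometry(1)[OF assms(1,2)]
    using tendsto_norm_zero[OF u] .
  then have "(\<lambda>n. K_op hb \<Gamma> k (u n) - K_op hb \<Gamma> k (l2_of (modulate \<Lambda> n g))) \<longlonglongrightarrow> 0"
    by (rule tendsto_norm_zero_cancel)
  from tendsto_add[OF this K_op_asymptotics[OF assms(1-6)]] show ?thesis by simp
qed

text \<open>Both sides are linear and are compared on the standard basis. The last three facts are the values
  on which the signs of the momenta along the way depend.\<close>

lemma trop_pentagon:
  fixes \<Gamma>0 :: "'n::finite seed" and s :: int
  assumes \<Gamma>: "D_seed \<Gamma>0" and s: "s = 1 \<or> s = - 1"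
    and e: "exch \<Gamma>0 i j = - s" "exch \<Gamma>0 j i = s"
    and \<Gamma>': "\<Gamma>1 = mutate i \<Gamma>0" "\<Gamma>2 = mutate j \<Gamma>1" "\<Gamma>4 = mutate j \<Gamma>0"
  shows "trop s \<Gamma>2 i (trop s \<Gamma>1 j (trop s \<Gamma>0 i a)) =
    (\<chi> l. trop s \<Gamma>4 i (trop s \<Gamma>0 j a) $ inv (Transposition.transpose i j) l)" (is "?L a = ?R a")
    and "trop s \<Gamma>2 i (trop s \<Gamma>1 j (axis j 1)) = - axis i 1 - axis j 1"
    and "trop s \<Gamma>2 i (trop s \<Gamma>1 j (trop s \<Gamma>0 i (axis i 1))) = - axis j 1"
    and "trop s \<Gamma>4 i (trop s \<Gamma>0 j (axis j 1)) = - axis j 1"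
proof -
  have ij: "i \<noteq> j" using e s by auto
  have D: "D_seed \<Gamma>1" "D_seed \<Gamma>2" "D_seed \<Gamma>4" unfolding \<Gamma>' by (intro D_seed_mutate \<Gamma>)+
  note diag = D_seed_diag(1)[OF \<Gamma>] D[THEN D_seed_diag(1)]
  note ax = diag[THEN trop_axis]
  note lin = linear_add[OF linear_trop] linear_diff[OF linear_trop] linear_neg[OF linear_trop] linear_scale[OF linear_trop]
  have pp: "pos_part (s * s) = 1" "pos_part (- (s * s)) = 0" using s by auto
  have e1: "exch \<Gamma>1 j i = - s" "exch \<Gamma>1 i j = s" and e2: "exch \<Gamma>2 i j = - s" and e4: "exch \<Gamma>4 i j = s"
    using e ij by (simp_all add: \<Gamma>' exch_mutate)
  show 1: "trop s \<Gamma>2 i (trop s \<Gamma>1 j (axis j 1)) = - axis i 1 - axis j 1"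
    using ij by (simp add: ax lin e2 pp)
  show 2: "trop s \<Gamma>2 i (trop s \<Gamma>1 j (trop s \<Gamma>0 i (axis i 1))) = - axis j 1"
    using ij by (simp add: ax lin e1 e2 pp)
  show 3: "trop s \<Gamma>4 i (trop s \<Gamma>0 j (axis j 1)) = - axis j 1"
    using ij by (simp add: ax lin e4 pp)
  have "?L = ?R"
  proof (rule linear_eq_stdbasis)
    show "linear ?L" by (intro linear_compose[OF linear_trop, unfolded o_def] linear_trop)
    show "linear ?R"
    proof -
      have "linear (\<lambda>b::real^'n. \<chi> l. b $ inv (Transposition.transpose i j) l)" by (rule linearI) (auto simp: vec_eq_iff)
      moreover have "linear (\<lambda>a. trop s \<Gamma>4 i (trop s \<Gamma>0 j a))" by (intro linear_compose[OF linear_trop, unfolded o_def] linear_trop)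
      ultimately show ?thesis using linear_compose unfolding o_def by blast
    qed
    fix b :: "real^'n" assume "b \<in> Basis"
    then obtain m where b: "b = axis m 1" by (auto simp: Basis_vec_def)
    have P: "(\<chi> l. (- axis j 1) $ inv (Transposition.transpose i j) l) = - axis i (1::real)"
      "(\<chi> l. (- axis i 1) $ inv (Transposition.transpose i j) l) = - axis j (1::real)"
      using ij by (auto simp: vec_eq_iff axis_def Transposition.transpose_def)
    consider "m = i" | "m = j" | "m \<noteq> i" "m \<noteq> j" by blast
    then show "?L b = ?R b"
    proof cases
      case 1
      have "trop s \<Gamma>4 i (trop s \<Gamma>0 j (axis i 1)) = - axis i 1" using ij by (simp add: ax lin e pp)
      then show ?thesis unfolding b 1 2 by (simp only: P)
    next
      case 2
      have "trop s \<Gamma>2 i (trop s \<Gamma>1 j (trop s \<Gamma>0 i (axis j 1))) = - axis i 1" using ij by (simp add: ax lin e e1 pp)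
      then show ?thesis unfolding b 2 3 by (simp only: P)
    next
      case m: 3
      \<comment> \<open>the multiples of the \<open>i\<close>-th and \<open>j\<close>-th basis vectors that are added to the \<open>m\<close>-th one\<close>
      define A B C D E where "A = pos_part (- s * exch \<Gamma>0 i m)" and "B = pos_part (- s * exch \<Gamma>1 j m)"
        and "C = pos_part (- s * exch \<Gamma>2 i m)" and "D = pos_part (- s * exch \<Gamma>0 j m)" and "E = pos_part (- s * exch \<Gamma>4 i m)"
      have BC: "B + C = D" "A + B = E"
        using s ij m e unfolding A_def B_def C_def D_def E_def
        by (auto simp: \<Gamma>' exch_mutate pos_part_def max_def)
      have R: "trop s \<Gamma>4 i (trop s \<Gamma>0 j (axis m 1)) = axis m 1 + of_int E *\<^sub>R axis i 1 + of_int D *\<^sub>R axis j 1"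
        using m ij by (simp add: ax lin e4 pp D_def E_def)
      have L: "?L (axis m 1) = axis m 1 + of_int D *\<^sub>R axis i 1 + of_int E *\<^sub>R axis j 1"
        using m ij by (simp add: ax lin e1 e2 pp BC[symmetric] algebra_simps) (simp add: A_def B_def C_def)
      show ?thesis
        unfolding b R L inv_transpose_eq using m ij by (auto simp: vec_eq_iff axis_def Transposition.transpose_def)
    qed
  qed
  then show "?L a = ?R a" by (rule fun_cong)
qed

theorem proposition134:
  fixes hb :: real
    and \<Gamma>0 \<Gamma>1 \<Gamma>2 \<Gamma>3 \<Gamma>4 \<Gamma>5 :: "'n::finite seed"
    and i j :: 'n
    and c :: complex
  assumes "hb > 0" and "hb \<notin> \<rat>"
    and "D_seed \<Gamma>0"
    and "(exch \<Gamma>0 i j = 1 \<and> exch \<Gamma>0 j i = - 1) \<or> (exch \<Gamma>0 i j = - 1 \<and> exch \<Gamma>0 j i = 1)"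
    and "\<Gamma>1 = mutate i \<Gamma>0" and "\<Gamma>2 = mutate j \<Gamma>1" and "\<Gamma>3 = mutate i \<Gamma>2"
    and "\<Gamma>4 = mutate j \<Gamma>0" and "\<Gamma>5 = mutate i \<Gamma>4"
    and "cmod c = 1"
    and "\<And>f. (K_op hb \<Gamma>0 i \<circ> K_op hb \<Gamma>1 j \<circ> K_op hb \<Gamma>2 i) f =
              c *\<^sub>C (K_op hb \<Gamma>0 j \<circ> K_op hb \<Gamma>4 i \<circ> P_op (Transposition.transpose i j)) f"
  shows "c = 1"
proof -
  note hb = \<open>hb > 0\<close> and \<Gamma> = \<open>D_seed \<Gamma>0\<close>
  define s where "s = exch \<Gamma>0 j i"
  have s: "s = 1 \<or> s = - 1" and e: "exch \<Gamma>0 i j = - s" "exch \<Gamma>0 j i = s"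
    using assms(4) by (auto simp: s_def)
  have ij: "i \<noteq> j" using e s by auto
  have D: "D_seed \<Gamma>1" "D_seed \<Gamma>2" "D_seed \<Gamma>4" unfolding assms(5,6,8) by (intro D_seed_mutate \<Gamma>)+
  note diag = D_seed_diag(1)[OF \<Gamma>] D[THEN D_seed_diag(1)]
  note ax = diag[THEN trop_axis]
  note trop = trop_pentagon[OF \<Gamma> s e assms(5,6,8)]
  define \<pi> :: "real^'n \<Rightarrow> real^'n" where "\<pi> a = (\<chi> l. a $ inv (Transposition.transpose i j) l)" for a
  have \<pi>: "volume_preserving \<pi>" unfolding \<pi>_def[abs_def] by (rule volume_preserving_transposition)
  have \<pi>i: "\<pi> (- axis i 1) = - axis j 1" "\<pi> (- axis j 1) = - axis i 1"
    using ij by (auto simp: \<pi>_def vec_eq_iff axis_def Transposition.transpose_def)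
  have \<pi>l: "linear \<pi>" by (rule linearI) (auto simp: \<pi>_def vec_eq_iff)
  have \<pi>2: "\<pi> (\<pi> a) = a" for a by (simp add: \<pi>_def vec_eq_iff)
  \<comment> \<open>with this form the momentum in the direction of each of the five mutations is \<open>s\<close> or \<open>2 s\<close>\<close>
  define \<Lambda> :: "real^'n \<Rightarrow> real" where "\<Lambda> a = - of_int s * (a $ i + a $ j)" for a
  have \<Lambda>: "linear \<Lambda>" by (rule linearI) (auto simp: \<Lambda>_def algebra_simps)
  have ss: "real_of_int s * of_int s = 1" using s by auto
  have \<Lambda>_axis: "\<Lambda> (- axis i 1) = of_int s" "\<Lambda> (- axis j 1) = of_int s" "\<Lambda> (- axis i 1 - axis j 1) = 2 * of_int s"
    using ij by (simp_all add: \<Lambda>_def axis_def)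
  define g :: "real^'n \<Rightarrow> complex" where "g = gauss (\<lambda>_. 1) (\<lambda>_. 0)"
  have g: "rapidly_decaying g" unfolding g_def by (rule rapidly_decaying_gauss) simp
  define f where "f n = l2_of (modulate \<Lambda> n g)" for n
  define A where "A n = K_op hb \<Gamma>0 i (K_op hb \<Gamma>1 j (K_op hb \<Gamma>2 i (f n)))" for n
  define B where "B n = K_op hb \<Gamma>0 j (K_op hb \<Gamma>4 i (P_op (Transposition.transpose i j) (f n)))" for n
  have AB: "A n = c *\<^sub>C B n" for n using assms(11)[of "f n"] by (simp add: A_def B_def)
  have mg: "rapidly_decaying (modulate \<Lambda> n g)" for n by (rule rapidly_decaying_modulate[OF g \<Lambda>])
  note inv_dec = rapidly_decaying_involution[OF _ linear_trop trop_involution]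
  have lin_comp: "linear (\<lambda>a. M (N a))" if "linear M" "linear N" for M :: "real^'n \<Rightarrow> real" and N :: "real^'n \<Rightarrow> real^'n"
    using linear_compose[OF that(2,1)] by (simp add: o_def)
  have trop2: "linear (\<lambda>a. trop s \<Gamma>2 i (trop s \<Gamma>1 j a))"
    by (rule linear_compose[OF linear_trop linear_trop, unfolded o_def])
  have trop_\<pi>: "linear (\<lambda>a. \<pi> (trop s \<Gamma>4 i a))"
    by (rule linear_compose[OF linear_trop \<pi>l, unfolded o_def])
  have g\<pi>: "rapidly_decaying (\<lambda>a. g (\<pi> a))" by (rule rapidly_decaying_involution[OF g \<pi>l \<pi>2])
  have norm_B: "norm (B n) = norm (l2_of g)" for n
  proof -
    have "norm (f n) = norm (l2_of g)"
    proof -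
      have "(norm (f n))\<^sup>2 = (norm (l2_of g))\<^sup>2"
        unfolding f_def norm_l2_of[OF rapidly_decaying_square_integrable[OF mg]]
          norm_l2_of[OF rapidly_decaying_square_integrable[OF g]]
        by (simp add: modulate_def norm_mult norm_exp_eq_Re)
      then show ?thesis by simp
    qed
    then show ?thesis
      unfolding B_def K_op_isometry(1)[OF \<Gamma> hb] K_op_isometry(1)[OF D(3) hb] P_op_def \<pi>_def[symmetric]
      by (simp only: pullback_simps(1)[OF \<pi>])
  qed

  have "(\<lambda>n. A n - l2_of (modulate (\<lambda>a. \<Lambda> (trop s \<Gamma>2 i (trop s \<Gamma>1 j (trop s \<Gamma>0 i a)))) n
      (\<lambda>a. g (trop s \<Gamma>2 i (trop s \<Gamma>1 j (trop s \<Gamma>0 i a)))))) \<longlonglongrightarrow> 0"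
    unfolding A_def
  proof (intro K_op_asymptotics_step \<Gamma> D hb s g \<Lambda> inv_dec lin_comp trop2 linear_trop diag)
    show "of_int s * \<Lambda> (trop s \<Gamma>2 i (axis i 1)) > 0" by (simp add: ax \<Lambda>_axis ss)
    show "of_int s * \<Lambda> (trop s \<Gamma>2 i (trop s \<Gamma>1 j (axis j 1))) > 0" by (simp add: trop(2) \<Lambda>_axis ss)
    show "of_int s * \<Lambda> (trop s \<Gamma>2 i (trop s \<Gamma>1 j (trop s \<Gamma>0 i (axis i 1)))) > 0" by (simp add: trop(3) \<Lambda>_axis ss)
  qed (simp add: f_def)
  moreover have "(\<lambda>n. B n - l2_of (modulate (\<lambda>a. \<Lambda> (\<pi> (trop s \<Gamma>4 i (trop s \<Gamma>0 j a)))) n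
      (\<lambda>a. g (\<pi> (trop s \<Gamma>4 i (trop s \<Gamma>0 j a)))))) \<longlonglongrightarrow> 0"
    unfolding B_def
  proof (intro K_op_asymptotics_step[where \<Lambda> = "\<lambda>a. \<Lambda> (\<pi> (trop s \<Gamma>4 i a))"] K_op_asymptotics_step[where \<Lambda> = "\<lambda>a. \<Lambda> (\<pi> a)"]
      \<Gamma> D hb s g g\<pi> \<Lambda> inv_dec lin_comp trop_\<pi> linear_trop diag \<pi>l)
    show "of_int s * \<Lambda> (\<pi> (trop s \<Gamma>4 i (axis i 1))) > 0" by (simp add: ax \<pi>i \<Lambda>_axis ss)
    show "of_int s * \<Lambda> (\<pi> (trop s \<Gamma>4 i (trop s \<Gamma>0 j (axis j 1)))) > 0" by (simp add: trop(4) \<pi>i \<Lambda>_axis ss)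
    have "P_op (Transposition.transpose i j) (f n) = l2_of (modulate (\<lambda>a. \<Lambda> (\<pi> a)) n (\<lambda>a. g (\<pi> a)))" for n
      unfolding P_op_def f_def \<pi>_def[symmetric] pullback_l2_of[OF \<pi> rapidly_decaying_square_integrable[OF mg]]
      by (simp add: modulate_def[abs_def])
    then show "(\<lambda>n. P_op (Transposition.transpose i j) (f n) - l2_of (modulate (\<lambda>a. \<Lambda> (\<pi> a)) n (\<lambda>a. g (\<pi> a)))) \<longlonglongrightarrow> 0"
      by simp
  qed
  moreover have "trop s \<Gamma>2 i (trop s \<Gamma>1 j (trop s \<Gamma>0 i a)) = \<pi> (trop s \<Gamma>4 i (trop s \<Gamma>0 j a))" for a
    unfolding \<pi>_def by (rule trop(1))
  ultimately have "(\<lambda>n. A n - B n) \<longlonglongrightarrow> 0" using tendsto_diff by fastforce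
  then have lim: "(\<lambda>n. norm (A n - B n)) \<longlonglongrightarrow> 0" by (rule tendsto_norm_zero)
  have "A n - B n = (c - 1) *\<^sub>C B n" for n unfolding AB by (simp add: scaleC_simps)
  then have "norm (A n - B n) = cmod (c - 1) * norm (l2_of g)" for n by (simp add: norm_scaleC norm_B)
  then have "cmod (c - 1) * norm (l2_of g) = 0" using lim by (simp add: LIMSEQ_const_iff)
  moreover have "norm (l2_of g) \<noteq> 0"
  proof
    assume "norm (l2_of g) = 0"
    then have "cinner (l2_of g) (l2_of g) = 0" by (simp add: cinner_self)
    then show False unfolding g_def by (simp add: cinner_gauss)
  qed
  ultimately show ?thesis by simp
qed

end
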